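(* Let $R$ be a non-local finite commutative ring with unity. Then the genus of the upper ideal relation graph $\Gamma_U(R)$ is $2$ if and only if $R$ is isomorphic to one of the following $9$ rings: $\mathbb{Z}_2 \times \mathbb{Z}_2 \times \mathbb{Z}_3$, $\mathbb{Z}_2 \times \mathbb{F}_8$, $\mathbb{Z}_3 \times \mathbb{F}_8$, $\mathbb{F}_4 \times \mathbb{F}_8$, $\mathbb{Z}_7 \times \mathbb{Z}_7$, $\mathbb{Z}_5 \times \mathbb{Z}_7$, $\mathbb{Z}_5 \times \mathbb{Z}_5$, $\mathbb{F}_4 \times \mathbb{Z}_4$, $\mathbb{F}_4 \times \frac{\mathbb{Z}_2[x]}{(x^2)}$.
   Context: Rings have a unity. A ring is local if it has a unique maximal ideal; a non-local finite commutative ring is (up to isomorphism) a direct product $R_1\times\cdots\times R_n$ of finite commutative local rings with $n\ge 2$. For $x\in R$, $(x)$ is the ideal generated by $x$. The upper ideal relation graph $\Gamma_U(R)$ is the simple undirected graph whose vertex set is the set of all non-unit elements of $R$ (including $0$), where two distinct vertices $x,y$ are adjacent if and only if there exists a non-unit $z\in R$ with $(x)\subseteq (z)$ and $(y)\subseteq (z)$. $\mathbb{F}_q$ denotes the field with $q$ elements. The genus of a graph is the minimum non-negative integer $g$ such that the graph can be embedded (drawn without edge crossings) in the orientable surface $\mathbb{S}_g$ with $g$ handles. *)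

theory Defs
  imports
    "HOL-Analysis.Analysis"
    "HOL-Library.Extended_Nat"
    "HOL-Algebra.Chinese_Remainder"
    "HOL-Algebra.UnivPoly"
    "HOL-Number_Theory.Residues"
begin

section \<open>Graphs on surfaces\<close>

text \<open>
  The standard body with \<open>g\<close> handles is a rectangular slab of thickness one pierced by \<open>g\<close>
  pairwise disjoint square tunnels in the third coordinate direction. Its boundary
  consists of the pierced top and bottom, the outer walls and the tunnel walls, and is the closed
  orientable surface of genus \<open>g\<close>: the sphere for \<open>g = 0\<close>, the torus for \<open>g = 1\<close>, and so on.
\<close>

definition handlebody :: "nat \<Rightarrow> (real \<times> real \<times> real) set" where
  "handlebody g =
     {0..2 * real g + 1} \<times> {0..3} \<times> {0..1}
     - (\<Union>i<g. {2 * real i + 1<..<2 * real i + 2} \<times> {1<..<2} \<times> UNIV)"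

definition handle_surface :: "nat \<Rightarrow> (real \<times> real \<times> real) set" where
  "handle_surface g = frontier (handlebody g)"

text \<open>
  A simple undirected graph is given by its vertex set \<open>V\<close> and its set \<open>E\<close> of edges, each edge
  being the two-element set of its ends. In a drawing without crossings the edge \<open>e\<close> is an arc
  joining the points of its ends; it passes through no other vertex, and two
  distinct edges meet only in the points of their common ends.
\<close>

definition graph_embeds_in ::
    "'v set \<Rightarrow> 'v set set \<Rightarrow> ('p :: topological_space) set \<Rightarrow> bool" where
  "graph_embeds_in V E S \<longleftrightarrow>
     (\<exists>(f :: 'v \<Rightarrow> 'p) (\<gamma> :: 'v set \<Rightarrow> real \<Rightarrow> 'p).
        inj_on f V \<and> f ` V \<subseteq> S \<and>
        (\<forall>e\<in>E. arc (\<gamma> e) \<and> path_image (\<gamma> e) \<subseteq> S \<and>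
               {pathstart (\<gamma> e), pathfinish (\<gamma> e)} = f ` e \<and>
               path_image (\<gamma> e) \<inter> f ` V = f ` e) \<and>
        (\<forall>e\<in>E. \<forall>e'\<in>E. e \<noteq> e' \<longrightarrow>
               path_image (\<gamma> e) \<inter> path_image (\<gamma> e') = f ` (e \<inter> e')))"

text \<open>
  The infimum in \<^typ>\<open>enat\<close> of a nonempty set of natural numbers is its minimum. The value would be
  \<open>\<infinity>\<close> for a graph that embeds in none of the surfaces, which does not occur for finite graphs.
\<close>

definition graph_genus :: "'v set \<Rightarrow> 'v set set \<Rightarrow> enat" where
  "graph_genus V E = Inf (enat ` {g. graph_embeds_in V E (handle_surface g)})"


section \<open>The upper ideal relation graph\<close>

definition local_ring :: "('a, 'm) ring_scheme \<Rightarrow> bool" where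
  "local_ring R \<longleftrightarrow> (\<exists>!M. maximalideal M R)"

definition nonunits :: "('a, 'm) ring_scheme \<Rightarrow> 'a set" where
  "nonunits R = carrier R - Units R"

definition upper_ideal_edges :: "('a, 'm) ring_scheme \<Rightarrow> 'a set set" where
  "upper_ideal_edges R =
     {{x, y} | x y. x \<in> nonunits R \<and> y \<in> nonunits R \<and> x \<noteq> y \<and>
        (\<exists>z\<in>nonunits R. Idl\<^bsub>R\<^esub> {x} \<subseteq> Idl\<^bsub>R\<^esub> {z} \<and> Idl\<^bsub>R\<^esub> {y} \<subseteq> Idl\<^bsub>R\<^esub> {z})}"

definition upper_ideal_genus :: "('a, 'm) ring_scheme \<Rightarrow> enat" where
  "upper_ideal_genus R = graph_genus (nonunits R) (upper_ideal_edges R)"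


section \<open>The rings in the classification\<close>

text \<open>
  The field with \<open>q\<close> elements is determined only up to isomorphism; the statement uses copies of
  it with carrier in \<^typ>\<open>nat\<close>, and every finite field has such a copy.
\<close>

definition is_GF :: "nat \<Rightarrow> ('a, 'm) ring_scheme \<Rightarrow> bool" where
  "is_GF q F \<longleftrightarrow> field F \<and> card (carrier F) = q"

definition Z2_dual_numbers :: "(nat \<Rightarrow> int) set ring" where
  "Z2_dual_numbers =
     (let P = UP (residue_ring 2) in P Quot (Idl\<^bsub>P\<^esub> {monom P \<one>\<^bsub>residue_ring 2\<^esub> 2}))"

end

theory Submission
  imports
    Defs
    "HOL-Combinatorics.Permutations"
    "HOL-Combinatorics.Orbits"
    "HOL-Algebra.Sylow"
begin

text \<open>Nonlocality provides a nontrivial idempotent, so the ring is a product of two factors. Large factors force large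
cliques or dense subgraphs into the graph, which leaves only factors with at most eight elements.

Lower bounds on the genus: the handlebody is a union of voxels, so the facets of a fine subdivision form a cell
complex on its boundary. A graph drawn on the surface is a minor of this complex once the cells are small compared to
the distances between disjoint parts of the drawing. Hence the graph has a rotation system with at least \<open>E - V + 2 - 2 g\<close>
faces. Most graphs are excluded because all faces have length at least three. Two exceptions are one-point unions of
two cliques, where each face splits into parts of length at least three in either clique, and a graph of
twelve vertices whose faces would be triangles except for at most one quadrangle, which the local structure at the
corners does not permit.

Upper bounds: the graphs are drawn with polygonal edges on the boundary of the handlebody. That the edges meet only in
common end points is a finite statement on integer coordinates.\<close>

section \<open>Permutations and their orbits\<close>

text \<open>The arcs of a drawing are merely continuous, so the regions that they cut out of the
  surface are out of reach. The topology is therefore traded for an inequality on permutations: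
  contracting an edge between distinct vertices preserves \<open>V - E + F\<close>, and deleting an
  edge never lowers it. A minor of the voxel complex thus inherits the bound \<open>2 - 2 g\<close>,
  and the complex itself only has to be counted from one side. The surface must be connected for
  this, since the branch sets of the minor have to exhaust the complex.

  Counting triangles gives \<open>E + 6 <= 3 V + 6 g\<close>. This excludes \<open>K_9\<close> on
  genus two and \<open>K_8\<close> on the torus, but it leaves room for \<open>K_5\<close> and
  \<open>K_8\<close> sharing a vertex on genus two (44 against 48), for two \<open>K_5\<close>
  sharing a vertex on the torus (26 against 33), and for the graph of twelve vertices on genus two
  (47 against 48), which arises when one factor has order eight and is not a field. Hence the
  separate arguments for these three.\<close>

abbreviation swp :: "'a => 'a => 'a => 'a" where
  "swp \<equiv> Transposition.transpose"

text \<open>An orbit is generated from \<open>f x\<close> onward and contains \<open>x\<close> only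
  because a permutation of a finite set returns. A fixed point in \<open>D\<close> counts as a
  cycle.\<close>

definition ncyc :: "('a => 'a) => 'a set => nat" where
  "ncyc f D = card (orbit f ` D)"

lemma self_in_orbit:
  assumes "f permutes D" "finite D"
  shows "x : orbit f x"
  using assms by (meson permutation_permutes permutation_self_in_orbit)

lemma orbit_eqI':
  assumes "f permutes D" "finite D" "y : orbit f x"
  shows "orbit f y = orbit f x"
proof -
  have "x : orbit f y"
    by (rule orbit_swap[OF self_in_orbit[OF assms(1,2)] assms(3)])
  with assms(3) show ?thesis
    using orbit_trans by (metis subsetI subset_antisym)
qed

lemma orbit_subset_closed:
  assumes "!!y. y : A ==> f y : A" "x : A"
  shows "orbit f x \<subseteq> A"
proof
  fix y assume "y : orbit f x"
  then show "y : A" by (induction) (use assms in auto)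
qed

lemma orbit_subset_dom:
  assumes "f permutes D" "x : D"
  shows "orbit f x \<subseteq> D"
  using permutes_orbit_subset[OF assms] .

text \<open>The transposition moves \<open>b\<close> to \<open>a\<close> in the first step and is
  not felt again until the walk of \<open>f\<close> from \<open>a\<close> arrives at
  \<open>a\<close> or \<open>b\<close>.\<close>

lemma funpow_transpose:
  assumes "!!i. 0 < i ==> i < k ==> (f ^^ i) a ~: {a, b}" "0 < k"
  shows "((f o swp a b) ^^ k) b = (f ^^ k) a"
  using assms
proof (induction k)
  case 0
  then show ?case by simp
next
  case (Suc k)
  show ?case
  proof (cases "k = 0")
    case True
    then show ?thesis by simp
  next
    case False
    have eq: "((f o swp a b) ^^ k) b = (f ^^ k) a"
    proof (intro Suc.IH)
      fix i assume "0 < i" "i < k"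
      then show "(f ^^ i) a ~: {a, b}" by (intro Suc.prems(1)) auto
    qed (use False in simp)
    have "(f ^^ k) a ~: {a, b}"
      by (rule Suc.prems(1)) (use False in auto)
    then have "swp a b ((f ^^ k) a) = (f ^^ k) a"
      by (simp add: Transposition.transpose_def)
    then have "(f o swp a b) (((f o swp a b) ^^ k) b) = f ((f ^^ k) a)"
      unfolding eq by simp
    then show ?thesis
      unfolding funpow.simps(2) o_apply[of "f o swp a b" "(f o swp a b) ^^ k"] o_apply[of f "f ^^ k"] .
  qed
qed

lemma funpow_in_orbit': "0 < k ==> (f ^^ k) x : orbit f x"
  by (auto simp: orbit_altdef)

text \<open>From \<open>b\<close> the new permutation jumps to the successor of \<open>a\<close>,
  runs through the whole cycle of \<open>a\<close>, and on reaching \<open>a\<close> passes into the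
  cycle of \<open>b\<close>. The two cycles become one and no other cycle is touched.\<close>

lemma orbit_transpose_merge:
  assumes f: "f permutes D" "finite D" and ab: "a : D" "b : D" "b ~: orbit f a"
  defines "g \<equiv> f o swp a b"
  shows "x : orbit f a Un orbit f b ==> orbit g x = orbit f a Un orbit f b"
    and "x ~: orbit f a Un orbit f b ==> orbit g x = orbit f x"
proof -
  have g: "g permutes D"
    unfolding g_def using f ab by (intro permutes_compose permutes_swap_id) auto
  have step: "y : orbit f z" if "f y : orbit f z" for y z
    by (metis f orbit_eqI' self_in_orbit that orbit.base)
  have half: "orbit f a \<subseteq> orbit (f o swp a b) b" if ab: "b ~: orbit f a" for a b
  proof -
    obtain m where m: "0 < m" "(f ^^ m) a = a"
      using self_in_orbit[OF f, of a] by (auto simp: orbit_altdef)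
    define k where "k = (LEAST m. 0 < m & (f ^^ m) a = a)"
    have k: "0 < k" "(f ^^ k) a = a" "!!i. 0 < i ==> i < k ==> (f ^^ i) a ~= a"
      using LeastI[of "%m. 0 < m & (f ^^ m) a = a" m] m not_less_Least[of _ "%m. 0 < m & (f ^^ m) a = a"]
      unfolding k_def by auto
    have nb: "(f ^^ i) a ~= b" if "0 < i" for i
      using ab that by (auto simp: orbit_altdef)
    have gi: "((f o swp a b) ^^ i) b = (f ^^ i) a" if "0 < i" "i <= k" for i
      by (rule funpow_transpose) (use that nb k(3) in auto)
    show ?thesis
    proof
      fix y assume "y : orbit f a"
      then obtain n where n: "0 < n" "y = (f ^^ n) a" by (auto simp: orbit_altdef)
      have y: "y = (f ^^ (n mod k)) a"
        using n(2) funpow_mod_eq[OF k(2)] by metis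
      show "y : orbit (f o swp a b) b"
      proof (cases "n mod k = 0")
        case True
        then have "y = (f ^^ k) a" using y k(2) by simp
        then show ?thesis
          using gi[of k] k(1) funpow_in_orbit'[of k "f o swp a b" b] by simp
      next
        case False
        then have "y = ((f o swp a b) ^^ (n mod k)) b"
          using gi[of "n mod k"] k(1) y by (simp add: less_imp_le)
        then show ?thesis
          using False funpow_in_orbit'[of "n mod k" "f o swp a b" b] by simp
      qed
    qed
  qed
  have ba: "a ~: orbit f b"
    using ab(3) f orbit_eqI' self_in_orbit by metis
  have sub1: "orbit f a \<subseteq> orbit g b" using half[OF ab(3)] by (simp add: g_def)
  have sub2: "orbit f b \<subseteq> orbit g a"
    using half[OF ba] by (simp add: g_def Transposition.transpose_commute)
  have "b : orbit g a" "a : orbit g b"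
    using sub1 sub2 self_in_orbit[OF f] by auto
  then have eq: "orbit g a = orbit g b"
    using orbit_eqI' g f(2) by metis
  have cl: "g y : orbit f a Un orbit f b" if "y : orbit f a Un orbit f b" for y
  proof -
    have "swp a b y : orbit f a Un orbit f b"
      using that self_in_orbit[OF f] by (auto simp: Transposition.transpose_def)
    then show ?thesis by (auto simp: g_def intro: orbit.step)
  qed
  have ga: "orbit g a = orbit f a Un orbit f b"
  proof
    show "orbit g a \<subseteq> orbit f a Un orbit f b"
      by (rule orbit_subset_closed) (use cl self_in_orbit[OF f] in auto)
  qed (use sub1 sub2 eq in auto)
  show "orbit g x = orbit f a Un orbit f b" if "x : orbit f a Un orbit f b"
    using that ga orbit_eqI'[OF g f(2)] by metis
  show "orbit g x = orbit f x" if x: "x ~: orbit f a Un orbit f b"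
  proof -
    have "orbit f x Int (orbit f a Un orbit f b) = {}"
    proof (rule ccontr)
      assume "~ ?thesis"
      then obtain y where y: "y : orbit f x" "y : orbit f a | y : orbit f b" by auto
      then have "orbit f x = orbit f a | orbit f x = orbit f b"
        using orbit_eqI'[OF f] by metis
      then show False using x self_in_orbit[OF f, of x] by auto
    qed
    then have ag: "g y = f y" if "y : orbit f x" for y
      using that self_in_orbit[OF f] by (auto simp: g_def Transposition.transpose_def)
    show ?thesis
      by (rule orbit_cong0[of x "orbit f x" f g, symmetric])
        (use ag self_in_orbit[OF f] in \<open>auto intro: orbit.step\<close>)
  qed
qed

lemma ncyc_transpose_merge:
  assumes f: "f permutes D" "finite D" and ab: "a : D" "b : D" "b ~: orbit f a"
  shows "Suc (ncyc (f o swp a b) D) = ncyc f D"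
proof -
  define g where "g = f o swp a b"
  define A where "A = orbit f a" define B where "B = orbit f b"
  define R where "R = orbit f ` D - {A, B}"
  have AB: "A ~= B" using ab(3) self_in_orbit[OF f, of b] by (auto simp: A_def B_def)
  have fD: "orbit f ` D = insert A (insert B R)"
    using ab by (auto simp: R_def A_def B_def)
  have cases: "orbit f x : {A, B} \<longleftrightarrow> x : A Un B" for x
  proof
    show "x : A Un B" if "orbit f x : {A, B}"
      using that self_in_orbit[OF f, of x] by blast
    show "orbit f x : {A, B}" if "x : A Un B"
      using that orbit_eqI'[OF f, of x a] orbit_eqI'[OF f, of x b] unfolding A_def B_def by blast
  qed
  have gD: "orbit g ` D = insert (A Un B) R"
  proof -
    have "orbit g x : insert (A Un B) R" if "x : D" for x
    proof (cases "x : A Un B")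
      case True
      then have "orbit g x = A Un B"
        using orbit_transpose_merge(1)[OF f ab, of x] by (simp only: g_def A_def B_def)
      then show ?thesis by blast
    next
      case False
      then have "orbit g x = orbit f x"
        using orbit_transpose_merge(2)[OF f ab, of x] unfolding g_def A_def B_def by blast
      moreover have "orbit f x ~: {A, B}" using False cases[of x] by blast
      ultimately show ?thesis using that unfolding R_def by (metis DiffI imageI insertI2)
    qed
    moreover have "y : orbit g ` D" if y: "y : R" for y
    proof -
      obtain x where x: "x : D" "y = orbit f x" "y ~: {A,B}" using y unfolding R_def by blast
      then have "x ~: A Un B" using cases[of x] by blast
      then have "orbit g x = y"
        using orbit_transpose_merge(2)[OF f ab, of x] x(2) unfolding g_def A_def B_def by blast
      then show ?thesis using x(1) by blast
    qed
    moreover have "A Un B : orbit g ` D"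
    proof -
      have "orbit g a = A Un B"
        using orbit_transpose_merge(1)[OF f ab, of a] self_in_orbit[OF f, of a]
        unfolding g_def A_def B_def by blast
      then show ?thesis using ab(1) by blast
    qed
    ultimately show ?thesis by blast
  qed
  have "A Un B ~: R"
  proof
    assume "A Un B : R"
    then obtain x where x: "A Un B = orbit f x" "A Un B ~: {A,B}" unfolding R_def by blast
    then have "a : orbit f x" using self_in_orbit[OF f, of a] unfolding A_def by blast
    then show False using orbit_eqI'[OF f, of a x] x unfolding A_def by blast
  qed
  moreover have "finite R" using f(2) by (simp add: R_def)
  ultimately show ?thesis
    using AB unfolding ncyc_def fD gD[unfolded g_def]
    by (subst card_insert_disjoint; (simp add: R_def)?)+
qed

lemma orbit_transpose_split:
  assumes f: "f permutes D" "finite D" and ab: "a ~= b" "b : orbit f a"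
  shows "a ~: orbit (f o swp a b) b"
proof -
  obtain m where m: "0 < m" "(f ^^ m) a : {a, b}"
    using ab(2) by (auto simp: orbit_altdef)
  define k where "k = (LEAST m. 0 < m & (f ^^ m) a : {a, b})"
  have k: "0 < k" "(f ^^ k) a : {a, b}" "!!i. 0 < i ==> i < k ==> (f ^^ i) a ~: {a, b}"
    using LeastI[of "%m. 0 < m & (f ^^ m) a : {a, b}" m] m
      not_less_Least[of _ "%m. 0 < m & (f ^^ m) a : {a, b}"]
    unfolding k_def by auto
  have kb: "(f ^^ k) a = b"
  proof (rule ccontr)
    assume "(f ^^ k) a ~= b"
    then have ka: "(f ^^ k) a = a" using k(2) by auto
    obtain n where n: "0 < n" "b = (f ^^ n) a" using ab(2) by (auto simp: orbit_altdef)
    have "b = (f ^^ (n mod k)) a"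
      using n(2) funpow_mod_eq[OF ka] by metis
    then show False
      using k(3)[of "n mod k"] k(1) ab(1) by (cases "n mod k = 0") auto
  qed
  have gi: "((f o swp a b) ^^ i) b = (f ^^ i) a" if "0 < i" "i <= k" for i
    by (rule funpow_transpose) (use that k(3) in auto)
  have gk: "((f o swp a b) ^^ k) b = b" using gi[of k] k(1) kb by simp
  show ?thesis
  proof
    assume "a : orbit (f o swp a b) b"
    then obtain n where n: "a = ((f o swp a b) ^^ n) b"
      by (auto simp: orbit_altdef)
    have a: "a = ((f o swp a b) ^^ (n mod k)) b"
      using n funpow_mod_eq[OF gk] by metis
    show False
    proof (cases "n mod k = 0")
      case True
      then show ?thesis using a ab(1) by simp
    next
      case False
      then have "a = (f ^^ (n mod k)) a"
        using gi[of "n mod k"] k(1) a by (simp add: less_imp_le)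
      then show ?thesis using k(3)[of "n mod k"] False k(1) by auto
    qed
  qed
qed

text \<open>A transposition is its own inverse, so a splitting is a merging undone.\<close>

lemma ncyc_transpose_split:
  assumes f: "f permutes D" "finite D" and ab: "a : D" "b : D" "a ~= b" "b : orbit f a"
  shows "ncyc (f o swp a b) D = Suc (ncyc f D)"
proof -
  have g: "(f o swp a b) permutes D"
    using f ab by (intro permutes_compose permutes_swap_id) auto
  have "Suc (ncyc ((f o swp a b) o swp b a) D) = ncyc (f o swp a b) D"
    by (rule ncyc_transpose_merge[OF g f(2) ab(2,1) orbit_transpose_split[OF f ab(3,4)]])
  moreover have eq: "(f o swp a b) o swp b a = f"
    by (simp add: fun_eq_iff Transposition.transpose_commute)
  ultimately have "Suc (ncyc f D) = ncyc (f o swp a b) D"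
    by (simp only: eq)
  then show ?thesis ..
qed

lemma ncyc_transpose:
  assumes f: "f permutes D" "finite D" and ab: "a : D" "b : D" "a ~= b"
  shows "ncyc f D <= Suc (ncyc (f o swp a b) D)"
    and "even (ncyc (f o swp a b) D) \<longleftrightarrow> odd (ncyc f D)"
proof -
  have "ncyc f D = Suc (ncyc (f o swp a b) D) | ncyc (f o swp a b) D = Suc (ncyc f D)"
  proof (cases "b : orbit f a")
    case True
    show ?thesis by (rule disjI2) (rule ncyc_transpose_split[OF f ab True])
  next
    case False
    show ?thesis by (rule disjI1) (rule ncyc_transpose_merge[OF f ab(1,2) False, symmetric])
  qed
  then show "ncyc f D <= Suc (ncyc (f o swp a b) D)"
    and "even (ncyc (f o swp a b) D) \<longleftrightarrow> odd (ncyc f D)"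
    by auto
qed

text \<open>With an involution \<open>f\<close> that pairs the two darts of each edge,
  \<open>restr f A\<close> is the product of the transpositions of the edges in \<open>A\<close>.
  Composing with it switches on exactly these edges.\<close>

definition restr :: "('a => 'a) => 'a set => 'a => 'a" where
  "restr f A x = (if x : A then f x else x)"

lemma restr_permutes:
  assumes "!!x. x : A ==> f x : A" "!!x. x : A ==> f (f x) = x" "A \<subseteq> D"
  shows "restr f A permutes D"
proof -
  have "restr f A permutes A"
  proof (rule bij_imp_permutes)
    show "bij_betw (restr f A) A A"
      by (rule bij_betw_byWitness[where f' = f]) (use assms in \<open>auto simp: restr_def\<close>)
  qed (auto simp: restr_def)
  then show ?thesis using assms(3) permutes_subset by blast
qed

lemma restr_remove_pair:
  assumes "a : A" "f a : A" "f (f a) = a" "f a ~= a"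
    and inj: "!!x. x : A ==> f (f x) = x"
  shows "restr f A = restr f (A - {a, f a}) o swp a (f a)"
proof
  fix x
  show "restr f A x = (restr f (A - {a, f a}) o swp a (f a)) x"
    using assms by (cases "x = a"; cases "x = f a") (auto simp: restr_def)
qed

text \<open>The involution on \<open>A\<close> is a product of \<open>card A div 2\<close> disjoint
  transpositions, each of which changes the number of cycles by exactly one. The inequality bounds
  what deletions cost in faces; the parity becomes the parity of the Euler characteristic.\<close>

lemma ncyc_restr:
  assumes "f permutes D" "finite D" "A \<subseteq> D"
    and "!!x. x : A ==> r x : A" "!!x. x : A ==> r (r x) = x" "!!x. x : A ==> r x ~= x"
  shows "even (card A) & 2 * ncyc f D <= 2 * ncyc (f o restr r A) D + card A
    & (even (ncyc f D + card A div 2) \<longleftrightarrow> even (ncyc (f o restr r A) D))"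
  using assms
proof (induction "card A" arbitrary: A rule: less_induct)
  case less
  show ?case
  proof (cases "A = {}")
    case True
    then have "f o restr r A = f" by (auto simp: restr_def)
    then show ?thesis using True by simp
  next
    case False
    then obtain a where a: "a : A" by blast
    define A' where "A' = A - {a, r a}"
    have finA: "finite A" using less.prems(2,3) finite_subset by blast
    have ra: "r a : A" "r a ~= a" "r (r a) = a" using less.prems(4,5,6) a by auto
    have "A = insert a (insert (r a) A')" "a ~: insert (r a) A'" "r a ~: A'" "finite A'"
      using a ra finA by (auto simp: A'_def)
    then have card: "card A = card A' + 2" by (metis add_2_eq_Suc' card_insert_disjoint finite_insert)
    have A'_cl: "r x : A'" if "x : A'" for x
      using that less.prems(4,5) a ra unfolding A'_def by (metis Diff_iff insert_iff singletonD)
    have IH: "even (card A') & 2 * ncyc f D <= 2 * ncyc (f o restr r A') D + card A'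
      & (even (ncyc f D + card A' div 2) \<longleftrightarrow> even (ncyc (f o restr r A') D))"
    proof (rule less.hyps)
      show "card A' < card A" using card by simp
      show "A' \<subseteq> D" using less.prems(3) by (auto simp: A'_def)
    qed (use less.prems A'_cl in \<open>auto simp: A'_def\<close>)
    have eq: "f o restr r A = f o restr r A' o swp a (r a)"
      using restr_remove_pair[of a A r] a ra less.prems(5) by (simp add: A'_def o_assoc)
    have g: "f o restr r A' permutes D"
      using less.prems(1,3,5) A'_cl
      by (intro permutes_compose restr_permutes) (auto simp: A'_def)
    have aD: "a : D" "r a : D" "a ~= r a" using a ra less.prems(3) by auto
    show ?thesis
      using IH ncyc_transpose[OF g less.prems(2) aD] unfolding eq card by auto
  qed
qed

section \<open>Contraction and deletion in rotation systems\<close>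

text \<open>Cycles of \<open>s\<close> are vertices and pairs of \<open>r\<close> are edges. The
  condition says that each label class is connected through edges with both ends in the class, that
  is, a branch set of a minor.\<close>

definition fibres_connected :: "'a set => ('a => 'a) => ('a => 'a) => ('a => 'v) => bool" where
  "fibres_connected D s r lab \<longleftrightarrow> (\<forall>X\<subseteq>D. (ALL z:X. s z : X & (lab (r z) = lab z --> r z : X)) -->
     (ALL x:X. ALL y:D. lab y = lab x --> y : X))"

text \<open>A largest good set \<open>A\<close> is a spanning forest of the branch sets. By
  maximality no edge inside a class joins two different cycles any more, so by connectivity each
  class is a single cycle.\<close>

lemma contraction:
  fixes lab :: "'a => 'v"
  assumes D: "finite D" and s: "s permutes D"
    and r: "!!x. x : D ==> r x : D" "!!x. x : D ==> r (r x) = x" "!!x. x : D ==> r x ~= x"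
    and lab: "!!x. x : D ==> lab (s x) = lab x"
    and conn: "fibres_connected D s r lab"
  shows "\<exists>A\<subseteq>D. (ALL x:A. r x : A & lab (r x) = lab x) &
    2 * ncyc s D = 2 * card (lab ` D) + card A &
    (ALL x:D. orbit (s o restr r A) x = {y : D. lab y = lab x})"
proof -
  \<comment> \<open>The equation says that every edge of \<open>A\<close> merged two cycles and none
    split one. The last clause keeps each old vertex inside one new cycle.\<close>
  define good where "good A \<longleftrightarrow> A \<subseteq> D & (ALL x:A. r x : A & lab (r x) = lab x) &
     2 * ncyc (s o restr r A) D + card A = 2 * ncyc s D &
     (ALL x:D. s x : orbit (s o restr r A) x)" for A
  have good0: "good {}"
  proof -
    have "s o restr r {} = s" by (auto simp: restr_def)
    then show ?thesis by (simp add: good_def orbit.base)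
  qed
  have bound: "ALL A. good A --> card A < Suc (card D)"
    using D card_mono[OF D] by (auto simp: good_def less_Suc_eq_le)
  have "EX A. good A & (ALL A'. good A' --> card A' <= card A)"
    by (rule ex_has_greatest_nat[OF good0 bound])
  then obtain A where A: "good A" and max: "!!A'. good A' ==> card A' <= card A"
    by blast
  define k where "k = s o restr r A"
  have AD: "A \<subseteq> D" and Acl: "!!x. x : A ==> r x : A & lab (r x) = lab x"
    and Acount: "2 * ncyc k D + card A = 2 * ncyc s D"
    and sk: "!!x. x : D ==> s x : orbit k x"
    using A by (auto simp: good_def k_def)
  have rA: "restr r A permutes D"
    by (rule restr_permutes) (use Acl r AD in auto)
  have kp: "k permutes D" unfolding k_def by (rule permutes_compose[OF rA s])
  have kD: "k x : D" if "x : D" for x using kp that permutes_in_image by metis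
  have klab: "lab (k x) = lab x" if "x : D" for x
    using that lab r(1) Acl AD by (auto simp: k_def restr_def)
  have orb_sub: "orbit k x \<subseteq> {y : D. lab y = lab x}" if "x : D" for x
    by (rule orbit_subset_closed) (use that kD klab in auto)
  have eq: "orbit k x = {y : D. lab y = lab x}" if x: "x : D" for x
  proof (rule antisym[OF orb_sub[OF x]], rule subsetI)
    fix y assume y: "y : {y : D. lab y = lab x}"
    have sub: "orbit k x \<subseteq> D" using orb_sub[OF x] by auto
    have "s z : orbit k x & (lab (r z) = lab z --> r z : orbit k x)" if z: "z : orbit k x" for z
    proof (intro conjI impI)
      show "s z : orbit k x"
        using sk[of z] z sub orbit_eqI'[OF kp D z] by auto
      assume lz: "lab (r z) = lab z"
      show "r z : orbit k x"
      proof (rule ccontr)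
        assume nz: "r z ~: orbit k x"
        have zD: "z : D" "r z : D" using z sub r by auto
        have oz: "orbit k z = orbit k x" by (rule orbit_eqI'[OF kp D z])
        have "z ~: A"
        proof
          assume "z : A"
          then have "k z = s (r z)" by (simp add: k_def restr_def)
          then have "s (r z) : orbit k z" by (metis orbit.base)
          moreover have "orbit k (s (r z)) = orbit k (r z)"
            by (rule orbit_eqI'[OF kp D sk[OF zD(2)]])
          moreover have "r z : orbit k (r z)" by (rule self_in_orbit[OF kp D])
          ultimately show False using nz oz orbit_eqI'[OF kp D, of "s (r z)" z] by auto
        qed
        then have nA: "z ~: A" "r z ~: A" using Acl r zD by force+
        define A' where "A' = insert z (insert (r z) A)"
        have rr: "r (r z) = z" "r z ~= z" using r zD by auto
        have eq': "s o restr r A' = k o swp z (r z)"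
        proof -
          have "restr r A' = restr r (A' - {z, r z}) o swp z (r z)"
            by (rule restr_remove_pair) (use rr AD r in \<open>auto simp: A'_def\<close>)
          moreover have "A' - {z, r z} = A" using nA by (auto simp: A'_def)
          ultimately show ?thesis by (simp add: k_def o_assoc)
        qed
        have "r z ~: orbit k z" using nz oz by simp
        note merge = orbit_transpose_merge[OF kp D zD this] ncyc_transpose_merge[OF kp D zD this]
        have "card A' = card A + 2"
          using nA rr(2) AD D finite_subset[OF AD D] by (simp add: A'_def)
        moreover have "good A'"
          unfolding good_def
        proof (intro conjI ballI)
          show "A' \<subseteq> D" using AD zD by (auto simp: A'_def)
          show "r w : A'" "lab (r w) = lab w" if "w : A'" for w
            using that Acl rr lz by (auto simp: A'_def)
          show "2 * ncyc (s o restr r A') D + card A' = 2 * ncyc s D"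
            using Acount merge(3) \<open>card A' = card A + 2\<close> unfolding eq' by simp
          show "s w : orbit (s o restr r A') w" if w: "w : D" for w
          proof (cases "w : orbit k z Un orbit k (r z)")
            case True
            then have "orbit (k o swp z (r z)) w = orbit k z Un orbit k (r z)" by (rule merge(1))
            moreover have "orbit k w = orbit k z | orbit k w = orbit k (r z)"
              using True orbit_eqI'[OF kp D] by blast
            ultimately show ?thesis unfolding eq' using sk[OF w] by blast
          next
            case False
            then have "orbit (k o swp z (r z)) w = orbit k w" by (rule merge(2))
            then show ?thesis unfolding eq' using sk[OF w] by simp
          qed
        qed
        ultimately show False using max[of A'] by simp
      qed
    qed
    then have "ALL u:orbit k x. ALL v:D. lab v = lab u --> v : orbit k x"
      using conn[unfolded fibres_connected_def, rule_format, OF sub] by blast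
    then show "y : orbit k x"
      using y self_in_orbit[OF kp D, of x] by blast
  qed
  have "orbit k ` D = (%l. {y : D. lab y = l}) ` lab ` D"
    unfolding image_image by (rule image_cong[OF refl eq])
  moreover have "inj_on (%l. {y : D. lab y = l}) (lab ` D)" by (auto simp: inj_on_def)
  ultimately have "ncyc k D = card (lab ` D)" by (simp add: ncyc_def card_image)
  then show ?thesis using AD Acl Acount eq unfolding k_def by (intro exI[of _ A]) auto
qed

text \<open>The predecessor of \<open>d\<close> is redirected to \<open>f d\<close>, so
  \<open>d\<close> becomes a fixed point and the rest of its cycle keeps its order.\<close>

lemma orbit_skip:
  assumes f: "f permutes D" and xd: "x ~= d"
  defines "g \<equiv> swp d (f d) o f"
  shows "orbit g x = orbit f x - {d}"
proof -
  have inj: "f a = f b \<longleftrightarrow> a = b" for a b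
    using permutes_inj[OF f] by (auto simp: inj_def)
  have gz: "g z = (if f z = d then f d else f z)" if "z ~= d" for z
    using that inj[of z d] by (auto simp: g_def Transposition.transpose_def)
  have fd: "f d ~= d" if "f z = d" "z ~= d" for z using that inj[of z d] by metis
  have 1: "y : orbit f x & y ~= d" if "y : orbit g x" for y
    using that
  proof induction
    case base
    show ?case using gz[OF xd] fd[OF _ xd] orbit.base[of f x] orbit.step[of d f x] by auto
  next
    case (step y)
    then show ?case using gz[of y] fd[of y] orbit.step[of y f x] orbit.step[of d f x] by auto
  qed
  have 2: "(y ~= d --> y : orbit g x) & (y = d --> f d : orbit g x)" if "y : orbit f x" for y
    using that
  proof induction
    case base
    show ?case using gz[OF xd] orbit.base[of g x] by (auto split: if_splits)
  next
    case (step y)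
    show ?case
    proof (cases "y = d")
      case False
      then show ?thesis using step.IH gz[of y] orbit.step[of y g x] by (auto split: if_splits)
    qed (use step.IH in auto)
  qed
  show ?thesis using 1 2 by auto
qed

text \<open>Points outside \<open>B\<close> are skipped one at a time. As \<open>h\<close> fixes
  them, skipping \<open>d\<close> in \<open>f\<close> also skips it in \<open>f o h\<close>, so one
  and the same \<open>g\<close> serves for the vertices and for the faces.\<close>

lemma first_return:
  assumes "finite D" "f permutes D" "h permutes B" "B \<subseteq> D"
  shows "EX g. g permutes B & (ALL x:B. orbit g x = orbit f x Int B & orbit (g o h) x = orbit (f o h) x Int B)"
  using assms
proof (induction "card (D - B)" arbitrary: D f)
  case 0
  then have fB: "f permutes B" by (metis Diff_eq_empty_iff card_0_eq finite_Diff subset_antisym)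
  have "orbit f x \<subseteq> B" "orbit (f o h) x \<subseteq> B" if "x : B" for x
    using that orbit_subset_dom[OF fB] orbit_subset_dom[OF permutes_compose[OF 0(4) fB]] by blast+
  then show ?case using fB by (intro exI[of _ f]) blast
next
  case (Suc n)
  have "D - B ~= {}" using Suc.hyps(2) by (metis card.empty nat.distinct(1))
  then obtain d where d: "d : D" "d ~: B" by blast
  define g where "g = swp d (f d) o f"
  have fd: "f d : D" using Suc.prems(2) d permutes_in_image by metis
  have hp: "f o h permutes D"
    using Suc.prems permutes_subset permutes_compose by metis
  have hd: "h d = d" using Suc.prems(3) d by (simp add: permutes_def)
  have gp: "g permutes D - {d}"
  proof (rule permutes_superset)
    show "g permutes D" unfolding g_def
      using Suc.prems(2) d fd by (intro permutes_compose permutes_swap_id)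
    fix x assume "x : D - (D - {d})"
    then show "g x = x" by (auto simp: g_def)
  qed
  have "EX k. k permutes B & (ALL x:B. orbit k x = orbit g x Int B & orbit (k o h) x = orbit (g o h) x Int B)"
  proof (rule Suc.hyps(1)[OF _ _ gp])
    have "D - {d} - B = (D - B) - {d}" by auto
    then show "n = card (D - {d} - B)" using Suc.hyps(2) d Suc.prems(1) by simp
  qed (use Suc.prems d in auto)
  then obtain k where k: "k permutes B"
    "!!x. x : B ==> orbit k x = orbit g x Int B & orbit (k o h) x = orbit (g o h) x Int B" by blast
  show ?case
  proof (intro exI conjI ballI)
    fix x assume x: "x : B"
    then have xd: "x ~= d" using d by auto
    have "orbit g x = orbit f x - {d}"
      unfolding g_def by (rule orbit_skip[OF Suc.prems(2) xd])
    then show "orbit k x = orbit f x Int B" using k(2)[OF x] d by auto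
    have "g o h = swp d ((f o h) d) o (f o h)" using hd by (simp add: g_def o_assoc)
    then have "orbit (g o h) x = orbit (f o h) x - {d}"
      using orbit_skip[OF hp xd] by (simp only:)
    then show "orbit (k o h) x = orbit (f o h) x Int B" using k(2)[OF x] d by auto
  qed (rule k)
qed

text \<open>\<open>s\<close> is the vertex rotation, \<open>s o r\<close> the face permutation, and
  \<open>card D\<close> twice the number of edges. The inequality states that
  \<open>2 (V - E + F)\<close> does not drop on passing to the minor whose edges are the pairs in
  \<open>B\<close>.\<close>

lemma minor_rotation:
  fixes lab :: "'a => 'v"
  assumes D: "finite D" and s: "s permutes D" and rp: "r permutes D"
    and r: "!!x. x : D ==> r (r x) = x" "!!x. x : D ==> r x ~= x"
    and lab: "!!x. x : D ==> lab (s x) = lab x"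
    and conn: "fibres_connected D s r lab"
    and B: "B \<subseteq> D" "!!x. x : B ==> r x : B & lab (r x) ~= lab x" "lab ` D = lab ` B"
  obtains g where "g permutes B" "!!x. x : B ==> orbit g x = {y : B. lab y = lab x}"
    "2 * ncyc s D + 2 * ncyc (s o r) D + card B <= 2 * ncyc (g o restr r B) B + card D + 2 * card (lab ` B)"
proof -
  have rD: "r x : D" if "x : D" for x using rp that permutes_in_image by metis
  have "\<exists>A\<subseteq>D. (ALL x:A. r x : A & lab (r x) = lab x) &
      2 * ncyc s D = 2 * card (lab ` D) + card A &
      (ALL x:D. orbit (s o restr r A) x = {y : D. lab y = lab x})"
    by (rule contraction[OF D s _ _ _ _ conn]) (use rD r lab in auto)
  then obtain A where "A \<subseteq> D & (ALL x:A. r x : A & lab (r x) = lab x) &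
      2 * ncyc s D = 2 * card (lab ` D) + card A &
      (ALL x:D. orbit (s o restr r A) x = {y : D. lab y = lab x})"
    by (elim exE) (rule that)
  then have A: "A \<subseteq> D" "!!x. x : A ==> r x : A & lab (r x) = lab x"
    and cnt: "2 * ncyc s D = 2 * card (lab ` D) + card A"
    and orb: "!!x. x : D ==> orbit (s o restr r A) x = {y : D. lab y = lab x}"
    by (elim conjE; blast)+
  \<comment> \<open>\<open>A\<close> is contracted, \<open>B\<close> is kept and \<open>C\<close> is
    deleted.\<close>
  define C where "C = D - A - B"
  define k where "k = s o restr r A"
  define p where "p = k o restr r B"
  have AB: "A Int B = {}" using A B by auto
  have kp: "k permutes D" unfolding k_def
    by (intro permutes_compose restr_permutes s) (use A r in auto)
  have pp: "p permutes D" unfolding p_def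
    by (intro permutes_compose restr_permutes kp) (use B r in auto)
  \<comment> \<open>Contraction does not alter faces: with the edges of \<open>A\<close> and
    \<open>B\<close> switched on, the permutation is the old face permutation with the edges of
    \<open>C\<close> switched off.\<close>
  have p_eq: "p = (s o r) o restr r C"
  proof
    fix x
    have CC': "r x : C" if "x : C"
    proof -
      have "r x ~: A" "r x ~: B" using that A(2)[of "r x"] B(2)[of "r x"] r(1)[of x] by (auto simp: C_def)
      then show ?thesis using that rD by (simp add: C_def)
    qed
    consider "x : A" | "x : B" | "x : C" | "x ~: D" by (auto simp: C_def)
    then show "p x = ((s o r) o restr r C) x"
    proof cases
      case 4
      then have "r x = x" using rp by (simp add: permutes_def)
      then show ?thesis using 4 A B by (auto simp: p_def k_def restr_def C_def)
    next
      case 2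
      then show ?thesis using AB A B by (auto simp: p_def k_def restr_def C_def)
    qed (use AB A B r CC' in \<open>auto simp: p_def k_def restr_def C_def\<close>)
  qed
  have "2 * ncyc (s o r) D <= 2 * ncyc p D + card C"
  proof -
    have "r x : C" if "x : C" for x
    proof -
      have "r x ~: A" "r x ~: B" using that A(2)[of "r x"] B(2)[of "r x"] r(1)[of x] by (auto simp: C_def)
      then show ?thesis using that rD by (simp add: C_def)
    qed
    then show ?thesis
      using ncyc_restr[OF permutes_compose[OF rp s] D, of C r] r unfolding p_eq C_def by auto
  qed
  moreover have "card D = card A + card B + card C"
  proof -
    have "D = A Un B Un C" "(A Un B) Int C = {}" using A B by (auto simp: C_def)
    moreover have "finite A" "finite B" "finite C" using A B D by (auto simp: C_def intro: finite_subset)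
    ultimately show ?thesis using AB by (simp add: card_Un_disjoint)
  qed
  moreover obtain g where g: "g permutes B"
    "!!x. x : B ==> orbit g x = orbit k x Int B & orbit (g o restr r B) x = orbit p x Int B"
  proof -
    have "restr r B permutes B" by (rule restr_permutes) (use B r in auto)
    from first_return[OF D kp this B(1)] show ?thesis
      using that unfolding p_def by blast
  qed
  moreover have "ncyc (g o restr r B) B = ncyc p D"
  proof -
    \<comment> \<open>A face avoiding \<open>B\<close> would be closed under \<open>k\<close> and so
      contain a whole label class, but every label occurs in \<open>B\<close>. Hence no face is lost
      when restricting to \<open>B\<close>.\<close>
    have meet: "orbit p x Int B ~= {}" if x: "x : D" for x
    proof
      assume e: "orbit p x Int B = {}"
      have "orbit k x \<subseteq> orbit p x"
      proof (rule orbit_subset_closed)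
        fix y assume y: "y : orbit p x"
        then have "p y = k y" using e by (auto simp: p_def restr_def)
        then show "k y : orbit p x" using y orbit.step by metis
      qed (rule self_in_orbit[OF pp D])
      moreover obtain b where "b : B" "lab b = lab x" using x B(3) by (metis imageE imageI)
      ultimately show False using e orb[OF x] B(1) unfolding k_def by auto
    qed
    have im: "orbit (g o restr r B) ` B = (%S. S Int B) ` orbit p ` D"
    proof (intro equalityI subsetI)
      fix S assume "S : (%S. S Int B) ` orbit p ` D"
      then obtain x where x: "x : D" "S = orbit p x Int B" by auto
      then obtain b where b: "b : orbit p x" "b : B" using meet by blast
      then have "orbit (g o restr r B) b = S" using g(2)[OF b(2)] x orbit_eqI'[OF pp D b(1)] by simp
      then show "S : orbit (g o restr r B) ` B" using b by auto
    qed (use g(2) B(1) in \<open>auto simp: image_iff\<close>)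
    have "inj_on (%S. S Int B) (orbit p ` D)"
    proof (rule inj_onI)
      fix S T assume "S : orbit p ` D" "T : orbit p ` D" and e: "S Int B = T Int B"
      then obtain x y where xy: "x : D" "y : D" "S = orbit p x" "T = orbit p y" by auto
      then obtain b where "b : S Int B" using meet by blast
      then show "S = T" using e xy orbit_eqI'[OF pp D, of b] by (metis IntD1)
    qed
    then show ?thesis unfolding ncyc_def im by (rule card_image)
  qed
  moreover have "orbit g x = {y : B. lab y = lab x}" if "x : B" for x
    using g(2)[OF that] orb[of x] that B(1) unfolding k_def by auto
  ultimately show ?thesis
    using that[of g] cnt B(3) by simp
qed

section \<open>Voxels of the handlebody\<close>

type_synonym ivec = "int \<times> int \<times> int"

fun cross :: "ivec => ivec => ivec" where
  "cross (a, b, c) (d, e, f) = (b * f - c * e, c * d - a * f, a * e - b * d)"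

definition axes :: "ivec list" where
  "axes = [(1,0,0), (0,1,0), (0,0,1), (-1,0,0), (0,-1,0), (0,0,-1)]"

definition frames :: "(ivec \<times> ivec) list" where
  "frames = filter (%(n, s). s ~= n & s ~= - n) (List.product axes axes)"

text \<open>From the centre of the unit cube, half steps along \<open>n\<close> and \<open>s\<close>
  reach the midpoint of the edge, and half a step against \<open>cross n s\<close>, the direction of
  travel, reaches its start.\<close>

fun corner :: "ivec \<times> ivec => ivec" where
  "corner ((a, b, c), (d, e, f)) = (case cross (a, b, c) (d, e, f) of (x, y, z) =>
     ((1 + a + d - x) div 2, (1 + b + e - y) div 2, (1 + c + f - z) div 2))"

text \<open>A voxel is named by its least corner, a facet by its voxel \<open>w\<close> and outer normal \<open>n\<close>. The dart \<open>(w, n, s)\<close> is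
  the edge of that facet on the side \<open>s\<close>, directed counterclockwise as seen from outside.\<close>

definition darts :: "ivec set => (ivec \<times> ivec \<times> ivec) set" where
  "darts W = {(w, n, s). w : W & w + n ~: W & (n, s) : set frames}"

fun start :: "ivec \<times> ivec \<times> ivec => ivec" where
  "start (w, n, s) = w + corner (n, s)"

fun turn :: "ivec set => ivec \<times> ivec \<times> ivec => ivec \<times> ivec \<times> ivec" where
  "turn W (w, n, s) = (if (w, n, s) : darts W then (w, n, cross n s) else (w, n, s))"

text \<open>The last three cases are the convex, flat and concave edges of the boundary.\<close>

fun opp :: "ivec set => ivec \<times> ivec \<times> ivec => ivec \<times> ivec \<times> ivec" where
  "opp W (w, n, s) =
     (if (w, n, s) ~: darts W then (w, n, s)
      else if w + s ~: W then (w, s, n)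
      else if w + s + n ~: W then (w + s, n, - s)
      else (w + s + n, - s, - n))"

text \<open>Crossing the edge of a dart and turning on the facet behind it leads to the next dart
  with the same start. So \<open>rot\<close> is the vertex rotation of the complex, and its face
  permutation \<open>rot o opp\<close> is \<open>turn\<close>.\<close>

definition rot :: "ivec set => ivec \<times> ivec \<times> ivec => ivec \<times> ivec \<times> ivec" where
  "rot W = turn W o opp W"

lemma frames_simp: "frames = [((1,0,0),(0,1,0)), ((1,0,0),(0,0,1)), ((1,0,0),(0,-1,0)), ((1,0,0),(0,0,-1)),
  ((0,1,0),(1,0,0)), ((0,1,0),(0,0,1)), ((0,1,0),(-1,0,0)), ((0,1,0),(0,0,-1)),
  ((0,0,1),(1,0,0)), ((0,0,1),(0,1,0)), ((0,0,1),(-1,0,0)), ((0,0,1),(0,-1,0)),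
  ((-1,0,0),(0,1,0)), ((-1,0,0),(0,0,1)), ((-1,0,0),(0,-1,0)), ((-1,0,0),(0,0,-1)),
  ((0,-1,0),(1,0,0)), ((0,-1,0),(0,0,1)), ((0,-1,0),(-1,0,0)), ((0,-1,0),(0,0,-1)),
  ((0,0,-1),(1,0,0)), ((0,0,-1),(0,1,0)), ((0,0,-1),(-1,0,0)), ((0,0,-1),(0,-1,0))]"
  by (simp add: frames_def axes_def)

lemma ball_frames: "(ALL f:set frames. P f) \<longleftrightarrow> list_all P frames"
  by (simp add: list_all_iff)

text \<open>All of this is evaluated on the 24 frames. The three identities for
  \<open>corner\<close> are the convex, flat and concave cases of \<open>start_rot\<close>; the
  ranges put the start of a dart into both cubes at its facet.\<close>

lemma frames_closed:
  assumes "(n, s) : set frames"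
  shows "(s, n) : set frames" "(n, - s) : set frames" "(- s, - n) : set frames" "(n, cross n s) : set frames"
    "cross n (cross n s) = - s" "s ~= n" "s ~= - n" "n ~= 0" "s ~= 0"
    "corner (s, cross s n) = corner (n, s)"
    "s + corner (n, cross n (- s)) = corner (n, s)"
    "s + n + corner (- s, cross (- s) (- n)) = corner (n, s)"
    "corner (n, s) - n : {0..1} \<times> {0..1} \<times> {0..1}" "corner (n, s) : {0..1} \<times> {0..1} \<times> {0..1}"
proof -
  have "ALL f:set frames. case f of (n, s) => (s, n) : set frames & (n, - s) : set frames & (- s, - n) : set frames &
    (n, cross n s) : set frames & cross n (cross n s) = - s & s ~= n & s ~= - n & n ~= 0 & s ~= 0 &
    corner (s, cross s n) = corner (n, s) & s + corner (n, cross n (- s)) = corner (n, s) &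
    s + n + corner (- s, cross (- s) (- n)) = corner (n, s) &
    corner (n, s) - n : {0..1} \<times> {0..1} \<times> {0..1} & corner (n, s) : {0..1} \<times> {0..1} \<times> {0..1}"
    unfolding frames_simp by (simp add: zero_prod_def)
  from bspec[OF this assms] show "(s, n) : set frames" "(n, - s) : set frames" "(- s, - n) : set frames" "(n, cross n s) : set frames"
    "cross n (cross n s) = - s" "s ~= n" "s ~= - n" "n ~= 0" "s ~= 0"
    "corner (s, cross s n) = corner (n, s)"
    "s + corner (n, cross n (- s)) = corner (n, s)"
    "s + n + corner (- s, cross (- s) (- n)) = corner (n, s)"
    "corner (n, s) - n : {0..1} \<times> {0..1} \<times> {0..1}" "corner (n, s) : {0..1} \<times> {0..1} \<times> {0..1}" by auto
qed

lemma in_darts: "(w, n, s) : darts W \<longleftrightarrow> w : W & w + n ~: W & (n, s) : set frames"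
  by (simp add: darts_def)

lemma finite_darts: "finite W ==> finite (darts W)"
  by (rule finite_subset[of _ "W \<times> set frames"]) (auto simp: darts_def)

lemma opp_darts: "d : darts W ==> opp W d : darts W"
proof -
  assume d: "d : darts W"
  obtain w n s where eq: "d = (w, n, s)" by (cases d) auto
  have "(n, s) : set frames" using d by (simp add: eq in_darts)
  from frames_closed(1-3)[OF this] show ?thesis
    using d by (auto simp: eq in_darts algebra_simps)
qed

lemma opp_opp: "opp W (opp W d) = d"
proof -
  obtain w n s where d: "d = (w, n, s)" by (cases d) auto
  show ?thesis
  proof (cases "d : darts W")
    case True
    then have "(n, s) : set frames" by (simp add: d in_darts)
    from frames_closed(1-3)[OF this] show ?thesis
      using True unfolding d by (auto simp: in_darts algebra_simps)
  qed (auto simp: d)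
qed

lemma opp_neq: "d : darts W ==> opp W d ~= d"
proof -
  assume d: "d : darts W"
  obtain w n s where eq: "d = (w, n, s)" by (cases d) auto
  have "(n, s) : set frames" using d by (simp add: eq in_darts)
  from frames_closed(6-9)[OF this] show ?thesis
    using d by (auto simp: eq in_darts)
qed

lemma turn_darts: "d : darts W ==> turn W d : darts W"
proof -
  assume d: "d : darts W"
  obtain w n s where eq: "d = (w, n, s)" by (cases d) auto
  have "(n, s) : set frames" using d by (simp add: eq in_darts)
  from frames_closed(4)[OF this] show ?thesis
    using d by (auto simp: eq in_darts)
qed

lemma opp_permutes: "opp W permutes darts W"
proof (rule bij_imp_permutes)
  show "bij_betw (opp W) (darts W) (darts W)"
    by (rule bij_betw_byWitness[where f' = "opp W"]) (auto simp: opp_opp intro: opp_darts simp del: opp.simps)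
qed auto

lemma turn4: "turn W (turn W (turn W (turn W d))) = d"
proof -
  obtain w n s where d: "d = (w, n, s)" by (cases d) auto
  show ?thesis
  proof (cases "d : darts W")
    case True
    then have f: "w : W" "w + n ~: W" "(n, s) : set frames" by (auto simp: d in_darts)
    note g = frames_closed(4)[OF f(3)] and h = frames_closed(4)[OF frames_closed(4)[OF f(3)]]
    note k = frames_closed(4)[OF h]
    have c: "cross n (cross n (cross n (cross n s))) = s"
      using frames_closed(5)[OF f(3)] frames_closed(5)[OF frames_closed(2)[OF f(3)]] by simp
    show ?thesis
      unfolding d using f g h k c by (simp add: in_darts)
  qed (auto simp: d)
qed

lemma turn_permutes: "turn W permutes darts W"
proof (rule bij_imp_permutes)
  show "bij_betw (turn W) (darts W) (darts W)"
    by (rule bij_betw_byWitness[where f' = "turn W o turn W o turn W"]) (auto simp: turn4 intro!: turn_darts simp del: turn.simps)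
qed auto

lemma rot_permutes: "rot W permutes darts W"
  unfolding rot_def by (rule permutes_compose[OF opp_permutes turn_permutes])

lemma rot_opp: "rot W o opp W = turn W"
  by (simp add: fun_eq_iff rot_def opp_opp del: opp.simps turn.simps split_paired_All)

lemma rot_simp:
  assumes "(w, n, s) : darts W"
  shows "rot W (w, n, s) =
     (if w + s ~: W then (w, s, cross s n)
      else if w + s + n ~: W then (w + s, n, cross n (- s))
      else (w + s + n, - s, cross (- s) (- n)))"
proof -
  have "opp W (w, n, s) : darts W" by (rule opp_darts[OF assms])
  then show ?thesis using assms by (auto simp: rot_def simp del: cross.simps)
qed

lemma start_rot: "d : darts W ==> start (rot W d) = start d"
proof -
  assume d: "d : darts W"
  obtain w n s where eq: "d = (w, n, s)" by (cases d) auto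
  have f: "(n, s) : set frames" using d by (simp add: eq in_darts)
  show ?thesis
    using frames_closed(10-12)[OF f] d unfolding eq by (subst rot_simp) (auto simp: add.assoc)
qed

text \<open>A facet has four sides. Since \<open>turn\<close> never leaves a facet, different facets
  give different cycles; a bound from below is the direction wanted for
  \<open>V - E + F\<close>.\<close>

lemma card_darts:
  assumes "finite W"
  shows "card (darts W) = 4 * card {(w, n). w : W & w + n ~: W & n : set axes}"
    and "card {(w, n). w : W & w + n ~: W & n : set axes} <= ncyc (turn W) (darts W)"
proof -
  let ?S = "{(w, n). w : W & w + n ~: W & n : set axes}"
  have finS: "finite ?S" by (rule finite_subset[of _ "W \<times> set axes"]) (use assms in auto)
  have fa: "n : set axes" if "(n, s) : set frames" for n s using that by (auto simp: frames_def)
  have eq: "darts W = (%((w, n), s). (w, n, s)) ` (SIGMA q:?S. {s. (snd q, s) : set frames})"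
  proof (intro equalityI subsetI)
    fix d assume d: "d : darts W"
    obtain w n s where e: "d = (w, n, s)" by (cases d) auto
    have "((w, n), s) : (SIGMA q:?S. {s. (snd q, s) : set frames})" using d fa[of n s] by (auto simp: e in_darts)
    then show "d : (%((w, n), s). (w, n, s)) ` (SIGMA q:?S. {s. (snd q, s) : set frames})"
      unfolding e by (rule rev_image_eqI) simp
  qed (auto simp: darts_def)
  have inj: "inj_on (%((w, n), s). (w, n, s)) A" for A :: "((ivec \<times> ivec) \<times> ivec) set"
    by (auto simp: inj_on_def)
  have "card {s. (n, s) : set frames} = 4" if "n : set axes" for n
  proof -
    have "{s. (n, s) : set frames} = set axes - {n, - n}"
      using that by (auto simp: frames_def)
    moreover have "card (set axes - {n, - n}) = 4"
    proof -
      have "ALL n:set axes. card (set axes - {n, - n}) = 4" by (simp add: axes_def)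
      then show ?thesis using that by blast
    qed
    ultimately show ?thesis by simp
  qed
  then have c4: "card {s. (snd q, s) : set frames} = 4" if "q : ?S" for q using that by auto
  have "card (SIGMA q:?S. {s. (snd q, s) : set frames}) = (\<Sum>q\<in>?S. card {s. (snd q, s) : set frames})"
    by (rule card_SigmaI[OF finS]) (use c4 in \<open>auto intro: card_ge_0_finite\<close>)
  also have "\<dots> = (\<Sum>q\<in>?S. 4)" by (rule sum.cong[OF refl c4])
  also have "\<dots> = 4 * card ?S" by simp
  finally show "card (darts W) = 4 * card ?S"
    unfolding eq by (subst card_image[OF inj]) simp
  have "(%O'. (fst (SOME d. d : O'), fst (snd (SOME d. d : O')))) ` orbit (turn W) ` darts W \<supseteq> ?S"
  proof
    fix q assume "q : ?S"
    then obtain w n where q: "q = (w, n)" "w : W" "w + n ~: W" "n : set axes" by auto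
    have "ALL n:set axes. EX f:set frames. fst f = n" by (simp add: frames_simp axes_def)
    then obtain f where "f : set frames" "fst f = n" using q(4) by blast
    then have "(n, snd f) : set frames" by auto
    then obtain s where "(n, s) : set frames" by blast
    then have d: "(w, n, s) : darts W" using q by (simp add: in_darts)
    have sub: "orbit (turn W) (w, n, s) \<subseteq> {d. fst d = w & fst (snd d) = n}"
      by (rule orbit_subset_closed) auto
    have "(SOME d. d : orbit (turn W) (w, n, s)) : orbit (turn W) (w, n, s)"
      by (rule someI[of "%d. d : orbit (turn W) (w, n, s)"], rule self_in_orbit[OF turn_permutes finite_darts[OF assms]])
    then have "q = (%O'. (fst (SOME d. d : O'), fst (snd (SOME d. d : O')))) (orbit (turn W) (w, n, s))"
      using sub q(1) by auto
    then show "q : (%O'. (fst (SOME d. d : O'), fst (snd (SOME d. d : O')))) ` orbit (turn W) ` darts W"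
      using d by blast
  qed
  then show "card ?S <= ncyc (turn W) (darts W)"
    unfolding ncyc_def by (rule surj_card_le[rotated]) (use finite_darts[OF assms] in auto)
qed

text \<open>By \<open>start_rot\<close>, cycles at different lattice points are different.\<close>

lemma card_start_le_ncyc:
  assumes "finite W"
  shows "card (start ` darts W) <= ncyc (rot W) (darts W)"
proof -
  have "start ` darts W \<subseteq> (%O'. start (SOME d. d : O')) ` orbit (rot W) ` darts W"
  proof
    fix p assume "p : start ` darts W"
    then obtain d where d: "d : darts W" "p = start d" by auto
    have sub: "orbit (rot W) d \<subseteq> {d':darts W. start d' = p}"
      by (rule orbit_subset_closed) (use d start_rot permutes_in_image[OF rot_permutes] in auto)
    have "(SOME d'. d' : orbit (rot W) d) : orbit (rot W) d"
      by (rule someI[of "%d'. d' : orbit (rot W) d"], rule self_in_orbit[OF rot_permutes finite_darts[OF assms]])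
    then have "p = (%O'. start (SOME d. d : O')) (orbit (rot W) d)"
      using sub by auto
    then show "p : (%O'. start (SOME d. d : O')) ` orbit (rot W) ` darts W"
      using d by blast
  qed
  then show ?thesis
    unfolding ncyc_def by (rule surj_card_le[rotated]) (use finite_darts[OF assms] in auto)
qed

section \<open>The surface around a lattice point\<close>

text \<open>The least corners, relative to a lattice point, of the eight cubes around it.\<close>

definition octants :: "ivec list" where
  "octants = List.product [-1, 0] (List.product [-1, 0] [-1, 0])"

text \<open>This is \<open>rot\<close> with the lattice point moved to the origin. A dart
  \<open>(w, n, s)\<close> starting there has \<open>w = - corner (n, s)\<close>, so its frame
  determines it, and \<open>F\<close> tells which of the eight cubes belong to the body.\<close>

definition local_rot :: "(ivec => bool) => ivec \<times> ivec => ivec \<times> ivec" where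
  "local_rot F = (%(n, s).
     (if ~ F (s - corner (n, s)) then (s, cross s n)
      else if ~ F (s + n - corner (n, s)) then (n, cross n (- s))
      else (- s, cross (- s) (- n))))"

definition local_darts :: "(ivec => bool) => (ivec \<times> ivec) list" where
  "local_darts F = filter (%(n, s). F (- corner (n, s)) & ~ F (n - corner (n, s))) frames"

text \<open>The first four flags are the columns around a vertical line, the last two the layers
  below and above the point. Every neighbourhood in a pillar has this form.\<close>

definition pattern :: "bool => bool => bool => bool => bool => bool => ivec => bool" where
  "pattern a b c d l u = (%(x, y, z).
     (if x = -1 then (if y = -1 then a else b) else (if y = -1 then c else d)) &
     (if z = -1 then l else u))"

fun iter :: "nat => ('a => 'a) => 'a => 'a list" where
  "iter 0 f x = [x]"
| "iter (Suc n) f x = x # iter n f (f x)"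

text \<open>The darts at the point form a single cycle: the surface is a manifold there. The clause
  without darts makes the eight cubes agree, so that the point lies off the surface.\<close>

definition local_cyclic :: "(ivec => bool) => bool" where
  "local_cyclic F = (case local_darts F of [] => list_all (%v. F v = F (0, 0, 0)) octants
     | d # ds => (let l = iter (length ds) (local_rot F) d in list_all (%e. e : set l) ds))"

text \<open>Evaluation of the 64 patterns. The premises forbid two columns that touch only along a
  diagonal, where two sheets of the boundary would meet in a vertical edge.\<close>

lemma local_cyclic_pattern:
  "ALL a b c d l u. (a & d --> b | c) --> (b & c --> a | d) --> local_cyclic (pattern a b c d l u)"
  unfolding all_bool_eq by (intro conjI; code_simp)


definition pillar :: "(int => int => bool) => int => ivec set" where
  "pillar Q N = {(x, y, z). Q x y & 0 <= z & z < N}"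

lemma pattern_pillar:
  assumes "v : set octants"
  shows "(x, y, z) + v : pillar Q N \<longleftrightarrow>
    pattern (Q (x - 1) (y - 1)) (Q (x - 1) y) (Q x (y - 1)) (Q x y) (0 <= z - 1 & z - 1 < N) (0 <= z & z < N) v"
proof -
  have "list_all (%v. (x, y, z) + v : pillar Q N \<longleftrightarrow>
    pattern (Q (x - 1) (y - 1)) (Q (x - 1) y) (Q x (y - 1)) (Q x y) (0 <= z - 1 & z - 1 < N) (0 <= z & z < N) v) octants"
    by (simp add: octants_def pattern_def pillar_def)
  then show ?thesis using assms by (simp add: list_all_iff)
qed

lemma frames_octants:
  assumes "f : set frames"
  shows "- corner f : set octants" "fst f - corner f : set octants" "snd f - corner f : set octants"
    "snd f + fst f - corner f : set octants"
proof -
  have "ALL f:set frames. - corner f : set octants & fst f - corner f : set octants & snd f - corner f : set octants &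
    snd f + fst f - corner f : set octants"
    unfolding ball_frames frames_simp octants_def by code_simp
  with assms show "- corner f : set octants" "fst f - corner f : set octants" "snd f - corner f : set octants"
    "snd f + fst f - corner f : set octants" by blast+
qed

definition dart_at :: "ivec => ivec \<times> ivec => ivec \<times> ivec \<times> ivec" where
  "dart_at p f = (p - corner f, f)"

lemma dart_at_darts:
  "dart_at p f : darts W \<longleftrightarrow> f : set (local_darts (%v. p + v : W))"
proof -
  obtain n s where f: "f = (n, s)" by (cases f) blast
  have e: "p - corner f + n = p + (n - corner f)" by (simp add: algebra_simps)
  show ?thesis
    unfolding dart_at_def f in_darts local_darts_def e[unfolded f] by (auto simp del: corner.simps)
qed

lemma dart_at_start: "start d = p \<longleftrightarrow> d = dart_at p (snd d)"
proof -
  obtain w n s where d: "d = (w, n, s)" by (cases d) blast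
  show ?thesis unfolding d dart_at_def by (simp add: eq_diff_eq del: corner.simps)
qed

lemma rot_dart_at:
  assumes "f : set (local_darts (%v. p + v : W))"
  shows "rot W (dart_at p f) = dart_at p (local_rot (%v. p + v : W) f)"
proof -
  have d: "dart_at p f : darts W" using assms by (simp add: dart_at_darts)
  obtain n s where f: "f = (n, s)" by (cases f) blast
  have eqs: "p + (s - corner f) = p - corner f + s" "p + (s + n - corner f) = p - corner f + s + n"
    by (simp_all add: add.assoc)
  have "snd (rot W (dart_at p f)) = local_rot (%v. p + v : W) f"
    unfolding f dart_at_def local_rot_def rot_simp[OF d[unfolded f dart_at_def]] prod.case
      eqs[unfolded f] by simp
  moreover have "start (rot W (dart_at p f)) = p"
    unfolding start_rot[OF d] by (simp add: dart_at_start) (simp add: dart_at_def)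
  ultimately show ?thesis using dart_at_start[of "rot W (dart_at p f)" p] by simp
qed

lemma iter_orbit:
  assumes "finite W" "f : set (local_darts (%v. p + v : W))" "e : set (iter k (local_rot (%v. p + v : W)) f)"
  shows "dart_at p e : orbit (rot W) (dart_at p f)"
  using assms(2,3)
proof (induction k arbitrary: f)
  case 0
  then show ?case using self_in_orbit[OF rot_permutes finite_darts[OF assms(1)]] by simp
next
  case (Suc k)
  let ?g = "local_rot (%v. p + v : W) f"
  consider "e = f" | "e : set (iter k (local_rot (%v. p + v : W)) ?g)" using Suc.prems(2) by auto
  then show ?case
  proof cases
    case 1
    then show ?thesis using self_in_orbit[OF rot_permutes finite_darts[OF assms(1)]] by simp
  next
    case 2
    have r: "rot W (dart_at p f) = dart_at p ?g" by (rule rot_dart_at[OF Suc.prems(1)])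
    have "?g : set (local_darts (%v. p + v : W))"
      using Suc.prems(1) permutes_in_image[OF rot_permutes, of W "dart_at p f"]
      by (simp add: dart_at_darts[symmetric] r)
    then have "dart_at p e : orbit (rot W) (dart_at p ?g)" using Suc.IH 2 by blast
    moreover have "dart_at p ?g : orbit (rot W) (dart_at p f)" using orbit.base[of "rot W" "dart_at p f"] r by simp
    ultimately show ?thesis by (rule orbit_trans)
  qed
qed

lemma local_cong:
  assumes "!!v. v : set octants ==> F v = G v"
  shows "local_darts F = local_darts G" "f : set frames ==> local_rot F f = local_rot G f"
proof -
  show "local_darts F = local_darts G"
    unfolding local_darts_def
  proof (rule filter_cong[OF refl])
    fix f assume f: "f : set frames"
    obtain n s where e: "f = (n, s)" by (cases f) blast
    show "(case f of (n, s) => F (- corner (n, s)) & ~ F (n - corner (n, s))) =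
      (case f of (n, s) => G (- corner (n, s)) & ~ G (n - corner (n, s)))"
      using frames_octants(1,2)[OF f] assms unfolding e prod.case fst_conv snd_conv by simp
  qed
  show "local_rot F f = local_rot G f" if "f : set frames"
  proof -
    obtain n s where e: "f = (n, s)" by (cases f) blast
    have "F (s - corner f) = G (s - corner f)" "F (s + n - corner f) = G (s + n - corner f)"
      using frames_octants(3,4)[OF that] assms unfolding e fst_conv snd_conv by blast+
    then show ?thesis unfolding local_rot_def e prod.case by simp
  qed
qed

text \<open>Closedness keeps the iterates among the frames, where the local rotation consults only
  the octants.\<close>

lemma local_cyclic_cong:
  assumes agree: "!!v. v : set octants ==> F v = G v"
    and closed: "!!f. f : set (local_darts F) ==> local_rot F f : set (local_darts F)"
    and "local_cyclic G"
  shows "local_cyclic F"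
proof -
  have ld: "local_darts F = local_darts G" by (rule local_cong(1)) (rule agree)
  have lr: "local_rot F f = local_rot G f" if "f : set frames" for f
    by (rule local_cong(2)[OF _ that]) (rule agree)
  have sub: "set (local_darts F) \<subseteq> set frames" by (auto simp: local_darts_def)
  have it: "iter k (local_rot F) f = iter k (local_rot G) f" if "f : set (local_darts F)" for k f
    using that
  proof (induction k arbitrary: f)
    case (Suc k)
    then show ?case using lr[of f] sub closed[of f] by auto
  qed simp
  have "(0, 0, 0) : set octants" by (simp add: octants_def)
  moreover have "list_all (%v. F v = F (0, 0, 0)) octants = list_all (%v. G v = G (0, 0, 0)) octants"
    using agree calculation by (simp add: list_all_iff)
  ultimately show ?thesis
    using assms(3) it unfolding local_cyclic_def ld[symmetric]
    by (cases "local_darts F") (simp_all add: Let_def)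
qed

lemma pillar_local_cyclic:
  assumes Q: "!!x y. Q (x - 1) (y - 1) ==> Q x y ==> Q (x - 1) y | Q x (y - 1)"
      "!!x y. Q (x - 1) y ==> Q x (y - 1) ==> Q (x - 1) (y - 1) | Q x y"
  shows "local_cyclic (%v. p + v : pillar Q N)"
proof -
  obtain x y z where p: "p = (x, y, z)" by (cases p) blast
  show ?thesis
  proof (rule local_cyclic_cong)
    show "local_cyclic (pattern (Q (x - 1) (y - 1)) (Q (x - 1) y) (Q x (y - 1)) (Q x y)
        (0 <= z - 1 & z - 1 < N) (0 <= z & z < N))"
      by (rule local_cyclic_pattern[rule_format]) (use Q[of x y] in blast)+
    show "local_rot (%v. p + v : pillar Q N) f : set (local_darts (%v. p + v : pillar Q N))"
      if "f : set (local_darts (%v. p + v : pillar Q N))" for f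
      using that permutes_in_image[OF rot_permutes, of "pillar Q N" "dart_at p f"]
      by (simp add: dart_at_darts[symmetric] rot_dart_at)
  qed (simp only: p pattern_pillar)
qed

text \<open>This identifies the cycles of \<open>rot\<close> with lattice points: a set of darts
  closed under \<open>rot\<close> contains all darts at a point or none.\<close>

lemma same_start_same_orbit:
  assumes "finite W" "local_cyclic (%v. start d + v : W)"
    and d: "d : darts W" "d' : darts W" "start d' = start d"
  shows "d' : orbit (rot W) d"
proof -
  define p where "p = start d"
  define F where "F = (%v. p + v : W)"
  have dd: "d = dart_at p (snd d)" "d' = dart_at p (snd d')"
    using dart_at_start[of d p] dart_at_start[of d' p] d(3) p_def by simp_all
  have m: "snd d : set (local_darts F)" "snd d' : set (local_darts F)"
    using d(1,2) dart_at_darts[of p "snd d" W] dart_at_darts[of p "snd d'" W] dd unfolding F_def by simp_all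
  then obtain e es where es: "local_darts F = e # es" by (cases "local_darts F") auto
  have "dart_at p f : orbit (rot W) (dart_at p e)" if "f : set (local_darts F)" for f
  proof -
    have "f : set (iter (length es) (local_rot F) e)"
    proof (cases "f = e")
      case True
      then show ?thesis by (cases "length es") auto
    next
      case False
      then show ?thesis
        using assms(2) that es unfolding local_cyclic_def p_def[symmetric] F_def[symmetric]
        by (auto simp: list_all_iff Let_def)
    qed
    then show ?thesis
      by (intro iter_orbit[OF assms(1)]) (use es in \<open>auto simp: F_def\<close>)
  qed
  then have "d : orbit (rot W) (dart_at p e)" "d' : orbit (rot W) (dart_at p e)"
    using m dd by metis+
  then show ?thesis
    using orbit_eqI'[OF rot_permutes finite_darts[OF assms(1)]] by metis
qed

text \<open>If no dart started at the point, the first clause of \<open>local_cyclic\<close> would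
  make all eight cubes agree.\<close>

lemma mixed_start:
  assumes "local_cyclic (%v. p + v : W)"
    and "v : set octants" "v' : set octants" "p + v : W" "p + v' ~: W"
  shows "p : start ` darts W"
proof (cases "local_darts (%v. p + v : W)")
  case Nil
  then show ?thesis using assms by (auto simp: local_cyclic_def list_all_iff)
next
  case (Cons f fs)
  then have "dart_at p f : darts W" by (simp add: dart_at_darts)
  moreover have "start (dart_at p f) = p" by (simp add: dart_at_start dart_at_def)
  ultimately show ?thesis by force
qed

section \<open>Euler characteristic of the voxel surface\<close>

text \<open>With \<open>N\<close> voxels to the unit length, the solid bridge number
  \<open>t\<close> occupies the first \<open>N\<close> voxels from \<open>hole N t\<close> on, and
  the tunnel number \<open>t\<close> the next \<open>N\<close>.\<close>

definition hole :: "int => nat => int" where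
  "hole N t = 2 * int t * N"

lemma int_card_Diff:
  "finite A ==> B \<subseteq> A ==> int (card (A - B)) = int (card A) - int (card B)"
  by (simp add: card_Diff_subset finite_subset card_mono of_nat_diff)

definition slab_cell :: "nat => int => int => int => bool" where
  "slab_cell g N x y \<longleftrightarrow> 0 <= x & x < hole N g + N & 0 <= y & y < 3 * N &
     ~((EX t<g. hole N t + N <= x & x < hole N t + 2 * N) & N <= y & y < 2 * N)"

definition voxels :: "nat => int => ivec set" where
  "voxels g N = pillar (slab_cell g N) N"

lemma in_voxels: "(x, y, z) : voxels g N \<longleftrightarrow> slab_cell g N x y & 0 <= z & z < N"
  by (simp add: voxels_def pillar_def)

lemma finite_voxels: "finite (voxels g N)"
  by (rule finite_subset[of _ "{0..<hole N g + N} \<times> {0..<3 * N} \<times> {0..<N}"])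
    (auto simp: voxels_def pillar_def slab_cell_def)

lemma voxels_local_cyclic: "local_cyclic (%v. p + v : voxels g N)"
  unfolding voxels_def
  by (rule pillar_local_cyclic; unfold slab_cell_def; blast)

context
  fixes g :: nat and N :: int
  assumes N: "1 <= N"
begin

lemma hole_mono: "t < t' ==> hole N t + 2 * N <= hole N t'"
proof -
  assume "t < t'"
  then have "(2 * int t + 2) * N <= (2 * int t') * N" using N by (intro mult_right_mono) auto
  then show ?thesis by (simp add: hole_def algebra_simps)
qed

lemma hole_nonneg: "0 <= hole N t"
  using N by (simp add: hole_def)

definition base :: "(int \<times> int) set" where
  "base = {0..<hole N g + N} \<times> {0..<3 * N} - (\<Union>t<g. {hole N t + N..<hole N t + 2 * N} \<times> {N..<2 * N})"

text \<open>Lattice points on the tunnel walls stay, so a tunnel removes only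
  \<open>(N - 1)^2\<close> points, against \<open>N^2\<close> cells in \<open>base\<close>.\<close>

definition base_pts :: "(int \<times> int) set" where
  "base_pts = {0..hole N g + N} \<times> {0..3 * N}
     - (\<Union>t<g. {hole N t + N + 1..hole N t + 2 * N - 1} \<times> {N + 1..2 * N - 1})"

definition rim :: "(int \<times> int) set" where
  "rim = ({0..hole N g + N} \<times> {0..3 * N} - {1..hole N g + N - 1} \<times> {1..3 * N - 1})
     Un (\<Union>t<g. {hole N t + N..hole N t + 2 * N} \<times> {N..2 * N}
          - {hole N t + N + 1..hole N t + 2 * N - 1} \<times> {N + 1..2 * N - 1})"

lemma in_base: "(x, y) : base \<longleftrightarrow> slab_cell g N x y"
  by (auto simp: base_def slab_cell_def)

lemma card_base: "int (card base) = (hole N g + N) * (3 * N) - int g * N\<^sup>2"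
proof -
  let ?H = "%t. {hole N t + N..<hole N t + 2 * N} \<times> {N..<2 * N}"
  have "card (\<Union>t<g. ?H t) = (\<Sum>t<g. card (?H t))"
  proof (rule card_UN_disjoint)
    show "ALL i:{..<g}. ALL j:{..<g}. i ~= j --> ?H i Int ?H j = {}"
    proof (intro ballI impI)
      fix i j :: nat assume "i ~= j"
      then consider "i < j" | "j < i" by linarith
      then show "?H i Int ?H j = {}" using hole_mono[of i j] hole_mono[of j i] N by cases fastforce+
    qed
  qed auto
  also have "\<dots> = g * nat (N * N)" using N by (simp add: card_cartesian_product nat_mult_distrib)
  finally have H: "int (card (\<Union>t<g. ?H t)) = int g * N\<^sup>2" using N by (simp add: power2_eq_square)
  have "int (card base) = int (card ({0..<hole N g + N} \<times> {0..<3 * N})) - int (card (\<Union>t<g. ?H t))"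
    unfolding base_def
  proof (rule int_card_Diff)
    show "(\<Union>t<g. ?H t) \<subseteq> {0..<hole N g + N} \<times> {0..<3 * N}"
    proof (intro UN_least)
      fix t assume "t : {..<g}"
      then show "?H t \<subseteq> {0..<hole N g + N} \<times> {0..<3 * N}"
        using hole_mono[of t g] hole_nonneg[of t] N by fastforce
    qed
  qed auto
  moreover have "int (card ({0..<hole N g + N} \<times> {0..<3 * N})) = (hole N g + N) * (3 * N)"
    using N hole_nonneg[of g] by (simp add: card_cartesian_product)
  ultimately show ?thesis using H by simp
qed

lemma card_base_pts: "(hole N g + N + 1) * (3 * N + 1) - int g * (N - 1)\<^sup>2 <= int (card base_pts)"
proof -
  let ?H = "%t. {hole N t + N + 1..hole N t + 2 * N - 1} \<times> {N + 1..2 * N - 1}"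
  have "card (\<Union>t<g. ?H t) <= (\<Sum>t<g. card (?H t))" by (rule card_UN_le) simp
  also have "\<dots> = g * nat ((N - 1) * (N - 1))"
    using N by (simp add: card_cartesian_product nat_mult_distrib)
  finally have H: "int (card (\<Union>t<g. ?H t)) <= int g * (N - 1)\<^sup>2"
    using N by (simp add: power2_eq_square of_nat_le_iff[symmetric, where 'a = int] del: of_nat_le_iff)
  have "int (card ({0..hole N g + N} \<times> {0..3 * N})) = (hole N g + N + 1) * (3 * N + 1)"
    using N hole_nonneg[of g] by (simp add: card_cartesian_product)
  moreover have "card ({0..hole N g + N} \<times> {0..3 * N}) - card (\<Union>t<g. ?H t) <= card base_pts"
    unfolding base_pts_def by (rule diff_card_le_card_Diff) auto
  ultimately show ?thesis using H by linarith
qed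

lemma card_rim: "int (card rim) = 2 * (hole N g + N) + 6 * N + 4 * int g * N"
proof -
  let ?O = "{0..hole N g + N} \<times> {0..3 * N} - {1..hole N g + N - 1} \<times> {1..3 * N - 1}"
  let ?H = "%t. {hole N t + N..hole N t + 2 * N} \<times> {N..2 * N}
          - {hole N t + N + 1..hole N t + 2 * N - 1} \<times> {N + 1..2 * N - 1}"
  have h0: "int (card (?H t)) = 4 * N" for t
  proof -
    have "int (card (?H t)) = int (card ({hole N t + N..hole N t + 2 * N} \<times> {N..2 * N}))
          - int (card ({hole N t + N + 1..hole N t + 2 * N - 1} \<times> {N + 1..2 * N - 1}))"
      by (rule int_card_Diff) auto
    moreover have "int (card ({hole N t + N..hole N t + 2 * N} \<times> {N..2 * N})) = (N + 1) * (N + 1)"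
      "int (card ({hole N t + N + 1..hole N t + 2 * N - 1} \<times> {N + 1..2 * N - 1})) = (N - 1) * (N - 1)"
      using N by (simp_all add: card_cartesian_product)
    ultimately have "int (card (?H t)) = (N + 1) * (N + 1) - (N - 1) * (N - 1)" by linarith
    then show ?thesis by (simp add: algebra_simps)
  qed
  have o0: "int (card ?O) = 2 * (hole N g + N) + 6 * N"
  proof -
    have "int (card ?O) = int (card ({0..hole N g + N} \<times> {0..3 * N})) - int (card ({1..hole N g + N - 1} \<times> {1..3 * N - 1}))"
      by (rule int_card_Diff) auto
    moreover have "int (card ({0..hole N g + N} \<times> {0..3 * N})) = (hole N g + N + 1) * (3 * N + 1)"
      "int (card ({1..hole N g + N - 1} \<times> {1..3 * N - 1})) = (hole N g + N - 1) * (3 * N - 1)"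
      using N hole_nonneg[of g] by (simp_all add: card_cartesian_product)
    ultimately have "int (card ?O) = (hole N g + N + 1) * (3 * N + 1) - (hole N g + N - 1) * (3 * N - 1)" by linarith
    then show ?thesis by (simp add: algebra_simps)
  qed
  have "card (\<Union>t<g. ?H t) = (\<Sum>t<g. card (?H t))"
  proof (rule card_UN_disjoint)
    show "ALL i:{..<g}. ALL j:{..<g}. i ~= j --> ?H i Int ?H j = {}"
    proof (intro ballI impI)
      fix i j :: nat assume "i ~= j"
      then consider "i < j" | "j < i" by linarith
      then show "?H i Int ?H j = {}" using hole_mono[of i j] hole_mono[of j i] N by cases fastforce+
    qed
  qed auto
  then have "int (card (\<Union>t<g. ?H t)) = (\<Sum>t<g. int (card (?H t)))" by simp
  then have H: "int (card (\<Union>t<g. ?H t)) = 4 * int g * N" unfolding h0 by simp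
  have "card rim = card ?O + card (\<Union>t<g. ?H t)"
    unfolding rim_def
  proof (rule card_Un_disjoint)
    have "?O Int ?H t = {}" if "t < g" for t
      using hole_mono[OF that] hole_nonneg[of t] N by fastforce
    then show "?O Int (\<Union>t<g. ?H t) = {}" by blast
  qed auto
  then show ?thesis using H o0 by simp
qed

lemma rim_subset: "rim \<subseteq> base_pts"
proof
  fix p assume p: "p : rim"
  obtain x y where xy: "p = (x, y)" by (cases p) blast
  have out: "~(hole N t + N + 1 <= x & x <= hole N t + 2 * N - 1 & N + 1 <= y & y <= 2 * N - 1)" if t: "t < g" for t
  proof
    assume h: "hole N t + N + 1 <= x & x <= hole N t + 2 * N - 1 & N + 1 <= y & y <= 2 * N - 1"
    consider "~(1 <= x & x <= hole N g + N - 1 & 1 <= y & y <= 3 * N - 1)"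
      | t' where "t' < g" "hole N t' + N <= x" "x <= hole N t' + 2 * N"
        "~(hole N t' + N + 1 <= x & x <= hole N t' + 2 * N - 1 & N + 1 <= y & y <= 2 * N - 1)"
      using p unfolding xy rim_def by auto
    then show False
    proof cases
      case 1
      then show ?thesis using h hole_mono[OF t] hole_nonneg[of t] N by linarith
    next
      case 2
      then consider "t' = t" | "t' < t" | "t < t'" by linarith
      then show ?thesis using 2 h hole_mono[of t' t] hole_mono[of t t'] N by cases auto
    qed
  qed
  have "0 <= x & x <= hole N g + N & 0 <= y & y <= 3 * N"
    using p unfolding xy rim_def
  proof (elim UnE UN_E)
    fix t assume "t : {..<g}" and "(x, y) : {hole N t + N..hole N t + 2 * N} \<times> {N..2 * N}
          - {hole N t + N + 1..hole N t + 2 * N - 1} \<times> {N + 1..2 * N - 1}"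
    then show ?thesis using hole_mono[of t g] hole_nonneg[of t] N by auto
  qed auto
  then show "p : base_pts" using out unfolding xy base_pts_def by auto
qed

lemma base_pts_adj:
  assumes "(x, y) : base_pts"
  shows "EX a:{-1, 0}. EX b:{-1, 0}. slab_cell g N (x + a) (y + b)"
proof -
  have xy: "0 <= x" "x <= hole N g + N" "0 <= y" "y <= 3 * N"
    and out: "!!t. t < g ==> ~(hole N t + N + 1 <= x & x <= hole N t + 2 * N - 1 & N + 1 <= y & y <= 2 * N - 1)"
    using assms by (auto simp: base_pts_def)
  note hg = hole_nonneg[of g]
  define a :: int where "a = (if x < hole N g + N then 0 else -1)"
  have a: "0 <= x + a" "x + a < hole N g + N" "a : {-1, 0}" using xy hg N by (auto simp: a_def)
  consider "y <= N" | "2 * N <= y" | "N + 1 <= y" "y <= 2 * N - 1" by linarith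
  then show ?thesis
  proof cases
    case 1
    define b :: int where "b = (if y < N then 0 else -1)"
    have "0 <= y + b" "y + b < N" "b : {-1, 0}" using 1 xy N by (auto simp: b_def)
    then have "slab_cell g N (x + a) (y + b)" using a N by (auto simp: slab_cell_def)
    then show ?thesis using a(3) \<open>b : {-1, 0}\<close> by blast
  next
    case 2
    define b :: int where "b = (if y < 3 * N then 0 else -1)"
    have "2 * N <= y + b" "y + b < 3 * N" "b : {-1, 0}" using 2 xy N by (auto simp: b_def)
    then have "slab_cell g N (x + a) (y + b)" using a N by (auto simp: slab_cell_def)
    then show ?thesis using a(3) \<open>b : {-1, 0}\<close> by blast
  next
    case 3
    then have out': "~(hole N t + N + 1 <= x & x <= hole N t + 2 * N - 1)" if "t < g" for t
      using out[OF that] by auto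
    have "EX a:{-1, 0}. 0 <= x + a & x + a < hole N g + N & (ALL t<g. ~(hole N t + N <= x + a & x + a < hole N t + 2 * N))"
    proof (cases "EX t<g. hole N t + N <= x & x < hole N t + 2 * N")
      case True
      then obtain t where t: "t < g" "hole N t + N <= x" "x < hole N t + 2 * N" by blast
      \<comment> \<open>At this height a lattice point outside the open tunnel but in its half-open
        range of cells is on the left wall, so the cell to its left is solid.\<close>
      then have xe: "x = hole N t + N" using out'[OF t(1)] by linarith
      have "~(hole N t' + N <= x + -1 & x + -1 < hole N t' + 2 * N)" for t'
      proof -
        consider "t' = t" | "t' < t" | "t < t'" by linarith
        then show ?thesis using xe hole_mono[of t' t] hole_mono[of t t'] N by cases auto
      qed
      moreover have "0 <= x + -1" "x + -1 < hole N g + N" using xe hole_nonneg[of t] xy N by auto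
      ultimately show ?thesis by blast
    next
      case False
      show ?thesis
      proof (cases "x < hole N g + N")
        case True
        then show ?thesis using False xy by (intro bexI[of _ 0]) auto
      next
        case f: False
        then have xe: "x = hole N g + N" using xy by simp
        have "~(hole N t + N <= x + -1 & x + -1 < hole N t + 2 * N)" if "t < g" for t
          using xe hole_mono[OF that] N by auto
        then show ?thesis using xe xy hg N by (intro bexI[of _ "-1"]) auto
      qed
    qed
    then obtain a where a: "a : {-1, 0}" "0 <= x + a" "x + a < hole N g + N"
      "!!t. t < g ==> ~(hole N t + N <= x + a & x + a < hole N t + 2 * N)" by blast
    then have "slab_cell g N (x + a) (y + 0)"
      using 3 N unfolding slab_cell_def by auto
    then show ?thesis using a(1) by blast
  qed
qed

lemma rim_adj:
  assumes "(x, y) : rim"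
  shows "EX a:{-1, 0}. EX b:{-1, 0}. ~ slab_cell g N (x + a) (y + b)"
proof -
  consider "x <= 0" | "hole N g + N <= x" | "y <= 0" | "3 * N <= y"
    | t where "t < g" "hole N t + N <= x" "x <= hole N t + 2 * N" "N <= y" "y <= 2 * N"
    using assms unfolding rim_def by fastforce
  then show ?thesis
  proof cases
    case 1 then show ?thesis by (intro bexI[of _ "-1"]) (auto simp: slab_cell_def)
  next
    case 2 then show ?thesis by (intro bexI[of _ "0"]) (auto simp: slab_cell_def)
  next
    case 3 then show ?thesis by (intro bexI[of _ "-1"]) (auto simp: slab_cell_def)
  next
    case 4 then show ?thesis by (intro bexI[of _ "0"]) (auto simp: slab_cell_def)
  next
    case 5
    define a :: int where "a = (if x < hole N t + 2 * N then 0 else -1)"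
    define b :: int where "b = (if y < 2 * N then 0 else -1)"
    have "hole N t + N <= x + a" "x + a < hole N t + 2 * N" "N <= y + b" "y + b < 2 * N" "a : {-1,0}" "b : {-1, 0}"
      using 5 N by (auto simp: a_def b_def)
    moreover from this have "~ slab_cell g N (x + a) (y + b)" using 5(1) by (auto simp: slab_cell_def)
    ultimately show ?thesis by blast
  qed
qed


lemma octantI: "a : {-1, 0} ==> b : {-1, 0} ==> c : {-1, 0} ==> (a, b, c) : set octants"
  by (auto simp: octants_def)

text \<open>The vertices counted are all of \<open>base_pts\<close> on the bottom and on the top,
  and \<open>rim\<close> at the \<open>N - 1\<close> levels between. Each has a voxel and an empty
  cube among its octants, so \<open>mixed_start\<close> applies.\<close>

lemma start_points: "2 * card base_pts + card rim * nat (N - 1) <= card (start ` darts (voxels g N))"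
proof -
  define P where "P = (%((x, y), z). (x, y, z)) ` (base_pts \<times> {0, N} Un rim \<times> {1..N - 1})"
  have fin: "finite base_pts" "finite rim"
    unfolding base_pts_def rim_def by auto
  have "card P = card (base_pts \<times> {0, N} Un rim \<times> {1..N - 1})"
    unfolding P_def by (rule card_image) (auto simp: inj_on_def)
  also have "\<dots> = card (base_pts \<times> {0, N}) + card (rim \<times> {1..N - 1})"
    by (rule card_Un_disjoint) (use fin in auto)
  also have "\<dots> = 2 * card base_pts + card rim * nat (N - 1)"
    using N by (simp add: card_cartesian_product)
  finally have card: "card P = 2 * card base_pts + card rim * nat (N - 1)" .
  have "P \<subseteq> start ` darts (voxels g N)"
  proof
    fix p assume "p : P"
    then obtain x y z where p: "p = (x, y, z)"
      and c: "(x, y) : base_pts & (z = 0 | z = N) | (x, y) : rim & 1 <= z & z <= N - 1"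
      unfolding P_def by auto
    then have "(x, y) : base_pts" using rim_subset by auto
    then obtain a b where ab: "a : {-1, 0}" "b : {-1, 0}" "slab_cell g N (x + a) (y + b)"
      using base_pts_adj by blast
    show "p : start ` darts (voxels g N)"
    proof (cases "z = 0 | z = N")
      case True
      define u :: int where "u = (if z = 0 then 0 else -1)"
      define v :: int where "v = (if z = 0 then -1 else 0)"
      have "0 <= z + u" "z + u < N" "~(0 <= z + v & z + v < N)" "u : {-1, 0}" "v : {-1, 0}"
        using True N by (auto simp: u_def v_def)
      then show ?thesis
        using ab by (intro mixed_start[OF voxels_local_cyclic, of "(a, b, u)" "(a, b, v)"] octantI)
          (auto simp: p in_voxels)
    next
      case False
      then have z: "1 <= z" "z <= N - 1" and "(x, y) : rim" using c by auto
      then obtain a' b' where ab': "a' : {-1, 0}" "b' : {-1, 0}" "~ slab_cell g N (x + a') (y + b')"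
        using rim_adj by blast
      show ?thesis
        using ab ab' z by (intro mixed_start[OF voxels_local_cyclic, of "(a, b, 0)" "(a', b', 0)"] octantI)
          (auto simp: p in_voxels)
    qed
  qed
  then have "card P <= card (start ` darts (voxels g N))"
    by (rule card_mono[rotated]) (use finite_darts[OF finite_voxels] in auto)
  then show ?thesis using card by simp
qed

lemma card_facets_le:
  assumes "{w : voxels g N. w + n ~: voxels g N} \<subseteq> (%((x, y), z). (x, y, z)) ` (P \<times> Z)"
    and "finite P" "finite Z" "int (card P) <= p" "int (card Z) <= q"
  shows "int (card {w : voxels g N. w + n ~: voxels g N}) <= p * q"
proof -
  have "card {w : voxels g N. w + n ~: voxels g N} <= card ((%((x, y), z). (x, y, z)) ` (P \<times> Z))"
    by (rule card_mono[OF _ assms(1)]) (use assms in auto)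
  also have "\<dots> <= card (P \<times> Z)" by (rule card_image_le) (use assms in auto)
  finally have "int (card {w : voxels g N. w + n ~: voxels g N}) <= int (card P) * int (card Z)"
    by (simp add: card_cartesian_product of_nat_le_iff[symmetric, where 'a = int] del: of_nat_le_iff)
  also have "\<dots> <= p * q" using assms(4,5) by (intro mult_mono) auto
  finally show ?thesis .
qed

lemma card_Un_UN_le:
  assumes "int (card A) <= a" "!!t. t < g ==> int (card (B t)) <= b"
  shows "int (card (A Un (\<Union>t<g. B t))) <= a + int g * b"
proof -
  have "card (A Un (\<Union>t<g. B t)) <= card A + (\<Sum>t<g. card (B t))"
    by (rule order_trans[OF card_Un_le add_left_mono[OF card_UN_le]]) auto
  then have "int (card (A Un (\<Union>t<g. B t))) <= int (card A) + (\<Sum>t<g. int (card (B t)))"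
    by (simp add: of_nat_le_iff[symmetric, where 'a = int] del: of_nat_le_iff)
  also have "(\<Sum>t<g. int (card (B t))) <= (\<Sum>t<g. b)" using assms by (intro sum_mono) auto
  finally show ?thesis using assms(1) by simp
qed

lemma facets_le:
  "int (card {(w, n). w : voxels g N & w + n ~: voxels g N & n : set axes})
     <= 2 * int (card base) + 2 * ((3 * N + int g * N) * N) + 2 * ((hole N g + N + int g * N) * N)"
proof -
  let ?F = "%n. {w : voxels g N. w + n ~: voxels g N}"
  have finb: "finite base" by (simp add: base_def)
  let ?cell = "%A. (%((x, y), z). (x, y, z)) ` (A \<times> {0..<N}) :: ivec set"
  have Z: "int (card {0..<N}) <= N" using N by simp
  have memI: "(x, y, z) : (%((x, y), z). (x, y, z)) ` (P \<times> Z) \<longleftrightarrow> (x, y) : P & z : Z" for x y z :: int and P Z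
    by force
  have top: "int (card (?F (0, 0, 1))) <= int (card base) * 1"
    by (rule card_facets_le[where P = base and Z = "{N - 1}"])
      (auto simp: in_voxels memI in_base finb)
  have bot: "int (card (?F (0, 0, -1))) <= int (card base) * 1"
    by (rule card_facets_le[where P = base and Z = "{0}"])
      (auto simp: in_voxels memI in_base finb)
  let ?R = "{hole N g + N - 1} \<times> {0..<3 * N} Un (\<Union>t<g. {hole N t + N - 1} \<times> {N..<2 * N})"
  have right: "int (card (?F (1, 0, 0))) <= (3 * N + int g * N) * N"
  proof (rule card_facets_le[where P = ?R and Z = "{0..<N}"])
    show "?F (1, 0, 0) \<subseteq> (%((x, y), z). (x, y, z)) ` (?R \<times> {0..<N})"
    proof
      fix w assume w: "w : ?F (1, 0, 0)"
      obtain x y z where e: "w = (x, y, z)" by (cases w) blast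
      have c: "slab_cell g N x y" "0 <= z" "z < N" "~ slab_cell g N (x + 1) y" using w by (auto simp: e in_voxels)
      then consider "x = hole N g + N - 1" "0 <= y" "y < 3 * N"
        | t where "t < g" "x = hole N t + N - 1" "N <= y" "y < 2 * N"
        unfolding slab_cell_def by force
      then show "w : (%((x, y), z). (x, y, z)) ` (?R \<times> {0..<N})"
        unfolding e memI using c by cases auto
    qed
    show "int (card ?R) <= 3 * N + int g * N"
      by (rule card_Un_UN_le) (use N in \<open>auto simp: card_cartesian_product\<close>)
  qed (use Z in auto)
  let ?L = "{0} \<times> {0..<3 * N} Un (\<Union>t<g. {hole N t + 2 * N} \<times> {N..<2 * N})"
  have left: "int (card (?F (-1, 0, 0))) <= (3 * N + int g * N) * N"
  proof (rule card_facets_le[where P = ?L and Z = "{0..<N}"])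
    show "?F (-1, 0, 0) \<subseteq> (%((x, y), z). (x, y, z)) ` (?L \<times> {0..<N})"
    proof
      fix w assume w: "w : ?F (-1, 0, 0)"
      obtain x y z where e: "w = (x, y, z)" by (cases w) blast
      have c: "slab_cell g N x y" "0 <= z" "z < N" "~ slab_cell g N (x - 1) y" using w by (auto simp: e in_voxels)
      then consider "x = 0" "0 <= y" "y < 3 * N"
        | t where "t < g" "x = hole N t + 2 * N" "N <= y" "y < 2 * N"
        unfolding slab_cell_def by force
      then show "w : (%((x, y), z). (x, y, z)) ` (?L \<times> {0..<N})"
        unfolding e memI using c by cases auto
    qed
    show "int (card ?L) <= 3 * N + int g * N"
      by (rule card_Un_UN_le) (use N in \<open>auto simp: card_cartesian_product\<close>)
  qed (use Z in auto)
  let ?U = "{0..<hole N g + N} \<times> {3 * N - 1} Un (\<Union>t<g. {hole N t + N..<hole N t + 2 * N} \<times> {N - 1})"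
  have up: "int (card (?F (0, 1, 0))) <= (hole N g + N + int g * N) * N"
  proof (rule card_facets_le[where P = ?U and Z = "{0..<N}"])
    show "?F (0, 1, 0) \<subseteq> (%((x, y), z). (x, y, z)) ` (?U \<times> {0..<N})"
    proof
      fix w assume w: "w : ?F (0, 1, 0)"
      obtain x y z where e: "w = (x, y, z)" by (cases w) blast
      have c: "slab_cell g N x y" "0 <= z" "z < N" "~ slab_cell g N x (y + 1)" using w by (auto simp: e in_voxels)
      then consider "y = 3 * N - 1" "0 <= x" "x < hole N g + N"
        | t where "t < g" "hole N t + N <= x" "x < hole N t + 2 * N" "y = N - 1"
        unfolding slab_cell_def by force
      then show "w : (%((x, y), z). (x, y, z)) ` (?U \<times> {0..<N})"
        unfolding e memI using c by cases auto
    qed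
    show "int (card ?U) <= hole N g + N + int g * N"
      by (rule card_Un_UN_le) (use N hole_nonneg[of g] in \<open>auto simp: card_cartesian_product\<close>)
  qed (use Z in auto)
  let ?D = "{0..<hole N g + N} \<times> {0} Un (\<Union>t<g. {hole N t + N..<hole N t + 2 * N} \<times> {2 * N})"
  have down: "int (card (?F (0, -1, 0))) <= (hole N g + N + int g * N) * N"
  proof (rule card_facets_le[where P = ?D and Z = "{0..<N}"])
    show "?F (0, -1, 0) \<subseteq> (%((x, y), z). (x, y, z)) ` (?D \<times> {0..<N})"
    proof
      fix w assume w: "w : ?F (0, -1, 0)"
      obtain x y z where e: "w = (x, y, z)" by (cases w) blast
      have c: "slab_cell g N x y" "0 <= z" "z < N" "~ slab_cell g N x (y - 1)" using w by (auto simp: e in_voxels)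
      then consider "y = 0" "0 <= x" "x < hole N g + N"
        | t where "t < g" "hole N t + N <= x" "x < hole N t + 2 * N" "y = 2 * N"
        unfolding slab_cell_def by force
      then show "w : (%((x, y), z). (x, y, z)) ` (?D \<times> {0..<N})"
        unfolding e memI using c by cases auto
    qed
    show "int (card ?D) <= hole N g + N + int g * N"
      by (rule card_Un_UN_le) (use N hole_nonneg[of g] in \<open>auto simp: card_cartesian_product\<close>)
  qed (use Z in auto)
  have "{(w, n). w : voxels g N & w + n ~: voxels g N & n : set axes} = (\<Union>n\<in>set axes. (%w. (w, n)) ` ?F n)"
    by auto
  then have "card {(w, n). w : voxels g N & w + n ~: voxels g N & n : set axes} <= (\<Sum>n\<in>set axes. card ((%w. (w, n)) ` ?F n))"
    by (simp only:) (rule card_UN_le, simp)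
  also have "\<dots> = (\<Sum>n\<in>set axes. card (?F n))"
    by (rule sum.cong[OF refl]) (auto intro!: card_image simp: inj_on_def)
  finally have "int (card {(w, n). w : voxels g N & w + n ~: voxels g N & n : set axes}) <= (\<Sum>n\<in>set axes. int (card (?F n)))"
    unfolding of_nat_sum[symmetric] of_nat_le_iff .
  also have "\<dots> = int (card (?F (1, 0, 0))) + int (card (?F (0, 1, 0))) + int (card (?F (0, 0, 1)))
     + int (card (?F (-1, 0, 0))) + int (card (?F (0, -1, 0))) + int (card (?F (0, 0, -1)))"
    by (simp add: axes_def)
  finally show ?thesis using top bot left right up down by linarith
qed

text \<open>With \<open>q\<close> facets there are \<open>4 q\<close> darts, so \<open>2 q\<close>
  edges. The faces number at least \<open>q\<close> and the vertices at least
  \<open>q + 2 - 2 g\<close>; the terms in \<open>N\<close> cancel.\<close>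

lemma voxels_euler:
  "int (card (darts (voxels g N))) + 4 - 4 * int g
    <= 2 * int (ncyc (rot (voxels g N)) (darts (voxels g N))) + 2 * int (ncyc (turn (voxels g N)) (darts (voxels g N)))"
proof -
  let ?D = "darts (voxels g N)" and ?q = "int (card {(w, n). w : voxels g N & w + n ~: voxels g N & n : set axes})"
  let ?p = "int (card (start ` ?D))"
  note fin = finite_voxels[of g N]
  have "2 * int (card base_pts) + int (card rim) * (N - 1) <= ?p"
    using start_points N by (simp add: of_nat_le_iff[symmetric, where 'a = int] del: of_nat_le_iff)
  then have p: "2 * ((hole N g + N + 1) * (3 * N + 1) - int g * (N - 1)\<^sup>2)
      + (2 * (hole N g + N) + 6 * N + 4 * int g * N) * (N - 1) <= ?p"
    using card_base_pts card_rim by simp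
  have q: "?q <= 2 * ((hole N g + N) * (3 * N) - int g * N\<^sup>2)
      + 2 * ((3 * N + int g * N) * N) + 2 * ((hole N g + N + int g * N) * N)"
    using facets_le card_base by simp
  have "2 * ((hole N g + N + 1) * (3 * N + 1) - int g * (N - 1)\<^sup>2)
      + (2 * (hole N g + N) + 6 * N + 4 * int g * N) * (N - 1)
    = 2 * ((hole N g + N) * (3 * N) - int g * N\<^sup>2)
      + 2 * ((3 * N + int g * N) * N) + 2 * ((hole N g + N + int g * N) * N) + 2 - 2 * int g"
    by (simp add: algebra_simps power2_eq_square)
  then have "?q + 2 - 2 * int g <= ?p" using p q by linarith
  moreover have "?p <= int (ncyc (rot (voxels g N)) ?D)" using card_start_le_ncyc[OF fin] by simp
  moreover have "?q <= int (ncyc (turn (voxels g N)) ?D)" using card_darts(2)[OF fin] by simp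
  moreover have "int (card ?D) = 4 * ?q" using card_darts(1)[OF fin] by simp
  ultimately show ?thesis by linarith
qed

end

section \<open>Minors of a surface complex\<close>

definition cvox :: "nat => ivec => (real \<times> real \<times> real) set" where
  "cvox N = (%(a, b, c). {a / N..(a + 1) / N} \<times> {b / N..(b + 1) / N} \<times> {c / N..(c + 1) / N})"

definition ovox :: "nat => ivec => (real \<times> real \<times> real) set" where
  "ovox N = (%(a, b, c). {a / N<..<(a + 1) / N} \<times> {b / N<..<(b + 1) / N} \<times> {c / N<..<(c + 1) / N})"

lemma in_cvox:
  "N > 0 ==> (x, y, z) : cvox N (a, b, c) \<longleftrightarrow> a <= N * x & N * x <= real_of_int a + 1 &
     b <= N * y & N * y <= real_of_int b + 1 & c <= N * z & N * z <= real_of_int c + 1"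
  by (simp add: cvox_def pos_divide_le_eq pos_le_divide_eq mult.commute[of _ "real N"])

lemma in_ovox:
  "N > 0 ==> (x, y, z) : ovox N (a, b, c) \<longleftrightarrow> a < N * x & N * x < real_of_int a + 1 &
     b < N * y & N * y < real_of_int b + 1 & c < N * z & N * z < real_of_int c + 1"
  by (simp add: ovox_def pos_divide_less_eq pos_less_divide_eq mult.commute[of _ "real N"])

lemma closed_cvox: "closed (cvox N w)"
  by (cases w) (auto simp: cvox_def intro!: closed_Times)

lemma cvox_closure_ovox: "N > 0 ==> closure (ovox N w) = cvox N w"
  by (cases w) (simp add: cvox_def ovox_def closure_Times divide_strict_right_mono)

text \<open>The right end \<open>b\<close> is assigned to the last unit interval, where rounding
  down would step outside.\<close>

lemma interval_cover:
  fixes x :: real and a b :: int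
  assumes "a <= x" "x <= b" "a < b"
  obtains i where "a <= i" "i < b" "i <= x" "x <= real_of_int i + 1"
proof (cases "x < b")
  case True
  then have "a <= \<lfloor>x\<rfloor>" "\<lfloor>x\<rfloor> < b" using assms(1) by (simp_all add: le_floor_iff floor_less_iff)
  then show ?thesis using that[of "\<lfloor>x\<rfloor>"] by linarith
next
  case False
  then show ?thesis using that[of "b - 1"] assms by auto
qed

context
  fixes g :: nat and N :: nat
  assumes N: "N > 0"
begin

lemma N1: "1 <= int N" using N by simp

lemma handlebody_iff:
  "(x, y, z) : handlebody g \<longleftrightarrow> 0 <= x & x <= 2 * real g + 1 & 0 <= y & y <= 3 & 0 <= z & z <= 1 &
     (ALL i<g. ~(2 * real i + 1 < x & x < 2 * real i + 2 & 1 < y & y < 2))"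
  by (auto simp: handlebody_def)

lemma handlebody_column:
  assumes "0 <= x" "x <= 2 * real g + 1" "!!i. i < g ==> ~(2 * real i + 1 < x & x < 2 * real i + 2)"
  obtains t where "t <= g" "2 * real t <= x" "x <= 2 * real t + 1"
proof -
  define t where "t = nat \<lfloor>x / 2\<rfloor>"
  have "real t = of_int \<lfloor>x / 2\<rfloor>" using assms(1) by (simp add: t_def)
  then have t: "real t <= x / 2" "x / 2 < real t + 1" by linarith+
  have "t <= g"
  proof (rule ccontr)
    assume "~ t <= g"
    then have "real g + 1 <= real t" by simp
    then show False using t assms(2) by linarith
  qed
  show ?thesis
  proof (cases "x <= 2 * real t + 1")
    case True
    then show ?thesis using that[of t] t \<open>t <= g\<close> by simp
  next
    case False
    then have "~ t < g" using assms(3)[of t] t by auto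
    then have "t = g" using \<open>t <= g\<close> by simp
    then show ?thesis using False assms(2) by simp
  qed
qed

lemma real_hole: "real_of_int (hole (int N) t) = 2 * real t * real N"
  by (simp add: hole_def)

lemma voxel_in_handlebody:
  assumes "w : voxels g N"
  shows "cvox N w \<subseteq> handlebody g"
proof
  fix p assume p: "p : cvox N w"
  obtain a b c where w: "w = (a, b, c)" by (cases w) blast
  obtain x y z where e: "p = (x, y, z)" by (cases p) blast
  have c: "slab_cell g N a b" "0 <= c" "c < N" using assms by (auto simp: w in_voxels)
  have r: "real_of_int 0 <= a" "real_of_int (a + 1) <= hole N g + N" "real_of_int 0 <= b" "real_of_int (b + 1) <= 3 * N"
      "real_of_int (c + 1) <= N"
    using c unfolding slab_cell_def of_int_le_iff by linarith+
  have q: "a <= N * x & N * x <= real_of_int a + 1 & b <= N * y & N * y <= real_of_int b + 1 & c <= N * z & N * z <= real_of_int c + 1"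
    using p in_cvox[OF N] unfolding w e by auto
  have mul: "u <= v" if "N * u <= N * v" for u v :: real
    using that N by simp
  have "N * (2 * real g + 1) = 2 * real g * N + N" by (simp add: algebra_simps)
  moreover have "0 <= N * x" "N * x <= 2 * real g * N + N" "0 <= N * y" "N * y <= N * 3" "0 <= N * z" "N * z <= N * 1"
    using r q c(2) real_hole[of g] by linarith+
  ultimately have box: "0 <= x" "x <= 2 * real g + 1" "0 <= y" "y <= 3" "0 <= z" "z <= 1"
    using mul[of 0 x] mul[of x "2 * real g + 1"] mul[of 0 y] mul[of y 3] mul[of 0 z] mul[of z 1] by simp_all
  have "~(2 * real i + 1 < x & x < 2 * real i + 2 & 1 < y & y < 2)" if i: "i < g" for i
  proof
    assume "2 * real i + 1 < x & x < 2 * real i + 2 & 1 < y & y < 2"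
    then have m: "N * (2 * real i + 1) < N * x" "N * x < N * (2 * real i + 2)" "real N * 1 < N * y" "N * y < real N * 2"
      using N by (simp_all only: mult_less_cancel_left_pos of_nat_0_less_iff)
    have "N * (2 * real i + 1) < real_of_int a + 1" "real_of_int a < N * (2 * real i + 2)"
      "real N * 1 < real_of_int b + 1" "real_of_int b < real N * 2"
      using q less_le_trans[OF m(1)] le_less_trans[OF _ m(2)] less_le_trans[OF m(3)] le_less_trans[OF _ m(4)] by blast+
    moreover have "N * (2 * real i + 1) = real_of_int (hole N i) + N" "N * (2 * real i + 2) = real_of_int (hole N i) + 2 * N"
      unfolding real_hole by (simp_all add: algebra_simps)
    ultimately have "real_of_int (hole N i) + N < real_of_int a + 1" "real_of_int a < real_of_int (hole N i) + 2 * N"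
      "N < real_of_int b + 1" "real_of_int b < 2 * N" by simp_all
    then have "real_of_int (hole N i + int N) < real_of_int (a + 1)" "real_of_int a < real_of_int (hole N i + 2 * int N)"
      "real_of_int (int N) < real_of_int (b + 1)" "real_of_int b < real_of_int (2 * int N)" by simp_all
    then have "hole N i + N <= a" "a < hole N i + 2 * N" "N <= b" "b < 2 * N" unfolding of_int_less_iff by linarith+
    then have "(EX t<g. hole N t + int N <= a & a < hole N t + 2 * int N) & int N <= b & b < 2 * int N"
      using i by (intro conjI exI[of _ i]) simp_all
    then show False using c(1) by (simp add: slab_cell_def)
  qed
  then show "p : handlebody g" unfolding e handlebody_iff using box by blast
qed

lemma handlebody_in_voxel:
  assumes "p : handlebody g"
  obtains w where "w : voxels g N" "p : cvox N w"
proof -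
  obtain x y z where e: "p = (x, y, z)" by (cases p) blast
  have h: "0 <= x" "x <= 2 * real g + 1" "0 <= y" "y <= 3" "0 <= z" "z <= 1"
    and out: "!!i. i < g ==> ~(2 * real i + 1 < x & x < 2 * real i + 2 & 1 < y & y < 2)"
    using assms unfolding e handlebody_iff by auto
  have mul: "N * u <= N * v" if "u <= v" for u v :: real
    using that by (simp add: mult_left_mono)
  obtain c :: int where c: "0 <= c" "c < N" "c <= N * z" "N * z <= real_of_int c + 1"
    using interval_cover[of 0 "N * z" "int N"] h mul[of z 1] N by auto
  have wide: "real_of_int 0 <= N * x" "N * x <= real_of_int (hole N g + N)" "0 < hole N g + N"
    using h(1) mul[OF h(2)] hole_nonneg[OF N1, of g] N by (auto simp: real_hole algebra_simps simp del: of_nat_mult)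
  have "EX a b. slab_cell g N a b & a <= N * x & N * x <= real_of_int a + 1 & b <= N * y & N * y <= real_of_int b + 1"
  proof -
    consider "y <= 1" | "2 <= y" | "1 < y" "y < 2" by linarith
    then show ?thesis
    proof cases
      case 1
      obtain a where a: "0 <= a" "a < hole N g + N" "a <= N * x" "N * x <= real_of_int a + 1"
        using interval_cover[OF wide] by blast
      obtain b :: int where b: "0 <= b" "b < N" "b <= N * y" "N * y <= real_of_int b + 1"
        using interval_cover[of 0 "N * y" "int N"] h mul[OF 1] N by auto
      have "slab_cell g N a b" unfolding slab_cell_def using a b by auto
      then show ?thesis using a b by (intro exI[of _ a] exI[of _ b]) auto
    next
      case 2
      obtain a where a: "0 <= a" "a < hole N g + N" "a <= N * x" "N * x <= real_of_int a + 1"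
        using interval_cover[OF wide] by blast
      obtain b :: int where b: "2 * N <= b" "b < 3 * N" "b <= N * y" "N * y <= real_of_int b + 1"
        using interval_cover[of "2 * int N" "N * y" "3 * int N"] h mul[OF 2] mul[OF h(4)] N by auto
      have "slab_cell g N a b" unfolding slab_cell_def using a b by auto
      then show ?thesis using a b by (intro exI[of _ a] exI[of _ b]) auto
    next
      case 3
      \<comment> \<open>On a tunnel wall rounding down could select an empty cube. The bridge that
        contains the point supplies a solid one.\<close>
      then obtain t where t: "t <= g" "2 * real t <= x" "x <= 2 * real t + 1"
        using handlebody_column[OF h(1,2)] out by metis
      obtain a where a: "hole N t <= a" "a < hole N t + N" "a <= N * x" "N * x <= real_of_int a + 1"
        using interval_cover[of "hole N t" "N * x" "hole N t + N"] mul[OF t(2)] mul[OF t(3)] N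
        by (auto simp: real_hole algebra_simps)
      obtain b :: int where b: "0 <= b" "b < 3 * N" "b <= N * y" "N * y <= real_of_int b + 1"
        using interval_cover[of 0 "N * y" "3 * int N"] h mul[OF h(4)] N by auto
      have gt: "hole N t <= hole N g"
        using hole_mono[OF N1, of t g] t(1) N by (cases "t = g") auto
      have "~(hole N i + N <= a & a < hole N i + 2 * N)" for i
      proof -
        consider "i = t" | "i < t" | "t < i" by linarith
        then show ?thesis using a hole_mono[OF N1, of i t] hole_mono[OF N1, of t i] by cases auto
      qed
      then have "slab_cell g N a b"
        unfolding slab_cell_def using a b gt hole_nonneg[OF N1, of t] by auto
      then show ?thesis using a b by (intro exI[of _ a] exI[of _ b]) auto
    qed
  qed
  then obtain a b where ab: "slab_cell g N a b" "a <= N * x" "N * x <= real_of_int a + 1" "b <= N * y" "N * y <= real_of_int b + 1" by blast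
  show ?thesis
  proof (rule that)
    show "(a, b, c) : voxels g N" using ab c by (simp add: in_voxels)
    show "p : cvox N (a, b, c)" unfolding e in_cvox[OF N] using ab c by simp
  qed
qed

lemma closed_handlebody: "closed (handlebody g)"
proof -
  have "handlebody g = (\<Union>w\<in>voxels g N. cvox N w)"
    using voxel_in_handlebody handlebody_in_voxel by blast
  then show ?thesis using finite_voxels closed_cvox by (metis closed_UN)
qed

lemma ovox_outside:
  assumes "u ~: voxels g N"
  shows "ovox N u Int handlebody g = {}"
proof (rule ccontr)
  assume "ovox N u Int handlebody g ~= {}"
  then obtain p where p: "p : ovox N u" "p : handlebody g" by blast
  then obtain w where w: "w : voxels g N" "p : cvox N w" using handlebody_in_voxel by blast
  obtain a b c a' b' c' where e: "w = (a, b, c)" "u = (a', b', c')" by (cases w; cases u) blast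
  obtain x y z where q: "p = (x, y, z)" by (cases p) blast
  have "a = a'" "b = b'" "c = c'"
    using p(1) w(2) unfolding e q in_ovox[OF N] in_cvox[OF N] by linarith+
  then show False using w assms e by blast
qed

definition facet :: "ivec => ivec => (real \<times> real \<times> real) set" where
  "facet w n = cvox N w Int cvox N (w + n)"

text \<open>The open cube beyond the facet misses the body, so its closure lies in the closure of
  the complement, while the cube behind the facet lies in the body.\<close>

lemma facet_in_surface:
  assumes "w : voxels g N" "w + n ~: voxels g N"
  shows "facet w n \<subseteq> handle_surface g"
proof -
  have "ovox N (w + n) \<subseteq> - handlebody g" using ovox_outside[OF assms(2)] by blast
  then have "cvox N (w + n) \<subseteq> closure (- handlebody g)"
    using closure_mono cvox_closure_ovox[OF N] by metis
  moreover have "cvox N w \<subseteq> closure (handlebody g)"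
    using voxel_in_handlebody[OF assms(1)] closure_subset by blast
  ultimately show ?thesis unfolding facet_def handle_surface_def frontier_closures by blast
qed

text \<open>If every cube at \<open>p\<close> belonged to the body, the finitely many empty cubes
  nearby would stay at positive distance from \<open>p\<close>, and a small ball around
  \<open>p\<close> would lie in the body.\<close>

lemma outside_voxel:
  assumes "p : handle_surface g"
  obtains u where "u ~: voxels g N" "p : cvox N u"
proof (rule ccontr)
  assume "~ thesis"
  then have all: "!!u. p : cvox N u ==> u : voxels g N" using that by blast
  obtain x y z where e: "p = (x, y, z)" by (cases p) blast
  \<comment> \<open>Within distance \<open>1 / N\<close> the rounded coordinate changes by at most
    one, so a window of three on either side is ample.\<close>
  define K where "K = (%x::real. {\<lfloor>N * x\<rfloor> - 3..\<lfloor>N * x\<rfloor> + 3})"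
  define Z where "Z = K x \<times> K y \<times> K z - voxels g N"
  define T where "T = (\<Union>u\<in>Z. cvox N u)"
  have "closed T" unfolding T_def
    by (intro closed_UN closed_cvox ballI) (simp add: Z_def K_def)
  moreover have "p ~: T" using all by (auto simp: T_def Z_def)
  ultimately obtain r where r: "0 < r" "ball p r \<subseteq> - T"
    using open_contains_ball[of "- T"] by (auto simp: closed_def)
  define r' where "r' = min r (1 / N)"
  have "ball p r' \<subseteq> handlebody g"
  proof
    fix q assume q: "q : ball p r'"
    obtain x' y' z' where e': "q = (x', y', z')" by (cases q) blast
    have d: "dist p q < 1 / N" "q ~: T" using q r by (auto simp: r'_def)
    have "dist x x' <= dist p q" "dist (y, z) (y', z') <= dist p q" "dist y y' <= dist (y, z) (y', z')" "dist z z' <= dist (y, z) (y', z')"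
      unfolding e e' using dist_fst_le[of "(x, y, z)" "(x', y', z')"] dist_snd_le[of "(x, y, z)" "(x', y', z')"]
        dist_fst_le[of "(y, z)" "(y', z')"] dist_snd_le[of "(y, z)" "(y', z')"] by auto
    then have "dist x x' < 1 / N" "dist y y' < 1 / N" "dist z z' < 1 / N" using d(1) by linarith+
    moreover have near: "\<lfloor>N * s'\<rfloor> : K s" if "dist s s' < 1 / N" for s s' :: real
    proof -
      have "\<bar>N * s - N * s'\<bar> < 1"
        using that N unfolding right_diff_distrib[symmetric] abs_mult by (simp add: dist_real_def field_simps)
      then show ?thesis unfolding K_def by simp linarith
    qed
    ultimately have k: "\<lfloor>N * x'\<rfloor> : K x" "\<lfloor>N * y'\<rfloor> : K y" "\<lfloor>N * z'\<rfloor> : K z" by blast+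
    let ?u = "(\<lfloor>N * x'\<rfloor>, \<lfloor>N * y'\<rfloor>, \<lfloor>N * z'\<rfloor>)"
    have "q : cvox N ?u" unfolding e' in_cvox[OF N] by linarith
    moreover from this have "?u : voxels g N" using d(2) k unfolding T_def Z_def by blast
    ultimately show "q : handlebody g" using voxel_in_handlebody by blast
  qed
  then have "p : interior (handlebody g)"
    using r(1) N by (intro interiorI[of "ball p r'"]) (auto simp: r'_def)
  then show False using assms by (simp add: handle_surface_def frontier_def)
qed

text \<open>The coordinates of a voxel \<open>w\<close> at \<open>p\<close> are replaced one at a
  time by those of an empty cube \<open>u\<close> at \<open>p\<close>. Cubes are products of
  intervals, so all intermediate cubes contain \<open>p\<close>, and the first step out of the body
  crosses a facet through \<open>p\<close>.\<close>

lemma surface_in_facet: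
  assumes "p : handle_surface g"
  obtains w n where "w : voxels g N" "w + n ~: voxels g N" "n : set axes" "p : facet w n"
proof -
  have "p : handlebody g"
    using assms closed_handlebody by (simp add: handle_surface_def frontier_def)
  then obtain w where w: "w : voxels g N" "p : cvox N w" using handlebody_in_voxel by blast
  obtain u where u: "u ~: voxels g N" "p : cvox N u" using outside_voxel[OF assms] by blast
  obtain a b c a' b' c' where e: "w = (a, b, c)" "u = (a', b', c')" by (cases w; cases u) blast
  obtain x y z where q: "p = (x, y, z)" by (cases p) blast
  have in_w: "a <= N * x & N * x <= real_of_int a + 1 & b <= N * y & N * y <= real_of_int b + 1 & c <= N * z & N * z <= real_of_int c + 1"
    and in_u: "a' <= N * x & N * x <= real_of_int a' + 1 & b' <= N * y & N * y <= real_of_int b' + 1 & c' <= N * z & N * z <= real_of_int c' + 1"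
    using w(2) u(2) unfolding e q in_cvox[OF N] by auto
  have diff: "a' - a : {-1, 0, 1}" "b' - b : {-1, 0, 1}" "c' - c : {-1, 0, 1}"
  proof -
    have "real_of_int a <= a' + 1" "real_of_int a' <= a + 1" "real_of_int b <= b' + 1" "real_of_int b' <= b + 1"
      "real_of_int c <= c' + 1" "real_of_int c' <= c + 1"
      using in_w in_u unfolding of_int_add of_int_1 by linarith+
    then show "a' - a : {-1, 0, 1}" "b' - b : {-1, 0, 1}" "c' - c : {-1, 0, 1}"
      unfolding of_int_le_iff by auto
  qed
  have step: thesis if "v : voxels g N" "v + n ~: voxels g N" "n : set ((0, 0, 0) # axes)" "p : cvox N v" "p : cvox N (v + n)" for v n
    using that \<open>!!n w. w : voxels g N ==> w + n ~: voxels g N ==> n : set axes ==> p : facet w n ==> thesis\<close>[of v n]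
    by (cases n) (auto simp: facet_def zero_prod_def[symmetric])
  let ?w1 = "(a', b, c)" and ?w2 = "(a', b', c)"
  have p12: "p : cvox N ?w1" "p : cvox N ?w2"
    unfolding q in_cvox[OF N] using in_w in_u by auto
  show thesis
  proof (cases "?w1 : voxels g N")
    case False
    then show thesis
      using step[of w "(a' - a, 0, 0)"] w p12 diff unfolding e by (auto simp: axes_def)
  next
    case 1: True
    show thesis
    proof (cases "?w2 : voxels g N")
      case False
      then show thesis
        using step[of ?w1 "(0, b' - b, 0)"] 1 p12 diff by (auto simp: axes_def)
    next
      case True
      then show thesis
        using step[of ?w2 "(0, 0, c' - c)"] u p12 diff unfolding e by (auto simp: axes_def)
    qed
  qed
qed

end

section \<open>Connectedness of the surface\<close>

text \<open>The body consists of a front beam \<open>F\<close> and a back beam \<open>B\<close>,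
  joined by the bridges \<open>C t\<close> beside the tunnels.\<close>

lemma connected_handlebody: "connected (handlebody g)"
proof -
  define F where "F = {0..2 * real g + 1} \<times> {0..1::real} \<times> {0..1::real}"
  define B where "B = {0..2 * real g + 1} \<times> {2..3::real} \<times> {0..1::real}"
  define C where "C t = {2 * real t..2 * real t + 1} \<times> {0..3::real} \<times> {0..1::real}" for t
  have con: "connected F" "connected B" "!!t. connected (C t)"
    unfolding F_def B_def C_def by (intro connected_Times connected_Icc)+
  have "handlebody g = (\<Union>t\<le>g. F Un C t) Un B"
  proof (intro equalityI subsetI)
    fix p assume p: "p : handlebody g"
    obtain x y z where e: "p = (x, y, z)" by (cases p) blast
    have h: "0 <= x" "x <= 2 * real g + 1" "0 <= y" "y <= 3" "0 <= z" "z <= 1"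
      and out: "!!i. i < g ==> ~(2 * real i + 1 < x & x < 2 * real i + 2 & 1 < y & y < 2)"
      using p unfolding e by (subst (asm) handlebody_iff[of 1]; auto)+
    consider "y <= 1" | "2 <= y" | "1 < y" "y < 2" by linarith
    then show "p : (\<Union>t\<le>g. F Un C t) Un B"
    proof cases
      case 3
      then obtain t where "t <= g" "2 * real t <= x" "x <= 2 * real t + 1"
        using handlebody_column[of 1 x g] h out by auto
      then show ?thesis using h by (auto simp: e C_def)
    qed (use h in \<open>auto simp: e F_def B_def\<close>)
  next
    fix p assume p: "p : (\<Union>t\<le>g. F Un C t) Un B"
    obtain x y z where e: "p = (x, y, z)" by (cases p) blast
    have "x <= 2 * real g + 1" if "t <= g" "x <= 2 * real t + 1" for t
      using that by (smt (verit) of_nat_le_iff)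
    moreover have "~(2 * real i + 1 < x & x < 2 * real i + 2)" if "2 * real t <= x" "x <= 2 * real t + 1" for i t
    proof
      assume "2 * real i + 1 < x & x < 2 * real i + 2"
      then have "real i < real t" and lt: "real t < real i + 1" using that by linarith+
      then have "i + 1 <= t" by simp
      then have "real (i + 1) <= real t" by (simp only: of_nat_le_iff)
      then show False using lt by simp
    qed
    ultimately show "p : handlebody g"
      using p unfolding e by (subst handlebody_iff[of 1]) (auto simp: F_def B_def C_def)
  qed
  moreover have "connected (\<Union>t\<le>g. F Un C t)"
  proof (rule connected_Union)
    show "connected S" if "S : (%t. F Un C t) ` {..g}" for S
    proof -
      obtain t where t: "t <= g" "S = F Un C t" using \<open>S : _\<close> by auto
      have "(2 * real t, 0, 0) : F Int C t" using t by (auto simp: F_def C_def)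
      then show ?thesis unfolding t by (intro connected_Un con) blast
    qed
    have "(0, 0, 0) : \<Inter> ((%t. F Un C t) ` {..g})" by (auto simp: F_def)
    then show "\<Inter> ((%t. F Un C t) ` {..g}) ~= {}" by blast
  qed
  moreover have "(0, 2, 0) : (\<Union>t\<le>g. F Un C t) Int B"
    by (auto simp: F_def B_def C_def intro!: bexI[of _ 0])
  ultimately show ?thesis using con(2) connected_Un by (metis empty_iff)
qed

lemma connected_handlebody_compl: "connected (- handlebody g)"
proof -
  define X where "X = {0..2 * real g + 1} \<times> {0..3::real} \<times> {0..1::real}"
  define T where "T i = {2 * real i + 1<..<2 * real i + 2} \<times> {1<..<2::real} \<times> (UNIV :: real set)" for i
  have X: "connected (- X)"
    unfolding X_def
    by (intro connected_complement_bounded_convex bounded_Times convex_Times) auto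
  have T: "connected (- X Un T i)" for i
  proof (rule connected_Un[OF X])
    show "connected (T i)" unfolding T_def by (intro connected_Times connected_Ioo connected_UNIV)
    have "(2 * real i + 3 / 2, 3 / 2, 5) : - X Int T i" by (auto simp: X_def T_def)
    then show "- X Int T i ~= {}" by blast
  qed
  have "- handlebody g = - X Un (\<Union>i<g. T i)"
    by (auto simp: handlebody_def X_def T_def)
  also have "\<dots> = \<Union> (insert (- X) ((%i. - X Un T i) ` {..<g}))" by auto
  also have "connected \<dots>"
  proof (rule connected_Union)
    have "(-1, 0, 0) : - X" by (auto simp: X_def)
    then show "\<Inter> (insert (- X) ((%i. - X Un T i) ` {..<g})) ~= {}" by blast
  qed (use X T in auto)
  finally show ?thesis .
qed

text \<open>In Euclidean space a connected set with connected complement has a connected frontier.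
  This is what lets labels spread from a drawing over the whole complex.\<close>

lemma connected_handle_surface: "connected (handle_surface g)"
  unfolding handle_surface_def
  by (rule connected_frontier_simple[OF connected_handlebody connected_handlebody_compl])

section \<open>Branch sets and their labels\<close>

text \<open>Connectedness of a relation, phrased by closed subsets: this form matches topological
  connectedness by closed sets in \<open>conn_near_pts\<close> and the closed sets of darts in
  \<open>fibres_connected\<close>.\<close>

definition conn :: "('p => 'p => bool) => 'p set => bool" where
  "conn R C \<longleftrightarrow> (\<forall>A\<subseteq>C. A ~= {} --> (ALL p:A. ALL q:C. R p q --> q : A) --> A = C)"

lemma connD: "conn R C ==> A \<subseteq> C ==> A ~= {} ==> A ~= C ==> EX p:A. EX q:C - A. R p q"
  unfolding conn_def by blast

lemma conn_insert:
  assumes "conn R K" "p : K" "R p q" "R q p"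
  shows "conn R (insert q K)"
  unfolding conn_def
proof (intro allI impI)
  fix A assume A: "A \<subseteq> insert q K" "A ~= {}" "ALL p:A. ALL q':insert q K. R p q' --> q' : A"
  have "A Int K ~= {}"
  proof
    assume "A Int K = {}"
    then have "q : A" using A by blast
    then have "p : A" using A(3) assms by blast
    then show False using assms(2) \<open>A Int K = {}\<close> by blast
  qed
  moreover have "ALL p:A Int K. ALL q:K. R p q --> q : A Int K" using A(3) by blast
  ultimately have "A Int K = K" using assms(1) unfolding conn_def by (metis Int_lower2)
  then have "K \<subseteq> A" by blast
  then have "q : A" using A(3) assms by blast
  then show "A = insert q K" using A(1) \<open>K \<subseteq> A\<close> by blast
qed

definition good_labels :: "('p => 'p => bool) => ('p => 'v option) => bool" where
  "good_labels R lab \<longleftrightarrow> (ALL v. conn R {p. lab p = Some v})"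

text \<open>While \<open>C\<close> has unlabelled points, one of them is adjacent to a labelled
  point of \<open>C\<close> and inherits its label. Classes stay connected and no new label enters
  \<open>C\<close>.\<close>

lemma label_extend:
  assumes "finite C" "conn R C" and sym: "!!p q. R p q ==> R q p"
    and "good_labels R lab" "C Int dom lab ~= {}"
  shows "EX lab'. good_labels R lab' & lab \<subseteq>\<^sub>m lab' & dom lab' = dom lab Un C & lab' ` C \<subseteq> lab ` (C Int dom lab)"
  using assms(4,5)
proof (induction "card (C - dom lab)" arbitrary: lab)
  case 0
  then have "C \<subseteq> dom lab" using assms(1) by auto
  then have "dom lab = dom lab Un C" "C Int dom lab = C" by auto
  then show ?case using 0 by (intro exI[of _ lab]) (simp add: map_le_refl)
next
  case (Suc n)
  have "C - dom lab ~= {}" using Suc.hyps(2) by (metis card.empty nat.distinct(1))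
  then have "C Int dom lab ~= C" by blast
  then obtain p q where pq: "p : C" "p : dom lab" "q : C" "q ~: dom lab" "R p q"
    using connD[OF assms(2), of "C Int dom lab"] Suc.prems(2) by blast
  obtain v where v: "lab p = Some v" using pq by blast
  define lab1 where "lab1 = lab(q \<mapsto> v)"
  have "conn R {x. lab1 x = Some w}" for w
  proof (cases "w = v")
    case True
    then have "{x. lab1 x = Some w} = insert q {x. lab x = Some v}" by (auto simp: lab1_def)
    then show ?thesis
      using conn_insert[of R "{x. lab x = Some v}" p q] Suc.prems(1) v pq(5) sym
      unfolding good_labels_def by simp
  next
    case False
    then have "{x. lab1 x = Some w} = {x. lab x = Some w}" using pq(4) by (auto simp: lab1_def)
    then show ?thesis using Suc.prems(1) unfolding good_labels_def by simp
  qed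
  then have g1: "good_labels R lab1" by (simp add: good_labels_def)
  have dom1: "dom lab1 = insert q (dom lab)" by (auto simp: lab1_def)
  have "C - dom lab1 = (C - dom lab) - {q}" using dom1 by auto
  then have "n = card (C - dom lab1)" using Suc.hyps(2) pq assms(1) by simp
  from Suc.hyps(1)[OF this g1] obtain lab' where lab': "good_labels R lab'" "lab1 \<subseteq>\<^sub>m lab'"
    "dom lab' = dom lab1 Un C" "lab' ` C \<subseteq> lab1 ` (C Int dom lab1)"
    using pq dom1 by blast
  have sub: "lab1 ` (C Int dom lab1) \<subseteq> lab ` (C Int dom lab)"
  proof (rule image_subsetI)
    fix x assume x: "x : C Int dom lab1"
    show "lab1 x : lab ` (C Int dom lab)"
    proof (cases "x = q")
      case True
      then have "lab1 x = lab p" using v by (simp add: lab1_def)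
      then show ?thesis using pq by blast
    next
      case False
      then have "lab1 x = lab x" "x : dom lab" using x dom1 by (auto simp: lab1_def)
      then show ?thesis using x by blast
    qed
  qed
  have le: "lab \<subseteq>\<^sub>m lab1" using pq(4) by (auto simp: lab1_def map_le_def)
  have "dom lab' = dom lab Un C" unfolding lab'(3) dom1 using pq(3) by auto
  then show ?case
    using lab'(1) map_le_trans[OF le lab'(2)] order_trans[OF lab'(4) sub] by (intro exI[of _ lab'] conjI)
qed

text \<open>\<open>LX v\<close> surrounds the vertex \<open>v\<close> and \<open>LM e\<close> the
  middle of the edge \<open>e\<close>. \<open>LM e\<close> meets no foreign \<open>LX\<close> and no
  other \<open>LM\<close>, so only the two labels of \<open>e\<close> can grow into it. Both occur
  there, and connectedness gives two adjacent points where they change: these realise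
  \<open>e\<close>.\<close>

lemma branch_labels:
  fixes V :: "'v set" and LX :: "'v => 'p set" and LM :: "'v set => 'p set"
  assumes E: "finite E" "!!e. e : E ==> card e = 2" "\<Union>E = V" and V: "V ~= {}"
    and P: "finite P" "conn R P" and sym: "!!p q. R p q ==> R q p"
    and LX: "!!v. v : V ==> LX v \<subseteq> P & LX v ~= {} & conn R (LX v)"
      "!!v w. v : V ==> w : V ==> v ~= w ==> LX v Int LX w = {}"
    and LM: "!!e. e : E ==> LM e \<subseteq> P & conn R (LM e)"
      "!!e v. e : E ==> v : e ==> LM e Int LX v ~= {}"
      "!!e v. e : E ==> v : V ==> v ~: e ==> LM e Int LX v = {}"
      "!!e e'. e : E ==> e' : E ==> e ~= e' ==> LM e Int LM e' = {}"
  shows "EX lab. (ALL p:P. lab p : V) & (ALL v:V. conn R {p:P. lab p = v}) &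
    (ALL e:E. EX p:P. EX q:P. R p q & {lab p, lab q} = e)"
proof -
  define lab0 where "lab0 p = (if EX v:V. p : LX v then Some (THE v. v : V & p : LX v) else None)" for p
  have lab0: "lab0 p = Some v \<longleftrightarrow> v : V & p : LX v" for p v
  proof
    assume l: "v : V & p : LX v"
    then have "(THE v. v : V & p : LX v) = v" using LX(2) by (intro the_equality) blast+
    then show "lab0 p = Some v" using l by (auto simp: lab0_def)
  next
    assume l: "lab0 p = Some v"
    then obtain w where w: "w : V" "p : LX w" by (auto simp: lab0_def split: if_splits)
    then have "(THE v. v : V & p : LX v) = w" using LX(2) by (intro the_equality) blast+
    then show "v : V & p : LX v" using l w by (auto simp: lab0_def split: if_splits)
  qed
  have dom0: "dom lab0 = (\<Union>v\<in>V. LX v)" using lab0 by (auto simp: dom_def)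
  have good0: "good_labels R lab0"
    unfolding good_labels_def lab0
  proof
    fix v show "conn R {p. v : V & p : LX v}"
      using LX(1)[of v] by (cases "v : V") (auto simp: conn_def)
  qed
  have "EX lab. good_labels R lab & lab0 \<subseteq>\<^sub>m lab & dom lab = dom lab0 Un (\<Union>e\<in>F. LM e) &
      (ALL e:F. ALL p:LM e. EX v:e. lab p = Some v)" if "F \<subseteq> E" for F
    using finite_subset[OF that E(1)] that
  proof (induction F rule: finite_induct)
    case empty
    show ?case using good0 by (intro exI[of _ lab0]) (simp add: map_le_refl)
  next
    case (insert e F)
    then obtain lab where lab: "good_labels R lab" "lab0 \<subseteq>\<^sub>m lab" "dom lab = dom lab0 Un (\<Union>e\<in>F. LM e)"
      "ALL e:F. ALL p:LM e. EX v:e. lab p = Some v" by blast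
    have e: "e : E" "e ~= {}" using insert.prems E(2)[of e] by auto
    \<comment> \<open>The other middles are disjoint from \<open>LM e\<close>, so a point of it that
      is already labelled belongs to some \<open>LX v\<close> and kept its original label.\<close>
    have old: "lab p = lab0 p" if "p : LM e" "p : dom lab" for p
    proof -
      have "p ~: LM e'" if "e' : F" for e'
        using LM(4)[of e e'] e that insert.prems insert.hyps \<open>p : LM e\<close> by blast
      then have "p : dom lab0" using \<open>p : dom lab\<close> lab(3) by blast
      then show ?thesis using lab(2) by (simp add: map_le_def)
    qed
    obtain v where v: "v : e" using e(2) by blast
    then have "v : V" using e(1) E(3) by blast
    then have "LX v \<subseteq> dom lab" using dom0 lab(3) by blast
    then have "LM e Int dom lab ~= {}" using LM(2)[OF e(1) v] by blast
    from label_extend[OF _ _ sym lab(1) this] LM(1)[OF e(1)] P(1)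
    obtain lab' where lab': "good_labels R lab'" "lab \<subseteq>\<^sub>m lab'" "dom lab' = dom lab Un LM e"
      "lab' ` LM e \<subseteq> lab ` (LM e Int dom lab)" using finite_subset by blast
    have new: "EX v:e. lab' p = Some v" if "p : LM e" for p
    proof -
      obtain q where q: "q : LM e" "q : dom lab" "lab' p = lab q" using lab'(4) \<open>p : LM e\<close> by blast
      obtain v where "lab q = Some v" using q(2) by blast
      then have v: "lab0 q = Some v" using old[OF q(1,2)] by (simp only:)
      then have "v : V" "q : LX v" using lab0 by blast+
      then have "v : e" using LM(3)[OF e(1)] q(1) by blast
      moreover have "lab' p = Some v" using q(3) old[OF q(1,2)] v by (simp only:)
      ultimately show ?thesis by blast
    qed
    have keep: "lab' p = lab p" if "p : LM e'" "e' : F" for p e'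
    proof -
      have "p : dom lab" using lab(4) that by blast
      then show ?thesis using lab'(2) by (simp add: map_le_def)
    qed
    show ?case
    proof (intro exI[of _ lab'] conjI ballI)
      show "good_labels R lab'" by (rule lab')
      show "lab0 \<subseteq>\<^sub>m lab'" using lab(2) lab'(2) map_le_trans by blast
      show "dom lab' = dom lab0 Un (\<Union>e\<in>insert e F. LM e)" using lab(3) lab'(3) by auto
      fix e' p assume "e' : insert e F" "p : LM e'"
      then consider "p : LM e" "e' = e" | "p : LM e'" "e' : F" by blast
      then show "EX v:e'. lab' p = Some v"
      proof cases
        case 1
        then show ?thesis using new by blast
      next
        case 2
        then show ?thesis using keep[OF 2] lab(4) by (simp only:)
      qed
    qed
  qed
  from this[OF order_refl] obtain lab where "good_labels R lab & lab0 \<subseteq>\<^sub>m lab &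
      dom lab = dom lab0 Un (\<Union>e\<in>E. LM e) & (ALL e:E. ALL p:LM e. EX v:e. lab p = Some v)"
    by (elim exE) (rule that)
  then have lab: "good_labels R lab" "lab0 \<subseteq>\<^sub>m lab" "dom lab = dom lab0 Un (\<Union>e\<in>E. LM e)"
      "!!e p. e : E ==> p : LM e ==> EX v:e. lab p = Some v" by blast+
  have domP: "dom lab \<subseteq> P" using lab(3) dom0 LX(1) LM(1) by blast
  obtain v where v: "v : V" using V by blast
  have "LX v \<subseteq> dom lab" unfolding lab(3) dom0 by (rule le_supI1) (rule UN_upper[OF v])
  then have "P Int dom lab ~= {}" using LX(1)[OF v] by blast
  then have "EX lab'. good_labels R lab' & lab \<subseteq>\<^sub>m lab' & dom lab' = dom lab Un P & lab' ` P \<subseteq> lab ` (P Int dom lab)"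
    by (intro label_extend P lab(1)) (rule sym)
  then obtain lab' where "good_labels R lab' & lab \<subseteq>\<^sub>m lab' & dom lab' = dom lab Un P & lab' ` P \<subseteq> lab ` (P Int dom lab)"
    by (elim exE) (rule that)
  then have lab': "good_labels R lab'" "lab \<subseteq>\<^sub>m lab'"
    "dom lab' = dom lab Un P" "lab' ` P \<subseteq> lab ` (P Int dom lab)" by blast+
  have domP': "dom lab' = P" using lab'(3) domP by blast
  have labV: "v : V" if l: "lab p = Some v" for p v
  proof -
    have "p : dom lab" using l by blast
    then consider "p : dom lab0" | e where "e : E" "p : LM e" using lab(3) by blast
    then show ?thesis
    proof cases
      case 1
      then have "lab0 p = Some v" using lab(2) l by (simp add: map_le_def)
      then show ?thesis using lab0 by blast
    next
      case 2
      then show ?thesis using lab(4)[OF 2] l E(3) by auto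
    qed
  qed
  have lab'V: "the (lab' p) : V & lab' p = Some (the (lab' p))" if p: "p : P" for p
  proof -
    obtain q where q: "q : dom lab" "lab' p = lab q" using lab'(4) p by blast
    obtain v where "lab q = Some v" using q(1) by blast
    then show ?thesis using labV[of q v] q by simp
  qed
  show ?thesis
  proof (intro exI[of _ "%p. the (lab' p)"] conjI ballI)
    show "the (lab' p) : V" if "p : P" for p using lab'V[OF that] by blast
    show "conn R {p : P. the (lab' p) = v}" if "v : V" for v
    proof -
      have "{p : P. the (lab' p) = v} = {p. lab' p = Some v}"
        using domP' lab'V by (auto simp: dom_def)
      then show ?thesis using lab'(1) by (simp add: good_labels_def)
    qed
    fix e assume e: "e : E"
    then obtain u v where uv: "e = {u, v}" "u ~= v" using E(2) by (meson card_2_iff)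
    define A where "A = {p : LM e. lab p = Some u}"
    have LXlab: "lab p = Some w" if "w : e" "p : LX w" for p w
    proof -
      have "lab0 p = Some w" using lab0 that e E(3) by blast
      then show ?thesis using lab(2) by (metis domI map_le_def)
    qed
    have Ane: "A ~= {} & A ~= LM e"
    proof -
      obtain p q where "p : LM e" "p : LX u" "q : LM e" "q : LX v" using LM(2)[OF e] uv by blast
      moreover from this have "lab p = Some u" "lab q = Some v" using LXlab uv(1) by blast+
      ultimately have "p : A" "q : LM e" "q ~: A" using uv(2) unfolding A_def by simp_all
      then show ?thesis by blast
    qed
    have AM: "A \<subseteq> LM e" unfolding A_def by blast
    from connD[OF conjunct2[OF LM(1)[OF e]] AM] Ane
    obtain p q where pq: "p : A" "q : LM e" "q ~: A" "R p q" by blast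
    obtain w where w: "w : e" "lab q = Some w" using lab(4)[OF e pq(2)] by blast
    have "w ~= u" using w(2) pq unfolding A_def by blast
    then have "lab q = Some v" "lab p = Some u" using w uv pq(1) unfolding A_def by auto
    then have "lab' p = Some u" "lab' q = Some v" using lab'(2) unfolding map_le_def by (metis domI)+
    then have "{the (lab' p), the (lab' q)} = e" unfolding uv(1) by simp
    moreover have "p : P" "q : P" using pq(1,2) AM LM(1)[OF e] by blast+
    ultimately show "EX p:P. EX q:P. R p q & {the (lab' p), the (lab' q)} = e"
      using pq(4) by blast
  qed
qed

section \<open>Replacing subsets of the surface by vertices of the complex\<close>

lemma facet_corner:
  assumes "n : set axes" "(p1, p2, p3) : {0..1} \<times> {0..1} \<times> {0..1}" "(p1, p2, p3) - n : {0..1} \<times> {0..1} \<times> {0..1}"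
  shows "EX s. (n, s) : set frames & corner (n, s) = (p1, p2, p3)"
proof -
  have "list_all (%n. list_all (%p. (case p - n of (x, y, z) => 0 <= x & x <= 1 & 0 <= y & y <= 1 & 0 <= z & z <= 1) -->
      list_ex (%f. fst f = n & corner f = p) frames) (List.product [0, 1] (List.product [0, 1] [0, 1]))) axes"
    by code_simp
  moreover have "p1 = 0 | p1 = 1" "p2 = 0 | p2 = 1" "p3 = 0 | p3 = 1" using assms(2) by auto
  then have "(p1, p2, p3) : set (List.product [0, 1] (List.product [0, 1] [0, 1]))" by auto
  ultimately have "list_ex (%f. fst f = n & corner f = (p1, p2, p3)) frames"
    using assms(1,3) unfolding list_all_iff by (cases n) fastforce
  then show ?thesis unfolding list_ex_iff by (metis prod.collapse)
qed

context
  fixes g :: nat and N :: nat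
  assumes N: "N > 0"
begin

abbreviation surf_darts where "surf_darts \<equiv> darts (voxels g (int N))"
abbreviation surf_opp where "surf_opp \<equiv> opp (voxels g (int N))"

definition dfacet :: "ivec \<times> ivec \<times> ivec => (real \<times> real \<times> real) set" where
  "dfacet d = facet N (fst d) (fst (snd d))"

text \<open>\<open>dfacet\<close> depends only on the facet of a dart, and the darts of a facet
  start at all of its corners. So these are all corners of the facets that meet
  \<open>X\<close>.\<close>

definition near_pts :: "(real \<times> real \<times> real) set => ivec set" where
  "near_pts X = start ` {d : surf_darts. dfacet d Int X ~= {}}"

definition adj :: "ivec => ivec => bool" where
  "adj p q \<longleftrightarrow> (EX d:surf_darts. start d = p & start (surf_opp d) = q)"

lemma adj_sym: "adj p q ==> adj q p"
proof -
  assume "adj p q"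
  then obtain d where d: "d : surf_darts" "start d = p" "start (surf_opp d) = q" unfolding adj_def by blast
  have "surf_opp d : surf_darts" "start (surf_opp (surf_opp d)) = p"
    using opp_darts[OF d(1)] d(2) by (simp_all only: opp_opp)
  then show "adj q p" unfolding adj_def using d(3) by blast
qed

text \<open>The opposite dart starts where the dart ends, and that is where the next dart of the
  same facet starts.\<close>

lemma start_opp:
  assumes "d : surf_darts"
  shows "start (surf_opp d) = start (turn (voxels g N) d)"
proof -
  have "rot (voxels g N) (surf_opp d) = turn (voxels g N) d" using fun_cong[OF rot_opp, of "voxels g N" d] by (simp only: comp_apply)
  then show ?thesis using start_rot[OF opp_darts[OF assms]] by (simp only:)
qed

lemma dart_of_facet:
  assumes "w : voxels g N" "w + n ~: voxels g N" "n : set axes"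
  obtains s where "(w, n, s) : surf_darts"
proof -
  have "ALL n:set axes. EX f:set frames. fst f = n" by (simp add: frames_simp axes_def)
  then obtain f where "f : set frames" "fst f = n" using assms(3) by blast
  then have "(n, snd f) : set frames" by auto
  then show ?thesis using that assms by (simp add: in_darts)
qed

lemma closed_dfacet: "closed (dfacet d)"
  unfolding dfacet_def facet_def[OF N] by (intro closed_Int closed_cvox)

lemma dfacet_surface: "d : surf_darts ==> dfacet d \<subseteq> handle_surface g"
  using facet_in_surface[OF N, of "fst d" g "fst (snd d)"] unfolding dfacet_def darts_def by auto

lemma surface_dfacet:
  assumes "p : handle_surface g"
  obtains d where "d : surf_darts" "p : dfacet d"
proof -
  obtain w n where "w : voxels g N" "w + n ~: voxels g N" "n : set axes" "p : facet N w n"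
    using surface_in_facet[OF N assms] by blast
  then show ?thesis using that dart_of_facet by (metis dfacet_def fst_conv snd_conv)
qed

lemma in_facet:
  fixes x y z :: real and a b c :: int
  shows "(x, y, z) : facet N (a, b, c) (n1, n2, n3) \<longleftrightarrow>
   (real_of_int a <= N * x & N * x <= real_of_int a + 1 & real_of_int b <= N * y & N * y <= real_of_int b + 1 & real_of_int c <= N * z & N * z <= real_of_int c + 1) &
   real_of_int (a + n1) <= N * x & N * x <= real_of_int (a + n1) + 1 & real_of_int (b + n2) <= N * y &
   N * y <= real_of_int (b + n2) + 1 & real_of_int (c + n3) <= N * z & N * z <= real_of_int (c + n3) + 1"
  unfolding facet_def[OF N] Int_iff add_Pair in_cvox[OF N] by (rule refl)

text \<open>A facet is bounded by integers in the scaled coordinates, so rounding a point down stays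
  in the facet. The rounded point depends only on the point, hence facets with a common point share
  a corner.\<close>

lemma facet_floor_corner:
  fixes x y z :: real
  assumes "(w, n, s) : surf_darts" "(x, y, z) : dfacet (w, n, s)"
  obtains s' where "(w, n, s') : surf_darts" "start (w, n, s') = (\<lfloor>N * x\<rfloor>, \<lfloor>N * y\<rfloor>, \<lfloor>N * z\<rfloor>)"
proof -
  obtain a b c n1 n2 n3 where e: "w = (a, b, c)" "n = (n1, n2, n3)" by (cases w; cases n) blast
  have "(x, y, z) : facet N (a, b, c) (n1, n2, n3)" using assms(2) by (simp add: dfacet_def e)
  from this[unfolded in_facet] have p: "a <= \<lfloor>N * x\<rfloor> & \<lfloor>N * x\<rfloor> <= a + 1" "b <= \<lfloor>N * y\<rfloor> & \<lfloor>N * y\<rfloor> <= b + 1" "c <= \<lfloor>N * z\<rfloor> & \<lfloor>N * z\<rfloor> <= c + 1"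
    "a + n1 <= \<lfloor>N * x\<rfloor> & \<lfloor>N * x\<rfloor> <= a + n1 + 1" "b + n2 <= \<lfloor>N * y\<rfloor> & \<lfloor>N * y\<rfloor> <= b + n2 + 1"
    "c + n3 <= \<lfloor>N * z\<rfloor> & \<lfloor>N * z\<rfloor> <= c + n3 + 1"
    by (auto simp: le_floor_iff floor_le_iff)
  have "n : set axes" using assms(1) by (auto simp: in_darts frames_def)
  then obtain s' where s': "(n, s') : set frames" "corner (n, s') = (\<lfloor>N * x\<rfloor> - a, \<lfloor>N * y\<rfloor> - b, \<lfloor>N * z\<rfloor> - c)"
    using facet_corner[of n "\<lfloor>N * x\<rfloor> - a" "\<lfloor>N * y\<rfloor> - b" "\<lfloor>N * z\<rfloor> - c"] p unfolding e by auto
  show ?thesis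
  proof (rule that)
    show "(w, n, s') : surf_darts" using assms(1) s'(1) unfolding in_darts by blast
    show "start (w, n, s') = (\<lfloor>N * x\<rfloor>, \<lfloor>N * y\<rfloor>, \<lfloor>N * z\<rfloor>)" using s'(2) by (simp add: e del: corner.simps)
  qed
qed

lemma facets_meet:
  assumes "d : surf_darts" "d' : surf_darts" "x : dfacet d" "x : dfacet d'"
  obtains s s' where "(fst d, fst (snd d), s) : surf_darts" "(fst d', fst (snd d'), s') : surf_darts"
    "start (fst d, fst (snd d), s) = start (fst d', fst (snd d'), s')"
proof -
  obtain w n s w' n' s' where d: "d = (w, n, s)" "d' = (w', n', s')" by (cases d; cases d') blast
  obtain x1 x2 x3 where x: "x = (x1, x2, x3)" by (cases x) blast
  obtain t where t: "(w, n, t) : surf_darts" "start (w, n, t) = (\<lfloor>N * x1\<rfloor>, \<lfloor>N * x2\<rfloor>, \<lfloor>N * x3\<rfloor>)"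
    using facet_floor_corner[of w n s x1 x2 x3] assms(1,3) unfolding d x by blast
  obtain t' where t': "(w', n', t') : surf_darts" "start (w', n', t') = (\<lfloor>N * x1\<rfloor>, \<lfloor>N * x2\<rfloor>, \<lfloor>N * x3\<rfloor>)"
    using facet_floor_corner[of w' n' s' x1 x2 x3] assms(2,4) unfolding d x by blast
  show ?thesis
    using that[of t t'] t t' unfolding d fst_conv snd_conv by (simp only:)
qed

lemma turn_connects:
  assumes A: "!!d. d : surf_darts ==> dfacet d Int X ~= {} ==> start d : A ==> start (surf_opp d) : A"
    and d: "(w, n, s) : surf_darts" "(w, n, s') : surf_darts" "dfacet (w, n, s) Int X ~= {}" "start (w, n, s) : A"
  shows "start (w, n, s') : A"
proof -
  let ?t = "turn (voxels g N)"
  have step: "fst (?t d) = w & fst (snd (?t d)) = n & ?t d : surf_darts & start (?t d) : A"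
    if "fst d = w & fst (snd d) = n & d : surf_darts & start d : A" for d
  proof -
    have "dfacet d Int X ~= {}" using d(3) that by (simp add: dfacet_def)
    then have "start (?t d) : A" using A[of d] that start_opp[of d] by simp
    moreover have "?t d : surf_darts" using that turn_darts by blast
    ultimately show ?thesis using that by (cases d) auto
  qed
  define dd where "dd = (%k. (?t ^^ k) (w, n, s))"
  have all: "fst (dd k) = w & fst (snd (dd k)) = n & dd k : surf_darts & start (dd k) : A" for k
    unfolding dd_def by (induction k) (use d step in auto)
  have "EX k. dd k = (w, n, s')"
  proof -
    have "ALL f:set frames. ALL f':set frames. fst f = fst f' --> snd f' : {snd f, cross (fst f) (snd f), - snd f, - cross (fst f) (snd f)}"
      unfolding frames_simp by simp
    moreover have f: "(n, s) : set frames" "(n, s') : set frames" using d by (auto simp: in_darts)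
    ultimately have s': "s' : {s, cross n s, - s, - cross n s}" by fastforce
    have f1: "(n, cross n s) : set frames" "(n, - s) : set frames" using frames_closed[OF f(1)] by blast+
    have t1: "?t (w, n, u) = (w, n, cross n u)" if "(n, u) : set frames" for u
      using that d(1) by (simp add: in_darts)
    have "dd 0 = (w, n, s)" "dd 1 = (w, n, cross n s)" "dd 2 = (w, n, - s)" "dd 3 = (w, n, - cross n s)"
      using t1[OF f(1)] t1[OF f1(1)] t1[OF f1(2)] frames_closed(5)[OF f(1)] frames_closed(5)[OF f1(1)]
      unfolding dd_def by (simp_all add: numeral_2_eq_2 numeral_3_eq_3 del: turn.simps cross.simps)
    then show ?thesis using s' by auto
  qed
  then show ?thesis using all by metis
qed

text \<open>The facets with a dart starting in \<open>A\<close> and those with a dart starting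
  outside \<open>A\<close> give two closed sets covering \<open>X\<close>. Two facets that meet in
  \<open>X\<close> share a corner, and walking around each of them keeps \<open>A\<close>, so the
  closed sets are disjoint on \<open>X\<close> and one of them misses \<open>X\<close>.\<close>

lemma conn_near_pts:
  assumes "connected X" "X \<subseteq> handle_surface g"
  shows "conn adj (near_pts X)"
  unfolding conn_def
proof (intro allI impI)
  fix A assume A: "A \<subseteq> near_pts X" "A ~= {}" "ALL p:A. ALL q:near_pts X. adj p q --> q : A"
  define SX where "SX = {d : surf_darts. dfacet d Int X ~= {}}"
  have finSX: "finite SX" unfolding SX_def using finite_darts[OF finite_voxels] by simp
  have sub: "start (surf_opp d) : near_pts X" if "d : SX" for d
  proof -
    have "turn (voxels g N) d : SX" using that turn_darts by (cases d) (auto simp: SX_def dfacet_def)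
    then show ?thesis using start_opp that unfolding near_pts_def SX_def by auto
  qed
  have stepA: "start (surf_opp d) : A" if "d : surf_darts" "dfacet d Int X ~= {}" "start d : A" for d
    using A(3) sub[of d] that unfolding SX_def adj_def by blast
  define U where "U = \<Union> (dfacet ` {d : SX. start d : A})"
  define V where "V = \<Union> (dfacet ` {d : SX. start d ~: A})"
  have "closed U" "closed V" unfolding U_def V_def
    by (intro closed_Union; use finSX closed_dfacet in auto)+
  moreover have "X \<subseteq> U Un V"
  proof
    fix x assume "x : X"
    then obtain d where "d : surf_darts" "x : dfacet d" using surface_dfacet assms(2) by blast
    then show "x : U Un V" using \<open>x : X\<close> unfolding U_def V_def SX_def by blast
  qed
  moreover have "U Int V Int X = {}"
  proof (rule ccontr)
    assume "U Int V Int X ~= {}"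
    then obtain x d d' where x: "d : SX" "d' : SX" "start d : A" "start d' ~: A" "x : dfacet d" "x : dfacet d'"
      unfolding U_def V_def by blast
    obtain w n r w' n' r' where e: "d = (w, n, r)" "d' = (w', n', r')" by (cases d; cases d') blast
    obtain s s' where s: "(w, n, s) : surf_darts" "(w', n', s') : surf_darts" "start (w, n, s) = start (w', n', s')"
      using facets_meet[of d d' x] x(1,2,5,6) unfolding SX_def e fst_conv snd_conv by blast
    have "start (w, n, s) : A"
      by (rule turn_connects[of X A w n r s, OF stepA]) (use x(1,3) s(1) in \<open>unfold SX_def e, blast+\<close>)
    then have sA: "start (w', n', s') : A" by (simp only: s(3))
    have "dfacet (w', n', s') Int X ~= {}" 
    proof -
      have "dfacet (w', n', r') Int X ~= {}" using x(2) unfolding SX_def e by blast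
      then show ?thesis by (simp add: dfacet_def)
    qed
    then have "start (w', n', r') : A"
      by (intro turn_connects[of X A w' n' s' r', OF stepA]) (use x(2) s(2) sA in \<open>unfold SX_def e, blast+\<close>)
    then show False using x(4) unfolding e by blast
  qed
  ultimately have "U Int X = {} | V Int X = {}"
    using assms(1) unfolding connected_closed by blast
  moreover have "U Int X ~= {}"
  proof -
    obtain p where "p : A" using A(2) by blast
    then obtain d where "d : SX" "start d = p" using A(1) unfolding near_pts_def SX_def by blast
    then show ?thesis using \<open>p : A\<close> unfolding U_def SX_def by blast
  qed
  ultimately have V: "V Int X = {}" by blast
  have "near_pts X \<subseteq> A"
  proof
    fix p assume "p : near_pts X"
    then obtain d where d: "d : SX" "start d = p" unfolding near_pts_def SX_def by blast
    then show "p : A" using V unfolding V_def SX_def by blast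
  qed
  then show "A = near_pts X" using A(1) by blast
qed

lemma near_pts_subset: "near_pts X \<subseteq> start ` surf_darts"
  unfolding near_pts_def by blast

lemma near_pts_meet:
  assumes "x : X" "x : Y" "x : handle_surface g"
  shows "near_pts X Int near_pts Y ~= {}"
proof -
  obtain d where "d : surf_darts" "x : dfacet d" using surface_dfacet[OF assms(3)] by blast
  then have "start d : near_pts X Int near_pts Y" using assms unfolding near_pts_def by blast
  then show ?thesis by blast
qed

lemma start_close:
  fixes x1 x2 x3 :: real and p1 p2 p3 :: int
  assumes "d : surf_darts" "x : dfacet d" "start d = (p1, p2, p3)" "x = (x1, x2, x3)"
  shows "\<bar>N * x1 - p1\<bar> <= 1" "\<bar>N * x2 - p2\<bar> <= 1" "\<bar>N * x3 - p3\<bar> <= 1"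
proof -
  obtain w n s where d: "d = (w, n, s)" by (cases d) blast
  obtain a b c where w: "w = (a, b, c)" by (cases w) blast
  have "corner (n, s) : {0..1} \<times> {0..1} \<times> {0..1}" using frames_closed(14) assms(1) by (simp add: d in_darts)
  moreover have "corner (n, s) = (p1 - a, p2 - b, p3 - c)"
    using assms(3) unfolding d w start.simps by (cases "corner (n, s)") (auto simp del: corner.simps)
  ultimately have "a <= p1" "p1 <= a + 1" "b <= p2" "p2 <= b + 1" "c <= p3" "p3 <= c + 1" by auto
  then have "real_of_int a <= p1" "real_of_int p1 <= real_of_int a + 1" "real_of_int b <= p2" "real_of_int p2 <= real_of_int b + 1"
     "real_of_int c <= p3" "real_of_int p3 <= real_of_int c + 1" by linarith+
  moreover have "(x1, x2, x3) : cvox N (a, b, c)"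
    using assms(2) unfolding d w assms(4) dfacet_def facet_def[OF N] by simp
  ultimately show "\<bar>N * x1 - p1\<bar> <= 1" "\<bar>N * x2 - p2\<bar> <= 1" "\<bar>N * x3 - p3\<bar> <= 1"
    unfolding in_cvox[OF N] by linarith+
qed

text \<open>Both points are within \<open>1 / N\<close> of the common corner in every coordinate, so
  they differ by at most \<open>2 / N\<close> in each of three coordinates.\<close>

lemma near_pts_dist:
  assumes "near_pts X Int near_pts Y ~= {}"
  obtains x y where "x : X" "y : Y" "dist x y <= 6 / N"
proof -
  obtain d d' x y where d: "d : surf_darts" "d' : surf_darts" "x : dfacet d" "x : X" "y : dfacet d'" "y : Y" "start d = start d'"
    using assms unfolding near_pts_def by blast
  obtain p1 p2 p3 where p: "start d = (p1, p2, p3)" by (cases "start d") blast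
  obtain x1 x2 x3 y1 y2 y3 where e: "x = (x1, x2, x3)" "y = (y1, y2, y3)" by (cases x; cases y) blast
  have "start d' = (p1, p2, p3)" using p d(7) by simp
  note 1 = start_close[OF d(1,3) p e(1)] start_close[OF d(2,5) this e(2)]
  have c: "dist u v <= 2 / N" if "\<bar>N * u - q\<bar> <= 1" "\<bar>N * v - q\<bar> <= 1" for u v :: real and q
  proof -
    have "\<bar>N * (u - v)\<bar> <= 2" using that unfolding right_diff_distrib by linarith
    then have "N * \<bar>u - v\<bar> <= 2" by (simp add: abs_mult)
    then show ?thesis using N by (simp add: dist_real_def field_simps)
  qed
  have "dist x1 y1 <= 2 / N" "dist x2 y2 <= 2 / N" "dist x3 y3 <= 2 / N"
    using c[OF 1(1) 1(4)] c[OF 1(2) 1(5)] c[OF 1(3) 1(6)] by blast+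
  moreover have "dist x y <= dist x1 y1 + dist (x2, x3) (y2, y3)" "dist (x2, x3) (y2, y3) <= dist x2 y2 + dist x3 y3"
    unfolding e dist_Pair_Pair by (rule sqrt_sum_squares_le_sum; simp)+
  ultimately have "dist x y <= 2 / N + 2 / N + 2 / N" by linarith
  then show ?thesis using that[of x y] d by simp
qed

lemma conn_all: "conn adj (start ` surf_darts)"
proof -
  have "start ` surf_darts = near_pts (handle_surface g)"
  proof (intro equalityI subsetI)
    fix p assume "p : start ` surf_darts"
    then obtain d where d: "d : surf_darts" "p = start d" by blast
    obtain w n s where e: "d = (w, n, s)" by (cases d) blast
    obtain a b c n1 n2 n3 where w: "w = (a, b, c)" "n = (n1, n2, n3)" by (cases w; cases n) blast
    obtain o1 o2 o3 where o: "corner (n, s) = (o1, o2, o3)" by (cases "corner (n, s)") blast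
    have f: "(n, s) : set frames" using d(1) by (simp add: e in_darts)
    have b: "0 <= o1" "o1 <= 1" "0 <= o2" "o2 <= 1" "0 <= o3" "o3 <= 1"
      "0 <= o1 - n1" "o1 - n1 <= 1" "0 <= o2 - n2" "o2 - n2 <= 1" "0 <= o3 - n3" "o3 - n3 <= 1"
      using frames_closed(13,14)[OF f] unfolding o by (auto simp: w)
    have "((a + o1) / N, (b + o2) / N, (c + o3) / N) : facet N w n"
      unfolding w in_facet using N b by auto
    then have "dfacet d ~= {}" unfolding e dfacet_def by auto
    then show "p : near_pts (handle_surface g)"
      using d dfacet_surface unfolding near_pts_def by blast
  qed (use near_pts_subset in blast)
  then show ?thesis using conn_near_pts[OF connected_handle_surface] by simp
qed

end

declare opp.simps [simp del]

section \<open>The rotation system of a drawing\<close>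

definition arcs_of :: "'v set set => ('v \<times> 'v) set" where
  "arcs_of E = {(u, v). {u, v} : E & u ~= v}"

lemma swap_arcs: "a : arcs_of E ==> prod.swap a : arcs_of E"
  by (cases a) (auto simp: arcs_of_def insert_commute)

lemma finite_separation:
  fixes K :: "'a :: heine_borel set set"
  assumes "finite K" "!!X. X : K ==> compact X"
  shows "EX d>0. ALL X:K. ALL Y:K. X Int Y = {} --> (ALL x:X. ALL y:Y. d <= dist x y)"
proof -
  have "EX d>0. fst P Int snd P = {} --> (ALL x:fst P. ALL y:snd P. d <= dist x y)" if "P : K \<times> K" for P
  proof (cases "fst P Int snd P = {}")
    case True
    have "compact (fst P)" "closed (snd P)"
      using that assms(2)[of "fst P"] compact_imp_closed[OF assms(2)[of "snd P"]] by auto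
    then obtain d where "d > 0" "ALL x:fst P. ALL y:snd P. d <= dist x y"
      using separate_compact_closed[of "fst P" "snd P"] True by blast
    then show ?thesis by blast
  qed (intro exI[of _ 1], simp)
  then have "ALL P:K \<times> K. EX d. d > 0 & (fst P Int snd P = {} --> (ALL x:fst P. ALL y:snd P. d <= dist x y))" by blast
  from bchoice[OF this] obtain d where
    d: "ALL P:K \<times> K. d P > 0 & (fst P Int snd P = {} --> (ALL x:fst P. ALL y:snd P. d P <= dist x y))" by blast
  define m where "m = Min (insert 1 (d ` (K \<times> K)))"
  have fin: "finite (insert 1 (d ` (K \<times> K)))" using assms(1) by simp
  have "m > 0" unfolding m_def using fin d by (subst Min_gr_iff) auto
  moreover have "m <= d P" if "P : K \<times> K" for P
    unfolding m_def using fin that by (intro Min_le) auto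
  ultimately show ?thesis using d by (intro exI[of _ m]) fastforce
qed

text \<open>The cycles of \<open>s\<close> are the arcs leaving one vertex, the cycles of the
  composite are the faces, and the inequality is \<open>V - E + F >= 2 - 2 g\<close>.\<close>

definition has_rotation :: "'v set => 'v set set => nat => bool" where
  "has_rotation V E g \<longleftrightarrow> (EX s. s permutes arcs_of E & (ALL a:arcs_of E. orbit s a = {b : arcs_of E. fst b = fst a}) &
     int (card E) + 2 - int (card V) - 2 * int g <= int (ncyc (s o restr prod.swap (arcs_of E)) (arcs_of E)))"

text \<open>For each graph edge one edge of the complex with the right labels is kept.
  \<open>minor_rotation\<close> contracts the branch sets and deletes the rest.\<close>

lemma rotation_of_labels:
  fixes V :: "'v set"
  assumes E: "finite E" "!!e. e : E ==> card e = 2" "\<Union>E = V" and N: "N > 0"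
    and lab: "!!p. p : start ` darts (voxels g (int N)) ==> lab p : V"
      "!!v. v : V ==> conn (adj g N) {p : start ` darts (voxels g (int N)). lab p = v}"
      "!!e. e : E ==> EX p:start ` darts (voxels g (int N)). EX q:start ` darts (voxels g (int N)). adj g N p q & {lab p, lab q} = e"
  shows "has_rotation V E g"
proof -
  let ?W = "voxels g (int N)"
  let ?D = "darts ?W" and ?r = "opp ?W" and ?s = "rot ?W"
  define l where "l d = lab (start d)" for d
  note finW = finite_voxels[of g "int N"]
  note finD = finite_darts[OF finW]
  have rr: "?r (?r d) = d" for d by (rule opp_opp)
  have rD: "?r d : ?D" if "d : ?D" for d by (rule opp_darts[OF that])
  have "EX d:?D. {l d, l (?r d)} = e" if "e : E" for e
  proof -
    from lab(3)[OF that] obtain p q where "adj g N p q" "{lab p, lab q} = e" by blast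
    then show ?thesis unfolding adj_def[OF N] l_def by blast
  qed
  then obtain c where c: "!!e. e : E ==> c e : ?D & {l (c e), l (?r (c e))} = e" by metis
  define B where "B = c ` E Un ?r ` c ` E"
  have BD: "B \<subseteq> ?D" unfolding B_def using c rD by blast
  have ends: "{l d, l (?r d)} : E & (d = c {l d, l (?r d)} | d = ?r (c {l d, l (?r d)}))" if "d : B" for d
  proof -
    obtain e where e: "e : E" "d = c e | d = ?r (c e)" using \<open>d : B\<close> unfolding B_def by blast
    have "{l d, l (?r d)} = e"
      using e(2)
    proof
      assume "d = ?r (c e)"
      then have "{l d, l (?r d)} = {l (c e), l (?r (c e))}" by (simp only: rr insert_commute)
      then show ?thesis using c[OF e(1)] by simp
    qed (use c[OF e(1)] in simp)
    then show ?thesis using e by blast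
  qed
  have neq: "l (?r d) ~= l d" if "d : B" for d
  proof
    assume "l (?r d) = l d"
    then have "card {l d, l (?r d)} = 1" by simp
    then show False using E(2)[OF conjunct1[OF ends[OF that]]] by simp
  qed
  have Bcl: "?r d : B" if d: "d : B" for d
  proof -
    obtain e where "e : E" "d = c e | d = ?r (c e)" using d unfolding B_def by blast
    then have "e : E" "?r d = ?r (c e) | ?r d = c e" by (auto simp only: rr)
    then show ?thesis unfolding B_def by blast
  qed
  \<comment> \<open>Naming a kept dart by the labels of its two ends carries the permutations on
    \<open>B\<close> over to the arcs of the graph.\<close>
  define h where "h d = (l d, l (?r d))" for d
  have h_inj: "inj_on h B"
  proof (rule inj_onI)
    fix d d' assume d: "d : B" "d' : B" "h d = h d'"
    then have e: "l d = l d'" "l (?r d) = l (?r d')" by (auto simp: h_def)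
    let ?c = "c {l d, l (?r d)}"
    have "d = ?c | d = ?r ?c" "d' = ?c | d' = ?r ?c" using ends[OF d(1)] ends[OF d(2)] e by simp_all
    then have "d = d' | d' = ?r d" by (metis rr)
    then show "d = d'" using neq[OF d(1)] e(1) by auto
  qed
  have h_img: "h ` B = arcs_of E"
  proof (intro equalityI subsetI)
    fix a assume "a : h ` B"
    then obtain d where "d : B" "a = h d" by blast
    then have "d : B" "a = (l d, l (?r d))" by (simp_all only: h_def)
    then show "a : arcs_of E" using ends[of d] neq[of d] unfolding arcs_of_def by auto
  next
    fix a assume "a : arcs_of E"
    then obtain u v where a: "a = (u, v)" "{u, v} : E" "u ~= v" by (auto simp: arcs_of_def)
    let ?c = "c {u, v}"
    have cc: "?c : B" "?r ?c : B" using a(2) unfolding B_def by blast+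
    have "{l ?c, l (?r ?c)} = {u, v}" using c[OF a(2)] by blast
    then consider "l ?c = u" "l (?r ?c) = v" | "l ?c = v" "l (?r ?c) = u" by (auto simp: doubleton_eq_iff)
    then show "a : h ` B"
    proof cases
      case 1
      then have "h ?c = a" unfolding h_def a by simp
      then show ?thesis using cc by blast
    next
      case 2
      then have "h (?r ?c) = a" unfolding h_def rr a by simp
      then show ?thesis using cc by blast
    qed
  qed
  have labs: "l ` ?D = V" "l ` B = V"
  proof -
    have "l ` ?D \<subseteq> V" using lab(1) unfolding l_def by blast
    moreover have "V \<subseteq> l ` B"
    proof
      fix v assume "v : V"
      then obtain e where e: "e : E" "v : e" using E(3) by blast
      then have "v = l (c e) | v = l (?r (c e))" using c[OF e(1)] by blast
      then show "v : l ` B" using e unfolding B_def by blast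
    qed
    ultimately show "l ` ?D = V" "l ` B = V" using BD by blast+
  qed
  have lrot: "l (?s d) = l d" if "d : ?D" for d using start_rot[OF that] by (simp only: l_def)
  \<comment> \<open>Inside a branch set one gets around a lattice point by \<open>rot\<close> and
    from one point to an adjacent one by an edge whose ends have equal labels.\<close>
  have fib: "fibres_connected ?D ?s ?r l"
    unfolding fibres_connected_def
  proof (intro allI impI ballI)
    fix X x y assume X: "X \<subseteq> ?D" "ALL z:X. ?s z : X & (l (?r z) = l z --> ?r z : X)"
      and xy: "x : X" "y : ?D" "l y = l x"
    have orb: "z' : X" if z: "z : X" "z' : ?D" "start z' = start z" for z z'
    proof -
      have "z' : orbit ?s z"
        by (rule same_start_same_orbit[OF finW voxels_local_cyclic]) (use z X(1) in auto)
      moreover have "orbit ?s z \<subseteq> X" by (rule orbit_subset_closed) (use X z in auto)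
      ultimately show ?thesis by blast
    qed
    define C where "C = {p : start ` ?D. lab p = l x}"
    define A where "A = start ` X Int C"
    have "conn (adj g N) C" unfolding C_def by (rule lab(2)) (use labs xy X in blast)
    moreover have "A \<subseteq> C" "A ~= {}" using xy X(1) unfolding A_def C_def l_def by blast+
    moreover have "q : A" if pq: "p : A" "q : C" "adj g N p q" for p q
    proof -
      obtain d where d: "d : ?D" "start d = p" "start (?r d) = q" using pq(3) unfolding adj_def[OF N] by blast
      obtain z where z: "z : X" "start z = p" using pq(1) unfolding A_def by blast
      have "d : X" using orb[OF z(1) d(1)] z(2) d(2) by simp
      moreover have "l (?r d) = l d" using pq(1,2) d unfolding A_def C_def l_def by simp
      ultimately have "?r d : X" using X(2) by blast
      then show ?thesis using d(3) pq(2) unfolding A_def by blast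
    qed
    ultimately have "A = C" unfolding conn_def by blast
    then have "start y : A" using xy unfolding C_def l_def by blast
    then obtain z where "z : X" "start z = start y" unfolding A_def by (metis IntD1 imageE)
    then show "y : X" using orb[of z y] xy by simp
  qed
  have Bp: "?r x : B & l (?r x) ~= l x" if "x : B" for x using Bcl[OF that] neq[OF that] by blast
  have "EX k. k permutes B & (ALL x:B. orbit k x = {y : B. l y = l x}) &
      2 * ncyc ?s ?D + 2 * ncyc (?s o ?r) ?D + card B <= 2 * ncyc (k o restr ?r B) B + card ?D + 2 * card (l ` B)"
  proof (rule minor_rotation[OF finD rot_permutes opp_permutes _ _ _ fib BD])
    show "l ` ?D = l ` B" using labs by simp
    fix k assume "k permutes B" "!!x. x : B ==> orbit k x = {y : B. l y = l x}"
      "2 * ncyc ?s ?D + 2 * ncyc (?s o ?r) ?D + card B <= 2 * ncyc (k o restr ?r B) B + card ?D + 2 * card (l ` B)"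
    then show ?thesis by (intro exI[of _ k] conjI ballI)
  qed (erule opp_neq lrot Bp | rule rr)+
  then obtain k where "k permutes B & (ALL x:B. orbit k x = {y : B. l y = l x}) &
      2 * ncyc ?s ?D + 2 * ncyc (?s o ?r) ?D + card B <= 2 * ncyc (k o restr ?r B) B + card ?D + 2 * card (l ` B)"
    by (elim exE) (rule that)
  then have k: "k permutes B" "!!x. x : B ==> orbit k x = {y : B. l y = l x}"
    and cnt: "2 * ncyc ?s ?D + 2 * ncyc (?s o ?r) ?D + card B <= 2 * ncyc (k o restr ?r B) B + card ?D + 2 * card (l ` B)"
    by (elim conjE; simp only:)+
  define h' where "h' = inv_into B h"
  have h': "h' a : B" "h (h' a) = a" if "a : arcs_of E" for a
    using inv_into_into[of a h B] f_inv_into_f[of a h B] that unfolding h'_def h_img by blast+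
  have h'h: "h' (h d) = d" if "d : B" for d unfolding h'_def by (rule inv_into_f_f[OF h_inj that])
  define s where "s a = (if a : arcs_of E then h (k (h' a)) else a)" for a
  have kB: "k d : B" if "d : B" for d using k(1) that permutes_in_image by metis
  have hB: "h d : arcs_of E" if "d : B" for d using h_img that by blast
  have bij: "bij_betw h B (arcs_of E)" using h_inj h_img by (simp add: bij_betw_def)
  have sp: "s permutes arcs_of E"
  proof (rule bij_imp_permutes)
    have "bij_betw (h o k o h') (arcs_of E) (arcs_of E)"
      unfolding h'_def comp_assoc
      by (rule bij_betw_trans[OF bij_betw_trans[OF bij_betw_inv_into[OF bij] permutes_imp_bij[OF k(1)]] bij, unfolded comp_assoc])
    then show "bij_betw s (arcs_of E) (arcs_of E)"
      using bij_betw_cong[of "arcs_of E" s "h o k o h'" "arcs_of E"] by (simp add: s_def)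
  qed (simp add: s_def)
  have conj: "orbit f' (h d) = h ` orbit f d"
    if "!!d. d : B ==> f d : B" "!!d. d : B ==> f' (h d) = h (f d)" "d : B" for f f' d
  proof -
    have 1: "((f ^^ n) d) : B & (f' ^^ n) (h d) = h ((f ^^ n) d)" for n
      by (induction n) (use that in auto)
    then have "(f' ^^ n) (h d) = h ((f ^^ n) d)" for n by blast
    then show ?thesis unfolding orbit_altdef setcompr_eq_image image_image by simp
  qed
  have sh: "s (h d) = h (k d)" if "d : B" for d
    unfolding s_def h'h[OF that] using hB[OF that] by simp
  have hr: "h (?r d) = prod.swap (h d)" for d by (simp only: h_def rr swap_simp)
  have orb: "orbit s a = {b : arcs_of E. fst b = fst a}" if a: "a : arcs_of E" for a
  proof -
    have "orbit s (h (h' a)) = h ` orbit k (h' a)"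
      by (rule conj) (erule kB sh | rule h'(1)[OF a])+
    then have "orbit s a = h ` {y : B. l y = l (h' a)}" unfolding h'(2)[OF a] k(2)[OF h'(1)[OF a]] .
    also have "\<dots> = {b : arcs_of E. fst b = fst a}"
    proof -
      have fh: "fst (h y) = l y" for y by (simp add: h_def)
      then have "l (h' a) = fst a" using h'(2)[OF a] by metis
      then show ?thesis unfolding h_img[symmetric] using fh by auto
    qed
    finally show ?thesis .
  qed
  have ncyc_eq: "ncyc (s o restr prod.swap (arcs_of E)) (arcs_of E) = ncyc (k o restr ?r B) B"
  proof -
    have "orbit (s o restr prod.swap (arcs_of E)) (h d) = h ` orbit (k o restr ?r B) d" if "d : B" for d
    proof (rule conj[OF _ _ that])
      fix d assume d: "d : B"
      show "(k o restr ?r B) d : B" using kB[OF Bcl[OF d]] d by (simp add: restr_def)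
      have "(s o restr prod.swap (arcs_of E)) (h d) = s (h (?r d))" using hB[OF d] by (simp only: comp_apply restr_def if_True hr)
      also have "\<dots> = h (k (?r d))" by (rule sh[OF Bcl[OF d]])
      finally show "(s o restr prod.swap (arcs_of E)) (h d) = h ((k o restr ?r B) d)" using d by (simp add: restr_def)
    qed
    then have eq: "orbit (s o restr prod.swap (arcs_of E)) ` arcs_of E = (`) h ` orbit (k o restr ?r B) ` B"
      unfolding h_img[symmetric] image_image by (rule image_cong[OF refl])
    have "inj_on ((`) h) (orbit (k o restr ?r B) ` B)"
    proof (rule inj_on_subset[OF inj_on_image_Pow[OF h_inj]])
      have "(k o restr ?r B) permutes B"
        by (intro permutes_compose[OF _ k(1)] restr_permutes) (erule Bcl | rule rr order_refl)+
      from orbit_subset_dom[OF this] show "orbit (k o restr ?r B) ` B \<subseteq> Pow B" by (intro image_subsetI PowI)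
    qed
    then show ?thesis unfolding ncyc_def eq by (rule card_image)
  qed
  have cardB: "card B = 2 * card E"
  proof -
    have finE: "finite E" by (rule E)
    have "inj_on c E" by (rule inj_on_inverseI[of _ "%d. {l d, l (?r d)}"]) (use c in blast)
    moreover have "inj_on ?r (c ` E)" by (rule inj_on_inverseI[of _ ?r]) (rule rr)
    moreover have "c ` E Int ?r ` c ` E = {}"
    proof (rule ccontr)
      assume "c ` E Int ?r ` c ` E ~= {}"
      then obtain e e' where e: "e : E" "e' : E" "c e = ?r (c e')" by blast
      have "{l (c e), l (?r (c e))} = {l (c e'), l (?r (c e'))}" unfolding e(3) rr by (rule insert_commute)
      then have "e = e'" using c[OF e(1)] c[OF e(2)] by simp
      then show False using e(3) opp_neq c[OF e(1)] by metis
    qed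
    ultimately show ?thesis
      unfolding B_def using finE by (simp add: card_Un_disjoint card_image)
  qed
  have "int (card ?D) + 4 - 4 * int g <= 2 * int (ncyc ?s ?D) + 2 * int (ncyc (turn ?W) ?D)"
    by (rule voxels_euler) (use N in simp)
  then have "int (card E) + 2 - int (card V) - 2 * int g <= int (ncyc (k o restr ?r B) B)"
    using cnt unfolding rot_opp cardB labs by linarith
  then show ?thesis unfolding has_rotation_def using sp orb ncyc_eq by (intro exI[of _ s]) (simp only:, blast)
qed


text \<open>Every arc is cut into thirds. \<open>X v\<close> is the point of \<open>v\<close> with
  the outer thirds ending there, \<open>M e\<close> the middle third of \<open>e\<close>. These are
  compact and connected and meet only when incident, so a mesh finer than their distances keeps the
  corners near them disjoint in the same cases.\<close>

theorem embedding_rotation: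
  fixes V :: "'v set"
  assumes E: "finite E" "!!e. e : E ==> card e = 2" "\<Union>E = V" and V: "V ~= {}"
    and emb: "graph_embeds_in V E (handle_surface g)"
  shows "has_rotation V E g"
proof -
  let ?S = "handle_surface g"
  obtain f \<gamma> where f: "inj_on f V" "f ` V \<subseteq> ?S"
    and \<gamma>: "!!e. e : E ==> arc (\<gamma> e) & path_image (\<gamma> e) \<subseteq> ?S & {pathstart (\<gamma> e), pathfinish (\<gamma> e)} = f ` e &
               path_image (\<gamma> e) Int f ` V = f ` e"
    and dis: "!!e e'. e : E ==> e' : E ==> e ~= e' ==> path_image (\<gamma> e) Int path_image (\<gamma> e') = f ` (e Int e')"
    using emb unfolding graph_embeds_in_def by metis
  have finV: "finite V"
    using E by (metis card.infinite finite_Union zero_neq_numeral)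
  have path: "path (\<gamma> e)" and inj: "inj_on (\<gamma> e) {0..1}" if "e : E" for e
    using \<gamma>[OF that] by (auto simp: arc_def)
  have sub: "e \<subseteq> V" if "e : E" for e using that E(3) by blast
  have inner: "\<gamma> e t ~: f ` V" if "e : E" "0 < t" "t < 1" for e t
  proof
    assume "\<gamma> e t : f ` V"
    moreover have "\<gamma> e t : path_image (\<gamma> e)" using that by (simp add: path_image_def)
    ultimately have "\<gamma> e t : {\<gamma> e 0, \<gamma> e 1}" using \<gamma>[OF that(1)] unfolding pathstart_def pathfinish_def by blast
    then show False using inj_onD[OF inj[OF that(1)], of t 0] inj_onD[OF inj[OF that(1)], of t 1] that by auto
  qed
  \<comment> \<open>Used for \<open>v\<close> in \<open>e\<close> only, where \<open>f v\<close> is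
    one end of the arc; the second branch is then the case that the arc ends at
    \<open>f v\<close>.\<close>
  define T :: "'v set => 'v => real set" where "T e v = (if \<gamma> e 0 = f v then {0..1/3} else {2/3..1})" for e v
  define piece where "piece e v = \<gamma> e ` T e v" for e v
  define X where "X v = insert (f v) (\<Union>e\<in>{e:E. v : e}. piece e v)" for v
  define M where "M e = \<gamma> e ` {1/3..2/3}" for e
  have T01: "T e v \<subseteq> {0..1}" for e v by (auto simp: T_def)
  have end_v: "\<gamma> e 0 = f v | \<gamma> e 1 = f v" if "e : E" "v : e" for e v
  proof -
    have "{\<gamma> e 0, \<gamma> e 1} = f ` e" using \<gamma>[OF that(1)] unfolding pathstart_def pathfinish_def by blast
    moreover have "f v : f ` e" using that(2) by (rule imageI)
    ultimately have "f v : {\<gamma> e 0, \<gamma> e 1}" by (simp only:)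
    then show ?thesis by auto
  qed
  have f_piece: "f v : piece e v" if "e : E" "v : e" for e v
  proof (cases "\<gamma> e 0 = f v")
    case True
    then show ?thesis unfolding piece_def T_def by (intro image_eqI[of _ _ 0]) auto
  next
    case False
    then show ?thesis using end_v[OF that] unfolding piece_def T_def by (intro image_eqI[of _ _ 1]) auto
  qed
  have piece_f: "p = f v" if pe: "e : E" "v : e" "p : piece e v" "p : f ` V" for e v p
  proof -
    obtain t where t: "t : T e v" "p = \<gamma> e t" using pe(3) unfolding piece_def by blast
    have "0 <= t" "t <= 1" using t(1) T01[of e v] by auto
    moreover have "~(0 < t & t < 1)" using inner[OF pe(1), of t] pe(4) unfolding t(2) by blast
    ultimately have "t = 0 | t = 1" by linarith
    then show ?thesis using t end_v[OF pe(1,2)] by (auto simp: T_def split: if_splits)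
  qed
  have piece_sub: "piece e v \<subseteq> path_image (\<gamma> e)" for e v
    using T01 unfolding piece_def path_image_def by blast
  have M_sub: "M e \<subseteq> path_image (\<gamma> e)" for e
    unfolding M_def path_image_def by (rule image_mono) auto
  have M_f: "p ~: f ` V" if eM: "e : E" "p : M e" for e p
  proof -
    obtain t where "1/3 <= t" "t <= 2/3" "p = \<gamma> e t" using eM(2) unfolding M_def by auto
    then show ?thesis using inner[OF eM(1), of t] by simp
  qed
  have common: "p : f ` V" if "e : E" "e' : E" "e ~= e'" "p : path_image (\<gamma> e)" "p : path_image (\<gamma> e')" for e e' p
    using dis[OF that(1-3)] that(4,5) sub[OF that(1)] by blast
  have cont: "continuous_on A (\<gamma> e)" if "e : E" "A \<subseteq> {0..1}" for e A
    using path[OF that(1)] continuous_on_subset that(2) unfolding path_def by blast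
  have compX: "compact (X v)" for v
  proof -
    have "compact (piece e v)" if "e : E" for e
      unfolding piece_def by (rule compact_continuous_image[OF cont[OF that T01]]) (simp add: T_def)
    then have "compact (\<Union>e\<in>{e:E. v : e}. piece e v)" using E(1) by (intro compact_UN) auto
    then show ?thesis unfolding X_def by (rule compact_insert)
  qed
  have compM: "compact (M e)" if "e : E" for e
    unfolding M_def by (rule compact_continuous_image[OF cont[OF that]]) auto
  have conX: "connected (X v)" for v
  proof -
    have "connected (piece e v)" if "e : E" for e
      unfolding piece_def by (rule connected_continuous_image[OF cont[OF that T01]]) (simp add: T_def)
    then have "connected (\<Union> (insert {f v} ((%e. piece e v) ` {e:E. v : e})))"
      using f_piece by (intro connected_Union) auto
    moreover have "X v = \<Union> (insert {f v} ((%e. piece e v) ` {e:E. v : e}))" unfolding X_def by blast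
    ultimately show ?thesis by simp
  qed
  have conM: "connected (M e)" if "e : E" for e
    unfolding M_def by (rule connected_continuous_image[OF cont[OF that]]) auto
  have XS: "X v \<subseteq> ?S" if "v : V" for v
    unfolding X_def using f(2) that piece_sub \<gamma> by blast
  have MS: "M e \<subseteq> ?S" if "e : E" for e using M_sub \<gamma>[OF that] by blast
  have XX: "X u Int X v = {}" if uv: "u : V" "v : V" "u ~= v" for u v
  proof (rule ccontr)
    assume "X u Int X v ~= {}"
    then obtain p where p: "p : X u" "p : X v" by blast
    have fX: "p = f w" if "p : X w" "p : f ` V" for w
      using that piece_f unfolding X_def by blast
    show False
    proof (cases "p : f ` V")
      case True
      then have "f u = f v" using fX[of u] fX[of v] p by simp
      then show False using inj_onD[OF f(1)] uv by blast
    next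
      case False
      then obtain e e' where e: "e : E" "u : e" "p : piece e u" "e' : E" "v : e'" "p : piece e' v"
        using p uv unfolding X_def by blast
      have "e = e'" using common[OF e(1,4)] False e(3,6) piece_sub by blast
      then have ev: "v : e" "p : piece e v" using e by simp_all
      obtain t t' where t: "t : T e u" "t' : T e v" "p = \<gamma> e t" "p = \<gamma> e t'"
        using e(3) ev(2) unfolding piece_def by blast
      have "t : {0..1}" "t' : {0..1}" using t(1,2) T01 by blast+
      then have "t = t'" using inj_onD[OF inj[OF e(1)], of t t'] t(3,4) by simp
      moreover have "~(\<gamma> e 0 = f u & \<gamma> e 0 = f v)" "~(\<gamma> e 1 = f u & \<gamma> e 1 = f v)"
        using inj_onD[OF f(1)] uv by auto
      ultimately show False
        using t(1,2) end_v[OF e(1,2)] end_v[OF e(1) ev(1)] by (auto simp: T_def split: if_splits)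
    qed
  qed
  have MX: "M e Int X v = {}" if "e : E" "v : V" "v ~: e" for e v
  proof (rule ccontr)
    assume "M e Int X v ~= {}"
    then obtain p where p: "p : M e" "p : X v" by blast
    then have "p ~= f v" using M_f[OF that(1)] that(2) by blast
    then obtain e' where e': "e' : E" "v : e'" "p : piece e' v" using p(2) unfolding X_def by blast
    then have "e ~= e'" using that(3) by blast
    then have "p : f ` V" using common[OF that(1) e'(1)] p(1) e'(3) M_sub piece_sub by blast
    then show False using M_f[OF that(1) p(1)] by blast
  qed
  have MM: "M e Int M e' = {}" if "e : E" "e' : E" "e ~= e'" for e e'
    using common[OF that] M_sub M_f that(1) by blast
  have MXe: "EX p. p : M e & p : X v" if "e : E" "v : e" for e v
  proof -
    have "\<gamma> e (if \<gamma> e 0 = f v then 1/3 else 2/3) : M e" unfolding M_def by (rule imageI) auto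
    moreover have "\<gamma> e (if \<gamma> e 0 = f v then 1/3 else 2/3) : piece e v"
      unfolding piece_def by (rule imageI) (auto simp: T_def)
    ultimately show ?thesis using that unfolding X_def by blast
  qed
  define K where "K = X ` V Un M ` E"
  have "finite K" "!!Y. Y : K ==> compact Y" using finV E(1) compX compM unfolding K_def by auto
  from finite_separation[OF this] obtain \<delta> where \<delta>: "\<delta> > 0"
    "ALL Y:K. ALL Z:K. Y Int Z = {} --> (ALL x:Y. ALL y:Z. \<delta> <= dist x y)" by blast
  \<comment> \<open>The constant 6 is that of \<open>near_pts_dist\<close>.\<close>
  obtain N :: nat where "6 / \<delta> < N" using reals_Archimedean2 by blast
  then have N: "N > 0" "6 / N < \<delta>"
  proof -
    have "0 < real N" using \<open>6 / \<delta> < N\<close> \<delta>(1) by (meson divide_pos_pos less_trans zero_less_numeral)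
    then show "N > 0" by simp
    show "6 / N < \<delta>" using \<open>6 / \<delta> < N\<close> \<open>0 < real N\<close> \<delta>(1) by (simp add: field_simps)
  qed
  let ?L = "near_pts g N"
  have Ldis: "?L Y Int ?L Z = {}" if "Y : K" "Z : K" "Y Int Z = {}" for Y Z
  proof (rule ccontr)
    assume "?L Y Int ?L Z ~= {}"
    then obtain x y where "x : Y" "y : Z" "dist x y <= 6 / N" using near_pts_dist[OF N(1)] by blast
    then show False using \<delta>(2) that N(2) by force
  qed
  have "EX lab. (ALL p:start ` darts (voxels g (int N)). lab p : V) &
     (ALL v:V. conn (adj g N) {p:start ` darts (voxels g (int N)). lab p = v}) &
     (ALL e:E. EX p:start ` darts (voxels g (int N)). EX q:start ` darts (voxels g (int N)). adj g N p q & {lab p, lab q} = e)"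
  proof (rule branch_labels[where LX = "%v. ?L (X v)" and LM = "%e. ?L (M e)"])
    show "finite (start ` darts (voxels g (int N)))" using finite_darts[OF finite_voxels] by blast
    show "conn (adj g N) (start ` darts (voxels g (int N)))" by (rule conn_all[OF N(1)])
    show "adj g N q p" if "adj g N p q" for p q by (rule adj_sym[OF N(1) that])
    show "?L (X v) \<subseteq> start ` darts (voxels g (int N)) & ?L (X v) ~= {} & conn (adj g N) (?L (X v))" if "v : V" for v
    proof (intro conjI)
      show "?L (X v) \<subseteq> start ` darts (voxels g (int N))" by (rule near_pts_subset[OF N(1)])
      show "conn (adj g N) (?L (X v))" by (rule conn_near_pts[OF N(1) conX XS[OF that]])
      have "f v : X v" "f v : ?S" using f(2) that unfolding X_def by auto
      then show "?L (X v) ~= {}" using near_pts_meet[OF N(1), of "f v" "X v" "X v"] by blast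
    qed
    show "?L (X v) Int ?L (X w) = {}" if "v : V" "w : V" "v ~= w" for v w
      by (rule Ldis) (use that XX in \<open>auto simp: K_def\<close>)
    show "?L (M e) \<subseteq> start ` darts (voxels g (int N)) & conn (adj g N) (?L (M e))" if "e : E" for e
      using near_pts_subset[OF N(1)] conn_near_pts[OF N(1) conM[OF that] MS[OF that]] by blast
    show "?L (M e) Int ?L (X v) ~= {}" if ev: "e : E" "v : e" for e v
    proof -
      obtain p where "p : M e" "p : X v" using MXe[OF ev] by blast
      then show ?thesis using near_pts_meet[OF N(1)] MS[OF ev(1)] by blast
    qed
    show "?L (M e) Int ?L (X v) = {}" if "e : E" "v : V" "v ~: e" for e v
      by (rule Ldis) (use that MX in \<open>auto simp: K_def\<close>)
    show "?L (M e) Int ?L (M e') = {}" if "e : E" "e' : E" "e ~= e'" for e e'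
      by (rule Ldis) (use that MM in \<open>auto simp: K_def\<close>)
  qed (use E V in auto)
  then obtain lab where lab: "(ALL p:start ` darts (voxels g (int N)). lab p : V) &
     (ALL v:V. conn (adj g N) {p:start ` darts (voxels g (int N)). lab p = v}) &
     (ALL e:E. EX p:start ` darts (voxels g (int N)). EX q:start ` darts (voxels g (int N)). adj g N p q & {lab p, lab q} = e)"
    by (elim exE) (rule that)
  show ?thesis
    by (rule rotation_of_labels[OF E N(1), where lab = lab]) (use lab in blast)+
qed

section \<open>Rotation systems\<close>

definition rotation :: "'v set set => ('v \<times> 'v => 'v \<times> 'v) => bool" where
  "rotation E s \<longleftrightarrow> s permutes arcs_of E & (ALL a:arcs_of E. orbit s a = {b : arcs_of E. fst b = fst a})"

text \<open>Face tracing: after traversing \<open>(u, v)\<close>, the walk reverses the arc and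
  takes the next one in the rotation at \<open>v\<close>.\<close>

definition face_perm :: "'v set set => ('v \<times> 'v => 'v \<times> 'v) => 'v \<times> 'v => 'v \<times> 'v" where
  "face_perm E s = s o restr prod.swap (arcs_of E)"

definition faces :: "'v set set => ('v \<times> 'v => 'v \<times> 'v) => ('v \<times> 'v) set set" where
  "faces E s = orbit (face_perm E s) ` arcs_of E"

lemma has_rotationE:
  assumes "has_rotation V E g"
  obtains s where "rotation E s" "int (card E) + 2 - int (card V) - 2 * int g <= int (card (faces E s))"
  using assms unfolding has_rotation_def rotation_def faces_def face_perm_def ncyc_def by blast

lemma arcs_of_Un: "arcs_of (E Un E') = arcs_of E Un arcs_of E'"
  by (auto simp: arcs_of_def)

lemma arcs_of_mono: "E \<subseteq> E' ==> arcs_of E \<subseteq> arcs_of E'"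
  by (auto simp: arcs_of_def)

definition simple_edges :: "'v set set => bool" where
  "simple_edges E \<longleftrightarrow> finite E & (ALL e:E. card e = 2)"

lemma finite_arcs:
  assumes "simple_edges E"
  shows "finite (arcs_of E)" "card (arcs_of E) = 2 * card E"
proof -
  have eq: "arcs_of E = (\<Union>e\<in>E. {(u, v). {u, v} = e & u ~= v})" by (auto simp: arcs_of_def)
  have two: "finite {(u, v). {u, v} = e & u ~= v} & card {(u, v). {u, v} = e & u ~= v} = 2" if "e : E" for e
  proof -
    obtain x y where xy: "e = {x, y}" "x ~= y" using assms \<open>e : E\<close> unfolding simple_edges_def by (meson card_2_iff)
    then have "{(u, v). {u, v} = e & u ~= v} = {(x, y), (y, x)}" by (auto simp: doubleton_eq_iff)
    then show ?thesis using xy(2) by simp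
  qed
  show "finite (arcs_of E)" unfolding eq using assms two unfolding simple_edges_def by blast
  have "card (arcs_of E) = (\<Sum>e\<in>E. card {(u, v). {u, v} = e & u ~= v})"
    unfolding eq by (rule card_UN_disjoint) (use assms two in \<open>auto simp: simple_edges_def\<close>)
  then show "card (arcs_of E) = 2 * card E" using two by simp
qed

lemma sum_card_orbits:
  assumes "f permutes A" "finite A" "B \<subseteq> A"
  shows "(\<Sum>F\<in>orbit f ` A. card (F Int B)) = card B"
proof -
  have "card (\<Union>F\<in>orbit f ` A. F Int B) = (\<Sum>F\<in>orbit f ` A. card (F Int B))"
  proof (rule card_UN_disjoint)
    show "finite (orbit f ` A)" using assms(2) by simp
    show "ALL F:orbit f ` A. finite (F Int B)" using assms(2,3) finite_subset by blast
    show "ALL F:orbit f ` A. ALL F':orbit f ` A. F ~= F' --> F Int B Int (F' Int B) = {}"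
    proof (intro ballI impI, rule ccontr)
      fix F F' assume F: "F : orbit f ` A" "F' : orbit f ` A" "F ~= F'" "F Int B Int (F' Int B) ~= {}"
      then obtain x y z where "F = orbit f x" "F' = orbit f y" "z : orbit f x" "z : orbit f y" by blast
      then show False using F(3) orbit_eqI'[OF assms(1,2)] by metis
    qed
  qed
  moreover have "(\<Union>F\<in>orbit f ` A. F Int B) = B"
    using self_in_orbit[OF assms(1,2)] assms(3) by blast
  ultimately show ?thesis by simp
qed

lemma face_perm_permutes: "rotation E s ==> face_perm E s permutes arcs_of E"
  unfolding rotation_def face_perm_def
  by (intro permutes_compose restr_permutes) (auto intro: swap_arcs)

lemma face_perm_arc: "rotation E s ==> a : arcs_of E ==> face_perm E s a : arcs_of E"
  using face_perm_permutes permutes_in_image by metis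

lemma face_perm_swap: "a : arcs_of E ==> face_perm E s a = s (prod.swap a)"
  by (simp add: face_perm_def restr_def)

lemma rotation_fst:
  assumes "rotation E s" "a : arcs_of E"
  shows "fst (s a) = fst a"
  using assms orbit.base[of s a] unfolding rotation_def by blast

lemma rotation_neq:
  assumes "rotation E s" "a : arcs_of E" "b : arcs_of E" "fst b = fst a" "b ~= a"
  shows "s a ~= a"
proof
  assume "s a = a"
  then have "orbit s a \<subseteq> {a}" by (intro orbit_subset_closed) auto
  moreover have "b : orbit s a" using assms unfolding rotation_def by blast
  ultimately show False using assms(5) by blast
qed

lemma face_perm_fst:
  assumes "rotation E s" "a : arcs_of E"
  shows "fst (face_perm E s a) = snd a"
  using rotation_fst[OF assms(1) swap_arcs[OF assms(2)]] face_perm_swap[OF assms(2)] by simp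

text \<open>No edge ends in a vertex of degree one. In a simple graph this rules out faces with
  fewer than three arcs.\<close>

definition min_degree2 :: "'v set set => bool" where
  "min_degree2 E \<longleftrightarrow> (ALL a:arcs_of E. EX b:arcs_of E. fst b = snd a & snd b ~= fst a)"

lemma face_no_return:
  assumes "rotation E s" "min_degree2 E" "a : arcs_of E"
  shows "snd (face_perm E s a) ~= fst a"
proof
  assume e: "snd (face_perm E s a) = fst a"
  obtain b where b: "b : arcs_of E" "fst b = snd a" "snd b ~= fst a"
    using assms(2,3) unfolding min_degree2_def by blast
  have "face_perm E s a = prod.swap a" using e face_perm_fst[OF assms(1,3)] by (simp add: prod_eq_iff)
  then have "s (prod.swap a) = prod.swap a" using face_perm_swap[OF assms(3)] by metis
  moreover have "s (prod.swap a) ~= prod.swap a"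
    by (rule rotation_neq[OF assms(1) swap_arcs[OF assms(3)] b(1)]) (use b in auto)
  ultimately show False by blast
qed

text \<open>The three arcs start at the ends of an edge and at a third vertex, since a face walk
  turns back only at a vertex of degree one.\<close>

lemma face_three:
  assumes "rotation E s" "min_degree2 E" "a : arcs_of E"
  defines "p \<equiv> face_perm E s"
  shows "card {a, p a, p (p a)} = 3"
proof -
  have arcs: "p a : arcs_of E" "p (p a) : arcs_of E" using face_perm_arc[OF assms(1)] assms(3) unfolding p_def by blast+
  have f: "fst (p a) = snd a" "fst (p (p a)) = snd (p a)"
    using face_perm_fst[OF assms(1)] assms(3) arcs unfolding p_def by blast+
  have "fst a ~= snd a" "fst (p a) ~= snd (p a)" using assms(3) arcs by (auto simp: arcs_of_def)
  moreover have "snd (p a) ~= fst a" unfolding p_def by (rule face_no_return[OF assms(1-3)])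
  ultimately have "fst a ~= fst (p a)" "fst a ~= fst (p (p a))" "fst (p a) ~= fst (p (p a))" using f by auto
  then show ?thesis by (auto simp: card_insert_if)
qed

lemma face_card_ge3:
  assumes "rotation E s" "min_degree2 E" "finite (arcs_of E)" "F : faces E s"
  shows "3 <= card F"
proof -
  let ?p = "face_perm E s"
  note perm = face_perm_permutes[OF assms(1)]
  obtain a where a: "a : arcs_of E" "F = orbit ?p a" using assms(4) unfolding faces_def by blast
  have "a : F" unfolding a by (rule self_in_orbit[OF perm assms(3)])
  then have "{a, ?p a, ?p (?p a)} \<subseteq> F" unfolding a by (auto intro: orbit.intros)
  moreover have "finite F" unfolding a using finite_subset[OF orbit_subset_dom[OF perm a(1)] assms(3)] .
  ultimately have "card {a, ?p a, ?p (?p a)} <= card F" by (rule card_mono[rotated])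
  then show ?thesis using face_three[OF assms(1,2) a(1)] by simp
qed

lemma faces_le:
  assumes "rotation E s" "min_degree2 E" "simple_edges E"
  shows "(\<Sum>F\<in>faces E s. card F) = 2 * card E" "3 * card (faces E s) <= 2 * card E"
proof -
  note fin = finite_arcs[OF assms(3)]
  have "F Int arcs_of E = F" if "F : faces E s" for F
    using that orbit_subset_dom[OF face_perm_permutes[OF assms(1)]] unfolding faces_def by blast
  then have "(\<Sum>F\<in>faces E s. card F) = (\<Sum>F\<in>faces E s. card (F Int arcs_of E))" by simp
  also have "\<dots> = card (arcs_of E)"
    unfolding faces_def by (rule sum_card_orbits[OF face_perm_permutes[OF assms(1)] fin(1)]) (rule order_refl)
  finally show sum: "(\<Sum>F\<in>faces E s. card F) = 2 * card E" using fin(2) by simp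
  have "(\<Sum>F\<in>faces E s. 3) <= (\<Sum>F\<in>faces E s. card F)"
    by (rule sum_mono) (rule face_card_ge3[OF assms(1,2) fin(1)])
  then show "3 * card (faces E s) <= 2 * card E" unfolding sum by simp
qed

section \<open>Edge bounds for embedded graphs\<close>

lemma embeds_mono:
  assumes "graph_embeds_in V E S" "inj_on h V'" "h ` V' \<subseteq> V" "!!e. e : E' ==> e \<subseteq> V' & h ` e : E"
  shows "graph_embeds_in V' E' S"
proof -
  obtain f \<gamma> where f: "inj_on f V" "f ` V \<subseteq> S"
    and g: "!!e. e : E ==> arc (\<gamma> e) & path_image (\<gamma> e) \<subseteq> S & {pathstart (\<gamma> e), pathfinish (\<gamma> e)} = f ` e &
               path_image (\<gamma> e) Int f ` V = f ` e"
    and dis: "!!e e'. e : E ==> e' : E ==> e ~= e' ==> path_image (\<gamma> e) Int path_image (\<gamma> e') = f ` (e Int e')"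
    using assms(1) unfolding graph_embeds_in_def by metis
  show ?thesis
    unfolding graph_embeds_in_def
  proof (intro exI[of _ "f o h"] exI[of _ "%e. \<gamma> (h ` e)"] conjI ballI impI)
    show "inj_on (f o h) V'" using assms(2,3) f(1) by (simp add: comp_inj_on inj_on_subset)
    show "(f o h) ` V' \<subseteq> S" using assms(3) f(2) by auto
  next
    fix e assume e: "e : E'"
    note ge = g[OF conjunct2[OF assms(4)[OF e]]]
    show "arc (\<gamma> (h ` e))" "path_image (\<gamma> (h ` e)) \<subseteq> S" using ge by blast+
    show "{pathstart (\<gamma> (h ` e)), pathfinish (\<gamma> (h ` e))} = (f o h) ` e" using ge by (simp add: image_comp)
    have "f ` h ` e \<subseteq> f ` h ` V'" using assms(4)[OF e] by blast
    moreover have "f ` h ` V' \<subseteq> f ` V" using assms(3) by blast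
    moreover have "path_image (\<gamma> (h ` e)) Int f ` V = f ` h ` e" using ge by blast
    moreover have "P Int B = A" if "P Int C = A" "A \<subseteq> B" "B \<subseteq> C" for P A B C :: "'b set" using that by blast
    ultimately show "path_image (\<gamma> (h ` e)) Int (f o h) ` V' = (f o h) ` e"
      unfolding image_comp[symmetric] by blast
  next
    fix e e' assume e: "e : E'" "e' : E'" "e ~= e'"
    have sub: "e \<subseteq> V'" "e' \<subseteq> V'" "h ` e : E" "h ` e' : E" using assms(4)[OF e(1)] assms(4)[OF e(2)] by blast+
    have "h ` e ~= h ` e'" using inj_on_image_eq_iff[OF assms(2) sub(1,2)] e(3) by blast
    then have "path_image (\<gamma> (h ` e)) Int path_image (\<gamma> (h ` e')) = f ` (h ` e Int h ` e')" using dis sub by blast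
    also have "h ` e Int h ` e' = h ` (e Int e')" using inj_on_image_Int[OF assms(2) sub(1,2)] by simp
    finally show "path_image (\<gamma> (h ` e)) Int path_image (\<gamma> (h ` e')) = (f o h) ` (e Int e')" by (simp add: image_comp)
  qed
qed

lemma embeds_subgraph:
  assumes "graph_embeds_in V E S" "V' \<subseteq> V" "E' \<subseteq> E" "!!e. e : E' ==> e \<subseteq> V'"
  shows "graph_embeds_in V' E' S"
  by (rule embeds_mono[OF assms(1), of id]) (use assms in auto)

text \<open>The vertex set is first cut down to the ends of \<open>E'\<close>, as
  \<open>embedding_rotation\<close> admits no isolated vertices.\<close>

lemma euler_bound:
  assumes "graph_embeds_in V E (handle_surface g)" "E' \<subseteq> E" "\<Union>E' \<subseteq> V"
    and "simple_edges E'" "E' ~= {}"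
  obtains s where "rotation E' s" "int (card E') + 2 - int (card (\<Union>E')) - 2 * int g <= int (card (faces E' s))"
proof -
  have "\<Union>E' ~= {}" using assms(4,5) unfolding simple_edges_def by fastforce
  moreover have "graph_embeds_in (\<Union>E') E' (handle_surface g)"
    by (rule embeds_subgraph[OF assms(1,3,2)]) blast
  ultimately have "has_rotation (\<Union>E') E' g"
    using assms(4) unfolding simple_edges_def by (intro embedding_rotation) simp_all
  then show ?thesis using that by (rule has_rotationE)
qed

text \<open>Euler's inequality combined with \<open>3 F <= 2 E\<close>.\<close>

lemma euler_edges:
  assumes "graph_embeds_in V E (handle_surface g)" "E' \<subseteq> E" "\<Union>E' \<subseteq> V"
    and "simple_edges E'" "E' ~= {}" "min_degree2 E'"
  shows "card E' + 6 <= 3 * card (\<Union>E') + 6 * g"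
proof -
  obtain s where s: "rotation E' s" "int (card E') + 2 - int (card (\<Union>E')) - 2 * int g <= int (card (faces E' s))"
    using euler_bound[OF assms(1-5)] .
  have "3 * card (faces E' s) <= 2 * card E'" by (rule faces_le[OF s(1) assms(6,4)])
  then show ?thesis using s(2) by linarith
qed

definition clique :: "'v set => 'v set set" where
  "clique C = {e. e \<subseteq> C & card e = 2}"

lemma clique_arcs: "arcs_of (clique C) = {(u, v). u : C & v : C & u ~= v}"
  by (auto simp: arcs_of_def clique_def)

lemma finite_clique: "finite C ==> finite (clique C)"
  by (simp add: clique_def)

lemma simple_edges_clique: "finite C ==> simple_edges (clique C)"
  by (simp add: simple_edges_def clique_def)

lemma simple_edges_Un: "simple_edges E ==> simple_edges E' ==> simple_edges (E Un E')"
  by (auto simp: simple_edges_def)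

lemma card_clique: "finite C ==> card (clique C) = card C choose 2"
  unfolding clique_def by (rule n_subsets)

lemma Union_clique: "2 <= card C ==> \<Union>(clique C) = C"
proof (intro equalityI subsetI)
  fix x assume C: "2 <= card C" "x : C"
  then have "~ C \<subseteq> {x}" by (metis card_mono finite.emptyI finite_insert card.empty card_insert_disjoint empty_iff not_less_eq_eq numeral_2_eq_2)
  then obtain y where "y : C" "y ~= x" by blast
  then have "{x, y} : clique C" using C by (auto simp: clique_def)
  then show "x : \<Union>(clique C)" by blast
qed (auto simp: clique_def)

lemma min_degree2_clique: "3 <= card C ==> min_degree2 (clique C)"
  unfolding min_degree2_def
proof
  fix a assume C: "3 <= card C" "a : arcs_of (clique C)"
  have "card {fst a, snd a} <= 2" by (simp add: card_insert_if)
  then have "~ C \<subseteq> {fst a, snd a}" using C(1) card_mono[of "{fst a, snd a}" C] by auto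
  then obtain w where "w : C" "w ~= fst a" "w ~= snd a" by blast
  then show "EX b:arcs_of (clique C). fst b = snd a & snd b ~= fst a"
    using C(2) unfolding clique_arcs by (intro bexI[of _ "(snd a, w)"]) auto
qed

lemma min_degree2_Un: "min_degree2 E ==> min_degree2 E' ==> min_degree2 (E Un E')"
  unfolding min_degree2_def arcs_of_Un by blast

lemma clique_embed_bound:
  assumes "graph_embeds_in V E (handle_surface g)" "clique C \<subseteq> E" "C \<subseteq> V" "finite C" "3 <= card C"
  shows "(card C choose 2) + 6 <= 3 * card C + 6 * g"
proof -
  note U = Union_clique[of C]
  have "card (clique C) + 6 <= 3 * card (\<Union>(clique C)) + 6 * g"
  proof (rule euler_edges[OF assms(1,2)])
    show "clique C ~= {}" using U assms(5) by auto
    show "\<Union> (clique C) \<subseteq> V" using U assms(3,5) by simp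
  qed (use assms simple_edges_clique min_degree2_clique in auto)
  then show ?thesis using U assms(4,5) by (simp add: card_clique)
qed

lemma two_cliques_embed_bound:
  assumes "graph_embeds_in V E (handle_surface g)" "clique C \<subseteq> E" "clique C' \<subseteq> E" "C \<subseteq> V" "C' \<subseteq> V"
    and "finite C" "finite C'" "3 <= card C" "3 <= card C'"
  shows "(card C choose 2) + (card C' choose 2) + 6 <= 3 * card (C Un C') + 6 * g + (card (C Int C') choose 2)"
proof -
  let ?E = "clique C Un clique C'"
  have U: "\<Union>?E = C Un C'" using Union_clique[of C] Union_clique[of C'] assms(8,9) by simp
  have "card ?E + 6 <= 3 * card (\<Union>?E) + 6 * g"
  proof (rule euler_edges[OF assms(1)])
    show "?E ~= {}" using U assms(8) by auto
    show "?E \<subseteq> E" "\<Union>?E \<subseteq> V" using U assms by auto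
    show "simple_edges ?E" by (intro simple_edges_Un simple_edges_clique assms)
    show "min_degree2 ?E" by (intro min_degree2_Un min_degree2_clique assms)
  qed
  moreover have "card ?E + card (clique C Int clique C') = card (clique C) + card (clique C')"
    using card_Un_Int[OF finite_clique finite_clique] assms(6,7) by metis
  moreover have "clique C Int clique C' = clique (C Int C')" by (auto simp: clique_def)
  ultimately show ?thesis using U assms(6,7) by (simp add: card_clique)
qed

section \<open>One-point unions of cliques\<close>

lemma rotation_ncyc:
  assumes "rotation E s"
  shows "card (orbit s ` arcs_of E) = card (fst ` arcs_of E)"
proof -
  have "orbit s ` arcs_of E = (%v. {b : arcs_of E. fst b = v}) ` fst ` arcs_of E"
    unfolding image_image using assms unfolding rotation_def by (intro image_cong) auto
  moreover have "inj_on (%v. {b : arcs_of E. fst b = v}) (fst ` arcs_of E)" by (auto simp: inj_on_def)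
  ultimately show ?thesis by (simp add: card_image)
qed

text \<open>The face permutation is the rotation times one transposition per edge, and the rotation
  has one cycle per vertex.\<close>

lemma faces_parity:
  assumes "rotation E s" "simple_edges E"
  shows "even (card (faces E s) + card (fst ` arcs_of E) + card E)"
proof -
  note fin = finite_arcs[OF assms(2)]
  have neq: "!!x. x : arcs_of E ==> prod.swap x ~= x" by (auto simp: arcs_of_def)
  have "s permutes arcs_of E" using assms(1) by (simp add: rotation_def)
  then have "even (card (arcs_of E)) & 2 * ncyc s (arcs_of E) <= 2 * ncyc (s o restr prod.swap (arcs_of E)) (arcs_of E) + card (arcs_of E)
    & (even (ncyc s (arcs_of E) + card (arcs_of E) div 2) \<longleftrightarrow> even (ncyc (s o restr prod.swap (arcs_of E)) (arcs_of E)))"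
    by (rule ncyc_restr[OF _ fin(1) subset_refl]) (simp_all add: swap_arcs neq)
  then have "even (ncyc s (arcs_of E) + card E) \<longleftrightarrow> even (card (faces E s))"
    unfolding fin(2) by (simp add: ncyc_def faces_def face_perm_def)
  then show ?thesis
    using rotation_ncyc[OF assms(1)] unfolding ncyc_def even_add by argo
qed

text \<open>Deleted arcs are skipped by \<open>first_return\<close>, which leaves a face alone if
  all its arcs survive.\<close>

lemma rotation_restrict:
  assumes "rotation E s" "simple_edges E" "E' \<subseteq> E"
  obtains g where "rotation E' g" "!!F. F : faces E s ==> F \<subseteq> arcs_of E' ==> F : faces E' g"
proof -
  let ?A = "arcs_of E" and ?B = "arcs_of E'"
  note fin = finite_arcs(1)[OF assms(2)]
  have sub: "?B \<subseteq> ?A" by (rule arcs_of_mono[OF assms(3)])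
  have s: "s permutes ?A" using assms(1) by (simp add: rotation_def)
  have "restr prod.swap ?B permutes ?B" by (rule restr_permutes) (auto intro: swap_arcs)
  from first_return[OF fin s this sub] obtain g where g: "g permutes ?B"
    "!!x. x : ?B ==> orbit g x = orbit s x Int ?B & orbit (g o restr prod.swap ?B) x = orbit (s o restr prod.swap ?B) x Int ?B"
    by blast
  have "rotation E' g"
    unfolding rotation_def
  proof (intro conjI ballI)
    fix a assume a: "a : ?B"
    then have "orbit s a = {b : ?A. fst b = fst a}" using assms(1) sub unfolding rotation_def by blast
    then show "orbit g a = {b : ?B. fst b = fst a}" using g(2)[OF a] sub by blast
  qed (rule g)
  moreover have "F : faces E' g" if F: "F : faces E s" "F \<subseteq> ?B" for F
  proof -
    obtain a where a: "a : ?A" "F = orbit (face_perm E s) a" using F(1) unfolding faces_def by blast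
    have perm: "face_perm E s permutes ?A" by (rule face_perm_permutes[OF assms(1)])
    have aF: "a : F" unfolding a by (rule self_in_orbit[OF perm fin])
    have "orbit (face_perm E s) a = orbit (s o restr prod.swap ?B) a"
    proof (rule orbit_cong0[of a F])
      show "face_perm E s : F \<rightarrow> F" unfolding a by (auto intro: orbit.step)
      fix y assume "y : F"
      then have "y : ?B" "y : ?A" using F(2) sub by blast+
      then show "face_perm E s y = (s o restr prod.swap ?B) y" by (simp add: face_perm_def restr_def)
    qed (rule aF)
    then have "F = orbit (face_perm E' g) a"
      using g(2)[of a] F(2) aF a(2) unfolding face_perm_def by blast
    then show ?thesis using aF F(2) unfolding faces_def by blast
  qed
  ultimately show ?thesis using that by blast
qed

lemma faces_cover:
  assumes "rotation E s" "simple_edges E"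
  shows "\<Union>(faces E s) = arcs_of E"
  using self_in_orbit[OF face_perm_permutes[OF assms(1)] finite_arcs(1)[OF assms(2)]]
    orbit_subset_dom[OF face_perm_permutes[OF assms(1)]]
  unfolding faces_def by blast

text \<open>A face of a one-point union of two cliques changes from one clique to the other only at the common
  vertex, and then needs three arcs to come back to it.\<close>

lemma block_face_ge3:
  assumes s: "rotation (clique C Un clique C') s" and C: "finite C" "finite C'" "3 <= card C" "3 <= card C'" "C Int C' = {v}"
    and F: "F : faces (clique C Un clique C') s" "F Int arcs_of (clique C) ~= {}"
  shows "3 <= card (F Int arcs_of (clique C))"
proof -
  let ?E = "clique C Un clique C'" and ?A = "arcs_of (clique C)" and ?A' = "arcs_of (clique C')"
  let ?p = "face_perm ?E s"
  have simp: "simple_edges ?E" by (intro simple_edges_Un simple_edges_clique C)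
  have md: "min_degree2 ?E" by (intro min_degree2_Un min_degree2_clique C)
  note fin = finite_arcs(1)[OF simp] and perm = face_perm_permutes[OF s]
  have arcs: "arcs_of ?E = ?A Un ?A'" by (rule arcs_of_Un)
  obtain a0 where a0: "a0 : arcs_of ?E" "F = orbit ?p a0" using F(1) unfolding faces_def by blast
  have FA: "F \<subseteq> arcs_of ?E" unfolding a0 by (rule orbit_subset_dom[OF perm a0(1)])
  have finF: "finite F" using FA fin finite_subset by blast
  have Fcl: "?p a : F" if "a : F" for a using that unfolding a0 by (rule orbit.step)
  show ?thesis
  proof (cases "F \<subseteq> ?A")
    case True
    then have "F Int ?A = F" by blast
    then show ?thesis using face_card_ge3[OF s md fin F(1)] by simp
  next
    case False
    have "EX x:F - ?A. ?p x : ?A"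
    proof (rule ccontr)
      assume n: "~ ?thesis"
      obtain x where x: "x : F - ?A" using False by blast
      have "orbit ?p x \<subseteq> F - ?A" by (rule orbit_subset_closed[OF _ x]) (use n Fcl in blast)
      moreover have "orbit ?p x = F" using orbit_eqI'[OF perm fin, of x a0] x a0 by blast
      ultimately show False using F(2) by blast
    qed
    then obtain x where x: "x : F" "x ~: ?A" "?p x : ?A" by blast
    define a where "a = ?p x"
    have xA: "x : arcs_of ?E" "x : ?A'" using x FA arcs by blast+
    have fa: "fst a = snd x" unfolding a_def by (rule face_perm_fst[OF s xA(1)])
    have cv: "y = v" if "y : C" "y : C'" for y using that C(5) by blast
    have "fst a : C" "snd x : C'" using x(3) xA(2) unfolding a_def clique_arcs by auto
    then have v: "fst a = v" using fa cv by simp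
    have aF: "a : F" "?p a : F" "?p (?p a) : F" using Fcl x(1) unfolding a_def by blast+
    have aE: "a : arcs_of ?E" "?p a : arcs_of ?E" using aF FA by blast+
    have in_A: "b : ?A" if "b : arcs_of ?E" "fst b : C" "fst b ~= v" for b
    proof (rule ccontr)
      assume "b ~: ?A"
      then have "b : ?A'" using that(1) arcs by blast
      then have "fst b : C'" unfolding clique_arcs by auto
      then show False using cv that(2,3) by blast
    qed
    have aA: "a : ?A" using x(3) by (simp add: a_def)
    have f1: "fst (?p a) = snd a" by (rule face_perm_fst[OF s aE(1)])
    have sa: "snd a : C" "snd a ~= v" using aA v unfolding clique_arcs by auto
    have pA: "?p a : ?A" by (rule in_A) (use aE f1 sa in auto)
    have f2: "fst (?p (?p a)) = snd (?p a)" by (rule face_perm_fst[OF s aE(2)])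
    have "snd (?p a) : C" using pA unfolding clique_arcs by auto
    moreover have "snd (?p a) ~= v" using face_no_return[OF s md aE(1)] v by simp
    ultimately have "?p (?p a) : ?A" using aF(3) FA f2 by (intro in_A) auto
    then have "{a, ?p a, ?p (?p a)} \<subseteq> F Int ?A" using aF aA pA by blast
    then have "card {a, ?p a, ?p (?p a)} <= card (F Int ?A)" by (rule card_mono[rotated]) (use finF in simp)
    then show ?thesis using face_three[OF s md aE(1)] by simp
  qed
qed

text \<open>\<open>P\<close> and \<open>P'\<close> are the faces within one clique and
  \<open>M\<close> the mixed ones. A mixed face uses up three arcs in each clique and so counts in
  both bounds. Without mixed faces the arcs of \<open>C\<close> would be closed under the rotation,
  although at \<open>v\<close> the arcs of both cliques form one cycle.\<close>

lemma block_faces: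
  assumes s: "rotation (clique C Un clique C') s" and C: "finite C" "finite C'" "3 <= card C" "3 <= card C'" "C Int C' = {v}"
  defines "Fs \<equiv> faces (clique C Un clique C') s"
  defines "M \<equiv> {F : Fs. ~ F \<subseteq> arcs_of (clique C) & ~ F \<subseteq> arcs_of (clique C')}"
  defines "P \<equiv> {F : Fs. F \<subseteq> arcs_of (clique C)}" and "P' \<equiv> {F : Fs. F \<subseteq> arcs_of (clique C')}"
  shows "card Fs = card P + card P' + card M" "3 * (card P + card M) <= 2 * (card C choose 2)"
    "3 * (card P' + card M) <= 2 * (card C' choose 2)" "M ~= {}"
proof -
  let ?E = "clique C Un clique C'" and ?A = "arcs_of (clique C)" and ?A' = "arcs_of (clique C')"
  let ?p = "face_perm ?E s"
  have simp: "simple_edges ?E" by (intro simple_edges_Un simple_edges_clique C)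
  note fin = finite_arcs(1)[OF simp] and perm = face_perm_permutes[OF s]
  have arcs: "arcs_of ?E = ?A Un ?A'" by (rule arcs_of_Un)
  have AA: "?A Int ?A' = {}"
  proof (rule ccontr)
    assume "?A Int ?A' ~= {}"
    then obtain x y where "x : C Int C'" "y : C Int C'" "x ~= y" unfolding clique_arcs by blast
    then show False unfolding C(5) by blast
  qed
  have Fsub: "F \<subseteq> ?A Un ?A'" "F ~= {}" if FF: "F : Fs" for F
  proof -
    obtain a where a: "a : arcs_of ?E" "F = orbit ?p a" using FF unfolding Fs_def faces_def by blast
    show "F \<subseteq> ?A Un ?A'" using orbit_subset_dom[OF perm a(1)] unfolding a arcs .
    show "F ~= {}" using self_in_orbit[OF perm fin] unfolding a by blast
  qed
  have finFs: "finite Fs" unfolding Fs_def faces_def using fin by simp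
  have "Fs = P Un P' Un M" unfolding P_def P'_def M_def by blast
  moreover have "P Int P' = {}" "(P Un P') Int M = {}" using Fsub AA unfolding P_def P'_def M_def by blast+
  moreover have fins: "finite P" "finite P'" "finite M" using finFs unfolding P_def P'_def M_def by auto
  ultimately show "card Fs = card P + card P' + card M" by (simp add: card_Un_disjoint)
  have half: "3 * (card Q + card M) <= 2 * (card D choose 2)"
    if D: "finite D" and Q: "Q \<subseteq> Fs" "Q Int M = {}" and ge: "!!F. F : Q Un M ==> 3 <= card (F Int arcs_of (clique D))"
      and sub: "arcs_of (clique D) \<subseteq> arcs_of ?E" for Q D
  proof -
    have QM: "Q Un M \<subseteq> Fs" using Q unfolding M_def by blast
    have "3 * card (Q Un M) = (\<Sum>F\<in>Q Un M. 3)" by simp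
    also have "\<dots> <= (\<Sum>F\<in>Q Un M. card (F Int arcs_of (clique D)))" by (rule sum_mono) (rule ge)
    also have "\<dots> <= (\<Sum>F\<in>Fs. card (F Int arcs_of (clique D)))" by (rule sum_mono2[OF finFs QM]) simp
    also have "\<dots> = card (arcs_of (clique D))" unfolding Fs_def faces_def by (rule sum_card_orbits[OF perm fin sub])
    also have "\<dots> = 2 * (card D choose 2)" using finite_arcs(2)[OF simple_edges_clique[OF D]] card_clique[OF D] by simp
    finally show ?thesis using Q fins finite_subset[OF Q(1) finFs] by (simp add: card_Un_disjoint)
  qed
  show "3 * (card P + card M) <= 2 * (card C choose 2)"
  proof (rule half)
    show "3 <= card (F Int ?A)" if "F : P Un M" for F
      using block_face_ge3[OF s C, of F] that Fsub[of F] unfolding P_def M_def Fs_def by blast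
  qed (use C arcs in \<open>auto simp: P_def M_def\<close>)
  have s': "rotation (clique C' Un clique C) s" "C' Int C = {v}" using s C(5) by (simp_all add: Un_commute Int_commute)
  show "3 * (card P' + card M) <= 2 * (card C' choose 2)"
  proof (rule half)
    show "3 <= card (F Int ?A')" if "F : P' Un M" for F
      using block_face_ge3[OF s'(1) C(2,1,4,3) s'(2), of F] that Fsub[of F]
      unfolding P'_def M_def Fs_def Un_commute[of "clique C"] by blast
  qed (use C arcs in \<open>auto simp: P'_def M_def\<close>)
  show "M ~= {}"
  proof
    assume M: "M = {}"
    have "v : C" "v : C'" using C(5) by auto
    moreover have "EX x:D. x ~= v" if "3 <= card D" for D
    proof -
      have "~ D \<subseteq> {v}" using that card_mono[of "{v}" D] by auto
      then show ?thesis by blast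
    qed
    ultimately obtain x y where xy: "x : C" "x ~= v" "y : C'" "y ~= v" using C(3,4) by meson
    have vx: "(v, x) : ?A" "(v, y) : ?A'" using xy C(5) unfolding clique_arcs by auto
    have "s a : ?A" if a: "a : ?A" for a
    proof -
      have b: "prod.swap a : ?A" "prod.swap a : arcs_of ?E" using swap_arcs[OF a] arcs by auto
      let ?F = "orbit ?p (prod.swap a)"
      have F: "?F : Fs" "prod.swap a : ?F" using b(2) self_in_orbit[OF perm fin] unfolding Fs_def faces_def by auto
      then have "?F \<subseteq> ?A" using M AA b(1) unfolding M_def by blast
      then have "?p (prod.swap a) : ?A" using orbit.base by fast
      then show ?thesis using face_perm_swap[OF b(2)] by simp
    qed
    then have "orbit s (v, x) \<subseteq> ?A" by (rule orbit_subset_closed) (use vx in simp_all)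
    moreover have "(v, y) : orbit s (v, x)"
      using s vx unfolding rotation_def arcs by auto
    ultimately show False using vx AA by blast
  qed
qed

lemma Union_two_cliques:
  assumes "3 <= card C" "3 <= card C'" "C Int C' = {v}" "finite C" "finite C'"
  shows "\<Union>(clique C Un clique C') = C Un C'" "card (C Un C') + 1 = card C + card C'"
    "card (clique C Un clique C') = (card C choose 2) + (card C' choose 2)" "simple_edges (clique C Un clique C')"
proof -
  show "\<Union>(clique C Un clique C') = C Un C'" using Union_clique[of C] Union_clique[of C'] assms by simp
  show "card (C Un C') + 1 = card C + card C'" using card_Un_Int[OF assms(4,5)] assms(3) by simp
  have "clique C Int clique C' = {}"
  proof -
    have "clique C Int clique C' = clique {v}" using assms(3) by (auto simp: clique_def)
    then show ?thesis by (auto simp: clique_def card_2_iff)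
  qed
  then show "card (clique C Un clique C') = (card C choose 2) + (card C' choose 2)"
    using card_Un_disjoint[OF finite_clique finite_clique] card_clique assms by metis
  show "simple_edges (clique C Un clique C')" by (intro simple_edges_Un simple_edges_clique assms)
qed

lemma two_blocks_rotation:
  assumes "graph_embeds_in V E (handle_surface g)" "clique C \<subseteq> E" "clique C' \<subseteq> E" "C \<subseteq> V" "C' \<subseteq> V"
    and C: "finite C" "finite C'" "3 <= card C" "3 <= card C'" "C Int C' = {v}"
  obtains s where "rotation (clique C Un clique C') s"
    "int (card C choose 2) + int (card C' choose 2) + 3 - int (card C) - int (card C') - 2 * int g <= int (card (faces (clique C Un clique C') s))"
proof -
  note U = Union_two_cliques[OF C(3,4,5,1,2)]
  obtain s where s: "rotation (clique C Un clique C') s"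
    "int (card (clique C Un clique C')) + 2 - int (card (\<Union>(clique C Un clique C'))) - 2 * int g <= int (card (faces (clique C Un clique C') s))"
  proof (rule euler_bound[OF assms(1)])
    show "clique C Un clique C' ~= {}"
    proof
      assume "clique C Un clique C' = {}"
      then have "C Un C' = {}" using U(1) by (simp only: Union_empty)
      then show False using C(3) by simp
    qed
  qed (use assms U in auto)
  show ?thesis by (rule that[OF s(1)]) (use s(2)[unfolded U(1,3)] U(2) in linarith)
qed

text \<open>At least 24 faces would be required. The 20 and 56 arcs allow at most 6 and 18 faces in
  the two cliques, and every mixed face, of which there is one, is counted twice.\<close>

lemma no_K5_K8:
  assumes "clique C \<subseteq> E" "clique C' \<subseteq> E" "C \<subseteq> V" "C' \<subseteq> V" "card C = 5" "card C' = 8" "C Int C' = {v}" "g <= 2"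
  shows "~ graph_embeds_in V E (handle_surface g)"
proof
  assume emb: "graph_embeds_in V E (handle_surface g)"
  have C: "finite C" "finite C'" "3 <= card C" "3 <= card C'" using assms(5,6) card.infinite by fastforce+
  obtain s where s: "rotation (clique C Un clique C') s"
    "int (card C choose 2) + int (card C' choose 2) + 3 - int (card C) - int (card C') - 2 * int g <= int (card (faces (clique C Un clique C') s))"
    using two_blocks_rotation[OF emb assms(1-4) C assms(7)] .
  define P where "P = {F : faces (clique C Un clique C') s. F \<subseteq> arcs_of (clique C)}"
  define P' where "P' = {F : faces (clique C Un clique C') s. F \<subseteq> arcs_of (clique C')}"
  define M where "M = {F : faces (clique C Un clique C') s. ~ F \<subseteq> arcs_of (clique C) & ~ F \<subseteq> arcs_of (clique C')}"
  note b = block_faces[OF s(1) C assms(7), folded P_def P'_def M_def]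
  have n: "(5 :: nat) choose 2 = 10" "(8 :: nat) choose 2 = 28" by (simp_all add: choose_two)
  have "finite (faces (clique C Un clique C') s)"
    unfolding faces_def using finite_arcs(1)[OF Union_two_cliques(4)[OF C(3,4) assms(7) C(1,2)]] by simp
  then have "0 < card M" using b(4) unfolding M_def by (simp add: card_gt_0_iff)
  moreover have "card P + card M <= 6" "card P' + card M <= 18" using b(2,3) unfolding assms(5,6) n by arith+
  moreover have "24 <= card P + card P' + card M" using s(2) assms(8) unfolding b(1) assms(5,6) n by linarith
  ultimately show False by linarith
qed

text \<open>Eleven faces are required, and 6 + 6 with a mixed face counted twice gives just that:
  one mixed face and five faces in each clique. Restricted to one \<open>K_5\<close>, these five
  persist, and the arcs of the mixed face lie on further faces, of which 20 arcs allow only one. But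
  \<open>5 - 10 + 6\<close> is odd.\<close>

lemma no_K5_K5:
  assumes "clique C \<subseteq> E" "clique C' \<subseteq> E" "C \<subseteq> V" "C' \<subseteq> V" "card C = 5" "card C' = 5" "C Int C' = {v}" "g <= 1"
  shows "~ graph_embeds_in V E (handle_surface g)"
proof
  assume emb: "graph_embeds_in V E (handle_surface g)"
  have C: "finite C" "finite C'" "3 <= card C" "3 <= card C'" using assms(5,6) card.infinite by fastforce+
  let ?E = "clique C Un clique C'"
  obtain s where s: "rotation ?E s"
    "int (card C choose 2) + int (card C' choose 2) + 3 - int (card C) - int (card C') - 2 * int g <= int (card (faces ?E s))"
    using two_blocks_rotation[OF emb assms(1-4) C assms(7)] .
  note simp = Union_two_cliques(4)[OF C(3,4) assms(7) C(1,2)]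
  have n: "(5 :: nat) choose 2 = 10" by (simp add: choose_two)
  define P where "P = {F : faces ?E s. F \<subseteq> arcs_of (clique C)}"
  define P' where "P' = {F : faces ?E s. F \<subseteq> arcs_of (clique C')}"
  define M where "M = {F : faces ?E s. ~ F \<subseteq> arcs_of (clique C) & ~ F \<subseteq> arcs_of (clique C')}"
  note b = block_faces[OF s(1) C assms(7), folded P_def P'_def M_def]
  have finF: "finite (faces ?E s)" unfolding faces_def using finite_arcs(1)[OF simp] by simp
  then have "0 < card M" using b(4) unfolding M_def by (simp add: card_gt_0_iff)
  moreover have "card P + card M <= 6" "card P' + card M <= 6" using b(2,3) unfolding assms(5,6) n by arith+
  moreover have "11 <= card P + card P' + card M" using s(2) assms(8) unfolding b(1) assms(5,6) n by linarith
  ultimately have P5: "card P = 5" by linarith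
  obtain g' where g': "rotation (clique C) g'" "!!F. F : faces ?E s ==> F \<subseteq> arcs_of (clique C) ==> F : faces (clique C) g'"
    using rotation_restrict[OF s(1) simp, of "clique C"] by blast
  note simpC = simple_edges_clique[OF C(1)]
  have PF: "P \<subseteq> faces (clique C) g'" using g'(2) unfolding P_def by blast
  have finG: "finite (faces (clique C) g')" unfolding faces_def using finite_arcs(1)[OF simpC] by simp
  have "P ~= faces (clique C) g'"
  proof
    assume e: "P = faces (clique C) g'"
    obtain F where F: "F : M" using b(4) by blast
    have "F \<subseteq> arcs_of (clique C) Un arcs_of (clique C')"
      using F faces_cover[OF s(1) simp] unfolding M_def arcs_of_Un by blast
    then obtain a where a: "a : F" "a : arcs_of (clique C)" using F unfolding M_def by blast
    then obtain F' where F': "F' : P" "a : F'" using faces_cover[OF g'(1) simpC] e by blast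
    note perm = face_perm_permutes[OF s(1)]
    have "F = orbit (face_perm ?E s) a" "F' = orbit (face_perm ?E s) a"
      using a(1) F F' orbit_eqI'[OF perm finite_arcs(1)[OF simp], of a] unfolding M_def P_def faces_def by blast+
    then show False using F F' unfolding M_def P_def by blast
  qed
  then have "card P < card (faces (clique C) g')" using PF finG psubset_card_mono by blast
  moreover have "3 * card (faces (clique C) g') <= 20"
    using faces_le(2)[OF g'(1) min_degree2_clique[OF C(3)] simpC] card_clique[OF C(1)] assms(5) n by simp
  ultimately have "card (faces (clique C) g') = 6" using P5 by linarith
  moreover have "fst ` arcs_of (clique C) = C"
  proof -
    have "x : fst ` arcs_of (clique C)" if x: "x : C" for x
    proof -
      have "~ C \<subseteq> {x}" using C(3) card_mono[of "{x}" C] by auto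
      then obtain y where "y : C" "y ~= x" by blast
      then have "(x, y) : arcs_of (clique C)" using x unfolding clique_arcs by auto
      then show ?thesis by (rule rev_image_eqI) simp
    qed
    then show ?thesis unfolding clique_arcs by auto
  qed
  moreover have "card (clique C) = 10" using card_clique[OF C(1)] assms(5) n by simp
  ultimately show False
    using faces_parity[OF g'(1) simpC] assms(5) by simp
qed

section \<open>The graph of twelve vertices\<close>

text \<open>The relation \<open>P x y z\<close> says that some face walk passes from \<open>x\<close> over \<open>y\<close> to \<open>z\<close>. The last condition
  says that all faces are triangles, except for at most one quadrangle. The conditions are
  invariant under reversal of all walks.\<close>

definition corner_system :: "('v => 'v set) => ('v => 'v => 'v => bool) => bool" where
  "corner_system N P \<longleftrightarrow>
     (ALL x y z. P x y z --> x : N y & z : N y & x ~= z) &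
     (ALL y. ALL x:N y. (EX z. P x y z) & (EX z. P z y x)) &
     (ALL x y z z'. P x y z & P x y z' --> z = z') &
     (ALL x x' y z. P x y z & P x' y z --> x = x') &
     (ALL y S. S \<subseteq> N y & S ~= {} & (ALL x:S. ALL z. P x y z --> z : S) --> S = N y) &
     (ALL x y z. P x y z & ~(P y z x & P z x y) --> (EX u. P y z u & P z u x & P u x y &
        (ALL x' y' z'. P x' y' z' & ~(P y' z' x' & P z' x' y') -->
           (x', y', z') : {(x, y, z), (y, z, u), (z, u, x), (u, x, y)})))"

lemma corner_systemD:
  assumes "corner_system N P"
  shows "ALL x y z. P x y z --> x : N y & z : N y & x ~= z"
    "ALL y. ALL x:N y. (EX z. P x y z) & (EX z. P z y x)"
    "ALL x y z z'. P x y z & P x y z' --> z = z'"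
    "ALL x x' y z. P x y z & P x' y z --> x = x'"
    "ALL y S. S \<subseteq> N y & S ~= {} & (ALL x:S. ALL z. P x y z --> z : S) --> S = N y"
    "ALL x y z. P x y z & ~(P y z x & P z x y) --> (EX u. P y z u & P z u x & P u x y &
        (ALL x' y' z'. P x' y' z' & ~(P y' z' x' & P z' x' y') -->
           (x', y', z') : {(x, y, z), (y, z, u), (z, u, x), (u, x, y)}))"
  using assms unfolding corner_system_def by - ((elim conjE, assumption)+)

text \<open>The mirror image of the drawing; it halves the case analysis on orientations.\<close>

lemma corner_system_reverse:
  assumes "corner_system N P"
  shows "corner_system N (%x y z. P z y x)"
proof -
  have a1: "x : N y & z : N y & x ~= z" if "P x y z" for x y z
    using corner_systemD(1)[OF assms] that by blast
  have a4: "S = N y" if "S \<subseteq> N y" "S ~= {}" "!!x z. x : S ==> P x y z ==> z : S" for S y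
    using corner_systemD(5)[OF assms] that by blast
  have r5: "S = N y" if S: "S \<subseteq> N y" "S ~= {}" "!!x z. x : S ==> P z y x ==> z : S" for S y
  proof (rule ccontr)
    assume "S ~= N y"
    then have "N y - S ~= {}" using S(1) by blast
    \<comment> \<open>If a set is closed under predecessors, its complement is closed under
      successors.\<close>
    then have "N y - S = N y" using S(3) a1 by (intro a4) blast+
    then show False using S(1,2) by blast
  qed
  have r6: "EX u. P u z y & P x u z & P y x u & (ALL x' y' z'. P z' y' x' & ~(P x' z' y' & P y' x' z') -->
           (x', y', z') : {(x, y, z), (y, z, u), (z, u, x), (u, x, y)})"
    if zyx: "P z y x" "~(P x z y & P y x z)" for x y z
  proof -
    have nb: "P z y x & ~(P y x z & P x z y)" using zyx by blast
    from corner_systemD(6)[OF assms, rule_format, OF nb] obtain u where uu: "P y x u & P x u z & P u z y &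
        (ALL x' y' z'. P x' y' z' & ~(P y' z' x' & P z' x' y') --> (x', y', z') : {(z, y, x), (y, x, u), (x, u, z), (u, z, y)})"
      by (elim exE) (rule that)
    have "(x', y', z') : {(x, y, z), (y, z, u), (z, u, x), (u, x, y)}"
      if "P z' y' x'" "~(P x' z' y' & P y' x' z')" for x' y' z'
    proof -
      have "(z', y', x') : {(z, y, x), (y, x, u), (x, u, z), (u, z, y)}" using uu that by blast
      then show ?thesis by auto
    qed
    then have "ALL x' y' z'. P z' y' x' & ~(P x' z' y' & P y' x' z') -->
        (x', y', z') : {(x, y, z), (y, z, u), (z, u, x), (u, x, y)}" by (intro allI impI) (elim conjE)
    then show ?thesis using uu by (intro exI[of _ u] conjI; elim conjE)
  qed
  have q1: "ALL x y z. P z y x --> x : N y & z : N y & x ~= z" using corner_systemD(1)[OF assms] by blast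
  have q2: "ALL y. ALL x:N y. (EX z. P z y x) & (EX z. P x y z)" using corner_systemD(2)[OF assms] by blast
  have q3: "ALL x y z z'. P z y x & P z' y x --> z = z'" using corner_systemD(4)[OF assms] by blast
  have q4: "ALL x x' y z. P z y x & P z y x' --> x = x'" using corner_systemD(3)[OF assms] by blast
  have q5: "ALL y S. S \<subseteq> N y & S ~= {} & (ALL x:S. ALL z. P z y x --> z : S) --> S = N y"
    by (intro allI impI, elim conjE, rule r5) auto
  have q6: "ALL x y z. P z y x & ~(P x z y & P y x z) --> (EX u. P u z y & P x u z & P y x u &
      (ALL x' y' z'. P z' y' x' & ~(P x' z' y' & P y' x' z') --> (x', y', z') : {(x, y, z), (y, z, u), (z, u, x), (u, x, y)}))"
    by (intro allI impI, elim conjE, rule r6)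
  show ?thesis
    unfolding corner_system_def by (intro conjI q1 q2 q3 q4 q5 q6)
qed

context
  fixes N :: "'v => 'v set" and P
  assumes sys: "corner_system N P"
begin

lemma corner_neigh: "P x y z ==> x : N y & z : N y & x ~= z"
  using corner_systemD(1)[OF sys] by blast

lemma corner_next: "x : N y ==> EX z. P x y z"
  using corner_systemD(2)[OF sys] by blast

lemma corner_unique: "P x y z ==> P x y z' ==> z = z'" "P x y z ==> P x' y z ==> x = x'"
  using corner_systemD(3,4)[OF sys] by blast+

lemma corner_closed: "S \<subseteq> N y ==> S ~= {} ==> (!!x z. x : S ==> P x y z ==> z : S) ==> S = N y"
  using corner_systemD(5)[OF sys] by blast

lemma corner_bad:
  assumes "P x y z" "~(P y z x & P z x y)"
  obtains u where "P y z u" "P z u x" "P u x y"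
    "!!x' y' z'. P x' y' z' ==> (x', y', z') ~: {(x, y, z), (y, z, u), (z, u, x), (u, x, y)} ==> P y' z' x' & P z' x' y'"
proof -
  from corner_systemD(6)[OF sys, rule_format, OF conjI[OF assms]] obtain u where "P y z u & P z u x & P u x y &
        (ALL x' y' z'. P x' y' z' & ~(P y' z' x' & P z' x' y') -->
           (x', y', z') : {(x, y, z), (y, z, u), (z, u, x), (u, x, y)})"
    by (elim exE) (rule that)
  then show ?thesis using that[of u] by blast
qed

lemma corner_no_triangle:
  assumes "3 < card (N y)" "P a y b" "P b y c" "P c y a"
  shows False
proof -
  have "{a, b, c} = N y"
    using corner_neigh[OF assms(2)] corner_neigh[OF assms(3)] corner_unique(1) assms(2-4) by (intro corner_closed) blast+
  moreover have "card {a, b, c} <= 3" by (simp add: card_insert_if)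
  ultimately show False using assms(1) by simp
qed

lemma corner_no_digon:
  assumes "3 < card (N y)" "P a y b" "P b y a"
  shows False
proof -
  have "{a, b} = N y"
    using corner_neigh[OF assms(2)] corner_unique(1) assms(2-3) by (intro corner_closed) blast+
  moreover have "card {a, b} <= 2" by (simp add: card_insert_if)
  ultimately show False using assms(1) by simp
qed

text \<open>Three neighbours admit two cyclic orders.\<close>

lemma corner_degree3:
  assumes "N w = {c, v, b}" "distinct [c, v, b]"
  shows "P c w v & P v w b & P b w c | P v w c & P c w b & P b w v"
proof -
  obtain x where x: "P c w x" using corner_next[of c w] assms(1) by blast
  obtain y where y: "P v w y" using corner_next[of v w] assms(1) by blast
  obtain z where z: "P b w z" using corner_next[of b w] assms(1) by blast
  note xyz = x y z
  have m: "x : {v, b}" "y : {c, b}" "z : {c, v}"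
    using corner_neigh[OF xyz(1)] corner_neigh[OF xyz(2)] corner_neigh[OF xyz(3)] assms(1) by auto
  have d: "x ~= y" "x ~= z" "y ~= z" 
    using corner_unique(2)[OF x, of v] corner_unique(2)[OF x, of b] corner_unique(2)[OF y, of b] y z assms(2) by auto
  show ?thesis using m d xyz assms(2) by auto
qed

text \<open>\<open>c w v u\<close> is the quadrangle, so all other corners belong to triangles.
  Propagating these triangles around the vertices of degree three ends, for every \<open>u\<close>,
  in a rotation at \<open>v\<close>, \<open>b\<close> or \<open>b'\<close> that closes up after two
  or three neighbours, or in two predecessors of one neighbour.\<close>

lemma corner_core:
  assumes N: "N w = {c, v, b}" "N w' = {c, v, b'}" "N w'' = {c, v, b''}" "N v = {c, b, b', b'', w, w', w''}"
    and dist: "distinct [c, v, b, b', b'', w, w', w'']"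
    and card: "3 < card (N b)" "3 < card (N b')" "3 < card (N v)"
    and bad: "P c w v" "~(P w v c & P v c w)"
    and u: "P w v u" "P v u c" "P u c w"
    and good: "!!x y z. P x y z ==> (x, y, z) ~: {(c, w, v), (w, v, u), (v, u, c), (u, c, w)} ==> P y z x & P z x y"
    and ub: "u = b' | u = w' | u = b"
  shows False
proof -
  have uw: "u ~= w" using corner_neigh[OF u(1)] by blast
  have d3: "distinct [c, v, b]" "distinct [c, v, b']" "distinct [c, v, b'']" using dist by auto
  have "~ P c w b" using corner_unique(1)[OF bad(1), of b] dist by auto
  then have w: "P v w b" "P b w c" using corner_degree3[OF N(1) d3(1)] by blast+
  have "P w b v & P b v w" by (rule good[OF w(1)]) (use dist uw in auto)
  then have wb: "P w b v" "P b v w" by blast+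
  have "P w c b & P c b w" by (rule good[OF w(2)]) (use dist uw in auto)
  then have wo: "P w c b" "P c b w" by blast+
  from ub show False
  proof (elim disjE)
    assume "u = b"
    then show False using corner_no_digon[OF card(3) wb(2)] u(1) by blast
  next
    assume ue: "u = b'"
    have g: "P y z x & P z x y" if "P x y z" "y = w'" for x y z by (rule good[OF that(1)]) (use that dist ue in auto)
    from corner_degree3[OF N(2) d3(2)] consider "P c w' v" "P v w' b'" "P b' w' c" | "P v w' c" "P c w' b'" "P b' w' v" by blast
    then show False
    proof cases
      case 1
      have "P w' b' v" "P c b' w'" using g[OF 1(2)] g[OF 1(3)] by blast+
      then show False using corner_no_triangle[OF card(2)] u(2) ue by blast
    next
      case 2
      have "P w' v b'" using g[OF 2(3)] by blast
      then have "w' = w" using corner_unique(2) u(1) ue by blast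
      then show False using dist by simp
    qed
  next
    assume ue: "u = w'"
    have w': "P c w' b'" "P b' w' v"
    proof -
      have "~ P v w' b'" using corner_unique(1)[of v w' c b'] u(2) ue dist by auto
      then show "P c w' b'" "P b' w' v" using corner_degree3[OF N(2) d3(2)] by blast+
    qed
    have "P w' v b' & P v b' w'" by (rule good[OF w'(2)]) (use dist ue in auto)
    then have w'v: "P w' v b'" "P v b' w'" by blast+
    have "P w' b' c & P b' c w'" by (rule good[OF w'(1)]) (use dist ue in auto)
    then have w'b: "P w' b' c" by blast
    have g: "P y z x & P z x y" if "P x y z" "y = w''" for x y z by (rule good[OF that(1)]) (use that dist ue in auto)
    have gv: "P v z x & P z x v" if "P x v z" "x ~= w" for x z by (rule good[OF that(1)]) (use that dist ue in auto)
    note un = corner_unique(2)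
    have uv: "P w v w'" using u(1) ue by simp
    from corner_degree3[OF N(3) d3(3)] consider "P c w'' v" "P v w'' b''" "P b'' w'' c" | "P v w'' c" "P c w'' b''" "P b'' w'' v" by blast
    then show False
    proof cases
      case 1
      have q: "P w'' v c" "P b'' v w''" using g[OF 1(1)] g[OF 1(2)] by blast+
      obtain z where z: "P c v z" using corner_next[of c v] N(4) by blast
      have "z : N v" "z ~= c" using corner_neigh[OF z] by auto
      moreover have "z ~= w" using un[OF z, of b] wb(2) dist by auto
      moreover have "z ~= w'" using un[OF z, of w] uv dist by auto
      moreover have "z ~= b'" using un[OF z, of w'] w'v(1) dist by auto
      moreover have "z ~= w''" using un[OF z, of b''] q(2) dist by auto
      moreover have "z ~= b''" using corner_no_triangle[OF card(3) q(2) q(1)] z by blast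
      ultimately have zb: "z = b" using N(4) by auto
      have "P v b c" using gv[OF z] dist unfolding zb by auto
      then show False using corner_no_triangle[OF card(1) wo(2) wb(1)] by blast
    next
      case 2
      have q: "P c v w''" "P w'' v b''" using g[OF 2(1)] g[OF 2(3)] by blast+
      have notv: "z ~= w & z ~= w' & z ~= w''" if "P x v z" "x : {b', b''}" for x z
        using un[OF that(1), of b] un[OF that(1), of w] un[OF that(1), of c] that(2) wb(2) uv q(1) dist by auto
      obtain z where z: "P b'' v z" using corner_next[of b'' v] N(4) by blast
      have "z : N v" "z ~= b''" using corner_neigh[OF z] by auto
      moreover have "z ~= b'" using un[OF z, of w'] w'v(1) dist by auto
      moreover have "z ~= c" using corner_no_triangle[OF card(3) q(1) q(2)] z by blast
      ultimately have zb: "z = b" using N(4) notv[OF z] by auto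
      obtain t where t: "P b' v t" using corner_next[of b' v] N(4) by blast
      have "t : N v" "t ~= b'" using corner_neigh[OF t] by auto
      moreover have "t ~= b" using un[OF t, of b''] z zb dist by auto
      moreover have "t ~= b''" using un[OF t, of w''] q(2) dist by auto
      ultimately have te: "t = c" using N(4) notv[OF t] by auto
      have "P c b' v" using gv[OF t] dist unfolding te by auto
      then show False using corner_no_triangle[OF card(2) w'v(2) w'b] by blast
    qed
  qed
qed

text \<open>The fourth vertex \<open>u\<close> is a neighbour of \<open>v\<close> other than
  \<open>c\<close> and \<open>w\<close>. Exchanging the pairs \<open>b'\<close>, \<open>w'\<close>
  and \<open>b''\<close>, \<open>w''\<close> reduces its five values to the three treated in
  \<open>corner_core\<close>.\<close>

lemma corner_bad_False:
  assumes N: "N w = {c, v, b}" "N w' = {c, v, b'}" "N w'' = {c, v, b''}" "N v = {c, b, b', b'', w, w', w''}"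
    and dist: "distinct [c, v, b, b', b'', w, w', w'']"
    and card: "3 < card (N b)" "3 < card (N b')" "3 < card (N b'')" "3 < card (N v)"
    and irr: "c ~: N c" and bad: "P c w v" "~(P w v c & P v c w)"
  shows False
proof -
  obtain u where u: "P w v u" "P v u c" "P u c w"
    and good: "!!x y z. P x y z ==> (x, y, z) ~: {(c, w, v), (w, v, u), (v, u, c), (u, c, w)} ==> P y z x & P z x y"
    using corner_bad[OF bad] by blast
  have "u : N v" "u ~= w" "u ~= c" using corner_neigh[OF u(1)] corner_neigh[OF u(3)] irr by auto
  then have "u = b' | u = w' | u = b | u = b'' | u = w''" using N(4) by auto
  then consider "u = b' | u = w' | u = b" | "u = b'' | u = w'' | u = b" by blast
  then show False
  proof cases
    case 1
    show False by (rule corner_core[OF N dist card(1,2,4) bad u good 1])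
  next
    case 2
    have Nv: "N v = {c, b, b'', b', w, w'', w'}" "distinct [c, v, b, b'', b', w, w'', w']" using N(4) dist by auto
    show False by (rule corner_core[OF N(1,3,2) Nv card(1,3,4) bad u good 2])
  qed
qed

end

text \<open>Around each of \<open>w\<close>, \<open>w'\<close>, \<open>w''\<close> the neighbours
  \<open>c\<close> and \<open>v\<close> are consecutive. By \<open>corner_bad_False\<close>, for one
  orientation or for the reversed system, that corner belongs to a triangle, which then contains the
  edge between \<open>c\<close> and \<open>v\<close>. Three different triangles cannot share an edge
  with two sides.\<close>

lemma corner_system_contradiction:
  assumes sys: "corner_system N P"
    and N: "N w = {c, v, b}" "N w' = {c, v, b'}" "N w'' = {c, v, b''}" "N v = {c, b, b', b'', w, w', w''}"
    and dist: "distinct [c, v, b, b', b'', w, w', w'']"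
    and card: "3 < card (N b)" "3 < card (N b')" "3 < card (N b'')" "3 < card (N v)"
    and irr: "c ~: N c"
  shows False
proof -
  note sys' = corner_system_reverse[OF sys]
  have Nv: "N v = {c, b', b, b'', w', w, w''}" "N v = {c, b'', b, b', w'', w, w'}" using N(4) by auto
  have dist': "distinct [c, v, b', b, b'', w', w, w'']" "distinct [c, v, b'', b, b', w'', w, w']" using dist by auto
  have plus: "P w1 v c & P v c w1" if "P c w1 v" "w1 : {w, w', w''}" for w1
    using that corner_bad_False[OF sys N dist card irr] corner_bad_False[OF sys N(2,1,3) Nv(1) dist'(1) card(2,1,3,4) irr]
      corner_bad_False[OF sys N(3,1,2) Nv(2) dist'(2) card(3,1,2,4) irr] by blast
  have minus: "P c v w1 & P w1 c v" if "P v w1 c" "w1 : {w, w', w''}" for w1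
    using that corner_bad_False[OF sys' N dist card irr] corner_bad_False[OF sys' N(2,1,3) Nv(1) dist'(1) card(2,1,3,4) irr]
      corner_bad_False[OF sys' N(3,1,2) Nv(2) dist'(2) card(3,1,2,4) irr] by blast
  have each: "P v c w1 | P c v w1" if "N w1 = {c, v, d}" "distinct [c, v, d]" "w1 : {w, w', w''}" for w1 d
    using corner_degree3[OF sys that(1,2)] plus minus that(3) by blast
  have "P v c w | P c v w" by (rule each[OF N(1)]) (use dist in auto)
  moreover have "P v c w' | P c v w'" by (rule each[OF N(2)]) (use dist in auto)
  moreover have "P v c w'' | P c v w''" by (rule each[OF N(3)]) (use dist in auto)
  moreover have "w ~= w'" "w ~= w''" "w' ~= w''" using dist by auto
  ultimately show False using corner_unique(1)[OF sys] by metis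
qed

definition face_corner :: "'v set set => ('v \<times> 'v => 'v \<times> 'v) => 'v => 'v => 'v => bool" where
  "face_corner E s x y z \<longleftrightarrow> (x, y) : arcs_of E & face_perm E s (x, y) = (y, z)"

lemma arcs_sym: "(x, y) : arcs_of E \<longleftrightarrow> (y, x) : arcs_of E"
  using swap_arcs[of "(x, y)" E] swap_arcs[of "(y, x)" E] by auto

text \<open>The face lengths add up to at most \<open>3 F + 1\<close> and are at least three each,
  so at most one face is longer than a triangle, by one.\<close>

lemma rotation_corner_system:
  assumes s: "rotation E s" and md: "min_degree2 E" and simp: "simple_edges E"
    and tri: "2 * card E <= 3 * card (faces E s) + 1"
  shows "corner_system (%y. {x. (x, y) : arcs_of E}) (face_corner E s)"
proof -
  let ?p = "face_perm E s" and ?A = "arcs_of E"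
  note perm = face_perm_permutes[OF s] and fin = finite_arcs(1)[OF simp]
  have inj: "a = b" if "?p a = ?p b" for a b using permutes_inj[OF perm] that by (simp add: inj_eq)
  have step: "EX z. ?p (x, y) = (y, z) & (y, z) : ?A & x ~= z" if "(x, y) : ?A" for x y
  proof -
    obtain y' z where e: "?p (x, y) = (y', z)" by (cases "?p (x, y)") blast
    have "y' = y" using face_perm_fst[OF s that] e by simp
    moreover have "(y', z) : ?A" using face_perm_arc[OF s that] e by simp
    moreover have "z ~= x" using face_no_return[OF s md that] e by simp
    ultimately show ?thesis using e by auto
  qed
  have pre: "EX x. (x, y) : ?A & ?p (x, y) = (y, z)" if "(y, z) : ?A" for y z
  proof -
    obtain a where a: "?p a = (y, z)" using permutes_surj[OF perm] by (metis surjD)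
    then have "a : ?A" using permutes_in_image[OF perm, of a] that by simp
    then show ?thesis using a face_perm_fst[OF s, of a] by (cases a) auto
  qed
  have q1: "ALL x y z. face_corner E s x y z --> x : {x. (x, y) : ?A} & z : {x. (x, y) : ?A} & x ~= z"
  proof (intro allI impI)
    fix x y z assume "face_corner E s x y z"
    then have "(x, y) : ?A" "?p (x, y) = (y, z)" by (auto simp: face_corner_def)
    then show "x : {x. (x, y) : ?A} & z : {x. (x, y) : ?A} & x ~= z"
      using step[of x y] arcs_sym[of y z E] by auto
  qed
  have q2: "ALL y. ALL x:{x. (x, y) : ?A}. (EX z. face_corner E s x y z) & (EX z. face_corner E s z y x)"
  proof (intro allI ballI)
    fix y x assume "x : {x. (x, y) : ?A}"
    then have "(x, y) : ?A" "(y, x) : ?A" using arcs_sym[of x y E] by auto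
    then show "(EX z. face_corner E s x y z) & (EX z. face_corner E s z y x)"
      using step[of x y] pre[of y x] by (auto simp: face_corner_def)
  qed
  have q3: "ALL x y z z'. face_corner E s x y z & face_corner E s x y z' --> z = z'" by (auto simp: face_corner_def)
  have q4: "ALL x x' y z. face_corner E s x y z & face_corner E s x' y z --> x = x'"
  proof (intro allI impI, elim conjE)
    fix x x' y z assume "face_corner E s x y z" "face_corner E s x' y z"
    then have "?p (x, y) = ?p (x', y)" by (simp add: face_corner_def)
    then have "(x, y) = (x', y)" by (rule inj)
    then show "x = x'" by simp
  qed
  have q5: "ALL y S. S \<subseteq> {x. (x, y) : ?A} & S ~= {} & (ALL x:S. ALL z. face_corner E s x y z --> z : S) --> S = {x. (x, y) : ?A}"
  proof (intro allI impI, elim conjE)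
    fix y S assume S: "S \<subseteq> {x. (x, y) : ?A}" "S ~= {}" "ALL x:S. ALL z. face_corner E s x y z --> z : S"
    obtain x where x: "x : S" using S(2) by blast
    have SA: "(z, y) : ?A & (y, z) : ?A" if "z : S" for z using S(1) that arcs_sym[of z y E] by auto
    have "orbit s (y, x) \<subseteq> Pair y ` S"
    proof (rule orbit_subset_closed)
      fix a assume "a : Pair y ` S"
      then obtain z where z: "z : S" "a = (y, z)" by blast
      have "?p (z, y) = s (y, z)" using face_perm_swap[of "(z, y)" E s] SA[OF z(1)] by simp
      moreover obtain t where t: "?p (z, y) = (y, t)" using step[of z y] SA[OF z(1)] by blast
      moreover have "t : S" using S(3) z(1) t SA[OF z(1)] unfolding face_corner_def by blast
      ultimately show "s a : Pair y ` S" using z(2) by (metis imageI)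
    qed (use x in blast)
    moreover have "orbit s (y, x) = {b : ?A. fst b = y}" using s SA[OF x] unfolding rotation_def by auto
    ultimately have "{b : ?A. fst b = y} \<subseteq> Pair y ` S" by simp
    then have "z : S" if "(z, y) : ?A" for z using that arcs_sym[of z y E] by auto
    then show "S = {x. (x, y) : ?A}" using S(1) by blast
  qed
  have dist3: "card {a, ?p a, ?p (?p a)} = 3" if "a : ?A" for a by (rule face_three[OF s md that])
  have three: "?p (?p (?p a)) = a" if a: "a : ?A" "card (orbit ?p a) = 3" for a
  proof -
    have sub: "{a, ?p a, ?p (?p a)} \<subseteq> orbit ?p a"
      using self_in_orbit[OF perm fin, of a] by (auto intro: orbit.intros)
    have "finite (orbit ?p a)" using a(2) by (simp add: card_ge_0_finite)
    then have eq: "orbit ?p a = {a, ?p a, ?p (?p a)}"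
      using card_subset_eq[OF _ sub] dist3[OF a(1)] a(2) by simp
    have "?p (?p (?p a)) : orbit ?p a" by (intro orbit.intros)
    then have "?p (?p (?p a)) : {a, ?p a, ?p (?p a)}" by (simp only: eq)
    moreover have "?p (?p (?p a)) ~= ?p a" "?p (?p (?p a)) ~= ?p (?p a)"
      using dist3[OF a(1)] inj[of "?p (?p a)" a] inj[of "?p (?p a)" "?p a"] by (auto simp: card_insert_if split: if_splits)
    ultimately show ?thesis by blast
  qed
  have four: "?p (?p (?p (?p a))) = a & orbit ?p a = {a, ?p a, ?p (?p a), ?p (?p (?p a))}"
    if a: "a : ?A" "card (orbit ?p a) = 4" for a
  proof -
    define b where "b = ?p a" define c where "c = ?p b" define d where "d = ?p c"
    have abc: "card {a, b, c} = 3" using dist3[OF a(1)] unfolding b_def c_def by simp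
    have mem: "{a, b, c, d} \<subseteq> orbit ?p a" "?p d : orbit ?p a"
      using self_in_orbit[OF perm fin, of a] unfolding b_def c_def d_def by (auto intro: orbit.intros)
    have d1: "d ~= b" "d ~= c" using abc inj[of c a] inj[of c b] unfolding d_def
      by (auto simp: b_def[symmetric] c_def[symmetric] card_insert_if split: if_splits)
    have "d ~= a"
    proof
      assume "d = a"
      then have "?p a = b" "?p b = c" "?p c = a" unfolding b_def c_def d_def by simp_all
      then have "orbit ?p a \<subseteq> {a, b, c}"
        by (intro orbit_subset_closed) (elim insertE emptyE, simp_all only: insert_iff simp_thms)
      then have "card (orbit ?p a) <= 3" using card_mono[of "{a, b, c}" "orbit ?p a"] abc by simp
      then show False using a(2) by simp
    qed
    then have c4: "card {a, b, c, d} = 4" using d1 abc by (auto simp: card_insert_if split: if_splits)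
    have "finite (orbit ?p a)" using a(2) by (simp add: card_ge_0_finite)
    then have eq: "orbit ?p a = {a, b, c, d}" using card_subset_eq[OF _ mem(1)] c4 a(2) by simp
    have "?p d : {a, b, c, d}" using mem(2) eq by simp
    moreover have "?p d ~= b" using inj[of d a] \<open>d ~= a\<close> unfolding b_def by blast
    moreover have "?p d ~= c" using inj[of d b] d1(1) unfolding c_def by blast
    moreover have "?p d ~= d" using inj[of d c] d1(2) unfolding d_def by blast
    ultimately have "?p d = a" by blast
    then show ?thesis using eq unfolding b_def c_def d_def by simp
  qed
  have finF: "finite (faces E s)" unfolding faces_def using fin by simp
  have ge3: "3 <= card F" if "F : faces E s" for F by (rule face_card_ge3[OF s md fin that])
  have "(\<Sum>F\<in>faces E s. card F - 3) + 3 * card (faces E s) = (\<Sum>F\<in>faces E s. (card F - 3) + 3)"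
    by (simp add: sum.distrib)
  also have "\<dots> = (\<Sum>F\<in>faces E s. card F)" using ge3 by (intro sum.cong) auto
  \<comment> \<open>The total excess of the face lengths over three.\<close>
  finally have ex: "(\<Sum>F\<in>faces E s. card F - 3) <= 1" using tri faces_le(1)[OF s md simp] by simp
  have one: "card F = 4 & (ALL F':faces E s. F' ~= F --> card F' = 3)" if F: "F : faces E s" "card F ~= 3" for F
  proof -
    have "(\<Sum>F\<in>faces E s. card F - 3) = (card F - 3) + (\<Sum>F\<in>faces E s - {F}. card F - 3)"
      using finF F(1) by (rule sum.remove)
    moreover have "1 <= card F - 3" using ge3[OF F(1)] F(2) by simp
    ultimately have "card F - 3 = 1" "(\<Sum>F\<in>faces E s - {F}. card F - 3) = 0" using ex by linarith+
    then have "card F = 4" "ALL F':faces E s - {F}. card F' - 3 = 0" using finF by auto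
    then show ?thesis using ge3 by (metis DiffI diff_is_0_eq le_antisym singletonD)
  qed
  have q6: "ALL x y z. face_corner E s x y z & ~(face_corner E s y z x & face_corner E s z x y) -->
      (EX u. face_corner E s y z u & face_corner E s z u x & face_corner E s u x y &
        (ALL x' y' z'. face_corner E s x' y' z' & ~(face_corner E s y' z' x' & face_corner E s z' x' y') -->
           (x', y', z') : {(x, y, z), (y, z, u), (z, u, x), (u, x, y)}))"
  proof (intro allI impI, elim conjE)
    have bad4: "card (orbit ?p (x, y)) ~= 3" if "face_corner E s x y z" "~(face_corner E s y z x & face_corner E s z x y)" for x y z
    proof
      assume c3: "card (orbit ?p (x, y)) = 3"
      have a: "(x, y) : ?A" "?p (x, y) = (y, z)" using that(1) by (auto simp: face_corner_def)
      then obtain t where t: "?p (y, z) = (z, t)" "(y, z) : ?A" "(z, t) : ?A" using step[of x y] step[of y z] by auto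
      have "?p (z, t) = (x, y)" using three[OF a(1) c3] a(2) t(1) by simp
      moreover have "fst (?p (z, t)) = t" using face_perm_fst[OF s t(3)] by simp
      ultimately have "t = x" by simp
      then show False using that(2) t \<open>?p (z, t) = (x, y)\<close> by (auto simp: face_corner_def)
    qed
    fix x y z assume c: "face_corner E s x y z" "~(face_corner E s y z x & face_corner E s z x y)"
    then have a: "(x, y) : ?A" "?p (x, y) = (y, z)" by (auto simp: face_corner_def)
    have F: "orbit ?p (x, y) : faces E s" using a(1) unfolding faces_def by blast
    note oo = one[OF F bad4[OF c]]
    obtain u where u: "?p (y, z) = (z, u)" "(y, z) : ?A" "(z, u) : ?A" using a step[of x y] step[of y z] by auto
    obtain x' where x': "?p (z, u) = (u, x')" "(u, x') : ?A" using step[of z u] u by auto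
    have f: "?p (u, x') = (x, y)" "orbit ?p (x, y) = {(x, y), (y, z), (z, u), (u, x')}"
      using four[OF a(1) conjunct1[OF oo]] a(2) u(1) x'(1) by simp_all
    have "x' = x" using face_perm_fst[OF s x'(2)] f(1) by simp
    then have cu: "face_corner E s y z u" "face_corner E s z u x" "face_corner E s u x y"
      using u x' f(1) by (auto simp: face_corner_def)
    moreover have "(x'', y'', z'') : {(x, y, z), (y, z, u), (z, u, x), (u, x, y)}"
      if c': "face_corner E s x'' y'' z''" "~(face_corner E s y'' z'' x'' & face_corner E s z'' x'' y'')" for x'' y'' z''
    proof -
      have a'': "(x'', y'') : ?A" using c'(1) by (simp add: face_corner_def)
      have "orbit ?p (x'', y'') : faces E s" using a'' unfolding faces_def by blast
      then have "orbit ?p (x'', y'') = orbit ?p (x, y)" using oo bad4[OF c'] by blast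
      then have "(x'', y'') : {(x, y), (y, z), (z, u), (u, x)}"
        using self_in_orbit[OF perm fin, of "(x'', y'')"] f(2) \<open>x' = x\<close> by simp
      then show ?thesis using c'(1) c(1) cu unfolding face_corner_def by auto
    qed
    ultimately show "EX u. face_corner E s y z u & face_corner E s z u x & face_corner E s u x y &
        (ALL x' y' z'. face_corner E s x' y' z' & ~(face_corner E s y' z' x' & face_corner E s z' x' y') -->
           (x', y', z') : {(x, y, z), (y, z, u), (z, u, x), (u, x, y)})" by blast
  qed
  show ?thesis
    unfolding corner_system_def by (intro conjI q1 q2 q3 q4 q5 q6)
qed

section \<open>Graphs given by lists of edges\<close>

text \<open>Lists of increasing pairs of naturals make edge counts, degrees and neighbourhoods
  accessible to evaluation.\<close>

definition edges_of :: "(nat \<times> nat) list => nat set set" where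
  "edges_of l = (%(x, y). {x, y}) ` set l"

lemma edges_of_card:
  assumes "distinct l" "list_all (%(x, y). x < y) l"
  shows "card (edges_of l) = length l" "simple_edges (edges_of l)"
proof -
  have lt: "x < y" if "(x, y) : set l" for x y using assms(2) that by (auto simp: list_all_iff)
  have "inj_on (%(x, y). {x, y}) (set l)"
    by (auto simp: inj_on_def doubleton_eq_iff dest!: lt)
  then show "card (edges_of l) = length l"
    unfolding edges_of_def by (simp add: card_image distinct_card assms(1))
  show "simple_edges (edges_of l)"
    unfolding simple_edges_def edges_of_def using lt by (fastforce simp: card_insert_if)
qed

lemma edges_of_arcs:
  assumes "list_all (%(x, y). x < y) l"
  shows "arcs_of (edges_of l) = set l Un prod.swap ` set l"
proof -
  have lt: "x < y" if "(x, y) : set l" for x y using assms that by (auto simp: list_all_iff)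
  show ?thesis
    unfolding arcs_of_def edges_of_def
    by (auto simp: doubleton_eq_iff image_iff dest: lt) (metis lt prod.swap_def fst_conv snd_conv)+
qed

lemma min_degree2_edges_of:
  assumes "list_all (%(x, y). x < y) l"
    and "list_all (%a. list_ex (%b. fst b = snd a & snd b ~= fst a) (l @ map prod.swap l)) (l @ map prod.swap l)"
  shows "min_degree2 (edges_of l)"
proof -
  have "arcs_of (edges_of l) = set (l @ map prod.swap l)" unfolding edges_of_arcs[OF assms(1)] by simp
  then show ?thesis using assms(2) unfolding min_degree2_def list_all_iff list_ex_iff by simp
qed

lemma Union_edges_of:
  assumes "list_all (%(x, y). x < n & y < n) l" "list_all (%x. list_ex (%a. x = fst a | x = snd a) l) [0..<n]"
  shows "\<Union>(edges_of l) = {..<n}"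
proof (intro equalityI subsetI)
  fix x assume "x : {..<n}"
  then have "list_ex (%a. x = fst a | x = snd a) l"
    using assms(2) unfolding list_all_iff by simp
  then obtain a where "a : set l" "x = fst a | x = snd a" unfolding list_ex_iff by blast
  then show "x : \<Union>(edges_of l)" unfolding edges_of_def by (auto simp: case_prod_beta)
qed (use assms(1) in \<open>auto simp: edges_of_def list_all_iff\<close>)

lemma embeds_edges_of:
  assumes "graph_embeds_in V E S" "inj_on h {..<n}" "h ` {..<n} \<subseteq> V"
    and "!!x y. (x, y) : set l ==> x < n & y < n & {h x, h y} : E"
  shows "graph_embeds_in {..<n} (edges_of l) S"
  by (rule embeds_mono[OF assms(1-3)]) (use assms(4) in \<open>auto simp: edges_of_def\<close>)

text \<open>A clique on 0 to 7 and three cliques of four vertices \<open>{0, i, 8, 8 + i}\<close>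
  for \<open>i\<close> from 1 to 3, all containing 0 and 8. In the ring, 0 to 7 stand for the pairs
  \<open>(0, b)\<close>, with zero and three nonunits first, and 8 to 11 for \<open>(1, b)\<close>
  with these four \<open>b\<close>.\<close>

definition pinched_edges :: "(nat \<times> nat) list" where
  "pinched_edges = [(x, y). x \<leftarrow> [0..<8], y \<leftarrow> [0..<8], x < y] @ [(0,8), (1,8), (2,8), (3,8),
     (0,9), (8,9), (1,9), (0,10), (8,10), (2,10), (0,11), (8,11), (3,11)]"

text \<open>With 41 edges on 12 vertices, genus two demands 27 faces; they consume at least 81 of
  the 82 arcs. The single spare arc is the one quadrangle permitted by
  \<open>corner_system\<close>.\<close>

lemma no_pinched_graph:
  assumes "g <= 2"
  shows "~ graph_embeds_in {..<12} (edges_of pinched_edges) (handle_surface g)"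
proof
  assume emb: "graph_embeds_in {..<12} (edges_of pinched_edges) (handle_surface g)"
  let ?E = "edges_of pinched_edges"
  have wf: "distinct pinched_edges" "list_all (%(x, y). x < y) pinched_edges" "length pinched_edges = 41"
    by (code_simp, code_simp, code_simp)
  note card = edges_of_card[OF wf(1,2)] and arcs = edges_of_arcs[OF wf(2)]
  have nb: "{x. (x, y) : arcs_of ?E} = set (filter (%x. (x, y) : set (pinched_edges @ map prod.swap pinched_edges)) [0..<12])" for y
  proof -
    have "list_all (%(x, y). x < 12 & y < 12) pinched_edges" by code_simp
    then have "x < 12" if "(x, y) : arcs_of ?E" for x using that unfolding arcs by (auto simp: list_all_iff)
    then show ?thesis unfolding arcs by auto
  qed
  have md: "min_degree2 ?E" by (rule min_degree2_edges_of[OF wf(2)]) code_simp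
  have U: "\<Union>?E = {..<12}" by (rule Union_edges_of) (code_simp, code_simp)
  obtain s where s: "rotation ?E s" "int (card ?E) + 2 - int (card (\<Union>?E)) - 2 * int g <= int (card (faces ?E s))"
  proof (rule euler_bound[OF emb order_refl])
    show "?E ~= {}" using card(1) wf(3) by auto
  qed (use U card(2) in auto)
  have "27 <= card (faces ?E s)" using s(2) assms unfolding card(1) wf(3) U by simp
  then have "2 * card ?E <= 3 * card (faces ?E s) + 1" unfolding card(1) wf(3) by simp
  note sys = rotation_corner_system[OF s(1) md card(2) this]
  have N: "filter (%x. (x, 9) : set (pinched_edges @ map prod.swap pinched_edges)) [0..<12] = [0, 1, 8]"
    "filter (%x. (x, 10) : set (pinched_edges @ map prod.swap pinched_edges)) [0..<12] = [0, 2, 8]"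
    "filter (%x. (x, 11) : set (pinched_edges @ map prod.swap pinched_edges)) [0..<12] = [0, 3, 8]"
    "filter (%x. (x, 8) : set (pinched_edges @ map prod.swap pinched_edges)) [0..<12] = [0, 1, 2, 3, 9, 10, 11]"
    "filter (%x. (x, 1) : set (pinched_edges @ map prod.swap pinched_edges)) [0..<12] = [0, 2, 3, 4, 5, 6, 7, 8, 9]"
    "filter (%x. (x, 2) : set (pinched_edges @ map prod.swap pinched_edges)) [0..<12] = [0, 1, 3, 4, 5, 6, 7, 8, 10]"
    "filter (%x. (x, 3) : set (pinched_edges @ map prod.swap pinched_edges)) [0..<12] = [0, 1, 2, 4, 5, 6, 7, 8, 11]"
    by (code_simp, code_simp, code_simp, code_simp, code_simp, code_simp, code_simp)
  have irr: "y ~: {x. (x, y) : arcs_of ?E}" for y by (auto simp: arcs_of_def)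
  have N': "{x. (x, 9) : arcs_of ?E} = {0, 1, 8}" "{x. (x, 10) : arcs_of ?E} = {0, 2, 8}"
    "{x. (x, 11) : arcs_of ?E} = {0, 3, 8}" "{x. (x, 8) : arcs_of ?E} = {0, 1, 2, 3, 9, 10, 11}"
    "card {x. (x, 1) : arcs_of ?E} = 9" "card {x. (x, 2) : arcs_of ?E} = 9" "card {x. (x, 3) : arcs_of ?E} = 9"
    unfolding nb N by simp_all
  show False
    by (rule corner_system_contradiction[OF sys, of 9 0 8 1 10 2 11 3])
      (use irr[of 0] in \<open>simp_all only: N', auto\<close>)
qed

text \<open>The three maximal ideals of the product of orders 2, 2 and 3, as cliques with 6, 6 and 4
  elements. The numbering is that of \<open>h\<close> in \<open>genus_223\<close>.\<close>

definition three_ideals_edges :: "(nat \<times> nat) list" where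
  "three_ideals_edges = [x \<leftarrow> List.product [0..<10] [0..<10]. fst x < snd x &
     (fst x < 6 & snd x < 6 | fst x : {0, 1, 2, 6, 7, 8} & snd x : {0, 1, 2, 6, 7, 8} |
      fst x : {0, 3, 6, 9} & snd x : {0, 3, 6, 9})]"

text \<open>31 edges on 10 vertices, while the torus allows 30.\<close>

lemma no_three_ideals_graph:
  assumes "g <= 1"
  shows "~ graph_embeds_in {..<10} (edges_of three_ideals_edges) (handle_surface g)"
proof
  assume emb: "graph_embeds_in {..<10} (edges_of three_ideals_edges) (handle_surface g)"
  let ?E = "edges_of three_ideals_edges"
  have wf: "distinct three_ideals_edges" "list_all (%(x, y). x < y) three_ideals_edges" "length three_ideals_edges = 31"
    by (code_simp, code_simp, code_simp)
  note card = edges_of_card[OF wf(1,2)]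
  have md: "min_degree2 ?E" by (rule min_degree2_edges_of[OF wf(2)]) code_simp
  have U: "\<Union>?E = {..<10}" by (rule Union_edges_of) (code_simp, code_simp)
  have "?E ~= {}" using card(1) wf(3) by auto
  then have "card ?E + 6 <= 3 * card (\<Union>?E) + 6 * g"
    using euler_edges[OF emb order_refl _ card(2) _ md] U by simp
  then show False using assms unfolding card(1) wf(3) U by simp
qed

section \<open>Polygonal drawings\<close>

text \<open>The recursion ends with a segment of two points; a final constant path would spoil
  injectivity.\<close>

fun polyline :: "'a::real_normed_vector list => real => 'a" where
  "polyline (a # b # c # l) = linepath a b +++ polyline (b # c # l)"
| "polyline l = linepath (hd l) (last l)"

definition segments :: "'a list => ('a \<times> 'a) list" where
  "segments l = zip l (tl l)"

definition ends :: "'a \<times> 'a => 'a set" where "ends t = {fst t, snd t}"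

definition seg :: "'a::real_normed_vector \<times> 'a => 'a set" where "seg t = closed_segment (fst t) (snd t)"

definition touch :: "'a::real_normed_vector \<times> 'a => 'a \<times> 'a => bool" where
  "touch t t' \<longleftrightarrow> seg t Int seg t' \<subseteq> ends t Int ends t'"

lemma segments_simps: "segments (a # b # l) = (a, b) # segments (b # l)" "segments [a] = []"
  by (simp_all add: segments_def)

lemma ends_segments: "t : set (segments l) ==> ends t \<subseteq> set l"
  by (cases l; cases t) (auto simp: segments_def ends_def dest: set_zip_leftD set_zip_rightD)

lemma Union_ends_segments: "2 <= length l ==> (\<Union>t\<in>set (segments l). ends t) = set l"
proof (induction l rule: induct_list012)
  case (3 a b l)
  then show ?case by (cases l) (auto simp: segments_simps ends_def)
qed simp_all

lemma polyline_arc: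
  assumes "2 <= length l" "distinct l" "sorted_wrt touch (segments l)"
  shows "arc (polyline l) & pathstart (polyline l) = hd l & pathfinish (polyline l) = last l &
    path_image (polyline l) = (\<Union>t\<in>set (segments l). seg t)"
  using assms
proof (induction l rule: polyline.induct)
  case (1 a b c l)
  let ?q = "polyline (b # c # l)"
  have IH: "arc ?q" "pathstart ?q = b" "pathfinish ?q = last (b # c # l)"
    "path_image ?q = (\<Union>t\<in>set (segments (b # c # l)). seg t)"
    using 1 by (simp_all add: segments_simps)
  have "seg (a, b) Int seg t \<subseteq> {b}" if t: "t : set (segments (b # c # l))" for t
  proof -
    have "touch (a, b) t" using 1(4) t unfolding segments_simps(1)[of a b "c # l"] by (simp del: sorted_wrt2)
    moreover have "a ~: ends t" using ends_segments[OF t] 1(3) by auto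
    ultimately show ?thesis unfolding touch_def by (auto simp: ends_def)
  qed
  then have "path_image (linepath a b) Int path_image ?q \<subseteq> {b}" unfolding IH(4) by (auto simp: seg_def)
  moreover have "a ~= b" using 1(3) by simp
  ultimately have "arc (linepath a b +++ ?q)" using IH(1,2) by (intro arc_join) (auto simp: arc_linepath)
  moreover have "path_image (linepath a b +++ ?q) = seg (a, b) Un path_image ?q"
    using IH(2) by (subst path_image_join) (auto simp: seg_def)
  ultimately show ?case using IH by (simp add: segments_simps)
next
  case ("2_3" a b)
  then show ?case by (simp add: arc_linepath segments_def seg_def)
qed simp_all

text \<open>A single pairwise check on the list of all segments covers pairs within one edge as well
  as pairs from different edges.\<close>

lemma sorted_wrt_concat:
  assumes "sorted_wrt R (concat (map F Ds))" "symp R"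
  shows "(ALL d:set Ds. sorted_wrt R (F d)) &
    (ALL d:set Ds. ALL d':set Ds. d ~= d' --> (ALL t:set (F d). ALL t':set (F d'). R t t'))"
  using assms(1)
proof (induction Ds)
  case (Cons d Ds)
  have sym: "R x y \<longleftrightarrow> R y x" for x y using assms(2) by (auto dest: sympD)
  have "sorted_wrt R (F d)" "ALL t:set (F d). ALL d':set Ds. ALL t':set (F d'). R t t'" "sorted_wrt R (concat (map F Ds))"
    using Cons.prems by (auto simp: sorted_wrt_append)
  moreover from this(2) have "ALL d':set Ds. ALL t':set (F d'). ALL t:set (F d). R t' t" using sym by blast
  ultimately show ?case using Cons.IH by simp
qed simp

text \<open>An edge is encoded as \<open>(i, j, bends)\<close>: it runs from point \<open>i\<close>
  through the bends to point \<open>j\<close>.\<close>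

definition track :: "'a list => nat \<times> nat \<times> 'a list => 'a list" where
  "track P d = P ! fst d # snd (snd d) @ [P ! fst (snd d)]"

definition ends_of :: "nat \<times> nat \<times> 'a list => nat \<times> nat" where "ends_of d = (fst d, fst (snd d))"

text \<open>Bends are distinct from one another and from all vertices, so an end point shared by
  segments of different edges is a vertex.\<close>

lemma drawing:
  fixes P :: "'a::real_normed_vector list"
  assumes dist: "distinct (P @ concat (map (%d. snd (snd d)) Ds))"
    and range: "list_all (%d. fst d < fst (snd d) & fst (snd d) < length P) Ds"
    and cover: "list_all (%v. list_ex (%d. v = fst d | v = fst (snd d)) Ds) [0..<length P]"
    and touch: "sorted_wrt touch (concat (map (%d. segments (track P d)) Ds))"
    and S: "list_all (%t. seg t \<subseteq> S) (concat (map (%d. segments (track P d)) Ds))"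
  shows "graph_embeds_in {..<length P} (edges_of (map ends_of Ds)) S"
proof -
  let ?E = "edges_of (map ends_of Ds)"
  have rng: "fst d < length P" "fst (snd d) < length P" "fst d ~= fst (snd d)" if "d : set Ds" for d
    using range that by (auto simp: list_all_iff)
  have symp: "symp touch" by (auto simp: symp_def touch_def)
  note T = conjunct1[OF sorted_wrt_concat[OF touch symp]] conjunct2[OF sorted_wrt_concat[OF touch symp]]
  define f where "f v = (if v < length P then P ! v else undefined)" for v
  have fP: "f v = P ! v" if "v < length P" for v using that by (simp add: f_def)
  have inj: "inj_on f {..<length P}"
    using dist by (auto simp: inj_on_def fP nth_eq_iff_index_eq)
  have inner: "x ~: set P" if "d : set Ds" "x : set (snd (snd d))" for d x
    using dist that by auto
  have inner2: "d = d'" if "d : set Ds" "d' : set Ds" "x : set (snd (snd d))" "x : set (snd (snd d'))" for d d' x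
  proof -
    have "distinct (concat (map (%d. snd (snd d)) Ds))" using dist by simp
    then show ?thesis using that
    proof (induction Ds)
      case (Cons a Ds)
      then show ?case by auto
    qed simp
  qed
  have dd: "distinct (track P d)" if "d : set Ds" for d
  proof -
    have "distinct (snd (snd d))" using dist that by (induction Ds) auto
    moreover have "P ! fst d ~= P ! fst (snd d)" using rng[OF that] dist by (simp add: nth_eq_iff_index_eq)
    moreover have "P ! fst d : set P" "P ! fst (snd d) : set P" using rng[OF that] by simp_all
    ultimately show ?thesis using inner[OF that] unfolding track_def by auto
  qed
  have len: "2 <= length (track P d)" for d :: "nat \<times> nat \<times> 'a list" by (simp add: track_def)
  have arcs: "arc (polyline (track P d))" "pathstart (polyline (track P d)) = P ! fst d"
    "pathfinish (polyline (track P d)) = P ! fst (snd d)"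
    "path_image (polyline (track P d)) = (\<Union>t\<in>set (segments (track P d)). seg t)" if "d : set Ds" for d
    using polyline_arc[OF len dd[OF that]] T(1) that by (simp_all add: track_def)
  \<comment> \<open>There is no separate test of vertices against segments. Every vertex is an end
    of some segment by \<open>cover\<close>, and \<open>touch\<close> with that segment prevents it
    from lying inside another one.\<close>
  have on: "P ! v : ends t & v : {fst d, fst (snd d)}"
    if "v < length P" "d : set Ds" "t : set (segments (track P d))" "P ! v : seg t" for v d t
  proof -
    have *: "v : {fst d, fst (snd d)}" if e: "d : set Ds" "P ! v : set (track P d)" for d
    proof -
      have "P ! v ~: set (snd (snd d))" using inner[OF e(1)] nth_mem[OF \<open>v < length P\<close>] by blast
      then have "P ! v = P ! fst d | P ! v = P ! fst (snd d)" using e(2) by (auto simp: track_def)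
      then show ?thesis using rng[OF e(1)] \<open>v < length P\<close> dist by (auto simp: nth_eq_iff_index_eq)
    qed
    have "list_ex (%d. v = fst d | v = fst (snd d)) Ds" using cover that(1) by (simp add: list_all_iff)
    then obtain d' where d': "d' : set Ds" "v = fst d' | v = fst (snd d')" unfolding list_ex_iff by blast
    show ?thesis
    proof (cases "d' = d")
      case True
      have v: "P ! v : {hd (track P d), last (track P d)}" using d' True by (auto simp: track_def)
      have "P ! v : ends t"
      proof (rule ccontr)
        assume n: "P ! v ~: ends t"
        have "P ! v : set (track P d)" using v by (auto simp: track_def)
        then obtain t' where t': "t' : set (segments (track P d))" "P ! v : ends t'"
          using Union_ends_segments[OF len] by blast
        then have "t' ~= t" using n by blast
        moreover have "P ! v : seg t'" using t'(2) by (auto simp: ends_def seg_def)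
        moreover have "touch t t' | touch t' t"
          using sorted_wrt_iff_nth_less[of touch "segments (track P d)"] T(1) that(2,3) t'(1) \<open>t' ~= t\<close>
          by (metis in_set_conv_nth linorder_neqE_nat)
        ultimately show False using n that(4) unfolding touch_def by blast
      qed
      then show ?thesis using *[OF that(2)] ends_segments[OF that(3)] by blast
    next
      case False
      have "P ! v : set (track P d')" using d'(2) by (auto simp: track_def)
      then obtain t' where t': "t' : set (segments (track P d'))" "P ! v : ends t'"
        using Union_ends_segments[OF len] by blast
      have "P ! v : seg t'" using t'(2) by (auto simp: ends_def seg_def)
      moreover have "touch t t'" by (rule T(2)[rule_format, OF that(2) d'(1) False[symmetric] that(3) t'(1)])
      ultimately have "P ! v : ends t" using that(4) unfolding touch_def by blast
      then show ?thesis using *[OF that(2)] ends_segments[OF that(3)] by blast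
    qed
  qed
  define pick where "pick e = (SOME d. d : set Ds & {fst d, fst (snd d)} = e)" for e
  have pick: "pick e : set Ds" "{fst (pick e), fst (snd (pick e))} = e" if "e : ?E" for e
  proof -
    have "EX d. d : set Ds & {fst d, fst (snd d)} = e"
      using that by (force simp: edges_of_def ends_of_def)
    then have "pick e : set Ds & {fst (pick e), fst (snd (pick e))} = e" unfolding pick_def by (rule someI_ex)
    then show "pick e : set Ds" "{fst (pick e), fst (snd (pick e))} = e" by auto
  qed
  define \<gamma> where "\<gamma> e = polyline (track P (pick e))" for e
  have fe: "f ` e = {P ! fst (pick e), P ! fst (snd (pick e))}" if "e : ?E" for e
  proof -
    have "f ` e = f ` {fst (pick e), fst (snd (pick e))}" by (simp only: pick(2)[OF that])
    then show ?thesis using fP rng[OF pick(1)[OF that]] by simp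
  qed
  have ends_in: "f ` e \<subseteq> path_image (\<gamma> e)" if "e : ?E" for e
    using fe[OF that] arcs(2,3)[OF pick(1)[OF that]] pathstart_in_path_image[of "\<gamma> e"] pathfinish_in_path_image[of "\<gamma> e"]
    unfolding \<gamma>_def by simp
  have eV: "e \<subseteq> {..<length P}" if "e : ?E" for e
  proof -
    have "{fst (pick e), fst (snd (pick e))} \<subseteq> {..<length P}" using rng[OF pick(1)[OF that]] by simp
    then show ?thesis by (simp only: pick(2)[OF that])
  qed
  have segS: "path_image (\<gamma> e) \<subseteq> S" if "e : ?E" for e
    using S pick(1)[OF that] arcs(4)[OF pick(1)[OF that]] by (auto simp: \<gamma>_def list_all_iff)
  have fV: "path_image (\<gamma> e) Int f ` {..<length P} = f ` e" if ee: "e : ?E" for e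
  proof
    show "path_image (\<gamma> e) Int f ` {..<length P} \<subseteq> f ` e"
    proof
      fix x assume "x : path_image (\<gamma> e) Int f ` {..<length P}"
      then obtain v t where "v < length P" "x = P ! v" "t : set (segments (track P (pick e)))" "P ! v : seg t"
        using arcs(4)[OF pick(1)[OF ee]] fP by (auto simp: \<gamma>_def)
      then show "x : f ` e" using on[OF _ pick(1)[OF ee], of v t] fe[OF ee] by blast
    qed
  qed (use ends_in[OF ee] eV[OF ee] in blast)
  have cross: "path_image (\<gamma> e) Int path_image (\<gamma> e') = f ` (e Int e')" if e: "e : ?E" "e' : ?E" "e ~= e'" for e e'
  proof
    show "path_image (\<gamma> e) Int path_image (\<gamma> e') \<subseteq> f ` (e Int e')"
    proof
      fix x assume x: "x : path_image (\<gamma> e) Int path_image (\<gamma> e')"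
      let ?d = "pick e" and ?d' = "pick e'"
      have ne: "?d ~= ?d'" using pick(2)[OF e(1)] pick(2)[OF e(2)] e(3) by metis
      obtain t t' where t: "t : set (segments (track P ?d))" "t' : set (segments (track P ?d'))" "x : seg t" "x : seg t'"
        using x arcs(4)[OF pick(1)[OF e(1)]] arcs(4)[OF pick(1)[OF e(2)]] by (auto simp: \<gamma>_def)
      then have "touch t t'" by (intro T(2)[rule_format, OF pick(1)[OF e(1)] pick(1)[OF e(2)] ne])
      then have "x : ends t" "x : ends t'" using t unfolding touch_def by blast+
      then have xt: "x : set (track P ?d)" "x : set (track P ?d')"
        using ends_segments[OF t(1)] ends_segments[OF t(2)] by blast+
      have "x : set P"
      proof (rule ccontr)
        assume n: "x ~: set P"
        then have "x : set (snd (snd ?d))" "x : set (snd (snd ?d'))"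
          using xt rng[OF pick(1)[OF e(1)]] rng[OF pick(1)[OF e(2)]] by (auto simp: track_def)
        then show False using inner2[OF pick(1)[OF e(1)] pick(1)[OF e(2)]] ne by blast
      qed
      then obtain v where v: "v < length P" "x = P ! v" by (metis in_set_conv_nth)
      have "v : {fst ?d, fst (snd ?d)}" "v : {fst ?d', fst (snd ?d')}"
        using on[OF v(1) pick(1)[OF e(1)] t(1)] on[OF v(1) pick(1)[OF e(2)] t(2)] t(3,4) v(2) by blast+
      then have "v : e Int e'" using pick(2)[OF e(1)] pick(2)[OF e(2)] by blast
      then show "x : f ` (e Int e')" using v fP[OF v(1)] by (metis imageI)
    qed
  qed (use ends_in[OF e(1)] ends_in[OF e(2)] in auto)
  have fS: "f ` {..<length P} \<subseteq> S"
  proof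
    fix x assume "x : f ` {..<length P}"
    then obtain v where v: "v < length P" "x = f v" by auto
    have "list_ex (%d. v = fst d | v = fst (snd d)) Ds" using cover v by (simp add: list_all_iff)
    then obtain d where d: "d : set Ds" "v = fst d | v = fst (snd d)" unfolding list_ex_iff by blast
    then have "{fst d, fst (snd d)} : ?E" by (auto simp: edges_of_def ends_of_def image_iff)
    then show "x : S" using ends_in segS v d(2) by blast
  qed
  show ?thesis
    unfolding graph_embeds_in_def
  proof (intro exI[of _ f] exI[of _ \<gamma>] conjI ballI impI inj fS)
    fix e assume e: "e : ?E"
    show "arc (\<gamma> e)" "path_image (\<gamma> e) \<subseteq> S" "{pathstart (\<gamma> e), pathfinish (\<gamma> e)} = f ` e"
      "path_image (\<gamma> e) Int f ` {..<length P} = f ` e"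
      using arcs[OF pick(1)[OF e]] segS[OF e] fV[OF e] fe[OF e] by (simp_all add: \<gamma>_def)
  qed (use cross in blast)
qed

section \<open>Integer certificates for drawings\<close>

type_synonym ipoint = "int \<times> int \<times> int"

definition scaled :: "int => ipoint => real \<times> real \<times> real" where
  "scaled U p = (case p of (x, y, z) => (x / U, y / U, z / U))"

definition idiff :: "ipoint => ipoint => ipoint" where
  "idiff p q = (case p of (x, y, z) => case q of (x', y', z') => (x - x', y - y', z - z'))"

definition idot :: "ipoint => ipoint => int" where
  "idot p q = (case p of (x, y, z) => case q of (x', y', z') => x * x' + y * y' + z * z')"

definition icross :: "ipoint => ipoint => ipoint" where
  "icross p q = (case p of (x, y, z) => case q of (x', y', z') =>
     (y * z' - z * y', z * x' - x * z', x * y' - y * x'))"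

definition apart :: "int => int => int => int => bool" where
  "apart a b c d \<longleftrightarrow> a < c & a < d & b < c & b < d | c < a & c < b & d < a & d < b"

definition separates :: "ipoint => ipoint \<times> ipoint => ipoint \<times> ipoint => bool" where
  "separates n s t \<longleftrightarrow> apart (idot n (fst s)) (idot n (snd s)) (idot n (fst t)) (idot n (snd t))"

text \<open>Two segments from a common point meet elsewhere only if they leave in the same
  direction. A nonzero cross product or a negative inner product excludes this.\<close>

definition hinged :: "ipoint => ipoint => ipoint => ipoint => bool" where
  "hinged p a q b \<longleftrightarrow> p = q &
     (idot (idiff a p) (idiff b p) < 0 | icross (idiff a p) (idiff b p) ~= (0, 0, 0))"

text \<open>The coordinate directions are tried first, being cheapest. The list of normals is only a
  supply of candidates: separation along any direction proves the segments disjoint.\<close>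

definition touch_check :: "ipoint \<times> ipoint => ipoint \<times> ipoint => bool" where
  "touch_check s t \<longleftrightarrow>
     (case s of ((a, b, c), (d, e, f)) => case t of ((a', b', c'), (d', e', f')) =>
        apart a d a' d' | apart b e b' e' | apart c f c' f') |
     (case s of (p, a) => case t of (q, b) =>
        hinged p a q b | hinged a p q b | hinged p a b q | hinged a p b q |
        (let u = idiff a p; v = idiff b q in
          list_ex (%n. separates n s t) [icross u v, icross u (1, 0, 0), icross u (0, 1, 0), icross u (0, 0, 1),
            icross v (1, 0, 0), icross v (0, 1, 0), icross v (0, 0, 1)]))"

lemma separated_segments:
  fixes a b c d m :: "'a::real_inner"
  assumes "m \<bullet> a < m \<bullet> c" "m \<bullet> a < m \<bullet> d" "m \<bullet> b < m \<bullet> c" "m \<bullet> b < m \<bullet> d"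
  shows "closed_segment a b Int closed_segment c d = {}"
proof -
  let ?k = "max (m \<bullet> a) (m \<bullet> b)"
  have "closed_segment a b \<subseteq> {x. m \<bullet> x <= ?k}"
    by (intro closed_segment_subset) (auto simp: convex_halfspace_le)
  moreover have "closed_segment c d \<subseteq> {x. m \<bullet> x > ?k}"
    by (intro closed_segment_subset) (use assms in \<open>simp_all only: convex_halfspace_gt, auto\<close>)
  ultimately show ?thesis by fastforce
qed

lemma separates_sound:
  assumes "0 < U" "separates n (p, a) (q, b)"
  shows "closed_segment (scaled U p) (scaled U a) Int closed_segment (scaled U q) (scaled U b) = {}"
proof -
  let ?m = "scaled 1 n"
  have dot: "?m \<bullet> scaled U r = idot n r / U" for r
    using assms(1) by (cases n; cases r) (simp add: scaled_def idot_def inner_prod_def add_divide_distrib)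
  have lt: "?m \<bullet> scaled U r < ?m \<bullet> scaled U r' \<longleftrightarrow> idot n r < idot n r'" for r r'
    unfolding dot using assms(1) by (simp add: divide_strict_right_mono divide_less_cancel)
  from assms(2) show ?thesis
    unfolding separates_def apart_def fst_conv snd_conv
  proof (elim disjE conjE)
    assume "idot n q < idot n p" "idot n q < idot n a" "idot n b < idot n p" "idot n b < idot n a"
    then have "closed_segment (scaled U q) (scaled U b) Int closed_segment (scaled U p) (scaled U a) = {}"
      by (intro separated_segments[of ?m]) (simp_all only: lt)
    then show ?thesis by blast
  qed (intro separated_segments[of ?m], simp_all only: lt)
qed

lemma hinged_sound:
  assumes U: "0 < U" and h: "hinged p a q b"
  shows "closed_segment (scaled U p) (scaled U a) Int closed_segment (scaled U q) (scaled U b) \<subseteq> {scaled U p} & p = q"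
proof -
  obtain p1 p2 p3 a1 a2 a3 b1 b2 b3 where c: "p = (p1, p2, p3)" "a = (a1, a2, a3)" "b = (b1, b2, b3)"
    by (cases p, cases a, cases b) blast
  define u1 u2 u3 v1 v2 v3 where uv: "u1 = a1 - p1" "u2 = a2 - p2" "u3 = a3 - p3" "v1 = b1 - p1" "v2 = b2 - p2" "v3 = b3 - p3"
  have pq: "p = q" and ne: "u1 * v1 + u2 * v2 + u3 * v3 < 0 | u2 * v3 - u3 * v2 ~= 0 | u3 * v1 - u1 * v3 ~= 0 | u1 * v2 - u2 * v1 ~= 0"
    using h unfolding hinged_def c uv by (auto simp: icross_def idiff_def idot_def)
  have "x = scaled U p"
    if x: "x : closed_segment (scaled U p) (scaled U a)" "x : closed_segment (scaled U p) (scaled U b)" for x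
  proof -
    obtain s t where st: "0 <= s" "0 <= t" and s: "x = (1 - s) *\<^sub>R scaled U p + s *\<^sub>R scaled U a" "x = (1 - t) *\<^sub>R scaled U p + t *\<^sub>R scaled U b"
      using x unfolding closed_segment_def by blast
    have "(1 - s) *\<^sub>R scaled U p + s *\<^sub>R scaled U a = (1 - t) *\<^sub>R scaled U p + t *\<^sub>R scaled U b"
      using s by simp
    then have e: "s * real_of_int u1 = t * real_of_int v1" "s * real_of_int u2 = t * real_of_int v2" "s * real_of_int u3 = t * real_of_int v3"
      using U unfolding c uv by (simp_all add: scaled_def field_simps)
    have z: "s * (real_of_int w * real_of_int v' - real_of_int w' * real_of_int v) = 0"
      if "s * real_of_int w = t * real_of_int v" "s * real_of_int w' = t * real_of_int v'" for w w' v v'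
    proof -
      have "s * (real_of_int w * real_of_int v' - real_of_int w' * real_of_int v)
          = (s * real_of_int w) * real_of_int v' - (s * real_of_int w') * real_of_int v" by (simp add: algebra_simps)
      then show ?thesis unfolding that by (simp add: algebra_simps)
    qed
    have "s = 0"
    proof -
      have nz: "real_of_int w * real_of_int v' - real_of_int w' * real_of_int v ~= 0" if "w * v' - w' * v ~= 0" for w v w' v'
        using that by (metis of_int_diff of_int_eq_0_iff of_int_mult)
      show ?thesis using ne
      proof (elim disjE)
        assume "u1 * v1 + u2 * v2 + u3 * v3 < 0"
        then have neg: "real_of_int (u1 * v1 + u2 * v2 + u3 * v3) < 0" by (simp only: of_int_less_0_iff)
        have "s * real_of_int (u1 * v1 + u2 * v2 + u3 * v3)
            = (s * u1) * v1 + (s * u2) * v2 + (s * u3) * v3" by (simp add: algebra_simps)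
        also have "\<dots> = t * (real_of_int v1 ^ 2 + real_of_int v2 ^ 2 + real_of_int v3 ^ 2)"
          unfolding e by (simp add: algebra_simps power2_eq_square)
        also have "\<dots> >= 0" using st(2) by simp
        finally show ?thesis using neg st(1) by (simp add: zero_le_mult_iff)
      next
        assume "u2 * v3 - u3 * v2 ~= 0"
        then show ?thesis using z[OF e(2,3)] nz[of u2 v3 u3 v2] by simp
      next
        assume "u3 * v1 - u1 * v3 ~= 0"
        then show ?thesis using z[OF e(3,1)] nz[of u3 v1 u1 v3] by simp
      next
        assume "u1 * v2 - u2 * v1 ~= 0"
        then show ?thesis using z[OF e(1,2)] nz[of u1 v2 u2 v1] by simp
      qed
    qed
    then show ?thesis using s(1) by simp
  qed
  then show ?thesis using pq by blast
qed

lemma touch_check_sound: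
  assumes U: "0 < U" and t: "touch_check s t"
  shows "touch (map_prod (scaled U) (scaled U) s) (map_prod (scaled U) (scaled U) t)"
proof -
  obtain p a q b where c: "s = (p, a)" "t = (q, b)" by (cases s, cases t) blast
  let ?r = "scaled U"
  have goal: "touch (map_prod ?r ?r s) (map_prod ?r ?r t) \<longleftrightarrow>
      closed_segment (?r p) (?r a) Int closed_segment (?r q) (?r b) \<subseteq> {?r p, ?r a} Int {?r q, ?r b}"
    by (simp add: touch_def c seg_def ends_def)
  have ax: "separates (1, 0, 0) s t | separates (0, 1, 0) s t | separates (0, 0, 1) s t"
    if "case s of ((a, b, c), (d, e, f)) => case t of ((a', b', c'), (d', e', f')) =>
        apart a d a' d' | apart b e b' e' | apart c f c' f'"
    using that by (auto simp: separates_def idot_def split: prod.splits)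
  consider n where "separates n (p, a) (q, b)"
    | "hinged p a q b" | "hinged a p q b" | "hinged p a b q" | "hinged a p b q"
    using t ax unfolding touch_check_def c Let_def list_ex_iff case_prod_conv by blast
  then show ?thesis
  proof cases
    case 1
    then show ?thesis unfolding goal using separates_sound[OF U] by blast
  next
    case 2
    then show ?thesis unfolding goal using hinged_sound[OF U, of p a q b] by auto
  next
    case 3
    then show ?thesis unfolding goal using hinged_sound[OF U, of a p q b] by (auto simp: closed_segment_commute)
  next
    case 4
    then show ?thesis unfolding goal using hinged_sound[OF U, of p a b q] by (auto simp: closed_segment_commute)
  next
    case 5
    then show ?thesis unfolding goal using hinged_sound[OF U, of a p b q] by (auto simp: closed_segment_commute)
  qed
qed

definition slab :: "int => int => int => int => int => bool" where
  "slab U l h a b \<longleftrightarrow> l * U <= a & l * U <= b & a <= h * U & b <= h * U"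

text \<open>The first four conjuncts place the segment in the body, the last one on its boundary: on
  an outer plane, or in a closed tunnel, where a point of the body is on the wall.\<close>

definition surface_check :: "int => nat => ipoint \<times> ipoint => bool" where
  "surface_check U g s = (case s of ((x, y, z), (x', y', z')) =>
     slab U 0 (2 * int g + 1) x x' & slab U 0 3 y y' & slab U 0 1 z z' &
     (slab U 0 1 y y' | slab U 2 3 y y' | list_ex (%i. slab U (2 * int i) (2 * int i + 1) x x') [0..<Suc g]) &
     (slab U 0 0 z z' | slab U 1 1 z z' | slab U 0 0 y y' | slab U 3 3 y y' |
      slab U 0 0 x x' | slab U (2 * int g + 1) (2 * int g + 1) x x' |
      slab U 1 2 y y' & list_ex (%i. slab U (2 * int i + 1) (2 * int i + 2) x x') [0..<g]))"

lemma convex_slices: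
  "convex {p :: real \<times> real \<times> real. l <= fst p & fst p <= h}"
  "convex {p :: real \<times> real \<times> real. l <= fst (snd p) & fst (snd p) <= h}"
  "convex {p :: real \<times> real \<times> real. l <= snd (snd p) & snd (snd p) <= h}"
proof -
  have 1: "{p :: real \<times> real \<times> real. l <= fst p & fst p <= h} = {l..h} \<times> UNIV" by auto
  have 2: "{p :: real \<times> real \<times> real. l <= fst (snd p) & fst (snd p) <= h} = UNIV \<times> {l..h} \<times> UNIV" by auto
  have 3: "{p :: real \<times> real \<times> real. l <= snd (snd p) & snd (snd p) <= h} = UNIV \<times> UNIV \<times> {l..h}" by auto
  show "convex {p :: real \<times> real \<times> real. l <= fst p & fst p <= h}"
    "convex {p :: real \<times> real \<times> real. l <= fst (snd p) & fst (snd p) <= h}"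
    "convex {p :: real \<times> real \<times> real. l <= snd (snd p) & snd (snd p) <= h}"
    unfolding 1 2 3 by (intro convex_Times convex_UNIV convex_real_interval)+
qed

lemma slab_segment:
  assumes U: "0 < U" and p: "(X, Y, Z) : closed_segment (scaled U (x, y, z)) (scaled U (x', y', z'))"
  shows "slab U l h x x' ==> l <= X & X <= h"
    "slab U l h y y' ==> l <= Y & Y <= h"
    "slab U l h z z' ==> l <= Z & Z <= h"
proof -
  have U': "0 < real_of_int U" using U by simp
  have b: "real_of_int l <= a / U & a / U <= real_of_int h & real_of_int l <= b / U & b / U <= real_of_int h"
    if "slab U l h a b" for a b
    using that unfolding slab_def pos_le_divide_eq[OF U'] pos_divide_le_eq[OF U'] by (metis of_int_le_iff of_int_mult)
  have sub: "(X, Y, Z) : S" if "convex S" "scaled U (x, y, z) : S" "scaled U (x', y', z') : S" for S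
    using closed_segment_subset[OF that(2,3,1)] p by blast
  show "l <= X & X <= h" if "slab U l h x x'"
    using sub[OF convex_slices(1)[of l h]] b[OF that] by (simp add: scaled_def)
  show "l <= Y & Y <= h" if "slab U l h y y'"
    using sub[OF convex_slices(2)[of l h]] b[OF that] by (simp add: scaled_def)
  show "l <= Z & Z <= h" if "slab U l h z z'"
    using sub[OF convex_slices(3)[of l h]] b[OF that] by (simp add: scaled_def)
qed

lemma rim_in_surface:
  assumes H: "p : handlebody g" and T: "p : closure T" "T Int handlebody g = {}"
  shows "p : handle_surface g"
proof -
  have "p : closure (handlebody g)" using H closure_subset by blast
  moreover have "p : closure (- handlebody g)" using T closure_mono[of T "- handlebody g"] by blast
  ultimately show ?thesis by (simp add: handle_surface_def frontier_closures)
qed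

lemma surface_check_sound:
  assumes U: "0 < U" and b: "surface_check U g s"
  shows "seg (map_prod (scaled U) (scaled U) s) \<subseteq> handle_surface g"
proof
  fix p assume pin: "p : seg (map_prod (scaled U) (scaled U) s)"
  obtain x y z x' y' z' where s: "s = ((x, y, z), (x', y', z'))" by (metis prod_cases3 surj_pair)
  obtain X Y Z where P: "p = (X, Y, Z)" by (metis prod_cases3)
  have p: "(X, Y, Z) : closed_segment (scaled U (x, y, z)) (scaled U (x', y', z'))"
    using pin by (simp add: seg_def s P)
  note w = slab_segment[OF U p]
  have X: "0 <= X" "X <= 2 * real g + 1" and Y: "0 <= Y" "Y <= 3" and Z: "0 <= Z" "Z <= 1"
    using b w(1)[of 0 "2 * int g + 1"] w(2)[of 0 3] w(3)[of 0 1] by (auto simp: surface_check_def s)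
  have "slab U 0 1 y y' | slab U 2 3 y y' | (EX i. slab U (2 * int i) (2 * int i + 1) x x')"
    using b unfolding surface_check_def s list_ex_iff by auto
  then have col: "Y <= 1 | 2 <= Y | (EX i. 2 * real i <= X & X <= 2 * real i + 1)"
    using w(2)[of 0 1] w(2)[of 2 3] w(1)[of "2 * int i" "2 * int i + 1" for i] by force
  have "~(2 * real i + 1 < X & X < 2 * real i + 2 & 1 < Y & Y < 2)" for i
  proof
    assume a: "2 * real i + 1 < X & X < 2 * real i + 2 & 1 < Y & Y < 2"
    then obtain j where j: "2 * real j <= X" "X <= 2 * real j + 1" using col by force
    then have "real i < real j" "real j < real i + 1" using a by linarith+
    then have "i < j" "j < i + 1" by linarith+
    then show False by simp
  qed
  then have H: "p : handlebody g" unfolding handlebody_def P using X Y Z by force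
  have T: "p : handle_surface g" if "p : closure T" "T Int handlebody g = {}" for T
    by (rule rim_in_surface[OF H that])
  have "slab U 0 0 z z' | slab U 1 1 z z' | slab U 0 0 y y' | slab U 3 3 y y' |
      slab U 0 0 x x' | slab U (2 * int g + 1) (2 * int g + 1) x x' |
      slab U 1 2 y y' & (EX i<g. slab U (2 * int i + 1) (2 * int i + 2) x x')"
    using b unfolding surface_check_def s list_ex_iff by auto
  moreover have q: "slab U 0 0 z z' ==> Z = 0" "slab U 1 1 z z' ==> Z = 1" "slab U 0 0 y y' ==> Y = 0"
    "slab U 3 3 y y' ==> Y = 3" "slab U 0 0 x x' ==> X = 0"
    "slab U (2 * int g + 1) (2 * int g + 1) x x' ==> X = 2 * real g + 1"
    "slab U 1 2 y y' ==> 1 <= Y & Y <= 2"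
    "slab U (2 * int i + 1) (2 * int i + 2) x x' ==> 2 * real i + 1 <= X & X <= 2 * real i + 2" for i
    using w(3)[of 0 0] w(3)[of 1 1] w(2)[of 0 0] w(2)[of 3 3] w(1)[of 0 0] w(1)[of "2 * int g + 1" "2 * int g + 1"]
      w(2)[of 1 2] w(1)[of "2 * int i + 1" "2 * int i + 2"] by simp_all
  ultimately consider "Z = 0" | "Z = 1" | "Y = 0" | "Y = 3" | "X = 0" | "X = 2 * real g + 1"
    | i where "i < g" "1 <= Y" "Y <= 2" "2 * real i + 1 <= X" "X <= 2 * real i + 2"
    by blast
  then show "p : handle_surface g"
  proof cases
    case 1
    then show ?thesis by (intro T[of "UNIV \<times> UNIV \<times> {..<0}"]) (auto simp: closure_Times P handlebody_def)
  next
    case 2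
    then show ?thesis by (intro T[of "UNIV \<times> UNIV \<times> {1<..}"]) (auto simp: closure_Times P handlebody_def)
  next
    case 3
    then show ?thesis by (intro T[of "UNIV \<times> {..<0} \<times> UNIV"]) (auto simp: closure_Times P handlebody_def)
  next
    case 4
    then show ?thesis by (intro T[of "UNIV \<times> {3<..} \<times> UNIV"]) (auto simp: closure_Times P handlebody_def)
  next
    case 5
    then show ?thesis by (intro T[of "{..<0} \<times> UNIV \<times> UNIV"]) (auto simp: closure_Times P handlebody_def)
  next
    case 6
    then show ?thesis
      by (intro T[of "{2 * real g + 1<..} \<times> UNIV \<times> UNIV"]) (auto simp: closure_Times P handlebody_def)
  next
    case (7 i)
    then show ?thesis
      by (intro T[of "{2 * real i + 1<..<2 * real i + 2} \<times> {1<..<2} \<times> UNIV"])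
        (auto simp: closure_Times P handlebody_def)
  qed
qed

lemma inj_scaled: "0 < U ==> inj (scaled U)"
  by (auto simp: inj_def scaled_def)

definition drawing_check :: "int => nat => ipoint list => (nat \<times> nat \<times> ipoint list) list => bool" where
  "drawing_check U g P Ds \<longleftrightarrow>
     distinct (P @ concat (map (%d. snd (snd d)) Ds)) &
     list_all (%d. fst d < fst (snd d) & fst (snd d) < length P) Ds &
     list_all (%v. list_ex (%d. v = fst d | v = fst (snd d)) Ds) [0..<length P] &
     list_all (surface_check U g) (concat (map (%d. segments (track P d)) Ds)) &
     sorted_wrt touch_check (concat (map (%d. segments (track P d)) Ds))"

lemma drawing_check_sound:
  assumes U: "0 < U" and c: "drawing_check U g P Ds"
  shows "graph_embeds_in {..<length P} (edges_of (map ends_of Ds)) (handle_surface g)"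
proof -
  let ?r = "scaled U"
  define P' where "P' = map ?r P"
  define Ds' where "Ds' = map (%d. (fst d, fst (snd d), map ?r (snd (snd d)))) Ds"
  note C = c[unfolded drawing_check_def]
  have r: "fst d < length P" "fst (snd d) < length P" if "d : set Ds" for d
    using C that by (auto simp: list_all_iff)
  have segm: "segments (map f l) = map (map_prod f f) (segments l)" for f :: "ipoint => real \<times> real \<times> real" and l
    by (simp add: segments_def zip_map_map map_tl[symmetric] map_prod_def)
  have tr: "map (%d. segments (track P' d)) Ds' = map (%d. map (map_prod ?r ?r) (segments (track P d))) Ds"
    unfolding Ds'_def map_map comp_def
  proof (rule map_cong[OF refl])
    fix d assume d: "d : set Ds"
    have "track P' (fst d, fst (snd d), map ?r (snd (snd d))) = map ?r (track P d)"
      using r[OF d] by (simp add: track_def P'_def)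
    then show "segments (track P' (fst d, fst (snd d), map ?r (snd (snd d)))) = map (map_prod ?r ?r) (segments (track P d))"
      by (simp only: segm)
  qed
  have cc: "concat (map (%d. segments (track P' d)) Ds') = map (map_prod ?r ?r) (concat (map (%d. segments (track P d)) Ds))"
    unfolding tr map_concat by (simp add: comp_def)
  have e: "map ends_of Ds' = map ends_of Ds" by (simp add: Ds'_def ends_of_def comp_def)
  have len: "length P' = length P" by (simp add: P'_def)
  have pts: "P' @ concat (map (%d. snd (snd d)) Ds') = map ?r (P @ concat (map (%d. snd (snd d)) Ds))"
    by (simp add: P'_def Ds'_def map_concat comp_def)
  show ?thesis unfolding e[symmetric] len[symmetric]
  proof (rule drawing)
    show "distinct (P' @ concat (map (%d. snd (snd d)) Ds'))"
      unfolding pts distinct_map using C inj_on_subset[OF inj_scaled[OF U]] by blast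
    show "list_all (%d. fst d < fst (snd d) & fst (snd d) < length P') Ds'"
      using C by (simp add: Ds'_def list_all_iff len)
    show "list_all (%v. list_ex (%d. v = fst d | v = fst (snd d)) Ds') [0..<length P']"
      using C by (simp add: Ds'_def list_all_iff list_ex_iff len)
    show "sorted_wrt touch (concat (map (%d. segments (track P' d)) Ds'))"
      unfolding cc sorted_wrt_map
      by (rule sorted_wrt_mono_rel[of _ touch_check]) (use C touch_check_sound[OF U] in auto)
    show "list_all (%t. seg t \<subseteq> handle_surface g) (concat (map (%d. segments (track P' d)) Ds'))"
      unfolding cc using C surface_check_sound[OF U] by (auto simp: list_all_iff)
  qed
qed

section \<open>Explicit drawings on one and two handles\<close>

text \<open>One graph for two families. \<open>K_n\<close> with a \<open>K_4\<close> attached at 0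
  holds a field with at most \<open>n\<close> elements times one with at most 4; \<open>K_n\<close>
  with 0 and 1 joined to \<open>n\<close> and \<open>n + 1\<close> holds a field times a nonfield of
  order four.\<close>

definition tailed_clique_edges :: "nat => (nat \<times> nat) list" where
  "tailed_clique_edges n = [a \<leftarrow> List.product [0..<n + 3] [0..<n + 3]. fst a < snd a &
     (snd a < n | fst a = 0 | n <= fst a | fst a = 1 & snd a < n + 2)]"

text \<open>Coordinates are in units of \<open>1/24\<close>, so the tunnel extends from 24 to 48 in
  the first two directions. The later drawings use 40 and 48 units.\<close>

definition seven_points :: "ipoint list" where
  "seven_points = [(24, 36, 12), (72, 60, 12), (12, 72, 12), (36, 24, 12), (0, 36, 12), (60, 36, 24), (0, 60, 12), (12, 0, 12), (36, 0, 12), (60, 36, 0)]"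

definition seven_arcs :: "(nat \<times> nat \<times> ipoint list) list" where
  "seven_arcs = [
    (0, 1, [(24, 24, 8), (48, 24, 10), (48, 48, 4), (44, 48, 0), (72, 54, 0)]),
    (0, 2, [(24, 44, 0), (12, 72, 0)]),
    (0, 3, [(24, 24, 12)]),
    (0, 4, [(24, 36, 0), (0, 36, 0)]),
    (0, 5, [(24, 32, 0), (0, 12, 0), (0, 12, 24), (24, 6, 24), (64, 24, 24)]),
    (0, 6, [(24, 40, 0), (0, 60, 0)]),
    (0, 7, [(24, 28, 0), (8, 0, 0)]),
    (0, 8, [(24, 24, 6), (48, 24, 6), (48, 40, 0), (66, 42, 0), (64, 0, 0)]),
    (0, 9, [(24, 24, 4), (48, 24, 4), (48, 32, 0)]),
    (1, 2, [(72, 72, 12)]),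
    (1, 3, [(72, 60, 0), (42, 48, 0), (48, 48, 6), (48, 24, 14)]),
    (1, 4, [(72, 66, 0), (38, 48, 0), (48, 48, 10), (48, 24, 18), (36, 24, 24), (24, 18, 24), (0, 38, 24)]),
    (1, 5, [(72, 56, 24)]),
    (1, 6, [(72, 64, 24), (0, 66, 24)]),
    (1, 7, [(72, 12, 24), (12, 0, 24)]),
    (1, 8, [(72, 0, 12)]),
    (2, 3, [(30, 72, 0), (28, 48, 0), (24, 48, 8), (24, 33, 15), (24, 24, 16)]),
    (2, 4, [(42, 72, 0), (34, 48, 0), (48, 48, 14), (48, 24, 20), (42, 24, 24), (24, 14, 24), (0, 34, 24)]),
    (2, 5, [(36, 72, 0), (30, 48, 0), (48, 48, 18), (48, 32, 24)]),
    (2, 6, [(0, 72, 12)]),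
    (3, 4, [(30, 24, 24), (20, 24, 24), (0, 44, 24)]),
    (3, 5, [(24, 24, 18), (24, 48, 16), (48, 48, 20), (48, 40, 24)]),
    (3, 6, [(24, 24, 20), (24, 36, 24), (0, 54, 24)]),
    (4, 5, [(0, 28, 24), (24, 10, 24), (56, 24, 24)]),
    (4, 6, []),
    (5, 6, [(48, 56, 24), (0, 60, 24)]),
    (7, 8, []),
    (7, 9, [(16, 0, 0), (54, 24, 0)]),
    (8, 9, [(56, 0, 0)])]"

lemma seven_embeds: "graph_embeds_in {..<10} (edges_of (tailed_clique_edges 7)) (handle_surface 1)"
proof -
  have "drawing_check 24 1 seven_points seven_arcs" by code_simp
  then have "graph_embeds_in {..<length seven_points} (edges_of (map ends_of seven_arcs)) (handle_surface 1)"
    by (rule drawing_check_sound[rotated]) simp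
  moreover have "length seven_points = 10" "map ends_of seven_arcs = (tailed_clique_edges 7)" by (code_simp, code_simp)
  ultimately show ?thesis by simp
qed

definition three_ideals_points :: "ipoint list" where
  "three_ideals_points = [(60, 20, 0), (20, 20, 40), (100, 60, 40), (60, 20, 40), (0, 60, 20), (20, 60, 40), (140, 0, 20), (100, 60, 0), (180, 120, 20), (60, 40, 20)]"

definition three_ideals_arcs :: "(nat \<times> nat \<times> ipoint list) list" where
  "three_ideals_arcs = [
    (0, 1, [(100, 40, 0), (120, 66, 0), (120, 74, 40), (80, 74, 40), (80, 80, 30), (40, 80, 34), (40, 74, 40)]),
    (0, 2, [(80, 6, 0), (120, 60, 0), (120, 68, 40)]),
    (0, 3, [(50, 40, 0), (60, 40, 40)]),
    (0, 4, [(20, 40, 0), (0, 50, 0)]),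
    (0, 5, [(96, 40, 0), (120, 74, 0), (120, 80, 20), (130, 80, 40), (26, 80, 40)]),
    (0, 6, [(70, 40, 0), (80, 40, 20), (80, 46, 40), (96, 0, 40)]),
    (0, 7, [(84, 40, 0)]),
    (0, 8, [(90, 40, 0), (110, 70, 0), (110, 120, 0)]),
    (0, 9, [(60, 40, 0)]),
    (1, 2, [(40, 66, 40), (40, 80, 26), (80, 80, 20), (80, 66, 40)]),
    (1, 3, []),
    (1, 4, [(0, 20, 40)]),
    (1, 5, []),
    (1, 6, [(40, 46, 40), (40, 80, 6), (54, 80, 0), (60, 120, 0), (140, 120, 40), (150, 80, 40), (160, 80, 26), (160, 40, 30), (140, 40, 40), (140, 0, 40)]),
    (1, 7, [(40, 60, 40), (40, 80, 20), (80, 80, 10), (80, 70, 0)]),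
    (1, 8, [(40, 54, 40), (40, 80, 14), (66, 80, 0), (90, 120, 0)]),
    (2, 3, [(120, 58, 40), (120, 46, 0), (106, 0, 0), (54, 0, 40)]),
    (2, 4, [(120, 62, 40), (120, 54, 0), (94, 0, 0), (0, 0, 20)]),
    (2, 5, [(120, 46, 40), (120, 40, 26), (160, 40, 20), (160, 80, 14), (140, 80, 40), (40, 106, 40), (14, 80, 40)]),
    (2, 6, [(112, 0, 40)]),
    (2, 7, [(80, 60, 40), (80, 60, 0)]),
    (2, 8, [(120, 52, 40), (120, 40, 14), (160, 40, 10), (160, 60, 0), (180, 120, 0)]),
    (3, 4, [(54, 40, 40), (40, 40, 14), (40, 54, 0), (0, 60, 0)]),
    (3, 5, [(46, 40, 40), (40, 40, 26), (40, 66, 0), (0, 70, 0), (0, 66, 40)]),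
    (3, 6, [(66, 0, 40)]),
    (3, 9, [(66, 40, 40)]),
    (4, 5, [(0, 54, 40)]),
    (6, 7, [(104, 0, 40), (80, 54, 40), (80, 50, 0)]),
    (6, 8, [(180, 0, 40), (180, 120, 40)]),
    (6, 9, [(88, 0, 40), (74, 40, 40)]),
    (7, 8, [(100, 120, 0)])]"

lemma three_ideals_embeds: "graph_embeds_in {..<10} (edges_of three_ideals_edges) (handle_surface 2)"
proof -
  have "drawing_check 40 2 three_ideals_points three_ideals_arcs" by code_simp
  then have "graph_embeds_in {..<length three_ideals_points} (edges_of (map ends_of three_ideals_arcs)) (handle_surface 2)"
    by (rule drawing_check_sound[rotated]) simp
  moreover have "length three_ideals_points = 10" "map ends_of three_ideals_arcs = three_ideals_edges" by (code_simp, code_simp)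
  ultimately show ?thesis by simp
qed

definition eight_points :: "ipoint list" where
  "eight_points = [(20, 0, 20), (120, 60, 20), (180, 0, 20), (140, 100, 0), (40, 60, 20), (140, 0, 20), (100, 120, 20), (200, 20, 20), (160, 60, 20), (60, 40, 20), (20, 20, 0)]"

definition eight_arcs :: "(nat \<times> nat \<times> ipoint list) list" where
  "eight_arcs = [
    (0, 1, [(0, 0, 14), (0, 54, 0), (40, 54, 0), (40, 40, 14), (70, 40, 30), (80, 40, 26), (80, 54, 0), (120, 56, 0)]),
    (0, 2, [(0, 0, 26), (0, 66, 0), (40, 66, 0), (40, 40, 26), (60, 40, 40), (70, 0, 40), (106, 0, 0), (160, 18, 0), (180, 0, 0)]),
    (0, 3, [(94, 0, 0), (170, 40, 0), (160, 88, 0)]),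
    (0, 4, [(30, 0, 40), (20, 40, 40), (40, 70, 40)]),
    (0, 5, [(88, 0, 0), (152, 40, 0), (160, 40, 6), (160, 70, 10), (160, 50, 40), (160, 30, 40), (136, 0, 40)]),
    (0, 6, [(10, 0, 40), (14, 80, 40), (40, 106, 40), (100, 120, 40)]),
    (0, 7, [(20, 0, 40), (14, 40, 40), (40, 94, 40), (200, 106, 40)]),
    (0, 8, [(84, 0, 0), (144, 40, 0), (160, 40, 14)]),
    (0, 9, [(14, 0, 0), (10, 30, 0), (50, 40, 0)]),
    (0, 10, [(26, 0, 0)]),
    (1, 2, [(120, 64, 0), (80, 60, 0), (80, 46, 40), (88, 0, 40), (112, 0, 0), (160, 12, 0), (174, 0, 0)]),
    (1, 3, [(120, 80, 14), (134, 80, 0)]),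
    (1, 4, [(120, 60, 40), (80, 74, 40), (80, 80, 26), (40, 80, 24)]),
    (1, 5, [(120, 40, 26), (140, 40, 40), (128, 0, 40)]),
    (1, 6, [(120, 72, 0), (104, 120, 0)]),
    (1, 7, [(120, 80, 26), (160, 80, 26), (160, 70, 40), (200, 60, 40)]),
    (1, 8, [(120, 40, 14), (160, 40, 34)]),
    (1, 9, [(120, 48, 0), (80, 46, 0), (80, 40, 14)]),
    (2, 3, [(194, 0, 0), (190, 80, 0)]),
    (2, 4, [(186, 0, 0), (160, 22, 0), (102, 0, 0), (60, 0, 40), (34, 40, 40), (40, 50, 40)]),
    (2, 5, []),
    (2, 6, [(116, 0, 0), (96, 0, 40), (80, 54, 40), (80, 66, 0), (96, 120, 0)]),
    (2, 7, [(200, 0, 20)]),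
    (3, 4, [(180, 80, 0), (180, 40, 0), (98, 0, 0), (50, 0, 40), (26, 40, 40), (40, 60, 40)]),
    (3, 5, [(146, 80, 0), (160, 80, 14), (160, 60, 40), (186, 40, 40), (144, 0, 40)]),
    (3, 6, [(112, 120, 0)]),
    (3, 7, [(200, 100, 0)]),
    (4, 5, [(40, 80, 16), (80, 80, 14), (80, 66, 40), (112, 0, 40)]),
    (4, 6, [(40, 80, 8), (60, 80, 0), (60, 120, 0)]),
    (4, 7, [(40, 80, 32), (60, 80, 40), (200, 94, 40)]),
    (5, 6, [(104, 0, 40), (80, 60, 40), (80, 74, 0), (88, 120, 0)]),
    (5, 7, [(152, 0, 40), (200, 20, 40)]),
    (6, 7, [(200, 120, 20)]),
    (8, 9, [(160, 40, 26), (128, 40, 0), (70, 40, 0)]),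
    (8, 10, [(160, 40, 20), (136, 40, 0)]),
    (9, 10, [(60, 40, 0)])]"

lemma eight_embeds: "graph_embeds_in {..<11} (edges_of (tailed_clique_edges 8)) (handle_surface 2)"
proof -
  have "drawing_check 40 2 eight_points eight_arcs" by code_simp
  then have "graph_embeds_in {..<length eight_points} (edges_of (map ends_of eight_arcs)) (handle_surface 2)"
    by (rule drawing_check_sound[rotated]) simp
  moreover have "length eight_points = 11" "map ends_of eight_arcs = (tailed_clique_edges 8)" by (code_simp, code_simp)
  ultimately show ?thesis by simp
qed

text \<open>Two copies of \<open>K_7\<close> sharing the vertex 0. They accommodate all products of
  two fields with at most seven elements each.\<close>

definition two_sevens_edges :: "(nat \<times> nat) list" where
  "two_sevens_edges = [a \<leftarrow> List.product [0..<13] [0..<13]. fst a < snd a &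
     (snd a < 7 | 7 <= fst a | fst a = 0)]"

definition two_sevens_points :: "ipoint list" where
  "two_sevens_points = [(72, 120, 0), (120, 72, 48), (24, 144, 24), (24, 120, 48), (72, 0, 24), (120, 24, 48), (72, 24, 48), (216, 144, 24), (120, 72, 0), (120, 144, 24), (216, 72, 0), (72, 144, 24), (168, 144, 24)]"

definition two_sevens_arcs :: "(nat \<times> nat \<times> ipoint list) list" where
  "two_sevens_arcs = [
    (0, 1, [(60, 144, 0), (60, 144, 48), (128, 96, 48)]),
    (0, 2, [(34, 144, 0)]),
    (0, 3, [(42, 144, 0), (32, 144, 48)]),
    (0, 4, [(80, 96, 0), (96, 96, 8), (96, 48, 12), (68, 48, 48), (68, 0, 48)]),
    (0, 5, [(106, 96, 0), (102, 48, 0), (128, 0, 0), (134, 0, 48)]),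
    (0, 6, [(64, 96, 0), (96, 96, 16), (96, 48, 24), (76, 48, 48)]),
    (0, 7, [(116, 96, 0), (110, 48, 0), (136, 0, 0), (154, 0, 48), (154, 48, 48), (144, 48, 44), (144, 96, 42), (160, 96, 48), (216, 144, 48)]),
    (0, 8, [(134, 96, 0)]),
    (0, 9, [(124, 96, 0), (114, 66, 0), (144, 10, 0), (156, 0, 0), (164, 0, 48), (164, 48, 48), (144, 48, 38), (144, 96, 36), (168, 96, 0), (120, 144, 0)]),
    (0, 10, [(152, 96, 0), (144, 96, 12), (144, 48, 20), (192, 48, 32), (192, 68, 48), (240, 68, 48), (240, 68, 0)]),
    (0, 11, [(72, 144, 0)]),
    (0, 12, [(148, 96, 0), (144, 96, 6), (144, 48, 14), (192, 48, 24), (192, 96, 20), (184, 96, 0), (168, 144, 0)]),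
    (1, 2, [(96, 64, 48), (96, 96, 32), (48, 96, 24), (48, 72, 0), (20, 144, 0)]),
    (1, 3, [(96, 106, 48)]),
    (1, 4, [(96, 80, 48), (96, 96, 40), (48, 96, 36), (48, 80, 48), (28, 0, 48)]),
    (1, 5, []),
    (1, 6, [(96, 32, 48)]),
    (2, 3, [(16, 144, 48)]),
    (2, 4, [(14, 144, 0), (48, 60, 0), (48, 64, 48), (38, 0, 48)]),
    (2, 5, [(6, 144, 0), (32, 48, 0), (112, 0, 0), (116, 0, 48)]),
    (2, 6, [(28, 144, 0), (48, 84, 0), (48, 96, 12), (96, 96, 24), (96, 48, 36), (86, 48, 48)]),
    (3, 4, [(20, 0, 48)]),
    (3, 5, [(0, 72, 48), (0, 72, 0), (48, 16, 0), (104, 0, 0), (106, 0, 48)]),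
    (3, 6, [(10, 0, 48), (84, 0, 12), (86, 0, 48)]),
    (4, 5, [(58, 0, 48), (58, 48, 48), (72, 48, 0), (120, 0, 0), (124, 0, 48)]),
    (4, 6, [(76, 0, 48)]),
    (5, 6, []),
    (7, 8, [(208, 144, 0), (192, 72, 0), (192, 48, 8), (144, 48, 4), (144, 64, 0)]),
    (7, 9, [(228, 144, 48), (176, 96, 48), (172, 96, 0), (128, 144, 0)]),
    (7, 10, [(224, 144, 0)]),
    (7, 11, [(204, 144, 48), (144, 112, 48), (72, 144, 48)]),
    (7, 12, []),
    (8, 9, [(124, 48, 0), (168, 0, 0), (172, 0, 48), (172, 48, 48), (144, 48, 34), (144, 96, 30), (164, 96, 0), (112, 144, 0)]),
    (8, 10, [(144, 38, 0), (216, 48, 0)]),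
    (8, 11, [(144, 28, 0), (180, 0, 0), (182, 0, 48), (182, 48, 48), (144, 48, 28), (144, 96, 24), (160, 96, 0), (104, 144, 0)]),
    (8, 12, [(144, 80, 0), (144, 48, 10), (192, 48, 16), (192, 96, 10), (188, 96, 0), (180, 144, 0)]),
    (9, 10, [(136, 144, 0), (176, 96, 0), (192, 96, 38), (192, 86, 48), (240, 86, 48), (240, 86, 0)]),
    (9, 11, []),
    (9, 12, []),
    (10, 11, [(240, 58, 0), (240, 58, 48), (192, 58, 48), (192, 48, 40), (144, 48, 24), (144, 96, 18), (156, 96, 0), (84, 144, 0)]),
    (10, 12, [(240, 76, 0), (240, 76, 48), (192, 76, 48), (192, 96, 28), (180, 96, 0), (156, 144, 0)]),
    (11, 12, [(84, 144, 48)])]"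

lemma two_sevens_embeds: "graph_embeds_in {..<13} (edges_of two_sevens_edges) (handle_surface 2)"
proof -
  have "drawing_check 48 2 two_sevens_points two_sevens_arcs" by code_simp
  then have "graph_embeds_in {..<length two_sevens_points} (edges_of (map ends_of two_sevens_arcs)) (handle_surface 2)"
    by (rule drawing_check_sound[rotated]) simp
  moreover have "length two_sevens_points = 13" "map ends_of two_sevens_arcs = two_sevens_edges" by (code_simp, code_simp)
  ultimately show ?thesis by simp
qed

section \<open>The upper ideal relation graph\<close>

text \<open>Adjacency freed from ideals and from distinctness of the ends, which makes it compatible
  with direct products (\<open>common_RDirProd\<close>).\<close>

definition common :: "('a, 'm) ring_scheme => 'a => 'a => bool" where
  "common R x y \<longleftrightarrow> (EX z:nonunits R. EX r:carrier R. EX s:carrier R. x = z \<otimes>\<^bsub>R\<^esub> r & y = z \<otimes>\<^bsub>R\<^esub> s)"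

text \<open>The spectrum is connected. For finite nontrivial rings this implies being local
  (\<open>connected_local\<close>).\<close>

definition connected_ring :: "('a, 'm) ring_scheme => bool" where
  "connected_ring R \<longleftrightarrow> (ALL e:carrier R. e \<otimes>\<^bsub>R\<^esub> e = e --> e = \<zero>\<^bsub>R\<^esub> | e = \<one>\<^bsub>R\<^esub>)"

text \<open>The ideal generated by an idempotent \<open>e\<close>, as a ring with unity
  \<open>e\<close>. It stays on the type of \<open>R\<close>, so that a factor can be split again by
  the same lemma.\<close>

definition corner_ring :: "('a, 'm) ring_scheme => 'a => ('a, 'm) ring_scheme" where
  "corner_ring R e = R\<lparr>carrier := (%x. e \<otimes>\<^bsub>R\<^esub> x) ` carrier R, one := e\<rparr>"

context cring begin

lemma nonunitsD: "x : nonunits R ==> x : carrier R" "x : nonunits R ==> x ~: Units R"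
  by (auto simp: nonunits_def)

lemma Units_iff: "x : Units R \<longleftrightarrow> x : carrier R & (EX y:carrier R. x \<otimes> y = \<one>)"
  unfolding Units_def using m_comm by auto

lemma nonunit_mult:
  assumes "z : nonunits R" "r : carrier R"
  shows "z \<otimes> r : nonunits R"
proof -
  have "z \<otimes> r ~: Units R"
  proof
    assume "z \<otimes> r : Units R"
    then obtain y where "y : carrier R" "z \<otimes> r \<otimes> y = \<one>" using Units_iff by blast
    then have "z : Units R" using assms nonunitsD(1) Units_iff[of z] m_assoc[of z r y] by auto
    then show False using assms nonunitsD by blast
  qed
  then show ?thesis using assms nonunitsD(1) unfolding nonunits_def by simp
qed

lemma commonD: "common R x y ==> x : nonunits R & y : nonunits R"
  unfolding common_def using nonunit_mult by blast

lemma common_carrier: "common R x y ==> x : carrier R & y : carrier R"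
  using commonD nonunitsD by blast

lemma commonI:
  assumes "z : nonunits R" "r : carrier R" "s : carrier R"
  shows "common R (z \<otimes> r) (z \<otimes> s)"
  using assms unfolding common_def by blast

lemma zero_nonunit: "\<one> ~= \<zero> ==> \<zero> : nonunits R"
  unfolding nonunits_def Units_def by auto

lemma Idl_subset_iff:
  assumes "x : carrier R" "z : carrier R"
  shows "Idl {x} \<subseteq> Idl {z} \<longleftrightarrow> (EX r:carrier R. x = z \<otimes> r)"
proof -
  have "Idl {x} \<subseteq> Idl {z} \<longleftrightarrow> x : Idl {z}"
    using genideal_self'[OF assms(1)] genideal_minimal[OF genideal_ideal, of "{z}" "{x}"] assms by auto
  also have "\<dots> \<longleftrightarrow> (EX r:carrier R. x = z \<otimes> r)"
    using assms m_comm unfolding cgenideal_eq_genideal[OF assms(2), symmetric] cgenideal_def by auto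
  finally show ?thesis .
qed

lemma edges_common: "upper_ideal_edges R = {{x, y} | x y. x ~= y & common R x y}"
proof -
  have "(x : nonunits R & y : nonunits R & x ~= y &
        (EX z:nonunits R. Idl {x} \<subseteq> Idl {z} & Idl {y} \<subseteq> Idl {z})) \<longleftrightarrow> x ~= y & common R x y" for x y
  proof
    assume a: "x ~= y & common R x y"
    then have "x : nonunits R" "y : nonunits R" using commonD by blast+
    moreover have "EX z:nonunits R. Idl {x} \<subseteq> Idl {z} & Idl {y} \<subseteq> Idl {z}"
      using a calculation nonunitsD(1) unfolding common_def by (metis Idl_subset_iff)
    ultimately show "x : nonunits R & y : nonunits R & x ~= y &
        (EX z:nonunits R. Idl {x} \<subseteq> Idl {z} & Idl {y} \<subseteq> Idl {z})" using a by blast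
  next
    assume a: "x : nonunits R & y : nonunits R & x ~= y &
        (EX z:nonunits R. Idl {x} \<subseteq> Idl {z} & Idl {y} \<subseteq> Idl {z})"
    then obtain z where z: "z : nonunits R" "Idl {x} \<subseteq> Idl {z}" "Idl {y} \<subseteq> Idl {z}" by blast
    have "x : carrier R" "y : carrier R" "z : carrier R" using a z(1) nonunitsD(1) by auto
    then have "EX r:carrier R. x = z \<otimes> r" "EX r:carrier R. y = z \<otimes> r"
      using z(2,3) by (simp_all add: Idl_subset_iff)
    then show "x ~= y & common R x y" using a z(1) unfolding common_def by blast
  qed
  then show ?thesis unfolding upper_ideal_edges_def by simp
qed

lemma clique_edges:
  assumes "!!x y. x : C ==> y : C ==> common R x y"
  shows "clique C \<subseteq> upper_ideal_edges R" "C \<subseteq> nonunits R"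
proof -
  show "clique C \<subseteq> upper_ideal_edges R"
  proof
    fix d assume "d : clique C"
    then have d: "d \<subseteq> C" "card d = 2" by (simp_all add: clique_def)
    obtain x y where "d = {x, y}" "x ~= y" using d(2) by (meson card_2_iff)
    then show "d : upper_ideal_edges R" using assms[of x y] d(1) unfolding edges_common by auto
  qed
  show "C \<subseteq> nonunits R" using assms commonD by blast
qed

section \<open>Idempotents in finite rings\<close>

lemma idempotent_power:
  assumes fin: "finite (carrier R)" and x: "x : carrier R"
  obtains n :: nat where "0 < n" "x [^] n \<otimes> x [^] n = x [^] n"
proof -
  have "~ inj_on (%n::nat. x [^] n) UNIV"
  proof
    assume "inj_on (%n::nat. x [^] n) UNIV"
    moreover have "range (%n::nat. x [^] n) \<subseteq> carrier R" using x by auto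
    ultimately show False using fin by (meson finite_imageD finite_subset infinite_UNIV_nat)
  qed
  then obtain i j :: nat where ij: "i < j" "x [^] i = x [^] j"
    unfolding inj_on_def by (metis linorder_neqE_nat)
  define p where "p = j - i"
  have p: "0 < p" "x [^] (i + p) = x [^] i" using ij by (auto simp: p_def)
  have step: "x [^] (m + p) = x [^] m" if m: "i <= m" for m
  proof -
    have "x [^] (m + p) = x [^] (m - i) \<otimes> x [^] (i + p)" using x m by (simp add: nat_pow_mult)
    also have "\<dots> = x [^] (m - i) \<otimes> x [^] i" by (simp add: p(2))
    also have "\<dots> = x [^] m" using x m by (simp add: nat_pow_mult)
    finally show ?thesis .
  qed
  have steps: "x [^] (m + k * p) = x [^] m" if m: "i <= m" for m k
  proof (induction k)
    case (Suc k)
    have "m + Suc k * p = (m + k * p) + p" by simp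
    then have "x [^] (m + Suc k * p) = x [^] (m + k * p + p)" by (simp add: ac_simps)
    also have "\<dots> = x [^] (m + k * p)" using step[of "m + k * p"] m by simp
    finally show ?case using Suc by simp
  qed simp
  \<comment> \<open>From exponent \<open>i\<close> on the powers have period \<open>p\<close>. This
    multiple of \<open>p\<close> is at least \<open>i\<close>, so doubling the exponent changes
    nothing.\<close>
  define n where "n = Suc i * p"
  have "Suc i * 1 <= Suc i * p" using p(1) by (intro mult_le_mono) auto
  then have n: "i <= n" "0 < n" using p(1) by (simp_all only: n_def, simp_all)
  have "x [^] n \<otimes> x [^] n = x [^] (n + Suc i * p)" using x by (simp add: nat_pow_mult n_def)
  also have "\<dots> = x [^] n" by (rule steps[OF n(1)])
  finally show ?thesis using n(2) that by blast
qed

lemma injective_mult_unit: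
  assumes fin: "finite (carrier R)" and x: "x : carrier R"
    and inj: "!!s. s : carrier R ==> x \<otimes> s = \<zero> ==> s = \<zero>"
  shows "x : Units R"
proof -
  have "inj_on (%s. x \<otimes> s) (carrier R)"
  proof (rule inj_onI)
    fix s t assume st: "s : carrier R" "t : carrier R" "x \<otimes> s = x \<otimes> t"
    have "x \<otimes> (s \<ominus> t) = x \<otimes> s \<ominus> x \<otimes> t" using x st by algebra
    also have "\<dots> = \<zero>" unfolding st(3) using x st(2) by algebra
    finally have "s \<ominus> t = \<zero>" using inj st by simp
    then show "s = t" using st by simp
  qed
  then have "(%s. x \<otimes> s) ` carrier R = carrier R"
    using fin x by (intro endo_inj_surj) auto
  then obtain s where "s : carrier R" "x \<otimes> s = \<one>" by (metis imageE one_closed)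
  then show ?thesis using x Units_iff by blast
qed

end

lemma (in cring) corner_simps:
  "carrier (corner_ring R e) = (%x. e \<otimes> x) ` carrier R" "\<one>\<^bsub>corner_ring R e\<^esub> = e" "\<zero>\<^bsub>corner_ring R e\<^esub> = \<zero>"
  "x \<otimes>\<^bsub>corner_ring R e\<^esub> y = x \<otimes> y" "x \<oplus>\<^bsub>corner_ring R e\<^esub> y = x \<oplus> y"
  by (simp_all add: corner_ring_def)

context cring begin

context
  fixes e assumes e: "e : carrier R" "e \<otimes> e = e"
begin

lemma corner_carrier: "carrier (corner_ring R e) = {x : carrier R. e \<otimes> x = x}"
proof -
  have "e \<otimes> (e \<otimes> x) = e \<otimes> x" if "x : carrier R" for x
    using that e by (simp add: m_assoc[symmetric])
  then show ?thesis unfolding corner_simps using e(1) by (auto simp: image_iff) metis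
qed

lemma corner_cring: "cring (corner_ring R e)"
proof (rule cringI)
  have neg: "\<ominus> x : carrier R & e \<otimes> (\<ominus> x) = \<ominus> x" if "x : carrier R" "e \<otimes> x = x" for x
    using that e by (simp add: r_minus)
  show "abelian_group (corner_ring R e)"
  proof (rule abelian_groupI)
    fix x assume "x : carrier (corner_ring R e)"
    then have x: "x : carrier R" "e \<otimes> x = x" by (simp_all add: corner_carrier)
    have "\<ominus> x \<oplus> x = \<zero>" using x by (simp add: l_neg)
    then show "EX y:carrier (corner_ring R e). y \<oplus>\<^bsub>corner_ring R e\<^esub> x = \<zero>\<^bsub>corner_ring R e\<^esub>"
      using neg[OF x] by (auto simp: corner_carrier corner_simps(2-))
  qed (use e in \<open>auto simp: corner_carrier corner_simps(2-) r_distr a_ac\<close>)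
  show "Group.comm_monoid (corner_ring R e)"
  proof (rule comm_monoidI)
    fix x y assume "x : carrier (corner_ring R e)" "y : carrier (corner_ring R e)"
    then have xy: "x : carrier R" "e \<otimes> x = x" "y : carrier R" by (simp_all add: corner_carrier)
    have "e \<otimes> (x \<otimes> y) = x \<otimes> y" using xy e(1) by (simp add: m_assoc[symmetric])
    then show "x \<otimes>\<^bsub>corner_ring R e\<^esub> y : carrier (corner_ring R e)"
      using xy by (simp add: corner_carrier corner_simps(2-))
  qed (use e in \<open>auto simp: corner_carrier corner_simps(2-) m_ac\<close>)
qed (auto simp: corner_carrier corner_simps(2-) l_distr)

lemma idempotent_compl: "\<one> \<ominus> e : carrier R" "(\<one> \<ominus> e) \<otimes> (\<one> \<ominus> e) = \<one> \<ominus> e" "e \<otimes> (\<one> \<ominus> e) = \<zero>" "(\<one> \<ominus> e) \<otimes> e = \<zero>"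
proof -
  show c: "\<one> \<ominus> e : carrier R" using e by simp
  have "e \<otimes> (\<one> \<ominus> e) = e \<ominus> e \<otimes> e" using e(1) by algebra
  also have "\<dots> = \<zero>" unfolding e(2) using e(1) by simp
  finally show z: "e \<otimes> (\<one> \<ominus> e) = \<zero>" .
  then show "(\<one> \<ominus> e) \<otimes> e = \<zero>" using e(1) c by (simp add: m_comm)
  have "(\<one> \<ominus> e) \<otimes> (\<one> \<ominus> e) = (\<one> \<ominus> e) \<ominus> e \<otimes> (\<one> \<ominus> e)" using e(1) by algebra
  then show "(\<one> \<ominus> e) \<otimes> (\<one> \<ominus> e) = \<one> \<ominus> e" unfolding z using c by (simp add: a_minus_def)
qed

end

text \<open>The decomposition of \<open>x\<close> into \<open>e x\<close> and
  \<open>(1 - e) x\<close>, inverted by addition.\<close>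

lemma corner_iso:
  assumes e: "e : carrier R" "e \<otimes> e = e"
  shows "R \<simeq> RDirProd (corner_ring R e) (corner_ring R (\<one> \<ominus> e))"
proof -
  define f where "f = \<one> \<ominus> e"
  note f = idempotent_compl[OF e, folded f_def]
  have ef: "e \<oplus> f = \<one>" using e(1) unfolding f_def by algebra
  have cf: "carrier (corner_ring R f) = {x : carrier R. f \<otimes> x = x}" by (rule corner_carrier[OF f(1,2)])
  let ?h = "%x. (e \<otimes> x, f \<otimes> x)"
  have idem: "g \<otimes> (x \<otimes> y) = g \<otimes> x \<otimes> (g \<otimes> y)" if g: "g : carrier R" "g \<otimes> g = g" "x : carrier R" "y : carrier R" for g x y
  proof -
    have "g \<otimes> x \<otimes> (g \<otimes> y) = (g \<otimes> g) \<otimes> (x \<otimes> y)" using g(1,3,4) by (simp add: m_ac)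
    then show ?thesis using g(2) by simp
  qed
  have "?h : ring_iso R (RDirProd (corner_ring R e) (corner_ring R f))"
  proof (rule ring_iso_memI)
    show "bij_betw ?h (carrier R) (carrier (RDirProd (corner_ring R e) (corner_ring R f)))"
    proof (rule bij_betwI[where g = "%(a, b). a \<oplus> b"])
      show "?h : carrier R \<rightarrow> carrier (RDirProd (corner_ring R e) (corner_ring R f))"
        by (auto simp: RDirProd_carrier corner_simps(1))
      show "(%(a, b). a \<oplus> b) : carrier (RDirProd (corner_ring R e) (corner_ring R f)) \<rightarrow> carrier R"
        by (auto simp: RDirProd_carrier corner_carrier[OF e] cf)
      show "(%(a, b). a \<oplus> b) (?h x) = x" if x: "x : carrier R" for x
        using x e(1) f(1) ef by (simp add: l_distr[symmetric])
      show "?h ((%(a, b). a \<oplus> b) p) = p" if p: "p : carrier (RDirProd (corner_ring R e) (corner_ring R f))" for p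
      proof -
        obtain a b where ab: "p = (a, b)" "a : carrier R" "e \<otimes> a = a" "b : carrier R" "f \<otimes> b = b"
          using p by (auto simp: RDirProd_carrier corner_carrier[OF e] cf)
        have "e \<otimes> b = e \<otimes> f \<otimes> b" using ab(4,5) e(1) f(1) by (simp add: m_assoc)
        then have eb: "e \<otimes> b = \<zero>" using f(3) ab(4) by simp
        have "f \<otimes> a = f \<otimes> e \<otimes> a" using ab(2,3) e(1) f(1) by (simp add: m_assoc)
        then have fa: "f \<otimes> a = \<zero>" using f(4) ab(2) by simp
        show ?thesis using ab e(1) f(1) eb fa by (simp add: r_distr)
      qed
    qed
  qed (use e f in \<open>auto simp: RDirProd_def DirProd_def monoid.defs corner_simps idem r_distr\<close>)
  then show ?thesis unfolding is_ring_iso_def f_def by blast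
qed

text \<open>Some positive power is idempotent, hence zero or one, and it is not one since
  \<open>x\<close> is no unit.\<close>

lemma nonunit_nilpotent:
  assumes fin: "finite (carrier R)" and conn: "connected_ring R" and x: "x : nonunits R"
  obtains n :: nat where "x [^] n = \<zero>"
proof -
  have xc: "x : carrier R" using x nonunitsD by blast
  obtain n :: nat where n: "0 < n" "x [^] n \<otimes> x [^] n = x [^] n" using idempotent_power[OF fin xc] by blast
  have "x [^] n = \<zero> | x [^] n = \<one>" using n(2) conn xc unfolding connected_ring_def by simp
  moreover have "x [^] n ~= \<one>"
  proof
    assume "x [^] n = \<one>"
    moreover obtain m where "n = Suc m" using n(1) gr0_implies_Suc by blast
    ultimately have "x \<otimes> x [^] m = \<one>" using xc by (simp add: m_comm)
    then have "x : Units R" using xc Units_iff by blast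
    then show False using x nonunitsD by blast
  qed
  ultimately show ?thesis using that by blast
qed

text \<open>If \<open>(1 - t) s\<close> vanishes then \<open>s = t s = t^n s\<close>, which is zero
  for nilpotent \<open>t\<close>. In a finite ring an element that annihilates only zero is a
  unit.\<close>

lemma one_minus_unit:
  assumes fin: "finite (carrier R)" and conn: "connected_ring R" and t: "t : nonunits R"
  shows "\<one> \<ominus> t : Units R"
proof (rule injective_mult_unit[OF fin])
  have tc: "t : carrier R" using t nonunitsD by blast
  then show "\<one> \<ominus> t : carrier R" by simp
  obtain n :: nat where n: "t [^] n = \<zero>" by (rule nonunit_nilpotent[OF fin conn t])
  fix s assume s: "s : carrier R" "(\<one> \<ominus> t) \<otimes> s = \<zero>"
  have "(\<one> \<ominus> t) \<otimes> s = s \<ominus> t \<otimes> s" using tc s(1) by algebra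
  then have "s \<ominus> t \<otimes> s = \<zero>" using s(2) by simp
  then have st: "s = t \<otimes> s" using s(1) tc by simp
  have "s = t [^] k \<otimes> s" for k :: nat
  proof (induction k)
    case (Suc k)
    have "t [^] Suc k \<otimes> s = t [^] k \<otimes> (t \<otimes> s)" using tc s(1) by (simp add: m_assoc)
    then show ?case using Suc st by simp
  qed (use s in simp)
  from this[of n] show "s = \<zero>" using n s(1) by simp
qed

lemma nonunits_add:
  assumes fin: "finite (carrier R)" and conn: "connected_ring R"
    and x: "x : nonunits R" and y: "y : nonunits R"
  shows "x \<oplus> y : nonunits R"
proof (rule ccontr)
  have c: "x : carrier R" "y : carrier R" using x y nonunitsD by blast+
  assume "x \<oplus> y ~: nonunits R"
  then have "x \<oplus> y : Units R" using c unfolding nonunits_def by simp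
  then obtain u where u: "u : carrier R" "(x \<oplus> y) \<otimes> u = \<one>" using Units_iff by blast
  have yu: "y \<otimes> u : nonunits R" by (rule nonunit_mult[OF y u(1)])
  have "x \<otimes> u = (x \<oplus> y) \<otimes> u \<ominus> y \<otimes> u" using c u(1) by algebra
  also have "\<dots> = \<one> \<ominus> y \<otimes> u" by (simp add: u(2))
  finally have "x \<otimes> u : Units R" using one_minus_unit[OF fin conn yu] by simp
  then show False using nonunit_mult[OF x u(1)] nonunitsD by blast
qed

lemma nonunits_ideal:
  assumes fin: "finite (carrier R)" and conn: "connected_ring R" and nz: "\<one> ~= \<zero>"
  shows "ideal (nonunits R) R"
proof (rule idealI[OF ring_axioms])
  show "subgroup (nonunits R) (add_monoid R)"
  proof (rule add.subgroupI)
    show "nonunits R \<subseteq> carrier R" using nonunitsD by blast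
    show "nonunits R ~= {}" using zero_nonunit[OF nz] by blast
    show "\<ominus> a : nonunits R" if "a : nonunits R" for a
    proof -
      have "\<ominus> a = a \<otimes> \<ominus> \<one>" using that nonunitsD(1) by (simp add: r_minus)
      then show ?thesis using nonunit_mult[OF that, of "\<ominus> \<one>"] by simp
    qed
    show "a \<oplus> b : nonunits R" if "a : nonunits R" "b : nonunits R" for a b
      by (rule nonunits_add[OF fin conn that])
  qed
  show "x \<otimes> a : nonunits R" "a \<otimes> x : nonunits R" if "a : nonunits R" "x : carrier R" for a x
    using nonunit_mult[OF that] that nonunitsD(1) m_comm by (metis)+
qed

text \<open>The nonunits form an ideal, which contains every proper ideal. Contraposition yields the
  nontrivial idempotent of a nonlocal ring.\<close>

lemma connected_local:
  assumes fin: "finite (carrier R)" and conn: "connected_ring R" and nz: "\<one> ~= \<zero>"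
  shows "local_ring R"
proof -
  note I = nonunits_ideal[OF fin conn nz]
  have proper: "J \<subseteq> nonunits R" if J: "ideal J R" "J ~= carrier R" for J
  proof
    fix x assume x: "x : J"
    have xc: "x : carrier R" using ideal.Icarr[OF J(1) x] .
    have "x ~: Units R"
    proof
      assume "x : Units R"
      then obtain y where y: "y : carrier R" "x \<otimes> y = \<one>" using Units_iff by blast
      then have "\<one> : J" using ideal.I_r_closed[OF J(1) x y(1)] by simp
      then show False using J ideal.one_imp_carrier by blast
    qed
    then show "x : nonunits R" using xc unfolding nonunits_def by simp
  qed
  have one: "\<one> ~: nonunits R" using Units_one_closed nonunitsD by blast
  have "maximalideal (nonunits R) R"
  proof (rule maximalidealI[OF I])
    show "carrier R ~= nonunits R" using one one_closed by blast
    show "J = nonunits R | J = carrier R" if "ideal J R" "nonunits R \<subseteq> J" "J \<subseteq> carrier R" for J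
      using proper[OF that(1)] that(2) by blast
  qed
  moreover have "M = nonunits R" if M: "maximalideal M R" for M
  proof -
    have M': "ideal M R" "M ~= carrier R" using M maximalideal.axioms(1) maximalideal.I_notcarr by blast+
    have "nonunits R = M | nonunits R = carrier R"
      by (rule maximalideal.I_maximal[OF M I proper[OF M']]) (use nonunitsD in blast)
    then show ?thesis using one one_closed by blast
  qed
  ultimately show ?thesis unfolding local_ring_def by blast
qed

end

lemma ring_iso_Units:
  assumes R: "cring R" and S: "cring S" and h: "h : ring_iso R S" and x: "x : carrier R"
  shows "h x : Units S \<longleftrightarrow> x : Units R"
proof
  interpret R: cring R by (rule R)
  interpret S: cring S by (rule S)
  note m = ring_iso_memE[OF h]
  show "h x : Units S" if u: "x : Units R"
  proof -
    obtain y where y: "y : carrier R" "x \<otimes>\<^bsub>R\<^esub> y = \<one>\<^bsub>R\<^esub>" using u R.Units_iff by blast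
    have "h x \<otimes>\<^bsub>S\<^esub> h y = \<one>\<^bsub>S\<^esub>" "h y : carrier S" using m(2)[OF x y(1)] y(2) m(4) m(1)[OF y(1)] by simp_all
    then show ?thesis using m(1)[OF x] S.Units_iff by blast
  qed
  show "x : Units R" if u: "h x : Units S"
  proof -
    obtain t where t: "t : carrier S" "h x \<otimes>\<^bsub>S\<^esub> t = \<one>\<^bsub>S\<^esub>" using u S.Units_iff by blast
    obtain y where y: "y : carrier R" "t = h y" using t(1) m(5) unfolding bij_betw_def by blast
    have "h (x \<otimes>\<^bsub>R\<^esub> y) = h \<one>\<^bsub>R\<^esub>" using m(2)[OF x y(1)] m(4) t(2) y(2) by simp
    then have "x \<otimes>\<^bsub>R\<^esub> y = \<one>\<^bsub>R\<^esub>" using m(5) x y(1) unfolding bij_betw_def inj_on_def by auto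
    then show ?thesis using x y(1) R.Units_iff by blast
  qed
qed

lemma ring_iso_common:
  assumes R: "cring R" and S: "cring S" and h: "h : ring_iso R S" and c: "common R x y"
  shows "common S (h x) (h y)"
proof -
  interpret R: cring R by (rule R)
  note m = ring_iso_memE[OF h]
  obtain z r s where z: "z : nonunits R" "r : carrier R" "s : carrier R" "x = z \<otimes>\<^bsub>R\<^esub> r" "y = z \<otimes>\<^bsub>R\<^esub> s"
    using c unfolding common_def by blast
  have zc: "z : carrier R" "z ~: Units R" using z(1) by (simp_all add: nonunits_def)
  have "h z : nonunits S" using zc m(1)[OF zc(1)] ring_iso_Units[OF R S h zc(1)] by (simp add: nonunits_def)
  moreover have "h x = h z \<otimes>\<^bsub>S\<^esub> h r" "h y = h z \<otimes>\<^bsub>S\<^esub> h s" unfolding z(4,5) using m(2) zc(1) z(2,3) by blast+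
  ultimately show ?thesis unfolding common_def using m(1) z(2,3) by blast
qed

lemma embeds_if_common:
  assumes R: "cring R" and emb: "graph_embeds_in V E S" and h: "inj_on h (nonunits R)" "h ` nonunits R \<subseteq> V"
    and e: "!!x y. common R x y ==> x ~= y ==> {h x, h y} : E"
  shows "graph_embeds_in (nonunits R) (upper_ideal_edges R) S"
proof (rule embeds_mono[OF emb h])
  interpret cring R by (rule R)
  fix d assume "d : upper_ideal_edges R"
  then obtain x y where "d = {x, y}" "x ~= y" "common R x y" unfolding edges_common by blast
  then show "d \<subseteq> nonunits R & h ` d : E" using commonD e by auto
qed

lemma embeds_ring_iso:
  assumes R: "cring R" and S: "cring S" and h: "h : ring_iso R S"
    and emb: "graph_embeds_in (nonunits S) (upper_ideal_edges S) X"
  shows "graph_embeds_in (nonunits R) (upper_ideal_edges R) X"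
proof (rule embeds_if_common[OF R emb, of h])
  have inj: "inj_on h (carrier R)" using ring_iso_memE(5)[OF h] by (simp add: bij_betw_def)
  then show "inj_on h (nonunits R)" by (rule inj_on_subset) (auto simp: nonunits_def)
  show "h ` nonunits R \<subseteq> nonunits S"
    using ring_iso_Units[OF R S h] ring_iso_memE(1)[OF h] by (auto simp: nonunits_def)
  show "{h x, h y} : upper_ideal_edges S" if "common R x y" "x ~= y" for x y
  proof -
    have "x : carrier R" "y : carrier R" using cring.common_carrier[OF R that(1)] by auto
    then have "h x ~= h y" using inj that(2) by (auto simp: inj_on_def)
    then show ?thesis using ring_iso_common[OF R S h that(1)] unfolding cring.edges_common[OF S] by blast
  qed
qed

text \<open>The genus is a priori infinite if there is no embedding at all; a finite value is
  attained by a least element.\<close>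

lemma graph_genus_eq_2:
  "graph_genus V E = 2 \<longleftrightarrow> graph_embeds_in V E (handle_surface 2) & (ALL g<=1. ~ graph_embeds_in V E (handle_surface g))"
proof -
  let ?S = "{g. graph_embeds_in V E (handle_surface g)}"
  have two: "(2::enat) = enat 2" by (simp add: numeral_eq_enat)
  show ?thesis
  proof
    assume a: "graph_genus V E = 2"
    have "?S ~= {}"
    proof
      assume "?S = {}"
      then have "graph_genus V E = \<infinity>" unfolding graph_genus_def by (simp only: image_empty Inf_empty top_enat_def)
      then show False using a by simp
    qed
    then obtain g0 where "enat g0 : enat ` ?S" by blast
    then have "Inf (enat ` ?S) : enat ` ?S" by (rule wellorder_InfI)
    then have "2 : ?S" using a unfolding graph_genus_def two by auto
    moreover have "~ g <= 1" if "g : ?S" for g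
    proof -
      have "graph_genus V E <= enat g" unfolding graph_genus_def using that by (intro Inf_lower) auto
      then show ?thesis unfolding a two by simp
    qed
    ultimately show "graph_embeds_in V E (handle_surface 2) & (ALL g<=1. ~ graph_embeds_in V E (handle_surface g))" by blast
  next
    assume a: "graph_embeds_in V E (handle_surface 2) & (ALL g<=1. ~ graph_embeds_in V E (handle_surface g))"
    have "enat 2 <= Inf (enat ` ?S)"
    proof (rule Inf_greatest)
      fix x assume "x : enat ` ?S"
      then obtain g where "x = enat g" "g : ?S" by blast
      then show "enat 2 <= x" using a by (cases "g <= 1") auto
    qed
    moreover have "Inf (enat ` ?S) <= enat 2" using a by (intro Inf_lower) auto
    ultimately show "graph_genus V E = 2" unfolding graph_genus_def two by simp
  qed
qed

section \<open>Direct products of rings\<close>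

lemma RDirProd_simps:
  "carrier (RDirProd A B) = carrier A \<times> carrier B"
  "(a, b) \<otimes>\<^bsub>RDirProd A B\<^esub> (c, d) = (a \<otimes>\<^bsub>A\<^esub> c, b \<otimes>\<^bsub>B\<^esub> d)"
  "(a, b) \<oplus>\<^bsub>RDirProd A B\<^esub> (c, d) = (a \<oplus>\<^bsub>A\<^esub> c, b \<oplus>\<^bsub>B\<^esub> d)"
  "\<one>\<^bsub>RDirProd A B\<^esub> = (\<one>\<^bsub>A\<^esub>, \<one>\<^bsub>B\<^esub>)" "\<zero>\<^bsub>RDirProd A B\<^esub> = (\<zero>\<^bsub>A\<^esub>, \<zero>\<^bsub>B\<^esub>)"
  by (simp_all add: RDirProd_def DirProd_def monoid.defs)

lemma RDirProd_cring:
  assumes "cring A" "cring B"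
  shows "cring (RDirProd A B)"
proof -
  interpret A: cring A by fact
  interpret B: cring B by fact
  interpret P: ring "RDirProd A B" by (rule RDirProd_ring) (rule A.ring_axioms, rule B.ring_axioms)
  show ?thesis
    by unfold_locales (auto simp: RDirProd_simps A.m_comm B.m_comm)
qed

lemma RDirProd_Units:
  assumes "cring A" "cring B"
  shows "(a, b) : Units (RDirProd A B) \<longleftrightarrow> a : Units A & b : Units B"
proof -
  interpret A: cring A by fact
  interpret B: cring B by fact
  interpret P: cring "RDirProd A B" by (rule RDirProd_cring[OF assms])
  show ?thesis unfolding P.Units_iff A.Units_iff B.Units_iff by (auto simp: RDirProd_simps)
qed

lemma RDirProd_nonunits:
  assumes "cring A" "cring B"
  shows "(a, b) : nonunits (RDirProd A B) \<longleftrightarrow> a : carrier A & b : carrier B & (a : nonunits A | b : nonunits B)"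
  unfolding nonunits_def using RDirProd_Units[OF assms] by (auto simp: RDirProd_simps)

text \<open>A nonunit of the product has a nonunit component; conversely a nonunit divisor in one
  factor is completed by the unity in the other.\<close>

lemma common_RDirProd:
  assumes A: "cring A" and B: "cring B"
    and c: "a : carrier A" "a' : carrier A" "b : carrier B" "b' : carrier B"
  shows "common (RDirProd A B) (a, b) (a', b') \<longleftrightarrow> common A a a' | common B b b'"
proof
  interpret A: cring A by fact
  interpret B: cring B by fact
  assume "common (RDirProd A B) (a, b) (a', b')"
  then obtain z1 z2 r1 r2 s1 s2 where z: "(z1, z2) : nonunits (RDirProd A B)"
    "r1 : carrier A" "s1 : carrier A" "r2 : carrier B" "s2 : carrier B"
    "a = z1 \<otimes>\<^bsub>A\<^esub> r1" "b = z2 \<otimes>\<^bsub>B\<^esub> r2" "a' = z1 \<otimes>\<^bsub>A\<^esub> s1" "b' = z2 \<otimes>\<^bsub>B\<^esub> s2"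
    unfolding common_def by (auto simp: RDirProd_simps)
  from z(1) show "common A a a' | common B b b'"
    unfolding RDirProd_nonunits[OF A B] z(6-9) using A.commonI[OF _ z(2,3)] B.commonI[OF _ z(4,5)] by blast
next
  interpret A: cring A by fact
  interpret B: cring B by fact
  interpret P: cring "RDirProd A B" by (rule RDirProd_cring[OF A B])
  assume "common A a a' | common B b b'"
  then show "common (RDirProd A B) (a, b) (a', b')"
  proof
    assume "common A a a'"
    then obtain z r s where z: "z : nonunits A" "r : carrier A" "s : carrier A" "a = z \<otimes>\<^bsub>A\<^esub> r" "a' = z \<otimes>\<^bsub>A\<^esub> s"
      unfolding common_def by blast
    have "(z, \<one>\<^bsub>B\<^esub>) : nonunits (RDirProd A B)" using z(1) A.nonunitsD(1) RDirProd_nonunits[OF A B] by auto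
    then show ?thesis
      using P.commonI[of "(z, \<one>\<^bsub>B\<^esub>)" "(r, b)" "(s, b')"] z c by (simp add: RDirProd_simps)
  next
    assume "common B b b'"
    then obtain z r s where z: "z : nonunits B" "r : carrier B" "s : carrier B" "b = z \<otimes>\<^bsub>B\<^esub> r" "b' = z \<otimes>\<^bsub>B\<^esub> s"
      unfolding common_def by blast
    have "(\<one>\<^bsub>A\<^esub>, z) : nonunits (RDirProd A B)" using z(1) B.nonunitsD(1) RDirProd_nonunits[OF A B] by auto
    then show ?thesis
      using P.commonI[of "(\<one>\<^bsub>A\<^esub>, z)" "(a, r)" "(a', s)"] z c by (simp add: RDirProd_simps)
  qed
qed

lemma ring_iso_RDirProd:
  assumes "A \<simeq> A'" "B \<simeq> B'"
  shows "RDirProd A B \<simeq> RDirProd A' B'"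
  using assms RDirProd_iso6 unfolding is_ring_iso_def by blast

lemma ring_iso_RDirProd_swap: "RDirProd A B \<simeq> RDirProd B A"
  using RDirProd_iso1[of A B] unfolding is_ring_iso_def by blast

lemma ring_iso_RDirProd_assoc: "RDirProd (RDirProd A B) C \<simeq> RDirProd A (RDirProd B C)"
  using RDirProd_iso3[of A B C] unfolding is_ring_iso_def by blast

definition ring_embeds :: "('a, 'm) ring_scheme => nat => bool" where
  "ring_embeds R g \<longleftrightarrow> graph_embeds_in (nonunits R) (upper_ideal_edges R) (handle_surface g)"

lemma upper_ideal_genus_eq_2:
  "upper_ideal_genus R = 2 \<longleftrightarrow> ring_embeds R 2 & ~ ring_embeds R 1 & ~ ring_embeds R 0"
  unfolding upper_ideal_genus_def graph_genus_eq_2 ring_embeds_def by (auto simp: le_Suc_eq)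

section \<open>Forbidden cliques in the graph of a product\<close>

text \<open>\<open>36 + 6\<close> exceeds \<open>27 + 12\<close>, and \<open>28 + 6\<close> exceeds
  \<open>24 + 6\<close>. A finite subset of the critical size is enough.\<close>

lemma no_big_clique:
  assumes R: "cring R" and emb: "ring_embeds R g" and C: "!!x y. x : C ==> y : C ==> common R x y"
  shows "g <= 2 ==> card C <= 8" "g <= 1 ==> card C <= 7"
proof -
  have b: "(n choose 2) + 6 <= 3 * n + 6 * g" if n: "n <= card C" "3 <= n" for n
  proof -
    obtain C' where C': "C' \<subseteq> C" "card C' = n" "finite C'" by (rule obtain_subset_with_card_n[OF n(1)])
    have c: "common R x y" if "x : C'" "y : C'" for x y using C[of x y] that C'(1) by blast
    show ?thesis
      using clique_embed_bound[OF emb[unfolded ring_embeds_def] cring.clique_edges[OF R c] C'(3)] C'(2) n(2) by simp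
  qed
  show "card C <= 8" if "g <= 2"
  proof (rule ccontr)
    assume "~ card C <= 8"
    then have "((9::nat) choose 2) + 6 <= 3 * 9 + 6 * g" by (intro b) auto
    then show False using that by (simp add: choose_two)
  qed
  show "card C <= 7" if "g <= 1"
  proof (rule ccontr)
    assume "~ card C <= 7"
    then have "((8::nat) choose 2) + 6 <= 3 * 8 + 6 * g" by (intro b) auto
    then show False using that by (simp add: choose_two)
  qed
qed

text \<open>\<open>28 + 28 - 6 = 50\<close> edges on 12 vertices, where genus two allows 42.\<close>

lemma no_overlapping_cliques:
  assumes R: "cring R" and g: "g <= 2"
    and C: "!!x y. x : C ==> y : C ==> common R x y" "!!x y. x : C' ==> y : C' ==> common R x y"
    and card: "card C = 8" "card C' = 8" "card (C Int C') = 4"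
  shows "~ ring_embeds R g"
proof
  assume emb: "ring_embeds R g"
  have f: "finite C" "finite C'" using card card.infinite by fastforce+
  have "card (C Un C') = 12" using card_Un_Int[OF f] card by simp
  then show False
    using two_cliques_embed_bound[OF emb[unfolded ring_embeds_def] cring.clique_edges(1)[OF R C(1)]
        cring.clique_edges(1)[OF R C(2)] cring.clique_edges(2)[OF R C(1)] cring.clique_edges(2)[OF R C(2)] f] card g
    by (simp add: choose_two)
qed

lemma (in cring) common_nonunit:
  assumes m: "m : nonunits R" and x: "x : {\<zero>, m}" "y : {\<zero>, m}"
  shows "common R x y"
proof -
  have "m \<otimes> \<zero> = \<zero>" "m \<otimes> \<one> = m" using nonunitsD(1)[OF m] by simp_all
  then have "EX r:carrier R. x = m \<otimes> r" "EX r:carrier R. y = m \<otimes> r" using x by force+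
  then show ?thesis unfolding common_def using m by blast
qed

locale cring_pair = A: cring A + B: cring B for A :: "('a, 'm) ring_scheme" and B :: "('b, 'n) ring_scheme" +
  assumes nontrivial: "\<one>\<^bsub>A\<^esub> ~= \<zero>\<^bsub>A\<^esub>" "\<one>\<^bsub>B\<^esub> ~= \<zero>\<^bsub>B\<^esub>"
begin

sublocale P: cring "RDirProd A B"
  by (rule RDirProd_cring) (rule A.cring_axioms, rule B.cring_axioms)

lemma nonunits_iff:
  "(a, b) : nonunits (RDirProd A B) \<longleftrightarrow> a : carrier A & b : carrier B & (a : nonunits A | b : nonunits B)"
  by (rule RDirProd_nonunits) (rule A.cring_axioms, rule B.cring_axioms)

lemma common_iff:
  assumes "a : carrier A" "a' : carrier A" "b : carrier B" "b' : carrier B"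
  shows "common (RDirProd A B) (a, b) (a', b') \<longleftrightarrow> common A a a' | common B b b'"
  by (rule common_RDirProd[OF _ _ assms]) (rule A.cring_axioms, rule B.cring_axioms)

lemma fibre_clique:
  assumes "x : {\<zero>\<^bsub>A\<^esub>} \<times> carrier B" "y : {\<zero>\<^bsub>A\<^esub>} \<times> carrier B"
  shows "common (RDirProd A B) x y"
proof -
  obtain b b' where "x = (\<zero>\<^bsub>A\<^esub>, b)" "y = (\<zero>\<^bsub>A\<^esub>, b')" "b : carrier B" "b' : carrier B" using assms by blast
  then show ?thesis using A.common_nonunit[OF A.zero_nonunit[OF nontrivial(1)]] by (simp add: common_iff)
qed

lemma base_clique:
  assumes "m : nonunits B" "x : carrier A \<times> {\<zero>\<^bsub>B\<^esub>, m}" "y : carrier A \<times> {\<zero>\<^bsub>B\<^esub>, m}"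
  shows "common (RDirProd A B) x y"
proof -
  obtain a a' b b' where xy: "x = (a, b)" "y = (a', b')" "a : carrier A" "a' : carrier A" "b : {\<zero>\<^bsub>B\<^esub>, m}" "b' : {\<zero>\<^bsub>B\<^esub>, m}"
    using assms(2,3) by blast
  then have "b : carrier B" "b' : carrier B" using B.nonunitsD(1)[OF assms(1)] by auto
  then show ?thesis using B.common_nonunit[OF assms(1) xy(5,6)] xy by (simp add: common_iff)
qed

lemma card_fibre: "card ({\<zero>\<^bsub>A\<^esub>} \<times> carrier B) = card (carrier B)"
  by (simp add: card_cartesian_product)

lemma embeds_factor_card:
  assumes "ring_embeds (RDirProd A B) g"
  shows "g <= 2 ==> card (carrier B) <= 8" "g <= 1 ==> card (carrier B) <= 7"
proof -
  show "card (carrier B) <= 8" if "g <= 2"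
    unfolding card_fibre[symmetric] by (rule no_big_clique(1)[OF P.cring_axioms assms _ that]) (rule fibre_clique)
  show "card (carrier B) <= 7" if "g <= 1"
    unfolding card_fibre[symmetric] by (rule no_big_clique(2)[OF P.cring_axioms assms _ that]) (rule fibre_clique)
qed

text \<open>A nonzero nonunit \<open>m\<close> of \<open>B\<close> yields the clique
  \<open>carrier A \<times> {0, m}\<close>, twice as large as \<open>A\<close>.\<close>

lemma embeds_nonfield_card:
  assumes "ring_embeds (RDirProd A B) g" "m : nonunits B" "m ~= \<zero>\<^bsub>B\<^esub>"
  shows "g <= 2 ==> card (carrier A) <= 4" "g <= 1 ==> card (carrier A) <= 3"
proof -
  let ?C = "carrier A \<times> {\<zero>\<^bsub>B\<^esub>, m}"
  have card: "card ?C = 2 * card (carrier A)" using assms(3) by (simp add: card_cartesian_product)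
  show "card (carrier A) <= 4" if "g <= 2"
  proof -
    have "card ?C <= 8" by (rule no_big_clique(1)[OF P.cring_axioms assms(1) _ that]) (rule base_clique[OF assms(2)])
    then show ?thesis unfolding card by simp
  qed
  show "card (carrier A) <= 3" if "g <= 1"
  proof -
    have "card ?C <= 7" by (rule no_big_clique(2)[OF P.cring_axioms assms(1) _ that]) (rule base_clique[OF assms(2)])
    then show ?thesis unfolding card by simp
  qed
qed

text \<open>The two coordinate axes are cliques meeting only in zero; this is the source of the
  one-point unions.\<close>

lemma wedge_cliques:
  assumes C: "\<zero>\<^bsub>A\<^esub> : S" "S \<subseteq> carrier A" "\<zero>\<^bsub>B\<^esub> : T" "T \<subseteq> carrier B"
  shows "clique (S \<times> {\<zero>\<^bsub>B\<^esub>}) \<subseteq> upper_ideal_edges (RDirProd A B)" "S \<times> {\<zero>\<^bsub>B\<^esub>} \<subseteq> nonunits (RDirProd A B)"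
    "clique ({\<zero>\<^bsub>A\<^esub>} \<times> T) \<subseteq> upper_ideal_edges (RDirProd A B)" "{\<zero>\<^bsub>A\<^esub>} \<times> T \<subseteq> nonunits (RDirProd A B)"
    "(S \<times> {\<zero>\<^bsub>B\<^esub>}) Int ({\<zero>\<^bsub>A\<^esub>} \<times> T) = {(\<zero>\<^bsub>A\<^esub>, \<zero>\<^bsub>B\<^esub>)}"
proof -
  have 1: "common (RDirProd A B) x y" if "x : S \<times> {\<zero>\<^bsub>B\<^esub>}" "y : S \<times> {\<zero>\<^bsub>B\<^esub>}" for x y
    using base_clique[OF B.zero_nonunit[OF nontrivial(2)]] C(2) that by blast
  have 2: "common (RDirProd A B) x y" if "x : {\<zero>\<^bsub>A\<^esub>} \<times> T" "y : {\<zero>\<^bsub>A\<^esub>} \<times> T" for x y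
    using fibre_clique C(4) that by blast
  show "clique (S \<times> {\<zero>\<^bsub>B\<^esub>}) \<subseteq> upper_ideal_edges (RDirProd A B)" by (rule P.clique_edges(1)) (rule 1)
  show "S \<times> {\<zero>\<^bsub>B\<^esub>} \<subseteq> nonunits (RDirProd A B)" by (rule P.clique_edges(2)) (rule 1)
  show "clique ({\<zero>\<^bsub>A\<^esub>} \<times> T) \<subseteq> upper_ideal_edges (RDirProd A B)" by (rule P.clique_edges(1)) (rule 2)
  show "{\<zero>\<^bsub>A\<^esub>} \<times> T \<subseteq> nonunits (RDirProd A B)" by (rule P.clique_edges(2)) (rule 2)
qed (use C in blast)

lemma subset_with_zero:
  assumes "n <= card (carrier B)" "1 <= n"
  obtains T where "\<zero>\<^bsub>B\<^esub> : T" "T \<subseteq> carrier B" "card T = n"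
proof -
  have fin: "finite (carrier B)" using assms card.infinite by fastforce
  have "n - 1 <= card (carrier B - {\<zero>\<^bsub>B\<^esub>})" using assms fin by simp
  then obtain T where T: "T \<subseteq> carrier B - {\<zero>\<^bsub>B\<^esub>}" "card T = n - 1" "finite T" by (rule obtain_subset_with_card_n)
  show ?thesis
  proof (rule that)
    show "card (insert \<zero>\<^bsub>B\<^esub> T) = n" using T assms(2) by (subst card_insert_disjoint) auto
  qed (use T in auto)
qed

lemma swap_pair: "cring_pair B A"
  by unfold_locales (use nontrivial in auto)

lemma no_five_eight:
  assumes "5 <= card (carrier A)" "8 <= card (carrier B)" "g <= 2"
  shows "~ ring_embeds (RDirProd A B) g"
proof -
  obtain S where S: "\<zero>\<^bsub>A\<^esub> : S" "S \<subseteq> carrier A" "card S = 5"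
    by (rule cring_pair.subset_with_zero[OF swap_pair assms(1) one_le_numeral])
  obtain T where T: "\<zero>\<^bsub>B\<^esub> : T" "T \<subseteq> carrier B" "card T = 8" by (rule subset_with_zero[OF assms(2) one_le_numeral])
  note w = wedge_cliques[OF S(1,2) T(1,2)]
  show ?thesis unfolding ring_embeds_def
    by (rule no_K5_K8[OF w(1,3,2,4) _ _ w(5) assms(3)]) (simp_all add: card_cartesian_product S T)
qed

lemma no_five_five:
  assumes "5 <= card (carrier A)" "5 <= card (carrier B)" "g <= 1"
  shows "~ ring_embeds (RDirProd A B) g"
proof -
  obtain S where S: "\<zero>\<^bsub>A\<^esub> : S" "S \<subseteq> carrier A" "card S = 5"
    by (rule cring_pair.subset_with_zero[OF swap_pair assms(1) one_le_numeral])
  obtain T where T: "\<zero>\<^bsub>B\<^esub> : T" "T \<subseteq> carrier B" "card T = 5" by (rule subset_with_zero[OF assms(2) one_le_numeral])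
  note w = wedge_cliques[OF S(1,2) T(1,2)]
  show ?thesis unfolding ring_embeds_def
    by (rule no_K5_K5[OF w(1,3,2,4) _ _ w(5) assms(3)]) (simp_all add: card_cartesian_product S T)
qed

lemma no_two_nonfields:
  assumes k: "k : nonunits A" "k ~= \<zero>\<^bsub>A\<^esub>" and m: "m : nonunits B" "m ~= \<zero>\<^bsub>B\<^esub>"
    and card: "card (carrier A) = 4" "card (carrier B) = 4" and g: "g <= 2"
  shows "~ ring_embeds (RDirProd A B) g"
proof (rule no_overlapping_cliques[OF P.cring_axioms g])
  let ?C = "carrier A \<times> {\<zero>\<^bsub>B\<^esub>, m}" and ?C' = "{\<zero>\<^bsub>A\<^esub>, k} \<times> carrier B"
  show "common (RDirProd A B) x y" if "x : ?C" "y : ?C" for x y by (rule base_clique[OF m(1) that])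
  show "common (RDirProd A B) x y" if in_C': "x : ?C'" "y : ?C'" for x y
  proof -
    obtain a a' b b' where xy: "x = (a, b)" "y = (a', b')" "b : carrier B" "b' : carrier B" "a : {\<zero>\<^bsub>A\<^esub>, k}" "a' : {\<zero>\<^bsub>A\<^esub>, k}"
      using in_C' by blast
    then have "a : carrier A" "a' : carrier A" using A.nonunitsD(1)[OF k(1)] by auto
    then show ?thesis using A.common_nonunit[OF k(1) xy(5,6)] xy by (simp add: common_iff)
  qed
  show "card ?C = 8" "card ?C' = 8" using k(2) m(2) card by (simp_all add: card_cartesian_product)
  have "?C Int ?C' = {\<zero>\<^bsub>A\<^esub>, k} \<times> {\<zero>\<^bsub>B\<^esub>, m}" using A.nonunitsD(1)[OF k(1)] B.nonunitsD(1)[OF m(1)] by auto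
  then show "card (?C Int ?C') = 4" using k(2) m(2) by (simp add: card_cartesian_product)
qed

text \<open>Only zero and one of \<open>A\<close> enter: the elements \<open>(0, b)\<close> for all
  eight \<open>b\<close>, and \<open>(1, b)\<close> for zero and three nonzero nonunits
  \<open>b\<close>, contain the pinched graph.\<close>

lemma no_order_eight_nonfield:
  assumes card: "card (carrier B) = 8" and m: "4 <= card (nonunits B)" and g: "g <= 2"
  shows "~ ring_embeds (RDirProd A B) g"
proof
  assume emb: "ring_embeds (RDirProd A B) g"
  let ?z = "\<zero>\<^bsub>A\<^esub>" and ?u = "\<one>\<^bsub>A\<^esub>" and ?o = "\<zero>\<^bsub>B\<^esub>"
  have fin: "finite (carrier B)" using card card.infinite by fastforce
  have finN: "finite (nonunits B)" using fin by (rule finite_subset[rotated]) (auto simp: nonunits_def)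
  have "3 <= card (nonunits B - {?o})" using m finN by (auto simp: card_Diff_singleton_if)
  then obtain M where M: "M \<subseteq> nonunits B - {?o}" "card M = 3" "finite M" by (rule obtain_subset_with_card_n)
  then obtain m1 m2 m3 where Meq: "M = {m1, m2, m3}" "m1 ~= m2" "m1 ~= m3" "m2 ~= m3" by (metis card_3_iff)
  then have mm: "m1 : nonunits B" "m2 : nonunits B" "m3 : nonunits B" "m1 ~= ?o" "m2 ~= ?o" "m3 ~= ?o" using M by auto
  then have mc: "m1 : carrier B" "m2 : carrier B" "m3 : carrier B" using B.nonunitsD(1) by auto
  have "card (carrier B - {?o, m1, m2, m3}) = 4"
    using mc mm Meq card fin by (subst card_Diff_subset) auto
  moreover obtain l where "set l = carrier B - {?o, m1, m2, m3}" "distinct l"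
    using finite_distinct_list[of "carrier B - {?o, m1, m2, m3}"] fin by blast
  ultimately have l: "set l = carrier B - {?o, m1, m2, m3}" "distinct l" "length l = 4" using distinct_card[of l] by simp_all
  then obtain u1 u2 u3 u4 where l4: "l = [u1, u2, u3, u4]" by (auto simp: length_Suc_conv numeral_eq_Suc)
  \<comment> \<open>The order matches the vertex numbers of \<open>pinched_edges\<close>.\<close>
  define hs where "hs = map (Pair ?z) ([?o, m1, m2, m3] @ l) @ map (Pair ?u) [?o, m1, m2, m3]"
  define h where "h i = hs ! i" for i
  have len: "length hs = 12" by (simp add: hs_def l(3))
  have dist: "distinct hs" using l(1,2) Meq mm nontrivial(1) unfolding hs_def l4 by auto
  have inB: "set ([?o, m1, m2, m3] @ l) \<subseteq> carrier B" using l(1) mc by auto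
  have inN: "set [?o, m1, m2, m3] \<subseteq> nonunits B" using mm(1-3) B.zero_nonunit[OF nontrivial(2)] by simp
  have zN: "?z : nonunits A" by (rule A.zero_nonunit[OF nontrivial(1)])
  have set: "set hs \<subseteq> nonunits (RDirProd A B)"
  proof
    fix p assume "p : set hs"
    then have "(EX b:set ([?o, m1, m2, m3] @ l). p = (?z, b)) | (EX b:set [?o, m1, m2, m3]. p = (?u, b))"
      unfolding hs_def set_append set_map by blast
    then show "p : nonunits (RDirProd A B)"
    proof (elim disjE bexE)
      fix b assume "b : set ([?o, m1, m2, m3] @ l)" "p = (?z, b)"
      then show ?thesis using inB zN by (simp only: nonunits_iff) blast
    next
      fix b assume "b : set [?o, m1, m2, m3]" "p = (?u, b)"
      then show ?thesis using inN B.nonunitsD(1) by (simp only: nonunits_iff) blast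
    qed
  qed
  have hz: "h i : {?z} \<times> carrier B" if "i < 8" for i
  proof -
    have "hs ! i = (map (Pair ?z) ([?o, m1, m2, m3] @ l)) ! i" using that l(3) unfolding hs_def by (subst nth_append) simp
    moreover have "map (Pair ?z) ([?o, m1, m2, m3] @ l) ! i : set (map (Pair ?z) ([?o, m1, m2, m3] @ l))"
      using that l(3) by (intro nth_mem) simp
    ultimately show ?thesis using inB unfolding h_def set_map by auto
  qed
  have hv: "h 0 = (?z, ?o)" "h 1 = (?z, m1)" "h 2 = (?z, m2)" "h 3 = (?z, m3)" "h 8 = (?u, ?o)"
    "h 9 = (?u, m1)" "h 10 = (?u, m2)" "h 11 = (?u, m3)"
    unfolding h_def hs_def l4 by simp_all
  have bc: "common (RDirProd A B) (a, b) (a', b')"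
    if "m : nonunits B" "b : {?o, m}" "b' : {?o, m}" "a : {?z, ?u}" "a' : {?z, ?u}" for a a' b b' m
    by (rule base_clique[OF that(1)]) (use that in auto)
  have bb: "common (RDirProd A B) (a, b) (a', b')"
    if "b : {?o, m1} & b' : {?o, m1} | b : {?o, m2} & b' : {?o, m2} | b : {?o, m3} & b' : {?o, m3}"
      "a : {?z, ?u}" "a' : {?z, ?u}" for a a' b b'
    using that(1) by (elim disjE conjE) (rule bc[OF mm(1) _ _ that(2,3)] bc[OF mm(2) _ _ that(2,3)] bc[OF mm(3) _ _ that(2,3)]; assumption)+
  have "graph_embeds_in {..<12} (edges_of pinched_edges) (handle_surface g)"
  proof (rule embeds_edges_of[OF emb[unfolded ring_embeds_def], of h])
    show inj: "inj_on h {..<12}" unfolding h_def using dist len by (auto simp: inj_on_def nth_eq_iff_index_eq)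
    show "h ` {..<12} \<subseteq> nonunits (RDirProd A B)" using set len nth_mem unfolding h_def by fastforce
    fix x y assume xy: "(x, y) : set pinched_edges"
    have b: "x < 12 & y < 12 & x ~= y"
      and cases: "x < 8 & y < 8 | (x, y) : {(0,8), (1,8), (2,8), (3,8), (0,9), (8,9), (1,9), (0,10), (8,10), (2,10), (0,11), (8,11), (3,11)}"
      using xy unfolding pinched_edges_def by auto
    have "common (RDirProd A B) (h x) (h y)"
      using cases
    proof
      assume "x < 8 & y < 8"
      then show ?thesis using hz fibre_clique by blast
    next
      assume "(x, y) : {(0,8), (1,8), (2,8), (3,8), (0,9), (8,9), (1,9), (0,10), (8,10), (2,10), (0,11), (8,11), (3,11)}"
      then show ?thesis
        by (elim insertE emptyE Pair_inject, simp_all only: hv) (rule bb; simp)+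
    qed
    moreover have "h x ~= h y" using inj b by (auto simp: inj_on_def)
    ultimately show "x < 12 & y < 12 & {h x, h y} : upper_ideal_edges (RDirProd A B)"
      using b unfolding P.edges_common by blast
  qed
  then show False using no_pinched_graph[OF g] by blast
qed

end

section \<open>Products inside the drawn graphs\<close>

lemma edges_of_filter:
  "{x, y} : edges_of [a \<leftarrow> List.product [0..<n] [0..<n]. fst a < snd a & Q a] \<longleftrightarrow>
     x < n & y < n & (x < y & Q (x, y) | y < x & Q (y, x))"
proof -
  have "{x, y} : edges_of [a \<leftarrow> List.product [0..<n] [0..<n]. fst a < snd a & Q a] \<longleftrightarrow>
      (EX u v. {x, y} = {u, v} & u < n & v < n & u < v & Q (u, v))"
    unfolding edges_of_def by (auto simp: image_iff)
  then show ?thesis unfolding doubleton_eq_iff by auto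
qed

lemma tailed_clique_mem:
  assumes "i ~= j" "i < n + 3" "j < n + 3"
    "i < n & j < n | i = 0 | j = 0 | n <= i & n <= j | i = 1 & j < n + 2 | j = 1 & i < n + 2"
  shows "{i, j} : edges_of (tailed_clique_edges n)"
  unfolding tailed_clique_edges_def edges_of_filter using assms by auto

lemma two_sevens_mem:
  assumes "i ~= j" "i < 13" "j < 13" "i < 7 & j < 7 | i = 0 | j = 0 | 7 <= i & 7 <= j"
  shows "{i, j} : edges_of two_sevens_edges"
  unfolding two_sevens_edges_def edges_of_filter using assms by auto

lemma three_ideals_mem:
  "{i, j} : edges_of three_ideals_edges \<longleftrightarrow> i < 10 & j < 10 & i ~= j &
     (i < 6 & j < 6 | i : {0, 1, 2, 6, 7, 8} & j : {0, 1, 2, 6, 7, 8} | i : {0, 3, 6, 9} & j : {0, 3, 6, 9})"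
proof -
  let ?Q = "%i j. i < 6 & j < 6 | i : {0, 1, 2, 6, 7, 8} & j : {0, 1, 2, 6, 7, 8} | i : {0, 3, 6, 9} & j : {0, 3, 6, 9 :: nat}"
  have "(i < j & Q i j | j < i & Q j i) \<longleftrightarrow> i ~= j & Q i j" if "Q i j = Q j i" for Q
    using that by (cases i j rule: linorder_cases) auto
  moreover have "?Q i j = ?Q j i" by (simp only: conj_commute)
  ultimately have "(i < j & ?Q i j | j < i & ?Q j i) \<longleftrightarrow> i ~= j & ?Q i j" .
  then show ?thesis unfolding three_ideals_edges_def edges_of_filter fst_conv snd_conv by (simp only:)
qed

text \<open>The elements adjacent to both parts of the graph must receive the lowest labels, because
  only those vertices of the drawn graphs are joined to the tail.\<close>

lemma injection_with_base:
  assumes fin: "finite X" and Y: "Y \<subseteq> X" and n: "card X <= n"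
  obtains f :: "'a => nat" where "inj_on f X" "f ` X \<subseteq> {..<n}" "f ` Y \<subseteq> {..<card Y}"
proof -
  have finY: "finite Y" using fin Y finite_subset by blast
  have le: "card Y <= n" using card_mono[OF fin Y] n by simp
  obtain u where u: "inj_on u Y" "u ` Y \<subseteq> {..<card Y}"
    using inj_on_iff_card_le[OF finY, of "{..<card Y}"] by auto
  have "card (X - Y) <= card {card Y..<n}" using n by (simp add: card_Diff_subset[OF finY Y])
  then obtain v where v: "inj_on v (X - Y)" "v ` (X - Y) \<subseteq> {card Y..<n}"
    using inj_on_iff_card_le[of "X - Y" "{card Y..<n}"] fin by auto
  let ?f = "%x. if x : Y then u x else v x"
  show ?thesis
  proof (rule that[of ?f])
    have "inj_on ?f (Y Un (X - Y))"
      using u v by (subst inj_on_Un) (fastforce simp: inj_on_def)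
    then show "inj_on ?f X" using Y by (simp add: Un_absorb1)
    show "?f ` X \<subseteq> {..<n}" using u(2) v(2) le by fastforce
    show "?f ` Y \<subseteq> {..<card Y}" using u(2) by auto
  qed
qed

lemma (in field) nonunits_field: "nonunits R = {\<zero>}"
  unfolding nonunits_def field_Units by auto

lemma (in field) common_field: "common R x y ==> x = \<zero> & y = \<zero>"
  using commonD[of x y] unfolding nonunits_field by auto

text \<open>Any graph with at most seven vertices is a subgraph of \<open>K_7\<close>, which lies on
  the torus.\<close>

lemma few_nonunits_embed:
  assumes R: "cring R" and fin: "finite (nonunits R)" and card: "card (nonunits R) <= 7"
  shows "ring_embeds R 1"
proof -
  have "card (nonunits R) <= card {..<7::nat}" using card by simp
  then obtain h :: "'a => nat" where h: "inj_on h (nonunits R)" "h ` nonunits R \<subseteq> {..<7}"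
    using inj_on_iff_card_le[OF fin, of "{..<7::nat}"] by auto
  show ?thesis unfolding ring_embeds_def
  proof (rule embeds_if_common[OF R seven_embeds h(1)])
    show "h ` nonunits R \<subseteq> {..<10}" using h(2) by fastforce
    fix x y assume c: "common R x y" "x ~= y"
    then have "x : nonunits R" "y : nonunits R" using cring.commonD[OF R] by blast+
    then have "h x ~= h y" "h x < 7" "h y < 7" using h c(2) by (auto simp: inj_on_def)
    then show "{h x, h y} : edges_of (tailed_clique_edges 7)" by (intro tailed_clique_mem) auto
  qed
qed

text \<open>The elements with a nonunit second component form a clique, drawn on the labels below \<open>n\<close>;
  the remaining nonunits are adjacent only to one another and to the elements with a zero first component.\<close>

lemma field_product_embeds:
  fixes A :: "('a, 'm) ring_scheme" and B :: "('b, 'n) ring_scheme"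
  assumes "cring_pair A B" and A: "field A" and fin: "finite (carrier A)" "finite (carrier B)"
    and card: "card (carrier A) * card (nonunits B) <= n" "card (carrier B) <= card (nonunits B) + k"
    and emb: "graph_embeds_in {..<K} E (handle_surface g)" "n + k <= K"
    and E: "!!i j. i ~= j ==> i < n + k ==> j < n + k ==>
      i < n & j < n | n <= i & n <= j | i < card (nonunits B) | j < card (nonunits B) ==> {i, j} : E"
  shows "ring_embeds (RDirProd A B) g"
proof -
  interpret cring_pair A B by fact
  let ?z = "\<zero>\<^bsub>A\<^esub>" and ?N = "nonunits B"
  let ?X = "carrier A \<times> ?N" and ?Y = "{?z} \<times> (carrier B - ?N)" and ?Z = "{?z} \<times> ?N"
  have NB: "?N \<subseteq> carrier B" using B.nonunitsD(1) by blast
  have finN: "finite ?N" using NB fin(2) finite_subset by blast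
  have X: "finite ?X" "?Z \<subseteq> ?X" "card ?X <= n" using fin(1) finN card(1) by (auto simp: card_cartesian_product)
  obtain f where f: "inj_on f ?X" "f ` ?X \<subseteq> {..<n}" "f ` ?Z \<subseteq> {..<card ?Z}" by (rule injection_with_base[OF X])
  have "card ?Y <= card {n..<n + k}" using card(2) by (simp add: card_cartesian_product card_Diff_subset[OF finN NB])
  then obtain a where a: "inj_on a ?Y" "a ` ?Y \<subseteq> {n..<n + k}"
    using inj_on_iff_card_le[of ?Y "{n..<n + k}"] fin(2) by auto
  define h where "h p = (if p : ?X then f p else a p)" for p
  have N: "nonunits (RDirProd A B) = ?X Un ?Y"
  proof (rule Set.set_eqI)
    fix p :: "'a \<times> 'b"
    obtain x b where p: "p = (x, b)" by (cases p) blast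
    show "p : nonunits (RDirProd A B) \<longleftrightarrow> p : ?X Un ?Y"
      unfolding p nonunits_iff field.nonunits_field[OF A] using NB A.zero_closed by blast
  qed
  have hX: "h p < n" if "p : ?X" for p using that f(2) by (auto simp: h_def)
  have hZ: "h p < card ?N" if "p : ?Z" for p
  proof -
    have "p : ?X" using that X(2) by blast
    then have "h p = f p" by (simp only: h_def if_True)
    then show ?thesis using f(3) that by (auto simp: card_cartesian_product)
  qed
  have hY: "n <= h p & h p < n + k" if "p : ?Y" for p
  proof -
    have "p ~: ?X" using that by auto
    then have "h p = a p" by (simp only: h_def if_False)
    then show ?thesis using a(2) that by auto
  qed
  have inj: "inj_on h (nonunits (RDirProd A B))"
  proof (rule inj_onI)
    fix p q assume pq: "p : nonunits (RDirProd A B)" "q : nonunits (RDirProd A B)" "h p = h q"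
    consider "p : ?X" "q : ?X" | "p : ?Y" "q : ?Y" | "p : ?X" "q : ?Y" | "p : ?Y" "q : ?X"
      using pq(1,2) unfolding N by blast
    then show "p = q"
    proof cases
      case 1
      then have "f p = f q" using pq(3) unfolding h_def by (simp only: if_True)
      then show ?thesis using inj_onD[OF f(1)] 1 by blast
    next
      case 2
      then have "p ~: ?X" "q ~: ?X" by auto
      then have "a p = a q" using pq(3) unfolding h_def by (simp only: if_False)
      then show ?thesis using inj_onD[OF a(1)] 2 by blast
    next
      case 3
      then show ?thesis using hX[of p] hY[of q] pq(3) by linarith
    next
      case 4
      then show ?thesis using hX[of q] hY[of p] pq(3) by linarith
    qed
  qed
  show ?thesis unfolding ring_embeds_def
  proof (rule embeds_if_common[OF P.cring_axioms emb(1) inj])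
    have lt: "h p < n + k" if "p : nonunits (RDirProd A B)" for p
    proof (cases "p : ?X")
      case True
      then show ?thesis using hX[of p] by linarith
    next
      case False
      then have "p : ?Y" using that unfolding N by blast
      then show ?thesis using hY[of p] by linarith
    qed
    then show "h ` nonunits (RDirProd A B) \<subseteq> {..<K}" using emb(2) by fastforce
    fix p q assume c: "common (RDirProd A B) p q" "p ~= q"
    have pq: "p : nonunits (RDirProd A B)" "q : nonunits (RDirProd A B)" using P.commonD[OF c(1)] by auto
    obtain x b x' b' where xb: "p = (x, b)" "q = (x', b')" "x : carrier A" "x' : carrier A" "b : carrier B" "b' : carrier B"
      using P.common_carrier[OF c(1)] by (auto simp: RDirProd_simps)
    have "x = ?z & x' = ?z | b : ?N & b' : ?N"
      using c(1) field.common_field[OF A] B.commonD[of b b'] unfolding xb(1,2) common_iff[OF xb(3-6)] by blast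
    then have adj: "h p < n & h q < n | n <= h p & n <= h q | h p < card ?N | h q < card ?N"
    proof
      assume "b : ?N & b' : ?N"
      then have "p : ?X" "q : ?X" using xb by auto
      then show ?thesis using hX by blast
    next
      assume "x = ?z & x' = ?z"
      then have "p : ?Z | p : ?Y" "q : ?Z | q : ?Y" using xb by auto
      then show ?thesis using hZ hY by blast
    qed
    show "{h p, h q} : E" using E[OF _ lt[OF pq(1)] lt[OF pq(2)] adj] inj_onD[OF inj _ pq] c(2) by blast
  qed
qed

text \<open>The factors are exchanged: the \<open>n\<close> labels are for the elements of
  \<open>B\<close>, the other \<open>k\<close> for the nonzero elements of \<open>A\<close>, and
  label 0 goes to the pair of zeros, the only vertex in both cliques.\<close>

lemma field_pair_embeds:
  fixes A :: "('a, 'm) ring_scheme" and B :: "('b, 'n) ring_scheme"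
  assumes pair: "cring_pair A B" and A: "field A" and B: "field B"
    and E: "!!i j. i ~= j ==> i < n + k ==> j < n + k ==> i < n & j < n | i = 0 | j = 0 | n <= i & n <= j ==> {i, j} : E"
    and emb: "graph_embeds_in {..<n + k} E (handle_surface g)"
    and card: "card (carrier A) <= Suc k" "card (carrier B) <= n" and fin: "finite (carrier A)" "finite (carrier B)"
  shows "ring_embeds (RDirProd A B) g"
proof -
  interpret cring_pair A B by fact
  interpret Q: cring_pair B A by (rule swap_pair)
  have "ring_embeds (RDirProd B A) g"
  proof (rule field_product_embeds[where k = k and n = n, OF swap_pair B fin(2,1) _ _ emb])
    fix i j
    assume "i ~= j" "i < n + k" "j < n + k"
      "i < n & j < n | n <= i & n <= j | i < card (nonunits A) | j < card (nonunits A)"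
    then show "{i, j} : E" by (intro E) (auto simp: field.nonunits_field[OF A])
  qed (use card in \<open>simp_all add: field.nonunits_field[OF A]\<close>)
  then show ?thesis
    unfolding ring_embeds_def by (rule embeds_ring_iso[OF P.cring_axioms Q.P.cring_axioms RDirProd_iso1])
qed

text \<open>\<open>B\<close> has two nonunits and two units. The pairs of zero with a nonunit take
  the labels 0 and 1, and the units need the two tail vertices joined to both.\<close>

lemma field_nonfield_embeds:
  assumes pair: "cring_pair A B" and A: "field A" and B: "nonunits B = {\<zero>\<^bsub>B\<^esub>, m}" "m ~= \<zero>\<^bsub>B\<^esub>" "card (carrier B) = 4"
    and emb: "graph_embeds_in {..<n + 3} (edges_of (tailed_clique_edges n)) (handle_surface g)"
    and card: "2 * card (carrier A) <= n" and fin: "finite (carrier A)"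
  shows "ring_embeds (RDirProd A B) g"
proof -
  have finB: "finite (carrier B)" using B(3) card.infinite by fastforce
  have N: "card (nonunits B) = 2" unfolding B(1) using B(2) by simp
  show ?thesis
  proof (rule field_product_embeds[where k = 2 and n = n, OF pair A fin finB _ _ emb])
    fix i j :: nat
    assume "i ~= j" "i < n + 2" "j < n + 2"
      "i < n & j < n | n <= i & n <= j | i < card (nonunits B) | j < card (nonunits B)"
    then show "{i, j} : edges_of (tailed_clique_edges n)" unfolding N by (intro tailed_clique_mem) arith+
  qed (use card B(3) N in simp_all)
qed

section \<open>Classification\<close>

context cring begin

lemma int_embed_add: "add_pow R (k + l) \<one> = add_pow R (k :: int) \<one> \<oplus> add_pow R l \<one>"
  by (simp add: add.int_pow_mult)

lemma int_embed_mult: "add_pow R (k * l) \<one> = add_pow R (k :: int) \<one> \<otimes> add_pow R l \<one>"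
proof -
  have "add_pow R k \<one> \<otimes> add_pow R l \<one> = add_pow R k (add_pow R l \<one>)" using add_pow_ldistr_int[of \<one> "add_pow R l \<one>" k] by simp
  then show ?thesis using add.int_pow_pow[of \<one> k l] by (simp add: mult.commute)
qed

lemma card_multiple:
  assumes "x : carrier R"
  shows "add_pow R (int (card (carrier R))) x = \<zero>"
  using add.pow_order_eq_1[OF assms] add_pow_int_ge[of "int (card (carrier R))" R x] by (simp add: order_def)

lemma card_multiple_one: "add_pow R (int (card (carrier R))) \<one> = \<zero>"
  by (rule card_multiple) simp

lemma int_embed_mod:
  assumes "add_pow R (n :: int) \<one> = \<zero>"
  shows "add_pow R (k mod n) \<one> = add_pow R k \<one>"
proof -
  have "add_pow R k \<one> = add_pow R (n * (k div n) + k mod n) \<one>" by simp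
  also have "\<dots> = add_pow R (n) \<one> \<otimes> add_pow R (k div n) \<one> \<oplus> add_pow R (k mod n) \<one>" unfolding int_embed_add int_embed_mult ..
  finally show ?thesis using assms by simp
qed

text \<open>The multiples of one are distinct below \<open>n\<close> and exhaust the carrier by
  counting.\<close>

lemma residue_ring_iso:
  assumes card: "int (card (carrier R)) = n" and n: "1 < n"
    and nz: "!!k. 0 < k ==> k < n ==> add_pow R k \<one> ~= \<zero>"
  shows "residue_ring n \<simeq> R"
proof -
  have n0: "add_pow R (n) \<one> = \<zero>" using card_multiple_one card by simp
  let ?h = "%k :: int. add_pow R k \<one>"
  have inj1: False if "0 <= k" "k < l" "l < n" "?h k = ?h l" for k l
  proof -
    have "?h l = ?h (l - k) \<oplus> ?h k" using int_embed_add[of "l - k" k] by simp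
    then have "?h (l - k) \<oplus> ?h k = \<zero> \<oplus> ?h k" using that(4) by simp
    then have "?h (l - k) = \<zero>" by simp
    then show False using nz[of "l - k"] that by simp
  qed
  have inj: "inj_on ?h {0..n - 1}"
  proof (rule inj_onI)
    fix k l assume kl: "k : {0..n - 1}" "l : {0..n - 1}" "?h k = ?h l"
    show "k = l" using inj1[of k l] inj1[of l k] kl by (cases k l rule: linorder_cases) auto
  qed
  have "finite (carrier R)" using card n card.infinite by fastforce
  moreover have "?h ` {0..n - 1} \<subseteq> carrier R" by auto
  moreover have "card (?h ` {0..n - 1}) = card (carrier R)" using card_image[OF inj] card n by simp
  ultimately have "?h ` {0..n - 1} = carrier R" using card_subset_eq by blast
  then have bij: "bij_betw ?h {0..n - 1} (carrier R)" using inj by (simp add: bij_betw_def)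
  have "?h : ring_iso (residue_ring n) R"
    by (rule ring_iso_memI)
      (use bij in \<open>auto simp: residue_ring_def int_embed_mod[OF n0] int_embed_add int_embed_mult\<close>)
  then show ?thesis unfolding is_ring_iso_def by blast
qed

text \<open>An inverse of \<open>k\<close> modulo \<open>p\<close> makes the multiple
  \<open>k\<close> of one a unit, hence nonzero.\<close>

lemma prime_card_iso:
  assumes p: "prime p" and card: "card (carrier R) = p"
  shows "residue_ring (int p) \<simeq> R"
proof (rule residue_ring_iso)
  have p1: "1 < p" using p prime_gt_1_nat by blast
  then show "1 < int p" "int (card (carrier R)) = int p" using card by simp_all
  have one: "\<one> ~= \<zero>"
  proof
    assume "\<one> = \<zero>"
    then have "carrier R = {\<zero>}" using carrier_one_zero by blast
    then show False using card p1 by simp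
  qed
  fix k :: int assume k: "0 < k" "k < int p"
  have "coprime (int p) k" using p k by (intro prime_imp_coprime) (auto dest: zdvd_imp_le)
  then obtain x where x: "[k * x = 1] (mod int p)" using cong_solve_coprime_int[of k "int p"] by (auto simp: coprime_commute)
  have n0: "add_pow R (int p) \<one> = \<zero>" using card_multiple_one card by simp
  have "add_pow R (k * x) \<one> = add_pow R ((1 :: int)) \<one>"
    using int_embed_mod[OF n0, of "k * x"] int_embed_mod[OF n0, of 1] x unfolding cong_def by simp
  then have "add_pow R k \<one> \<otimes> add_pow R (x) \<one> = \<one>" unfolding int_embed_mult by simp
  then show "add_pow R k \<one> ~= \<zero>" using one by auto
qed

text \<open>The fibres of multiplication by \<open>m\<close> are the cosets of its
  annihilator.\<close>

lemma card_image_annihilator: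
  assumes fin: "finite (carrier R)" and m: "m : carrier R"
  shows "card (carrier R) = card ((%x. m \<otimes> x) ` carrier R) * card {x : carrier R. m \<otimes> x = \<zero>}"
proof -
  let ?f = "%x. m \<otimes> x" and ?A = "{x : carrier R. m \<otimes> x = \<zero>}"
  have fib: "card {x : carrier R. ?f x = y} = card ?A" if y: "y : ?f ` carrier R" for y
  proof -
    obtain x0 where x0: "x0 : carrier R" "y = m \<otimes> x0" using y by blast
    have "bij_betw (%x. x0 \<oplus> x) ?A {x : carrier R. ?f x = y}"
    proof (rule bij_betwI[where g = "%x. x \<ominus> x0"])
      show "(%x. x0 \<oplus> x) : ?A \<rightarrow> {x : carrier R. ?f x = y}" using m x0 by (auto simp: r_distr)
      show "(%x. x \<ominus> x0) : {x : carrier R. ?f x = y} \<rightarrow> ?A"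
      proof
        fix x assume x: "x : {x : carrier R. ?f x = y}"
        then have xc: "x : carrier R" "m \<otimes> x = m \<otimes> x0" using x0(2) by simp_all
        have "m \<otimes> (x \<ominus> x0) = m \<otimes> x \<ominus> m \<otimes> x0" using m x0(1) xc(1) by algebra
        then show "x \<ominus> x0 : ?A" using xc x0(1) m by simp
      qed
      have "(x0 \<oplus> x) \<ominus> x0 = x" "x0 \<oplus> (x \<ominus> x0) = x" if "x : carrier R" for x using that x0(1) by algebra+
      then show "(x0 \<oplus> x) \<ominus> x0 = x" if "x : ?A" for x using that by simp
      show "x0 \<oplus> (x \<ominus> x0) = x" if "x : {x : carrier R. ?f x = y}" for x
        using that \<open>!!x. x : carrier R ==> x0 \<oplus> (x \<ominus> x0) = x\<close> by simp
    qed
    from bij_betw_same_card[OF this] show ?thesis by simp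
  qed
  have "card (carrier R) = (\<Sum>x\<in>carrier R. 1)" by simp
  also have "\<dots> = (\<Sum>y\<in>?f ` carrier R. \<Sum>x | x : carrier R & ?f x = y. 1)" by (rule sum.image_gen[OF fin])
  also have "\<dots> = (\<Sum>y\<in>?f ` carrier R. card ?A)" using fib by (intro sum.cong) auto
  finally show ?thesis by simp
qed

lemma annihilator_nonunits:
  assumes "m : carrier R" "m ~= \<zero>"
  shows "{x : carrier R. m \<otimes> x = \<zero>} \<subseteq> nonunits R"
proof
  fix x assume x: "x : {x : carrier R. m \<otimes> x = \<zero>}"
  have "x ~: Units R"
  proof
    assume "x : Units R"
    then obtain y where y: "y : carrier R" "x \<otimes> y = \<one>" using Units_iff by blast
    have xm: "x : carrier R" "m \<otimes> x = \<zero>" using x by simp_all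
    have "m \<otimes> x \<otimes> y = m \<otimes> (x \<otimes> y)" by (rule m_assoc[OF assms(1) xm(1) y(1)])
    then have "m \<otimes> x \<otimes> y = m" using y(2) assms(1) by simp
    then show False unfolding xm(2) using y(1) assms(2) by simp
  qed
  then show "x : nonunits R" using x by (simp add: nonunits_def)
qed

lemma multiples_nonunits:
  assumes "m : nonunits R"
  shows "(%x. m \<otimes> x) ` carrier R \<subseteq> nonunits R"
  using nonunit_mult[OF assms] by blast

text \<open>The multiples and the annihilator of \<open>m\<close> consist of nonunits, and their
  sizes multiply to 8, so one of them has at least four elements.\<close>

lemma order_eight_nonunits:
  assumes card: "card (carrier R) = 8" and m: "m : nonunits R" "m ~= \<zero>"
  shows "4 <= card (nonunits R)"
proof -
  have fin: "finite (carrier R)" using card card.infinite by fastforce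
  have finN: "finite (nonunits R)" using fin by (rule finite_subset[rotated]) (auto simp: nonunits_def)
  let ?I = "(%x. m \<otimes> x) ` carrier R" and ?A = "{x : carrier R. m \<otimes> x = \<zero>}"
  have "card ?I * card ?A = 8" using card_image_annihilator[OF fin nonunitsD(1)[OF m(1)]] card by simp
  moreover have "card ?I <= card (nonunits R)" by (rule card_mono[OF finN multiples_nonunits[OF m(1)]])
  moreover have "card ?A <= card (nonunits R)"
    by (rule card_mono[OF finN annihilator_nonunits[OF nonunitsD(1)[OF m(1)] m(2)]])
  moreover have "a * b ~= 8" if "a <= 3" "b <= 3" for a b :: nat
  proof -
    have "a : {0, 1, 2, 3}" "b : {0, 1, 2, 3}" using that by auto
    then show ?thesis by auto
  qed
  ultimately have "~(card ?I <= 3 & card ?A <= 3)" "card ?I <= card (nonunits R)" "card ?A <= card (nonunits R)"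
    by blast+
  then show ?thesis by linarith
qed

text \<open>Modulo 6 the square of 3 is 3, so the multiple 3 of one is idempotent. If it is zero or
  one, then 3 or 2 annihilates the ring; Sylow's theorem gives a nonzero element annihilated by the
  other prime as well, which is impossible.\<close>

lemma order_six_idempotent:
  assumes card: "card (carrier R) = 6"
  shows "~ connected_ring R"
proof
  assume conn: "connected_ring R"
  have fin: "finite (carrier R)" using card card.infinite by fastforce
  have n0: "add_pow R (6 :: int) \<one> = \<zero>" using card_multiple_one card by simp
  have "add_pow R (3 :: int) \<one> \<otimes> add_pow R (3 :: int) \<one> = add_pow R (9 :: int) \<one>" unfolding int_embed_mult[symmetric] by simp
  also have "\<dots> = add_pow R (3 :: int) \<one>" using int_embed_mod[OF n0, of 9] by simp
  finally have "add_pow R (3 :: int) \<one> = \<zero> | add_pow R (3 :: int) \<one> = \<one>" using conn unfolding connected_ring_def by simp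
  moreover have "add_pow R (3 :: int) \<one> = add_pow R (2 :: int) \<one> \<oplus> \<one>" using int_embed_add[of 2 1] by simp
  ultimately have "add_pow R (3 :: int) \<one> = \<zero> | add_pow R (2 :: int) \<one> = \<zero>" using add.r_cancel_one[of \<one> "add_pow R (2 :: int) \<one>"] by auto
  then obtain p q :: nat and a b :: int where pq: "p * q = 6" "prime q" "add_pow R (int p) \<one> = \<zero>"
    and ab: "a * int p + b * int q = 1"
  proof
    assume "add_pow R (3 :: int) \<one> = \<zero>"
    then show thesis by (intro that[of 3 2 1 "- 1"]) (auto simp: two_is_prime_nat)
  next
    assume a: "add_pow R (2 :: int) \<one> = \<zero>"
    have "prime (3 :: nat)" by (simp add: prime_nat_numeral_eq)
    then show thesis using a by (intro that[of 2 3 "- 1" 1]) auto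
  qed
  have "EX H. subgroup H (add_monoid R) & card H = q ^ 1"
    by (rule sylow_thm[OF pq(2) add.group_axioms, of 1 p]) (use pq(1) card fin in \<open>simp_all add: order_def mult.commute\<close>)
  then obtain H where H: "subgroup H (add_monoid R)" "card H = q" by auto
  have "2 <= card H" using H(2) prime_ge_2_nat[OF pq(2)] by simp
  then have "~ H \<subseteq> {\<zero>}" using card_mono[of "{\<zero>}" H] by auto
  then obtain x where x: "x : H" "x ~= \<zero>" by blast
  have xc: "x : carrier R" using subgroup.mem_carrier[OF H(1) x(1)] by simp
  have "add_pow R (int p) x = add_pow R (int p) (\<one> \<otimes> x)" using xc by simp
  also have "\<dots> = add_pow R (int p) \<one> \<otimes> x" using add_pow_ldistr_int[of \<one> x "int p"] xc by simp
  finally have px: "add_pow R (int p) x = \<zero>" using pq(3) xc by simp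
  interpret H: group "(add_monoid R)\<lparr>carrier := H\<rparr>" using subgroup.subgroup_is_group[OF H(1) add.group_axioms] .
  have "x [^]\<^bsub>(add_monoid R)\<lparr>carrier := H\<rparr>\<^esub> order ((add_monoid R)\<lparr>carrier := H\<rparr>) = \<one>\<^bsub>(add_monoid R)\<lparr>carrier := H\<rparr>\<^esub>"
    by (rule H.pow_order_eq_1) (use x in simp)
  then have "x [^]\<^bsub>add_monoid R\<^esub> q = \<zero>" using H(2) by (simp add: order_def nat_pow_def)
  then have qx: "add_pow R (int q) x = \<zero>" using add_pow_int_ge[of "int q" R x] by (simp add: add_pow_def)
  have "x = add_pow R (a * int p + b * int q) x" using xc unfolding ab by simp
  also have "\<dots> = add_pow R (a) (add_pow R (int p) x) \<oplus> add_pow R (b) (add_pow R (int q) x)"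
    using xc by (simp add: add.int_pow_mult add.int_pow_pow mult.commute)
  finally show False using x(2) px qx by simp
qed

end

lemma connected_card_cases:
  assumes R: "cring R" and nz: "\<one>\<^bsub>R\<^esub> ~= \<zero>\<^bsub>R\<^esub>" and fin: "finite (carrier R)" and conn: "connected_ring R"
    and le: "card (carrier R) <= 8"
  shows "card (carrier R) : {2, 3, 4, 5, 7, 8}"
proof -
  interpret cring R by fact
  have "card {\<one>\<^bsub>R\<^esub>, \<zero>\<^bsub>R\<^esub>} <= card (carrier R)" using fin by (intro card_mono) auto
  then have "2 <= card (carrier R)" using nz by simp
  moreover have "card (carrier R) ~= 6" using order_six_idempotent conn by blast
  ultimately show ?thesis using le by (auto simp: le_Suc_eq numeral_eq_Suc)
qed

section \<open>Rings of order four with a nilpotent element\<close>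

text \<open>There are two such rings up to isomorphism, integers modulo 4 and dual numbers over two
  elements; they differ in whether \<open>1 + 1\<close> is \<open>m\<close> or zero.\<close>

locale square_zero_ring = cring R for R (structure) +
  fixes m
  assumes four: "card (carrier R) = 4" and m: "m : carrier R" "m ~= \<zero>" "m \<otimes> m = \<zero>"
begin

lemma fin: "finite (carrier R)"
  using four card.infinite by fastforce

lemma one_nz: "\<one> ~= \<zero>" "m ~= \<one>"
proof -
  show "\<one> ~= \<zero>" using m(1,2) l_one[OF m(1)] by (metis l_null)
  then show "m ~= \<one>" using m(3) by auto
qed

lemma one_plus_m: "\<one> \<oplus> m : carrier R" "\<one> \<oplus> m ~= \<zero>" "\<one> \<oplus> m ~= \<one>" "\<one> \<oplus> m ~= m"
proof -
  show "\<one> \<oplus> m : carrier R" using m(1) by simp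
  show "\<one> \<oplus> m ~= \<zero>"
  proof
    assume a: "\<one> \<oplus> m = \<zero>"
    have "m = (\<one> \<oplus> m) \<otimes> m" using m(1,3) by (simp add: l_distr)
    then show False using a m(1,2) by simp
  qed
  show "\<one> \<oplus> m ~= \<one>" using m(1,2) add.l_cancel_one[of \<one> m] by simp
  show "\<one> \<oplus> m ~= m" using m(1) one_nz(1) add.r_cancel_one[of m \<one>] by simp
qed

lemma carrier_eq: "carrier R = {\<zero>, \<one>, m, \<one> \<oplus> m}"
proof -
  have "{\<zero>, \<one>, m, \<one> \<oplus> m} \<subseteq> carrier R" using m(1) by auto
  moreover have "card {\<zero>, \<one>, m, \<one> \<oplus> m} = 4" using one_nz one_plus_m m(2) by (auto simp: card_insert_if)
  ultimately show ?thesis using card_subset_eq[OF fin] four by metis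
qed

lemma two_cases: "\<one> \<oplus> \<one> = \<zero> | \<one> \<oplus> \<one> = m"
proof -
  have "\<one> \<oplus> \<one> : carrier R" by simp
  moreover have "\<one> \<oplus> \<one> ~= \<one>" using one_nz(1) add.l_cancel_one[of \<one> \<one>] by simp
  moreover have "\<one> \<oplus> \<one> ~= \<one> \<oplus> m" using one_nz(2) m(1) add.right_cancel[of \<one> \<one> m] by (auto simp: a_comm)
  ultimately show ?thesis unfolding carrier_eq by auto
qed

lemma m_add: "m \<oplus> m = \<zero>"
proof -
  have "add_pow R (4 :: int) \<one> = \<zero>" using card_multiple_one four by simp
  moreover have "add_pow R (4 :: int) \<one> = (\<one> \<oplus> \<one>) \<oplus> (\<one> \<oplus> \<one>)"
    using int_embed_add[of 2 2] int_embed_add[of 1 1] by simp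
  ultimately have 4: "(\<one> \<oplus> \<one>) \<oplus> (\<one> \<oplus> \<one>) = \<zero>" by simp
  have "m \<oplus> m = (\<one> \<oplus> \<one>) \<otimes> m" using m(1) by (simp add: l_distr)
  then show ?thesis using two_cases m(1) 4 by auto
qed

lemma nonunits_eq: "nonunits R = {\<zero>, m}"
proof -
  have "(\<one> \<oplus> m) \<otimes> (\<one> \<oplus> m) = \<one> \<oplus> (m \<oplus> m) \<oplus> m \<otimes> m" using m(1) by algebra
  then have "(\<one> \<oplus> m) \<otimes> (\<one> \<oplus> m) = \<one>" using m m_add by simp
  then have u: "\<one> \<oplus> m : Units R" using one_plus_m(1) Units_iff by blast
  have "m ~: Units R"
  proof
    assume "m : Units R"
    then obtain y where y: "y : carrier R" "m \<otimes> y = \<one>" using Units_iff by blast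
    have "m \<otimes> m \<otimes> y = m \<otimes> (m \<otimes> y)" by (rule m_assoc[OF m(1) m(1) y(1)])
    then show False unfolding m(3) y(2) using m(1,2) y(1) by simp
  qed
  moreover have "\<zero> ~: Units R" using zero_nonunit[OF one_nz(1)] by (simp add: nonunits_def)
  ultimately show ?thesis unfolding nonunits_def carrier_eq using u by auto
qed

lemma residue_iso: "\<one> \<oplus> \<one> ~= \<zero> ==> residue_ring 4 \<simeq> R"
proof (rule residue_ring_iso)
  assume two: "\<one> \<oplus> \<one> ~= \<zero>"
  have n0: "add_pow R (4 :: int) \<one> = \<zero>" using card_multiple_one four by simp
  fix k :: int assume "0 < k" "k < 4"
  then have "k : {1, 2, 3}" by auto
  moreover have "add_pow R (1 :: int) \<one> ~= \<zero>" using one_nz(1) by simp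
  moreover have "add_pow R (2 :: int) \<one> ~= \<zero>" using two int_embed_add[of 1 1] by simp
  moreover have "add_pow R (3 :: int) \<one> ~= \<zero>"
  proof
    assume "add_pow R (3 :: int) \<one> = \<zero>"
    then have "add_pow R (4 :: int) \<one> = \<one>" using int_embed_add[of 3 1] by simp
    then show False using n0 one_nz(1) by simp
  qed
  ultimately show "add_pow R k \<one> ~= \<zero>" by blast
qed (use four in auto)

lemma char_two_table:
  assumes two: "\<one> \<oplus> \<one> = \<zero>"
  shows "\<one> \<oplus> (\<one> \<oplus> m) = m" "(\<one> \<oplus> m) \<oplus> \<one> = m" "m \<oplus> \<one> = \<one> \<oplus> m" "m \<oplus> (\<one> \<oplus> m) = \<one>" "(\<one> \<oplus> m) \<oplus> m = \<one>"
    "(\<one> \<oplus> m) \<oplus> (\<one> \<oplus> m) = \<zero>" "m \<otimes> (\<one> \<oplus> m) = m" "(\<one> \<oplus> m) \<otimes> m = m" "(\<one> \<oplus> m) \<otimes> (\<one> \<oplus> m) = \<one>"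
proof -
  show "\<one> \<oplus> (\<one> \<oplus> m) = m" using two m(1) by (simp add: a_assoc[symmetric])
  then show "(\<one> \<oplus> m) \<oplus> \<one> = m" using m(1) by (simp add: a_comm)
  show "m \<oplus> \<one> = \<one> \<oplus> m" using m(1) by (simp add: a_comm)
  show "(\<one> \<oplus> m) \<oplus> m = \<one>" using m(1) m_add by (simp add: a_assoc)
  then show "m \<oplus> (\<one> \<oplus> m) = \<one>" using m(1) by (simp add: a_comm)
  have "(\<one> \<oplus> m) \<oplus> (\<one> \<oplus> m) = (\<one> \<oplus> \<one>) \<oplus> (m \<oplus> m)" using m(1) by algebra
  then show "(\<one> \<oplus> m) \<oplus> (\<one> \<oplus> m) = \<zero>" using two m_add by simp
  show "m \<otimes> (\<one> \<oplus> m) = m" "(\<one> \<oplus> m) \<otimes> m = m" using m by (simp_all add: r_distr l_distr)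
  have "(\<one> \<oplus> m) \<otimes> (\<one> \<oplus> m) = \<one> \<oplus> (m \<oplus> m) \<oplus> m \<otimes> m" using m(1) by algebra
  then show "(\<one> \<oplus> m) \<otimes> (\<one> \<oplus> m) = \<one>" using m m_add by simp
qed

end

lemma square_zero_char_two_iso:
  assumes R: "square_zero_ring R m" and S: "square_zero_ring S n"
    and two: "\<one>\<^bsub>R\<^esub> \<oplus>\<^bsub>R\<^esub> \<one>\<^bsub>R\<^esub> = \<zero>\<^bsub>R\<^esub>" "\<one>\<^bsub>S\<^esub> \<oplus>\<^bsub>S\<^esub> \<one>\<^bsub>S\<^esub> = \<zero>\<^bsub>S\<^esub>"
  shows "R \<simeq> S"
proof -
  interpret R: square_zero_ring R m by fact
  interpret S: square_zero_ring S n by fact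
  define h where "h x = (if x = \<zero>\<^bsub>R\<^esub> then \<zero>\<^bsub>S\<^esub> else if x = \<one>\<^bsub>R\<^esub> then \<one>\<^bsub>S\<^esub> else if x = m then n else \<one>\<^bsub>S\<^esub> \<oplus>\<^bsub>S\<^esub> n)" for x
  have hv: "h \<zero>\<^bsub>R\<^esub> = \<zero>\<^bsub>S\<^esub>" "h \<one>\<^bsub>R\<^esub> = \<one>\<^bsub>S\<^esub>" "h m = n" "h (\<one>\<^bsub>R\<^esub> \<oplus>\<^bsub>R\<^esub> m) = \<one>\<^bsub>S\<^esub> \<oplus>\<^bsub>S\<^esub> n"
    using R.one_nz R.m(2) R.one_plus_m unfolding h_def by simp_all
  have "h : ring_iso R S"
  proof (rule ring_iso_memI)
    show "h x : carrier S" if "x : carrier R" for x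
      using that S.m(1) S.one_plus_m(1) unfolding R.carrier_eq by (elim insertE emptyE) (simp_all only: hv S.zero_closed S.one_closed)
    show "bij_betw h (carrier R) (carrier S)"
    proof -
      have im: "h ` carrier R = carrier S" unfolding R.carrier_eq S.carrier_eq by (simp add: hv)
      then have "inj_on h (carrier R)" using R.four S.four by (intro eq_card_imp_inj_on) (simp_all add: R.fin)
      then show ?thesis using im by (simp add: bij_betw_def)
    qed
    show "h (x \<otimes>\<^bsub>R\<^esub> y) = h x \<otimes>\<^bsub>S\<^esub> h y" if "x : carrier R" "y : carrier R" for x y
      using that unfolding R.carrier_eq
      by (elim insertE emptyE) (simp_all add: hv R.m S.m R.one_plus_m(1) S.one_plus_m(1) R.char_two_table(7-)[OF two(1)] S.char_two_table(7-)[OF two(2)])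
    show "h (x \<oplus>\<^bsub>R\<^esub> y) = h x \<oplus>\<^bsub>S\<^esub> h y" if "x : carrier R" "y : carrier R" for x y
      using that unfolding R.carrier_eq
      by (elim insertE emptyE) (simp_all add: hv two R.m(1) S.m(1) R.m_add S.m_add R.char_two_table(1-6)[OF two(1)] S.char_two_table(1-6)[OF two(2)])
  qed (rule hv(2))
  then show ?thesis unfolding is_ring_iso_def by blast
qed

text \<open>The multiples and the annihilator of \<open>m\<close> have at least two elements each,
  with product four. So the multiples are zero and \<open>m\<close>, and \<open>m * m = m\<close> is
  excluded by the absence of idempotents.\<close>

lemma (in cring) order_four_nonfield:
  assumes card: "card (carrier R) = 4" and conn: "connected_ring R" and m: "m : nonunits R" "m ~= \<zero>"
  shows "square_zero_ring R m"
proof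
  have mc: "m : carrier R" using m(1) nonunitsD by blast
  have fin: "finite (carrier R)" using card card.infinite by fastforce
  let ?I = "(%x. m \<otimes> x) ` carrier R" and ?A = "{x : carrier R. m \<otimes> x = \<zero>}"
  have c: "card ?I * card ?A = 4" using card_image_annihilator[OF fin mc] card by simp
  have "\<zero> : ?I" by (rule image_eqI[of _ _ \<zero>]) (use mc in simp_all)
  moreover have "m : ?I" by (rule image_eqI[of _ _ \<one>]) (use mc in simp_all)
  ultimately have sub: "{\<zero>, m} \<subseteq> ?I" by blast
  have "card {\<zero>, m} <= card ?I" using fin sub by (intro card_mono) auto
  then have I2: "2 <= card ?I" using m(2) by simp
  have "~ ?A \<subseteq> {\<zero>}"
  proof
    assume "?A \<subseteq> {\<zero>}"
    then have "m : Units R" using injective_mult_unit[OF fin mc] by blast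
    then show False using m(1) nonunitsD by blast
  qed
  then obtain a where "a : ?A" "a ~= \<zero>" by blast
  moreover have "\<zero> : ?A" using mc by simp
  ultimately have "card {\<zero>, a} <= card ?A" using fin by (intro card_mono) auto
  then have "2 <= card ?A" using \<open>a ~= \<zero>\<close> by simp
  have "card ?I = 2"
  proof (rule ccontr)
    assume "card ?I ~= 2"
    then have "3 * 2 <= card ?I * card ?A" using I2 \<open>2 <= card ?A\<close> by (intro mult_le_mono) auto
    then show False using c by simp
  qed
  then have I: "?I = {\<zero>, m}" using card_subset_eq[OF _ sub] fin m(2) by simp
  have "m \<otimes> m : ?I" using mc by blast
  then have "m \<otimes> m = \<zero> | m \<otimes> m = m" unfolding I by blast
  moreover have "m \<otimes> m ~= m"
  proof
    assume "m \<otimes> m = m"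
    then have "m = \<one>" using conn mc m(2) unfolding connected_ring_def by blast
    then show False using m(1) nonunitsD Units_one_closed by blast
  qed
  ultimately show "m \<otimes> m = \<zero>" by blast
  show "m : carrier R" by (rule mc)
qed (use card m in auto)

text \<open>\<open>(a, b)\<close> stands for \<open>a + b x\<close> with \<open>x^2 = 0\<close>: a
  table in place of the polynomial quotient.\<close>

definition dual_ring :: "(int \<times> int) ring" where
  "dual_ring = \<lparr>carrier = {0, 1} \<times> {0, 1},
     monoid.mult = %x y. ((fst x * fst y) mod 2, (fst x * snd y + snd x * fst y) mod 2),
     one = (1, 0), zero = (0, 0), add = %x y. ((fst x + fst y) mod 2, (snd x + snd y) mod 2)\<rparr>"

lemma dual_ring_simps:
  "carrier dual_ring = {0, 1} \<times> {0, 1}" "\<one>\<^bsub>dual_ring\<^esub> = (1, 0)" "\<zero>\<^bsub>dual_ring\<^esub> = (0, 0)"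
  "x \<otimes>\<^bsub>dual_ring\<^esub> y = ((fst x * fst y) mod 2, (fst x * snd y + snd x * fst y) mod 2)"
  "x \<oplus>\<^bsub>dual_ring\<^esub> y = ((fst x + fst y) mod 2, (snd x + snd y) mod 2)"
  by (simp_all add: dual_ring_def)

lemma dual_ring_cring: "cring dual_ring"
proof (rule cringI)
  show "abelian_group dual_ring"
  proof (rule abelian_groupI)
    fix x assume "x : carrier dual_ring"
    then show "EX y:carrier dual_ring. y \<oplus>\<^bsub>dual_ring\<^esub> x = \<zero>\<^bsub>dual_ring\<^esub>"
      by (intro bexI[of _ x]) (auto simp: dual_ring_simps)
  qed (auto simp: dual_ring_simps)
  show "Group.comm_monoid dual_ring"
    by (rule comm_monoidI) (auto simp: dual_ring_simps)
qed (auto simp: dual_ring_simps)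

text \<open>Taking the two lowest coefficients is a surjective homomorphism whose kernel is
  generated by the square of the variable.\<close>

lemma Z2_dual_numbers_iso: "ring Z2_dual_numbers" "Z2_dual_numbers \<simeq> dual_ring"
proof -
  let ?F = "residue_ring 2"
  define P where "P = UP ?F"
  interpret res: residues 2 ?F by unfold_locales simp_all
  interpret F: cring ?F by (rule res.cring)
  interpret UP_cring ?F P by unfold_locales (rule eq_reflection, rule P_def)
  let ?X = "monom P \<one>\<^bsub>?F\<^esub> 2"
  have X: "?X : carrier P" by simp
  have Z: "Z2_dual_numbers = P Quot (Idl\<^bsub>P\<^esub> {?X})" by (simp add: Z2_dual_numbers_def Let_def P_def)
  have I: "ideal (Idl\<^bsub>P\<^esub> {?X}) P" using P.genideal_ideal X by simp
  show "ring Z2_dual_numbers" unfolding Z by (rule ideal.quotient_is_ring[OF I])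
  have Fs: "carrier ?F = {0, 1}" "x \<otimes>\<^bsub>?F\<^esub> y = (x * y) mod 2" "x \<oplus>\<^bsub>?F\<^esub> y = (x + y) mod 2" "\<zero>\<^bsub>?F\<^esub> = 0" "\<one>\<^bsub>?F\<^esub> = 1" for x y
    by (auto simp: residue_ring_def)
  define \<phi> where "\<phi> p = (coeff P p 0, coeff P p 1)" for p
  have c01: "coeff P p n = 0 | coeff P p n = 1" if "p : carrier P" for p n
    using coeff_closed[OF that, of n] unfolding Fs(1) by blast
  have cf0: "coeff P (p \<otimes>\<^bsub>P\<^esub> q) 0 = coeff P p 0 \<otimes>\<^bsub>?F\<^esub> coeff P q 0"
    if "p : carrier P" "q : carrier P" for p q
    using that by simp
  have cf1: "coeff P (p \<otimes>\<^bsub>P\<^esub> q) (Suc 0) =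
      coeff P p (Suc 0) \<otimes>\<^bsub>?F\<^esub> coeff P q 0 \<oplus>\<^bsub>?F\<^esub> coeff P p 0 \<otimes>\<^bsub>?F\<^esub> coeff P q (Suc 0)"
    if "p : carrier P" "q : carrier P" for p q
    using that by (subst coeff_mult) (simp_all add: Pi_def)
  have hom: "\<phi> : ring_hom P dual_ring"
  proof (rule ring_hom_memI)
    show "\<phi> p : carrier dual_ring" if "p : carrier P" for p
      using c01[OF that] by (auto simp: \<phi>_def dual_ring_simps)
    show "\<phi> (p \<otimes>\<^bsub>P\<^esub> q) = \<phi> p \<otimes>\<^bsub>dual_ring\<^esub> \<phi> q" if pq: "p : carrier P" "q : carrier P" for p q
      using cf0[OF pq] cf1[OF pq] by (simp add: \<phi>_def dual_ring_simps Fs mod_simps add.commute)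
    show "\<phi> (p \<oplus>\<^bsub>P\<^esub> q) = \<phi> p \<oplus>\<^bsub>dual_ring\<^esub> \<phi> q" if "p : carrier P" "q : carrier P" for p q
      using that by (simp add: \<phi>_def dual_ring_simps Fs)
    show "\<phi> \<one>\<^bsub>P\<^esub> = \<one>\<^bsub>dual_ring\<^esub>" by (simp add: \<phi>_def dual_ring_simps Fs)
  qed
  interpret H: ring_hom_ring P dual_ring \<phi>
    by (rule ring_hom_ringI2[OF P.ring_axioms cring.axioms(1)[OF dual_ring_cring] hom])
  have surj: "\<phi> ` carrier P = carrier dual_ring"
  proof
    show "carrier dual_ring \<subseteq> \<phi> ` carrier P"
    proof
      fix x assume "x : carrier dual_ring"
      then obtain a b where ab: "x = (a, b)" "a : carrier ?F" "b : carrier ?F" by (auto simp: dual_ring_simps Fs)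
      let ?p = "monom P a 0 \<oplus>\<^bsub>P\<^esub> monom P b 1"
      have "?p : carrier P" using ab by simp
      moreover have "\<phi> ?p = x" using ab by (auto simp: \<phi>_def Fs)
      ultimately show "x : \<phi> ` carrier P" by blast
    qed
  qed (use H.hom_closed in blast)
  have ker: "a_kernel P dual_ring \<phi> = {p : carrier P. coeff P p 0 = 0 & coeff P p 1 = 0}"
    by (auto simp: a_kernel_def' \<phi>_def dual_ring_simps)
  have "a_kernel P dual_ring \<phi> = Idl\<^bsub>P\<^esub> {?X}"
  proof
    show "Idl\<^bsub>P\<^esub> {?X} \<subseteq> a_kernel P dual_ring \<phi>"
      by (rule P.genideal_minimal[OF H.kernel_is_ideal]) (simp add: ker Fs)
    show "a_kernel P dual_ring \<phi> \<subseteq> Idl\<^bsub>P\<^esub> {?X}"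
    proof
      fix p assume "p : a_kernel P dual_ring \<phi>"
      then have p: "p : carrier P" "coeff P p 0 = 0" "coeff P p 1 = 0" by (simp_all add: ker)
      \<comment> \<open>Shifting the coefficients by two divides a polynomial of the kernel by the
        square of the variable.\<close>
      define q where "q n = coeff P p (n + 2)" for n
      have car: "carrier P = up ?F" by (simp add: P_def UP_def)
      have "bound \<zero>\<^bsub>?F\<^esub> (deg ?F p) q"
      proof
        fix k assume "deg ?F p < k"
        then show "q k = \<zero>\<^bsub>?F\<^esub>" unfolding q_def using deg_aboveD[of p "k + 2"] p(1) by simp
      qed
      then have q: "q : carrier P" unfolding car using coeff_closed[OF p(1)] by (intro mem_upI) (auto simp: q_def)
      have cq: "coeff P q n = coeff P p (n + 2)" for n
        using q unfolding car by (simp add: P_def UP_def q_def)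
      have "p = ?X \<otimes>\<^bsub>P\<^esub> q"
      proof (rule up_eqI)
        fix n :: nat
        consider "n = 0" | "n = Suc 0" | k where "n = k + 2" by (metis One_nat_def add_2_eq_Suc' not0_implies_Suc)
        then show "coeff P p n = coeff P (?X \<otimes>\<^bsub>P\<^esub> q) n"
        proof cases
          case 1
          then show ?thesis using p q cf0[OF X q] by (simp add: Fs)
        next
          case 2
          then show ?thesis using p q cf1[OF X q] by (simp add: Fs)
        next
          case (3 k)
          then show ?thesis using coeff_monom_mult[of "\<one>\<^bsub>?F\<^esub>" q 2 k] q cq[of k] coeff_closed[OF p(1)] by simp
        qed
      qed (use p q X in auto)
      then have "p = q \<otimes>\<^bsub>P\<^esub> ?X" using P.m_comm[OF X q] by simp
      then show "p : Idl\<^bsub>P\<^esub> {?X}"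
        using ideal.I_l_closed[OF I P.genideal_self'[OF X] q] by simp
    qed
  qed
  then show "Z2_dual_numbers \<simeq> dual_ring" unfolding Z using H.FactRing_iso[OF surj] by simp
qed

section \<open>The listed rings have genus two\<close>

definition listed :: "('a, 'm) ring_scheme => bool" where
  "listed R \<longleftrightarrow>
      R \<simeq> RDirProd (residue_ring 2) (RDirProd (residue_ring 2) (residue_ring 3)) |
      (EX F8 :: nat ring. is_GF 8 F8 & R \<simeq> RDirProd (residue_ring 2) F8) |
      (EX F8 :: nat ring. is_GF 8 F8 & R \<simeq> RDirProd (residue_ring 3) F8) |
      (EX (F4 :: nat ring) (F8 :: nat ring). is_GF 4 F4 & is_GF 8 F8 & R \<simeq> RDirProd F4 F8) |
      R \<simeq> RDirProd (residue_ring 7) (residue_ring 7) |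
      R \<simeq> RDirProd (residue_ring 5) (residue_ring 7) |
      R \<simeq> RDirProd (residue_ring 5) (residue_ring 5) |
      (EX F4 :: nat ring. is_GF 4 F4 & R \<simeq> RDirProd F4 (residue_ring 4)) |
      (EX F4 :: nat ring. is_GF 4 F4 & R \<simeq> RDirProd F4 Z2_dual_numbers)"

lemma listed_iso: "R \<simeq> S ==> listed S ==> listed R"
  unfolding listed_def by (elim disjE exE conjE) (drule (1) ring_iso_trans, blast)+

lemma ring_embeds_iso:
  assumes "cring R" "cring S" "R \<simeq> S"
  shows "ring_embeds R g \<longleftrightarrow> ring_embeds S g"
proof -
  obtain h where h: "h : ring_iso R S" using assms(3) unfolding is_ring_iso_def by blast
  have h': "inv_into (carrier R) h : ring_iso S R" using ring_iso_set_sym[OF cring.axioms(1)[OF assms(1)] h] .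
  show ?thesis unfolding ring_embeds_def
    by (rule iffI) (erule embeds_ring_iso[OF assms(2,1) h'], erule embeds_ring_iso[OF assms(1,2) h])
qed

lemma residue_field: "prime p ==> field (residue_ring (int p))"
  by (rule residues_prime.is_field[OF residues_prime.intro])

lemma residue_small_fields:
  "field (residue_ring 2)" "field (residue_ring 3)" "field (residue_ring 5)" "field (residue_ring 7)"
  using residue_field[of 2] residue_field[of 3] residue_field[of 5] residue_field[of 7]
  by (simp_all add: prime_nat_numeral_eq)

lemma residue_card: "0 <= n ==> card (carrier (residue_ring n)) = nat n" "finite (carrier (residue_ring n))"
  by (simp_all add: residue_ring_def)

lemma residue_cring: "1 < n ==> cring (residue_ring n)"
  by (rule residues.cring[OF residues.intro])

lemma field_cring: "field F ==> cring F"
  by (rule domain.axioms(1)[OF field.axioms(1)])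

lemma field_pair: "field A ==> field B ==> cring_pair A B"
  by (intro cring_pair.intro cring_pair_axioms.intro field_cring domain.one_not_zero field.axioms(1))

text \<open>The eight elements of \<open>B\<close> and at most three nonzero elements of
  \<open>A\<close> fit the drawing of \<open>K_8\<close> with its tail; the \<open>K_8\<close>
  excludes the torus.\<close>

lemma genus_small_field_eight:
  assumes A: "field A" "card (carrier A) <= 4" "finite (carrier A)" and B: "field B" "card (carrier B) = 8"
  shows "ring_embeds (RDirProd A B) 2" "g <= 1 ==> ~ ring_embeds (RDirProd A B) g"
proof -
  note pair = field_pair[OF A(1) B(1)]
  have fin: "finite (carrier B)" using B(2) card.infinite by fastforce
  show "ring_embeds (RDirProd A B) 2"
    by (rule field_pair_embeds[OF pair A(1) B(1), of 8 3 "edges_of (tailed_clique_edges 8)"])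
      (use A B fin tailed_clique_mem[of _ _ 8] eight_embeds in auto)
  show "~ ring_embeds (RDirProd A B) g" if "g <= 1"
    using cring_pair.embeds_factor_card(2)[OF pair _ that] B(2) by fastforce
qed

lemma genus_middle_fields:
  assumes A: "field A" "5 <= card (carrier A)" "card (carrier A) <= 7" and B: "field B" "5 <= card (carrier B)" "card (carrier B) <= 7"
  shows "ring_embeds (RDirProd A B) 2" "g <= 1 ==> ~ ring_embeds (RDirProd A B) g"
proof -
  note pair = field_pair[OF A(1) B(1)]
  have fin: "finite (carrier A)" "finite (carrier B)" using A(2) B(2) card.infinite by fastforce+
  show "ring_embeds (RDirProd A B) 2"
    by (rule field_pair_embeds[OF pair A(1) B(1), of 7 6 "edges_of two_sevens_edges"])
      (use A B fin two_sevens_mem two_sevens_embeds in auto)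
  show "~ ring_embeds (RDirProd A B) g" if "g <= 1"
    by (rule cring_pair.no_five_five[OF pair A(2) B(2) that])
qed

lemma square_zero_pair: "field A ==> square_zero_ring B m ==> cring_pair A B"
  by (rule cring_pair.intro[OF field_cring square_zero_ring.axioms(1) cring_pair_axioms.intro])
    (assumption, assumption, rule domain.one_not_zero[OF field.axioms(1)], assumption, rule square_zero_ring.one_nz(1))

text \<open>The clique over the two nonunits of \<open>B\<close> has eight elements: it fills the
  \<open>K_8\<close> of the drawing and excludes the torus.\<close>

lemma genus_field_square_zero:
  assumes A: "field A" "card (carrier A) = 4" and B: "square_zero_ring B m"
  shows "ring_embeds (RDirProd A B) 2" "g <= 1 ==> ~ ring_embeds (RDirProd A B) g"
proof -
  note pair = square_zero_pair[OF A(1) B]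
  have fin: "finite (carrier A)" using A(2) card.infinite by fastforce
  note N = square_zero_ring.nonunits_eq[OF B] square_zero_ring.m(2)[OF B] square_zero_ring.four[OF B]
  show "ring_embeds (RDirProd A B) 2"
    by (rule field_nonfield_embeds[OF pair A(1) N, of 8]) (use eight_embeds A(2) fin in simp_all)
  show "~ ring_embeds (RDirProd A B) g" if "g <= 1"
    using cring_pair.embeds_nonfield_card(2)[OF pair _ _ N(2) that] N(1) A(2) by fastforce
qed

lemma small_fields_embed:
  assumes A: "field A" "card (carrier A) <= 4" "finite (carrier A)" and B: "field B" "card (carrier B) <= 7" "finite (carrier B)"
  shows "ring_embeds (RDirProd A B) 1"
  by (rule field_pair_embeds[OF field_pair[OF A(1) B(1)] A(1) B(1), of 7 3 "edges_of (tailed_clique_edges 7)"])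
    (use A B tailed_clique_mem[of _ _ 7] seven_embeds in auto)

lemma small_field_square_zero_embed:
  assumes A: "field A" "card (carrier A) <= 3" "finite (carrier A)" and B: "square_zero_ring B m"
  shows "ring_embeds (RDirProd A B) 1"
  by (rule field_nonfield_embeds[OF square_zero_pair[OF A(1) B] A(1) square_zero_ring.nonunits_eq[OF B]
        square_zero_ring.m(2)[OF B] square_zero_ring.four[OF B], of 7]) (use seven_embeds A in simp_all)

lemma dual_ring_square_zero: "square_zero_ring dual_ring (0, 1)"
  by (rule square_zero_ring.intro[OF dual_ring_cring]) (unfold_locales, auto simp: dual_ring_simps card_cartesian_product)

lemma residue_four_square_zero: "square_zero_ring (residue_ring 4) 2"
  by (rule square_zero_ring.intro[OF residue_cring]) (simp, unfold_locales, auto simp: residue_ring_def)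

definition residue_223 :: "(int \<times> int \<times> int) ring" where
  "residue_223 = RDirProd (residue_ring 2) (RDirProd (residue_ring 2) (residue_ring 3))"

lemma residue_223_cring: "cring residue_223"
  unfolding residue_223_def by (intro RDirProd_cring residue_cring) simp_all

lemma residue_223_nonunits:
  "(i, j, k) : nonunits residue_223 \<longleftrightarrow>
     i : {0, 1} & j : {0, 1} & k : {0, 1, 2} & (i = 0 | j = 0 | k = 0)"
proof -
  have c: "carrier (residue_ring 2) = {0, 1}" "carrier (residue_ring 3) = {0, 1, 2}" by (auto simp: residue_ring_def)
  have n: "nonunits (residue_ring 2) = {0}" "nonunits (residue_ring 3) = {0}"
    using residue_small_fields(1,2)[THEN field.nonunits_field] by (simp_all add: residue_ring_def)
  show ?thesis unfolding residue_223_def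
    using RDirProd_nonunits[OF residue_cring[of 2] RDirProd_cring[OF residue_cring[of 2] residue_cring[of 3]]]
      RDirProd_nonunits[OF residue_cring[of 2] residue_cring[of 3]]
    by (auto simp: c n RDirProd_simps)
qed

lemma residue_223_common:
  assumes "(i, j, k) : nonunits residue_223" "(i', j', k') : nonunits residue_223"
  shows "common residue_223 (i, j, k) (i', j', k') \<longleftrightarrow> i = 0 & i' = 0 | j = 0 & j' = 0 | k = 0 & k' = 0"
proof -
  have c: "carrier (residue_ring 2) = {0, 1}" "carrier (residue_ring 3) = {0, 1, 2}" by (auto simp: residue_ring_def)
  have z: "\<zero>\<^bsub>residue_ring n\<^esub> = 0" for n by (simp add: residue_ring_def)
  have m: "common (residue_ring p) x y \<longleftrightarrow> x = 0 & y = 0" if p: "field (residue_ring p)" for p x y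
  proof
    interpret field "residue_ring p" by (rule p)
    show "x = 0 & y = 0" if "common (residue_ring p) x y" using common_field[OF that] by (simp add: z)
    show "common (residue_ring p) x y" if "x = 0 & y = 0"
    proof -
      have "common (residue_ring p) \<zero>\<^bsub>residue_ring p\<^esub> \<zero>\<^bsub>residue_ring p\<^esub>"
        using commonI[OF zero_nonunit[OF one_not_zero] zero_closed zero_closed] by simp
      then show ?thesis using that by (simp only: z)
    qed
  qed
  have i: "i : {0, 1}" "j : {0, 1}" "k : {0, 1, 2}" "i' : {0, 1}" "j' : {0, 1}" "k' : {0, 1, 2}"
    using assms by (auto simp: residue_223_nonunits)
  have cc: "cring (residue_ring 2)" "cring (residue_ring 3)" "cring (RDirProd (residue_ring 2) (residue_ring 3))"
    by (simp_all add: residue_cring RDirProd_cring)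
  have "common residue_223 (i, j, k) (i', j', k') \<longleftrightarrow>
      common (residue_ring 2) i i' | common (RDirProd (residue_ring 2) (residue_ring 3)) (j, k) (j', k')"
    unfolding residue_223_def by (rule common_RDirProd[OF cc(1,3)]) (use i in \<open>simp_all only: c RDirProd_simps SigmaI\<close>)
  also have "common (RDirProd (residue_ring 2) (residue_ring 3)) (j, k) (j', k') \<longleftrightarrow>
      common (residue_ring 2) j j' | common (residue_ring 3) k k'"
    by (rule common_RDirProd[OF cc(1,2)]) (use i in \<open>simp_all add: c\<close>)
  finally show ?thesis unfolding m[OF residue_small_fields(1)] m[OF residue_small_fields(2)] .
qed

lemma genus_223: "ring_embeds residue_223 2" "g <= 1 ==> ~ ring_embeds residue_223 g"
proof -
  \<comment> \<open>Numbers 0 to 5 have first component zero, 6 to 8 are \<open>(1, 0, k)\<close>,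
    and 9 is \<open>(1, 1, 0)\<close>. The list \<open>v\<close> below is the inverse
    numbering.\<close>
  define h :: "int \<times> int \<times> int => nat" where
    "h = (%(i, j, k). nat (if i = 0 then 3 * j + k else if j = 0 then 6 + k else 9))"
  have hlt: "h p < 10" if "p : nonunits residue_223" for p
    using that by (cases p) (auto simp: residue_223_nonunits h_def)
  define hi :: "nat => int \<times> int \<times> int" where "hi n = (if n < 6 then (0, int n div 3, int n mod 3) else if n < 9 then (1, 0, int n - 6) else (1, 1, 0 :: int))"
    for n :: nat
  have hinv: "hi (h p) = p" if "p : nonunits residue_223" for p
    using that by (cases p) (auto simp: residue_223_nonunits h_def hi_def)
  have inj: "inj_on h (nonunits residue_223)" by (rule inj_on_inverseI[of _ hi]) (rule hinv)
  show "ring_embeds residue_223 2" unfolding ring_embeds_def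
  proof (rule embeds_if_common[OF residue_223_cring three_ideals_embeds inj])
    show "h ` nonunits residue_223 \<subseteq> {..<10}" using hlt by auto
    fix x y assume c: "common residue_223 x y" "x ~= y"
    obtain i j k i' j' k' where xy: "x = (i, j, k)" "y = (i', j', k')" by (metis prod_cases3)
    have N: "(i, j, k) : nonunits residue_223" "(i', j', k') : nonunits residue_223"
      using cring.commonD[OF residue_223_cring c(1)] unfolding xy by blast+
    have "h x ~= h y" using inj_onD[OF inj, of x y] N c(2) unfolding xy by blast
    moreover have "h x < 10" "h y < 10" using N hlt unfolding xy by blast+
    moreover have "h x < 6 & h y < 6 | h x : {0, 1, 2, 6, 7, 8} & h y : {0, 1, 2, 6, 7, 8} | h x : {0, 3, 6, 9} & h y : {0, 3, 6, 9}"
    proof -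
      have a: "h (0, b, d) < 6" if "b : {0, 1}" "d : {0, 1, 2}" for b d using that by (auto simp: h_def)
      have b: "h (a, 0, d) : {0, 1, 2, 6, 7, 8}" if "a : {0, 1}" "d : {0, 1, 2}" for a d using that by (auto simp: h_def)
      have e: "h (a, b, 0) : {0, 3, 6, 9}" if "a : {0, 1}" "b : {0, 1}" for a b using that by (auto simp: h_def)
      have "i = 0 & i' = 0 | j = 0 & j' = 0 | k = 0 & k' = 0" using c(1) residue_223_common[OF N] unfolding xy by blast
      then show ?thesis using N a[of j k] a[of j' k'] b[of i k] b[of i' k'] e[of i j] e[of i' j']
        unfolding xy residue_223_nonunits by (elim disjE conjE) simp_all
    qed
    ultimately show "{h x, h y} : edges_of three_ideals_edges" unfolding three_ideals_mem by blast
  qed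
  show "~ ring_embeds residue_223 g" if g: "g <= 1"
  proof
    assume emb: "ring_embeds residue_223 g"
    define v :: "nat => int \<times> int \<times> int" where
      "v n = [(0, 0, 0), (0, 0, 1), (0, 0, 2), (0, 1, 0), (0, 1, 1), (0, 1, 2), (1, 0, 0), (1, 0, 1), (1, 0, 2), (1, 1, 0)] ! n" for n
    have lt: "n : {0, 1, 2, 3, 4, 5, 6, 7, 8, 9}" if "n < 10" for n :: nat using that by auto
    have vv: "v 0 = (0, 0, 0)" "v 1 = (0, 0, 1)" "v 2 = (0, 0, 2)" "v 3 = (0, 1, 0)" "v 4 = (0, 1, 1)" "v 5 = (0, 1, 2)"
      "v 6 = (1, 0, 0)" "v 7 = (1, 0, 1)" "v 8 = (1, 0, 2)" "v 9 = (1, 1, 0)"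
      unfolding v_def by simp_all
    have vN: "v n : nonunits residue_223" if "n < 10" for n
      using lt[OF that] by (elim insertE emptyE) (simp_all only: vv, simp_all add: residue_223_nonunits)
    have "graph_embeds_in {..<10} (edges_of three_ideals_edges) (handle_surface g)"
    proof (rule embeds_edges_of[OF emb[unfolded ring_embeds_def], of v])
      show inj: "inj_on v {..<10}"
      proof -
        have "distinct [(0, 0, 0), (0, 0, 1), (0, 0, 2), (0, 1, 0), (0, 1, 1), (0, 1, 2), (1, 0, 0), (1, 0, 1), (1, 0, 2), (1, 1, 0 :: int) :: int \<times> int \<times> int]" by simp
        then show ?thesis unfolding v_def inj_on_def by (auto simp: nth_eq_iff_index_eq simp del: distinct.simps)
      qed
      show "v ` {..<10} \<subseteq> nonunits residue_223" using vN by auto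
      fix x y assume "(x, y) : set three_ideals_edges"
      then have "{x, y} : edges_of three_ideals_edges" by (auto simp: edges_of_def)
      then have xy: "x < 10" "y < 10" "x ~= y"
        and c: "x < 6 & y < 6 | x : {0, 1, 2, 6, 7, 8} & y : {0, 1, 2, 6, 7, 8} | x : {0, 3, 6, 9} & y : {0, 3, 6, 9}"
        unfolding three_ideals_mem by blast+
      have a: "fst (v n) = 0" if "n < 6" for n
      proof -
        have "n : {0, 1, 2, 3, 4, 5}" using that by auto
        then show ?thesis by (elim insertE emptyE) (simp_all only: vv fst_conv)
      qed
      have b: "fst (snd (v n)) = 0" if "n : {0, 1, 2, 6, 7, 8}" for n
        using that by (elim insertE emptyE) (simp_all only: vv fst_conv snd_conv)
      have e: "snd (snd (v n)) = 0" if "n : {0, 3, 6, 9}" for n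
        using that by (elim insertE emptyE) (simp_all only: vv snd_conv)
      have "common residue_223 (v x) (v y)"
      proof -
        obtain i j k i' j' k' where v: "v x = (i, j, k)" "v y = (i', j', k')" by (metis prod_cases3)
        have "i = 0 & i' = 0 | j = 0 & j' = 0 | k = 0 & k' = 0"
          using c a[of x] a[of y] b[of x] b[of y] e[of x] e[of y] unfolding v fst_conv snd_conv by blast
        then show ?thesis using residue_223_common[of i j k i' j' k'] vN[OF xy(1)] vN[OF xy(2)] unfolding v by blast
      qed
      moreover have "v x ~= v y" using inj_onD[OF inj, of x y] xy by blast
      ultimately show "x < 10 & y < 10 & {v x, v y} : upper_ideal_edges residue_223"
        using xy unfolding cring.edges_common[OF residue_223_cring] by blast
    qed
    then show False using no_three_ideals_graph[OF g] by blast
  qed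
qed

lemma listed_genus:
  assumes R: "cring R" and l: "listed R"
  shows "upper_ideal_genus R = 2"
proof -
  have pr: "cring (RDirProd A B)" if "field A" "cring B" for A :: "('p, 'q) ring_scheme" and B :: "('r, 's) ring_scheme"
    using RDirProd_cring[OF field_cring[OF that(1)] that(2)] .
  note rf = residue_small_fields
  show ?thesis using l unfolding listed_def
  proof (elim disjE exE conjE)
    assume "R \<simeq> RDirProd (residue_ring 2) (RDirProd (residue_ring 2) (residue_ring 3))"
    then show ?thesis
      using genus_223 ring_embeds_iso[OF R residue_223_cring] unfolding residue_223_def upper_ideal_genus_eq_2 by simp
  next
    fix F8 :: "nat ring" assume F: "is_GF 8 F8" and i: "R \<simeq> RDirProd (residue_ring 2) F8"
    have F: "field F8" "card (carrier F8) = 8" using F by (simp_all add: is_GF_def)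
    show ?thesis using ring_embeds_iso[OF R pr[OF rf(1) field_cring[OF F(1)]] i]
        genus_small_field_eight[OF rf(1) _ _ F] by (simp add: upper_ideal_genus_eq_2 residue_card)
  next
    fix F8 :: "nat ring" assume F: "is_GF 8 F8" and i: "R \<simeq> RDirProd (residue_ring 3) F8"
    have F: "field F8" "card (carrier F8) = 8" using F by (simp_all add: is_GF_def)
    show ?thesis using ring_embeds_iso[OF R pr[OF rf(2) field_cring[OF F(1)]] i]
        genus_small_field_eight[OF rf(2) _ _ F] by (simp add: upper_ideal_genus_eq_2 residue_card)
  next
    fix F4 F8 :: "nat ring" assume F: "is_GF 4 F4" "is_GF 8 F8" and i: "R \<simeq> RDirProd F4 F8"
    have F: "field F4" "card (carrier F4) = 4" "field F8" "card (carrier F8) = 8" using F by (simp_all add: is_GF_def)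
    have "finite (carrier F4)" using F(2) card.infinite by fastforce
    then show ?thesis using ring_embeds_iso[OF R pr[OF F(1) field_cring[OF F(3)]] i]
        genus_small_field_eight[OF F(1) _ _ F(3,4)] F(2) by (simp add: upper_ideal_genus_eq_2)
  next
    assume i: "R \<simeq> RDirProd (residue_ring 7) (residue_ring 7)"
    show ?thesis using ring_embeds_iso[OF R pr[OF rf(4) field_cring[OF rf(4)]] i]
        genus_middle_fields[OF rf(4) _ _ rf(4)] by (simp add: upper_ideal_genus_eq_2 residue_card)
  next
    assume i: "R \<simeq> RDirProd (residue_ring 5) (residue_ring 7)"
    show ?thesis using ring_embeds_iso[OF R pr[OF rf(3) field_cring[OF rf(4)]] i]
        genus_middle_fields[OF rf(3) _ _ rf(4)] by (simp add: upper_ideal_genus_eq_2 residue_card)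
  next
    assume i: "R \<simeq> RDirProd (residue_ring 5) (residue_ring 5)"
    show ?thesis using ring_embeds_iso[OF R pr[OF rf(3) field_cring[OF rf(3)]] i]
        genus_middle_fields[OF rf(3) _ _ rf(3)] by (simp add: upper_ideal_genus_eq_2 residue_card)
  next
    fix F4 :: "nat ring" assume F: "is_GF 4 F4" and i: "R \<simeq> RDirProd F4 (residue_ring 4)"
    have F: "field F4" "card (carrier F4) = 4" using F by (simp_all add: is_GF_def)
    show ?thesis using ring_embeds_iso[OF R pr[OF F(1) residue_cring] i]
        genus_field_square_zero[OF F residue_four_square_zero] by (simp add: upper_ideal_genus_eq_2)
  next
    fix F4 :: "nat ring" assume F: "is_GF 4 F4" and i: "R \<simeq> RDirProd F4 Z2_dual_numbers"
    have F: "field F4" "card (carrier F4) = 4" using F by (simp_all add: is_GF_def)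
    have "R \<simeq> RDirProd F4 dual_ring"
      using ring_iso_trans[OF i ring_iso_RDirProd[OF ring_iso_refl Z2_dual_numbers_iso(2)]] .
    then show ?thesis using ring_embeds_iso[OF R pr[OF F(1) dual_ring_cring]]
        genus_field_square_zero[OF F dual_ring_square_zero] by (simp add: upper_ideal_genus_eq_2)
  qed
qed

section \<open>Completeness of the list\<close>

lemma prime_card_residue_iso:
  assumes "cring R" "prime p" "card (carrier R) = p"
  shows "R \<simeq> residue_ring (int p)"
  by (rule ring_iso_sym[OF cring.axioms(1)[OF field_cring[OF residue_field[OF assms(2)]]] cring.prime_card_iso[OF assms]])

lemma prime_card_field:
  assumes R: "cring R" and p: "prime p" "card (carrier R) = p"
  shows "field R"
proof -
  interpret R: cring R by (rule R)
  interpret F: field "residue_ring (int p)" by (rule residue_field[OF p(1)])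
  obtain h where h: "h : ring_iso (residue_ring (int p)) R"
    using cring.prime_card_iso[OF R p] unfolding is_ring_iso_def by blast
  have "h \<zero>\<^bsub>residue_ring (int p)\<^esub> = \<zero>\<^bsub>R\<^esub>"
    by (rule ring_hom_zero[OF _ F.ring_axioms R.ring_axioms]) (use h in \<open>simp add: ring_iso_def\<close>)
  then show ?thesis using F.ring_iso_imp_img_field[OF h] by simp
qed

text \<open>The list speaks of fields with carrier in the naturals; transporting the structure along
  an injection provides them.\<close>

lemma field_nat_copy:
  assumes F: "field F" and fin: "finite (carrier F)"
  obtains G :: "nat ring" where "is_GF (card (carrier F)) G" "F \<simeq> G"
proof -
  obtain f :: "'a => nat" where f: "inj_on f (carrier F)"
    using finite_imp_inj_to_nat_seg[OF fin] by blast
  have iso: "f : ring_iso F (image_ring f F)" by (rule inj_imp_image_ring_iso[OF f])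
  show ?thesis
  proof (rule that[of "image_ring f F"])
    show "F \<simeq> image_ring f F" using iso unfolding is_ring_iso_def by blast
    show "is_GF (card (carrier F)) (image_ring f F)"
      unfolding is_GF_def using field.inj_imp_image_ring_is_field[OF F f] card_image[OF f] by (simp add: image_ring_carrier)
  qed
qed

lemma nonunits_zero_field:
  assumes "cring R" "nonunits R = {\<zero>\<^bsub>R\<^esub>}"
  shows "field R"
proof -
  interpret cring R by fact
  have "Units R = carrier R - {\<zero>\<^bsub>R\<^esub>}" using assms(2) Units_closed unfolding nonunits_def by blast
  then show ?thesis by (rule cring_fieldI)
qed

text \<open>With eight elements in \<open>B\<close>, the union of \<open>K_5\<close> and
  \<open>K_8\<close> limits \<open>A\<close> to four. Otherwise both have at most seven, and
  \<open>A\<close> has at least five because smaller products lie on the torus.\<close>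

lemma listed_two_fields:
  assumes A: "field A" "finite (carrier A)" and B: "field B" "finite (carrier B)"
    and cards: "card (carrier A) : {2, 3, 4, 5, 7, 8}" "card (carrier B) : {2, 3, 4, 5, 7, 8}" "card (carrier A) <= card (carrier B)"
    and emb: "ring_embeds (RDirProd A B) 2" "~ ring_embeds (RDirProd A B) 1"
  shows "listed (RDirProd A B)"
proof -
  note pair = field_pair[OF A(1) B(1)]
  have res: "X \<simeq> residue_ring (int p)" if "field X" "card (carrier X) = p" "p : {2, 3, 5, 7}" for X :: "('x, 'y) ring_scheme" and p
    using prime_card_residue_iso[OF field_cring[OF that(1)] _ that(2)] that(3) by (auto simp: prime_nat_numeral_eq)
  show ?thesis
  proof (cases "card (carrier B) = 8")
    case True
    have "~ 5 <= card (carrier A)" using cring_pair.no_five_eight[OF pair, of 2] True emb(1) by auto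
    then have cA: "card (carrier A) : {2, 3, 4}" using cards(1) by auto
    obtain F8 :: "nat ring" where F8: "is_GF 8 F8" "B \<simeq> F8" using field_nat_copy[OF B] True by metis
    from cA consider "card (carrier A) = 2" | "card (carrier A) = 3" | "card (carrier A) = 4" by blast
    then show ?thesis
    proof cases
      case 1
      then have "RDirProd A B \<simeq> RDirProd (residue_ring 2) F8" using ring_iso_RDirProd[OF res[OF A(1)] F8(2)] by simp
      then show ?thesis unfolding listed_def using F8(1) by blast
    next
      case 2
      then have "RDirProd A B \<simeq> RDirProd (residue_ring 3) F8" using ring_iso_RDirProd[OF res[OF A(1)] F8(2)] by simp
      then show ?thesis unfolding listed_def using F8(1) by blast
    next
      case 3
      obtain F4 :: "nat ring" where F4: "is_GF 4 F4" "A \<simeq> F4" using field_nat_copy[OF A] 3 by metis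
      then have "RDirProd A B \<simeq> RDirProd F4 F8" using ring_iso_RDirProd[OF F4(2) F8(2)] by simp
      then show ?thesis unfolding listed_def using F8(1) F4(1) by blast
    qed
  next
    case False
    then have cB: "card (carrier B) <= 7" using cards(2) by auto
    have "~ card (carrier A) <= 4" using small_fields_embed[OF A(1) _ A(2) B(1) cB B(2)] emb(2) by blast
    then have "card (carrier A) = 5 | card (carrier A) = 7" "card (carrier B) = 5 | card (carrier B) = 7"
      using cards cB by auto
    then consider "card (carrier A) = 5" "card (carrier B) = 5" | "card (carrier A) = 5" "card (carrier B) = 7"
      | "card (carrier A) = 7" "card (carrier B) = 7" using cards(3) by linarith
    then show ?thesis
    proof cases
      case 1
      then have "RDirProd A B \<simeq> RDirProd (residue_ring 5) (residue_ring 5)"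
        using ring_iso_RDirProd[OF res[OF A(1)] res[OF B(1)]] by simp
      then show ?thesis unfolding listed_def by blast
    next
      case 2
      then have "RDirProd A B \<simeq> RDirProd (residue_ring 5) (residue_ring 7)"
        using ring_iso_RDirProd[OF res[OF A(1)] res[OF B(1)]] by simp
      then show ?thesis unfolding listed_def by blast
    next
      case 3
      then have "RDirProd A B \<simeq> RDirProd (residue_ring 7) (residue_ring 7)"
        using ring_iso_RDirProd[OF res[OF A(1)] res[OF B(1)]] by simp
      then show ?thesis unfolding listed_def by blast
    qed
  qed
qed

lemma nonfield_cards:
  assumes "cring R" "finite (carrier R)" "connected_ring R" "\<one>\<^bsub>R\<^esub> ~= \<zero>\<^bsub>R\<^esub>" "card (carrier R) <= 8" "~ field R"
  shows "card (carrier R) : {4, 8}"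
proof -
  have "card (carrier R) : {2, 3, 4, 5, 7, 8}" by (rule connected_card_cases[OF assms(1,4,2,3,5)])
  moreover have "card (carrier R) ~: {2, 3, 5, 7}"
  proof
    assume "card (carrier R) : {2, 3, 5, 7}"
    then have "prime (card (carrier R))" by (auto simp: prime_nat_numeral_eq)
    then show False using prime_card_field[OF assms(1) _ refl] assms(6) by blast
  qed
  ultimately show ?thesis by blast
qed

lemma nonfield_nonunit:
  assumes "cring R" "\<one>\<^bsub>R\<^esub> ~= \<zero>\<^bsub>R\<^esub>" "~ field R"
  obtains m where "m : nonunits R" "m ~= \<zero>\<^bsub>R\<^esub>"
proof -
  have "nonunits R ~= {\<zero>\<^bsub>R\<^esub>}" using nonunits_zero_field[OF assms(1)] assms(3) by blast
  moreover have "\<zero>\<^bsub>R\<^esub> : nonunits R" by (rule cring.zero_nonunit[OF assms(1,2)])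
  ultimately show ?thesis using that by blast
qed

text \<open>A nonzero nonunit of \<open>B\<close> limits \<open>A\<close> to four elements, and
  \<open>B\<close> has order four or eight. Order eight contains the pinched graph, a nonfield
  \<open>A\<close> gives overlapping cliques, and \<open>A\<close> with at most three elements leads
  to the torus.\<close>

lemma listed_nonfield:
  assumes pair: "cring_pair A B" and fin: "finite (carrier A)" "finite (carrier B)"
    and conn: "connected_ring A" "connected_ring B" and B: "~ field B"
    and emb: "ring_embeds (RDirProd A B) 2" "~ ring_embeds (RDirProd A B) 1"
  shows "listed (RDirProd A B)"
proof -
  interpret cring_pair A B by (rule pair)
  obtain m where m: "m : nonunits B" "m ~= \<zero>\<^bsub>B\<^esub>" by (rule nonfield_nonunit[OF B.cring_axioms nontrivial(2) B])
  have cA: "card (carrier A) <= 4" by (rule embeds_nonfield_card(1)[OF emb(1) m]) simp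
  have "card (carrier B) : {4, 8}"
    by (rule nonfield_cards[OF B.cring_axioms fin(2) conn(2) nontrivial(2) embeds_factor_card(1)[OF emb(1)] B]) simp
  moreover have "card (carrier B) ~= 8"
    using no_order_eight_nonfield[OF _ B.order_eight_nonunits[OF _ m], of 2] emb(1) by auto
  ultimately have cB: "card (carrier B) = 4" by blast
  have sq: "square_zero_ring B m" by (rule B.order_four_nonfield[OF cB conn(2) m])
  have A: "field A"
  proof (rule ccontr)
    assume nA: "~ field A"
    obtain k where k: "k : nonunits A" "k ~= \<zero>\<^bsub>A\<^esub>" by (rule nonfield_nonunit[OF A.cring_axioms nontrivial(1) nA])
    have "card (carrier A) : {4, 8}"
      by (rule nonfield_cards[OF A.cring_axioms fin(1) conn(1) nontrivial(1) _ nA]) (use cA in simp)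
    then have "card (carrier A) = 4" using cA by auto
    then show False using no_two_nonfields[OF k m _ cB, of 2] emb(1) by simp
  qed
  have "~ card (carrier A) <= 3" using small_field_square_zero_embed[OF A _ fin(1) sq] emb(2) by blast
  then have "card (carrier A) = 4" using cA by simp
  then obtain F4 :: "nat ring" where F4: "is_GF 4 F4" "A \<simeq> F4" using field_nat_copy[OF A fin(1)] by metis
  show ?thesis
  proof (cases "\<one>\<^bsub>B\<^esub> \<oplus>\<^bsub>B\<^esub> \<one>\<^bsub>B\<^esub> = \<zero>\<^bsub>B\<^esub>")
    case True
    have "B \<simeq> dual_ring"
      by (rule square_zero_char_two_iso[OF sq dual_ring_square_zero True]) (simp add: dual_ring_simps)
    moreover have "dual_ring \<simeq> Z2_dual_numbers" by (rule ring_iso_sym[OF Z2_dual_numbers_iso])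
    ultimately have "RDirProd A B \<simeq> RDirProd F4 Z2_dual_numbers"
      using ring_iso_RDirProd[OF F4(2)] ring_iso_trans by blast
    then show ?thesis unfolding listed_def using F4(1) by blast
  next
    case False
    have "residue_ring 4 \<simeq> B" by (rule square_zero_ring.residue_iso[OF sq False])
    then have "B \<simeq> residue_ring 4" by (rule ring_iso_sym[OF cring.axioms(1)[OF residue_cring], rotated]) simp
    then have "RDirProd A B \<simeq> RDirProd F4 (residue_ring 4)" by (rule ring_iso_RDirProd[OF F4(2)])
    then show ?thesis unfolding listed_def using F4(1) by blast
  qed
qed

lemma listed_connected_pair:
  assumes pair: "cring_pair A B" and fin: "finite (carrier A)" "finite (carrier B)"
    and conn: "connected_ring A" "connected_ring B"
    and emb: "ring_embeds (RDirProd A B) 2" "~ ring_embeds (RDirProd A B) 1"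
  shows "listed (RDirProd A B)"
proof -
  interpret cring_pair A B by (rule pair)
  interpret Q: cring_pair B A by (rule swap_pair)
  have emb': "ring_embeds (RDirProd B A) 2" "~ ring_embeds (RDirProd B A) 1"
    using emb ring_embeds_iso[OF P.cring_axioms Q.P.cring_axioms ring_iso_RDirProd_swap] by blast+
  have sw: "listed (RDirProd B A) ==> listed (RDirProd A B)" by (rule listed_iso[OF ring_iso_RDirProd_swap])
  show ?thesis
  proof (cases "field A & field B")
    case True
    have cB: "card (carrier B) : {2, 3, 4, 5, 7, 8}"
      by (rule connected_card_cases[OF B.cring_axioms nontrivial(2) fin(2) conn(2) embeds_factor_card(1)[OF emb(1)]]) simp
    have cA: "card (carrier A) : {2, 3, 4, 5, 7, 8}"
      by (rule connected_card_cases[OF A.cring_axioms nontrivial(1) fin(1) conn(1) Q.embeds_factor_card(1)[OF emb'(1)]]) simp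
    show ?thesis
    proof (cases "card (carrier A) <= card (carrier B)")
      case le: True
      show ?thesis using True by (intro listed_two_fields[OF _ fin(1) _ fin(2) cA cB le emb]) auto
    next
      case False
      then have le: "card (carrier B) <= card (carrier A)" by simp
      show ?thesis using True by (intro sw listed_two_fields[OF _ fin(2) _ fin(1) cB cA le emb']) auto
    qed
  next
    case False
    then show ?thesis
      using listed_nonfield[OF pair fin conn _ emb] sw listed_nonfield[OF swap_pair fin(2,1) conn(2,1) _ emb'] by blast
  qed
qed

text \<open>The factors need not be local: nontriviality and size bounds already force the orders 2,
  2 and 3, which also disposes of products with more factors.\<close>

lemma listed_sorted_triple:
  assumes cr: "cring A" "cring B" "cring C" and nt: "\<one>\<^bsub>A\<^esub> ~= \<zero>\<^bsub>A\<^esub>" "\<one>\<^bsub>B\<^esub> ~= \<zero>\<^bsub>B\<^esub>" "\<one>\<^bsub>C\<^esub> ~= \<zero>\<^bsub>C\<^esub>"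
    and fin: "finite (carrier A)" "finite (carrier B)" "finite (carrier C)"
    and le: "card (carrier A) <= card (carrier B)" "card (carrier B) <= card (carrier C)"
    and emb: "ring_embeds (RDirProd A (RDirProd B C)) 2" "~ ring_embeds (RDirProd A (RDirProd B C)) 1"
  shows "listed (RDirProd A (RDirProd B C))"
proof -
  let ?R = "RDirProd A (RDirProd B C)"
  interpret A: cring A by fact
  interpret B: cring B by fact
  interpret C: cring C by fact
  interpret BC: cring_pair B C by unfold_locales (use nt in auto)
  interpret ABC: cring_pair A "RDirProd B C" by unfold_locales (use nt in \<open>auto simp: RDirProd_simps\<close>)
  interpret AC: cring_pair A C by unfold_locales (use nt in auto)
  have two: "2 <= card (carrier R)" if "cring R" "\<one>\<^bsub>R\<^esub> ~= \<zero>\<^bsub>R\<^esub>" "finite (carrier R)" for R :: "('x, 'y) ring_scheme"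
  proof -
    interpret cring R by fact
    have "card {\<one>\<^bsub>R\<^esub>, \<zero>\<^bsub>R\<^esub>} <= card (carrier R)" using that(3) by (intro card_mono) auto
    then show ?thesis using that(2) by simp
  qed
  have cC: "card (carrier C) <= 3"
  proof (rule ccontr)
    assume "~ card (carrier C) <= 3"
    then have "4 <= card (carrier C)" by simp
    then obtain T where T: "\<zero>\<^bsub>C\<^esub> : T" "T \<subseteq> carrier C" "card T = 4" by (rule BC.subset_with_zero[OF _ one_le_numeral])
    \<comment> \<open>Two cliques of eight elements in the ideals with first and with second
      component zero, overlapping in the four elements with both zero.\<close>
    let ?K = "{\<zero>\<^bsub>A\<^esub>} \<times> {\<zero>\<^bsub>B\<^esub>, \<one>\<^bsub>B\<^esub>} \<times> T" and ?L = "{\<zero>\<^bsub>A\<^esub>, \<one>\<^bsub>A\<^esub>} \<times> {\<zero>\<^bsub>B\<^esub>} \<times> T"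
    have K: "common ?R x y" if xy: "x : ?K" "y : ?K" for x y
      by (rule ABC.fibre_clique) (use xy T(2) in \<open>auto simp: RDirProd_simps\<close>)
    have L: "common ?R x y" if xy: "x : ?L" "y : ?L" for x y
    proof -
      obtain a c a' c' where e: "x = (a, \<zero>\<^bsub>B\<^esub>, c)" "y = (a', \<zero>\<^bsub>B\<^esub>, c')" "a : carrier A" "a' : carrier A" "c : carrier C" "c' : carrier C"
        using xy T(2) A.zero_closed A.one_closed by blast
      have "common (RDirProd B C) (\<zero>\<^bsub>B\<^esub>, c) (\<zero>\<^bsub>B\<^esub>, c')" by (rule BC.fibre_clique) (use e in auto)
      then show ?thesis unfolding e(1,2) using e(3-) by (subst ABC.common_iff) (auto simp: RDirProd_simps)
    qed
    have "~ ring_embeds ?R 2"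
    proof (rule no_overlapping_cliques[OF ABC.P.cring_axioms order_refl K L])
      show "card ?K = 8" "card ?L = 8" using nt T(3) by (auto simp: card_cartesian_product card_insert_if)
      have "?K Int ?L = {\<zero>\<^bsub>A\<^esub>} \<times> {\<zero>\<^bsub>B\<^esub>} \<times> T" by auto
      then show "card (?K Int ?L) = 4" using T(3) by (simp add: card_cartesian_product)
    qed
    then show False using emb(1) by blast
  qed
  have "card (carrier (RDirProd B C)) <= 8" by (rule ABC.embeds_factor_card(1)[OF emb(1)]) simp
  then have BC: "card (carrier B) * card (carrier C) <= 8" by (simp add: RDirProd_simps card_cartesian_product)
  have cB: "card (carrier B) = 2"
  proof (rule ccontr)
    assume "card (carrier B) ~= 2"
    then have "3 <= card (carrier B)" "3 <= card (carrier C)" using two[OF cr(2) nt(2) fin(2)] le(2) by linarith+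
    then have "3 * 3 <= card (carrier B) * card (carrier C)" by (rule mult_le_mono)
    then show False using BC by simp
  qed
  have cA: "card (carrier A) = 2" using two[OF cr(1) nt(1) fin(1)] le(1) cB by simp
  have "card (carrier C) ~= 2"
  proof
    \<comment> \<open>Eight elements, one of them the unity, leave at most seven nonunits, hence a
      toroidal graph.\<close>
    assume cC2: "card (carrier C) = 2"
    have finR: "finite (carrier ?R)" "card (carrier ?R) = 8" using fin cA cB cC2 by (simp_all add: RDirProd_simps card_cartesian_product)
    have sub: "nonunits ?R \<subseteq> carrier ?R - {\<one>\<^bsub>?R\<^esub>}" unfolding nonunits_def using ABC.P.Units_one_closed by blast
    have finD: "finite (carrier ?R - {\<one>\<^bsub>?R\<^esub>})" using finR(1) by blast
    have "card (carrier ?R - {\<one>\<^bsub>?R\<^esub>}) = 7" using finR ABC.P.one_closed by (subst card_Diff_singleton) simp_all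
    then have "card (nonunits ?R) <= 7" using card_mono[OF finD sub] by simp
    then have "ring_embeds ?R 1" by (rule few_nonunits_embed[OF ABC.P.cring_axioms finite_subset[OF sub finD]])
    then show False using emb(2) by blast
  qed
  then have cC3: "card (carrier C) = 3" using two[OF cr(3) nt(3) fin(3)] cC by simp
  have "A \<simeq> residue_ring 2" "B \<simeq> residue_ring 2" "C \<simeq> residue_ring 3"
    using prime_card_residue_iso[OF cr(1) _ cA] prime_card_residue_iso[OF cr(2) _ cB] prime_card_residue_iso[OF cr(3) _ cC3]
    by (simp_all add: prime_nat_numeral_eq)
  then have "?R \<simeq> RDirProd (residue_ring 2) (RDirProd (residue_ring 2) (residue_ring 3))"
    by (intro ring_iso_RDirProd)
  then show ?thesis unfolding listed_def by blast
qed

text \<open>Exchanging the last two factors and shifting all three cyclically sorts any triple; the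
  claim is transported along these isomorphisms.\<close>

lemma listed_triple:
  fixes A B C :: "('a, 'm) ring_scheme"
  assumes cr: "cring A" "cring B" "cring C" and nt: "\<one>\<^bsub>A\<^esub> ~= \<zero>\<^bsub>A\<^esub>" "\<one>\<^bsub>B\<^esub> ~= \<zero>\<^bsub>B\<^esub>" "\<one>\<^bsub>C\<^esub> ~= \<zero>\<^bsub>C\<^esub>"
    and fin: "finite (carrier A)" "finite (carrier B)" "finite (carrier C)"
    and emb: "ring_embeds (RDirProd A (RDirProd B C)) 2" "~ ring_embeds (RDirProd A (RDirProd B C)) 1"
  shows "listed (RDirProd A (RDirProd B C))"
proof -
  define good :: "('a, 'm) ring_scheme => bool" where "good X \<longleftrightarrow> cring X & \<one>\<^bsub>X\<^esub> ~= \<zero>\<^bsub>X\<^esub> & finite (carrier X)" for X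
  define T where "T X Y Z = RDirProd X (RDirProd Y Z)" for X Y Z :: "('a, 'm) ring_scheme"
  define ok where "ok X Y Z \<longleftrightarrow> (ring_embeds (T X Y Z) 2 & ~ ring_embeds (T X Y Z) 1 --> listed (T X Y Z))"
    for X Y Z :: "('a, 'm) ring_scheme"
  have crT: "cring (T X Y Z)" if "good X" "good Y" "good Z" for X Y Z
    using that unfolding T_def good_def by (intro RDirProd_cring) auto
  have perm: "ok X Y Z" if "good X" "good Y" "good Z" "good X'" "good Y'" "good Z'" "T X Y Z \<simeq> T X' Y' Z'" "ok X' Y' Z'"
    for X Y Z X' Y' Z'
    using ring_embeds_iso[OF crT[OF that(1-3)] crT[OF that(4-6)] that(7)] listed_iso[OF that(7)] that(8)
    unfolding ok_def by blast
  have iso1: "T X Y Z \<simeq> T X Z Y" for X Y Z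
    unfolding T_def by (rule ring_iso_RDirProd[OF ring_iso_refl ring_iso_RDirProd_swap])
  have iso2: "T X Y Z \<simeq> T Y Z X" for X Y Z
    unfolding T_def by (rule ring_iso_trans[OF ring_iso_RDirProd_swap ring_iso_RDirProd_assoc])
  have sorted: "ok X Y Z" if "good X" "good Y" "good Z" "card (carrier X) <= card (carrier Y)" "card (carrier Y) <= card (carrier Z)"
    for X Y Z
    using listed_sorted_triple[of X Y Z] that unfolding ok_def T_def good_def by blast
  have half: "ok X Y Z" if g: "good X" "good Y" "good Z" and le: "card (carrier X) <= card (carrier Y)" "card (carrier X) <= card (carrier Z)"
    for X Y Z
    using sorted[OF g] sorted[OF g(1,3,2)] perm[OF g g(1,3,2) iso1] le by linarith
  have g: "good A" "good B" "good C" using cr nt fin by (simp_all add: good_def)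
  have "ok A B C"
  proof -
    consider "card (carrier A) <= card (carrier B)" "card (carrier A) <= card (carrier C)"
      | "card (carrier B) <= card (carrier C)" "card (carrier B) <= card (carrier A)"
      | "card (carrier C) <= card (carrier A)" "card (carrier C) <= card (carrier B)" by linarith
    then show ?thesis
    proof cases
      case 1
      show ?thesis by (rule half[OF g 1])
    next
      case 2
      show ?thesis by (rule perm[OF g g(2,3,1) iso2 half[OF g(2,3,1) 2]])
    next
      case 3
      show ?thesis by (rule perm[OF g g(3,1,2) ring_iso_trans[OF iso2 iso2] half[OF g(3,1,2) 3]])
    qed
  qed
  then show ?thesis using emb unfolding ok_def T_def by blast
qed

lemma disconnected_split:
  fixes R :: "('a, 'm) ring_scheme"
  assumes R: "cring R" and fin: "finite (carrier R)" and disc: "~ connected_ring R"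
  obtains A B :: "('a, 'm) ring_scheme" where "cring_pair A B" "finite (carrier A)" "finite (carrier B)" "R \<simeq> RDirProd A B"
proof -
  interpret cring R by (rule R)
  obtain e where e: "e : carrier R" "e \<otimes>\<^bsub>R\<^esub> e = e" "e ~= \<zero>\<^bsub>R\<^esub>" "e ~= \<one>\<^bsub>R\<^esub>"
    using disc unfolding connected_ring_def by blast
  let ?f = "\<one>\<^bsub>R\<^esub> \<ominus>\<^bsub>R\<^esub> e"
  note f = idempotent_compl[OF e(1,2)]
  have "?f ~= \<zero>\<^bsub>R\<^esub>" using e(1,4) by auto
  show ?thesis
  proof (rule that[OF _ _ _ corner_iso[OF e(1,2)]])
    show "cring_pair (corner_ring R e) (corner_ring R ?f)"
      by (rule cring_pair.intro[OF corner_cring[OF e(1,2)] corner_cring[OF f(1,2)] cring_pair_axioms.intro])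
        (use e(3) \<open>?f ~= \<zero>\<^bsub>R\<^esub>\<close> in \<open>simp_all only: corner_simps not_False_eq_True\<close>)
    show "finite (carrier (corner_ring R e))" "finite (carrier (corner_ring R ?f))"
      using fin by (simp_all add: corner_simps)
  qed
qed

lemma genus_two_listed:
  fixes R :: "('a, 'm) ring_scheme"
  assumes R: "cring R" and fin: "finite (carrier R)" and loc: "~ local_ring R" and g: "upper_ideal_genus R = 2"
  shows "listed R"
proof -
  interpret cring R by (rule R)
  have emb: "ring_embeds R 2" "~ ring_embeds R 1" using g unfolding upper_ideal_genus_eq_2 by auto
  \<comment> \<open>The zero ring has no maximal ideal and so counts as nonlocal under
    \<open>local_ring\<close>. Its graph is empty, hence not of genus two.\<close>
  have nz: "\<one>\<^bsub>R\<^esub> ~= \<zero>\<^bsub>R\<^esub>"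
  proof
    assume "\<one>\<^bsub>R\<^esub> = \<zero>\<^bsub>R\<^esub>"
    then have "carrier R = {\<one>\<^bsub>R\<^esub>}" using carrier_one_zero by simp
    then have "nonunits R = {}" using Units_one_closed by (auto simp: nonunits_def)
    then show False using few_nonunits_embed[OF R] emb(2) by simp
  qed
  have "~ connected_ring R" using connected_local[OF fin _ nz] loc by blast
  then obtain A B :: "('a, 'm) ring_scheme" where AB: "cring_pair A B" "finite (carrier A)" "finite (carrier B)" "R \<simeq> RDirProd A B"
    by (rule disconnected_split[OF R fin])
  \<comment> \<open>A factor with a nontrivial idempotent splits once more, which leads to three
    factors.\<close>
  have triple: "listed R" if XY: "cring_pair X Y" "finite (carrier X)" "finite (carrier Y)" "R \<simeq> RDirProd X Y" "~ connected_ring Y"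
    for X Y :: "('a, 'm) ring_scheme"
  proof -
    interpret cring_pair X Y by (rule XY(1))
    obtain C D :: "('a, 'm) ring_scheme" where CD: "cring_pair C D" "finite (carrier C)" "finite (carrier D)" "Y \<simeq> RDirProd C D"
      by (rule disconnected_split[OF B.cring_axioms XY(3,5)])
    interpret CD: cring_pair C D by (rule CD(1))
    have iso: "R \<simeq> RDirProd X (RDirProd C D)"
      by (rule ring_iso_trans[OF XY(4) ring_iso_RDirProd[OF ring_iso_refl CD(4)]])
    note e = ring_embeds_iso[OF R RDirProd_cring[OF A.cring_axioms CD.P.cring_axioms] iso]
    show ?thesis
      by (rule listed_iso[OF iso listed_triple[OF A.cring_axioms CD.A.cring_axioms CD.B.cring_axioms nontrivial(1) CD.nontrivial
            XY(2) CD(2,3)]]) (use emb e in blast)+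
  qed
  show ?thesis
  proof (cases "connected_ring A & connected_ring B")
    case True
    interpret cring_pair A B by (rule AB(1))
    note e = ring_embeds_iso[OF R P.cring_axioms AB(4)]
    show ?thesis
      by (rule listed_iso[OF AB(4) listed_connected_pair[OF AB(1-3)]]) (use True emb e in blast)+
  next
    case False
    then show ?thesis
      using triple[OF AB] triple[OF cring_pair.swap_pair[OF AB(1)] AB(3,2) ring_iso_trans[OF AB(4) ring_iso_RDirProd_swap]] by blast
  qed
qed

theorem theorem4p7:
  fixes R :: "('a, 'm) ring_scheme"
  assumes "cring R" and "finite (carrier R)" and "\<not> local_ring R"
  shows "upper_ideal_genus R = 2 \<longleftrightarrow>
      R \<simeq> RDirProd (residue_ring 2) (RDirProd (residue_ring 2) (residue_ring 3)) \<or>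
      (\<exists>F8 :: nat ring. is_GF 8 F8 \<and> R \<simeq> RDirProd (residue_ring 2) F8) \<or>
      (\<exists>F8 :: nat ring. is_GF 8 F8 \<and> R \<simeq> RDirProd (residue_ring 3) F8) \<or>
      (\<exists>(F4 :: nat ring) (F8 :: nat ring). is_GF 4 F4 \<and> is_GF 8 F8 \<and> R \<simeq> RDirProd F4 F8) \<or>
      R \<simeq> RDirProd (residue_ring 7) (residue_ring 7) \<or>
      R \<simeq> RDirProd (residue_ring 5) (residue_ring 7) \<or>
      R \<simeq> RDirProd (residue_ring 5) (residue_ring 5) \<or>
      (\<exists>F4 :: nat ring. is_GF 4 F4 \<and> R \<simeq> RDirProd F4 (residue_ring 4)) \<or>
      (\<exists>F4 :: nat ring. is_GF 4 F4 \<and> R \<simeq> RDirProd F4 Z2_dual_numbers)"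
  unfolding listed_def[symmetric]
  using genus_two_listed[OF assms] listed_genus[OF assms(1)] by blast

end
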